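(* Let $\nu_h>0$, $T>0$, and let $u_0\in\mathcal{D}(\Lambda_h^{\alpha/2})\cap\mathrm{H}$ with $\omega_0=\partial_z u_0\in L^\infty$. Then: (i) For $\alpha\in[\frac32,2)$, the strong solution to the fractional primitive equations on $[0,T]$ with $u(0)=u_0$ is unique. (ii) For $\alpha\in(1,\frac32)$, there exists at most one strong solution $u$ on $[0,T]$ with $u(0)=u_0$, provided that $$\omega=\partial_z u\in L^\infty(0,T;\mathcal{D}(\Lambda_h^{\frac32-\alpha}))\cap L^2(0,T;\mathcal{D}(\Lambda_h^{\frac{3-\alpha}{2}})),$$ i.e. any two strong solutions satisfying this condition coincide.
   Context: $\Omega=\{(x,z):x\in\mathbb{T},\ z\in[0,1]\}$, $\mathbb{T}$ the torus of length $1$; $L^p=L^p(\Omega)$. $\Lambda_h^s=(-\partial_x^2)^{s/2}$ (Fourier multiplier in $x$), $\mathcal{D}(\Lambda_h^s)=\{f\in L^2:\|\Lambda_h^s f\|_{L^2}<\infty\}$, $\mathrm{H}=\{f\in L^2(\Omega):\int_0^1 f(x,z)\,\mathrm{d}z=0\ \forall x\in\mathbb{T}\}$. Fractional primitive equations: (1) $\partial_t u+u\partial_x u+w\partial_z u+\partial_x p+\nu_h\Lambda_h^\alpha u=0$, $\partial_z p=0$, $\partial_x u+\partial_z w=0$ on $\Omega$, with $w|_{z=0,1}=0$ (so $w=-\int_0^z\partial_x u\,\mathrm{d}\tilde z$). Strong solution on $[0,T]$ with $u(0)=u_0$: (1) holds a.e. in $\Omega\times[0,T]$, $u\in C([0,T];\mathrm{H})\cap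 L^\infty(0,T;\mathcal{D}(\Lambda_h^{\alpha/2})\cap L^\infty)\cap L^2(0,T;\mathcal{D}(\Lambda_h^\alpha))$, $\omega=\partial_z u\in L^\infty(0,T;L^\infty)\cap L^2(0,T;\mathcal{D}(\Lambda_h^{\alpha/2}))$. *)

theory Defs
  imports "HOL-Analysis.Analysis"
begin

text \<open>
  Functions on the torus of length 1 are 1-periodic functions on the reals; a function on
  \<open>\<Omega>\<close> takes a pair \<open>(x, z)\<close>, and its values for \<open>z\<close> outside \<open>[0,1]\<close> play no role.
  Elements of Lebesgue spaces are given by Borel representatives, and equality of such
  elements is equality almost everywhere.
\<close>

definition Omega :: "(real \<times> real) measure" where
  "Omega = restrict_space lborel ({0..1} \<times> {0..1})"

definition Itime :: "real \<Rightarrow> real measure" where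
  "Itime T = restrict_space lborel {0..T}"

definition OmegaT :: "real \<Rightarrow> (real \<times> real \<times> real) measure" where
  "OmegaT T = restrict_space lborel ({0..T} \<times> {0..1} \<times> {0..1})"

definition torus_fun :: "(real \<times> real \<Rightarrow> real) \<Rightarrow> bool" where
  "torus_fun f \<longleftrightarrow> f \<in> borel_measurable borel \<and> (\<forall>x z. f (x + 1, z) = f (x, z))"

definition L2 :: "(real \<times> real \<Rightarrow> real) set" where
  "L2 = {f. torus_fun f \<and> integrable Omega (\<lambda>y. (f y)\<^sup>2)}"

definition L2_norm :: "(real \<times> real \<Rightarrow> real) \<Rightarrow> real" where
  "L2_norm f = sqrt (integral\<^sup>L Omega (\<lambda>y. (f y)\<^sup>2))"

definition Linf :: "(real \<times> real \<Rightarrow> real) set" where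
  "Linf = {f. torus_fun f \<and> (\<exists>C. AE y in Omega. \<bar>f y\<bar> \<le> C)}"

definition Hspace :: "(real \<times> real \<Rightarrow> real) set" where
  "Hspace = {f \<in> L2. AE x in lborel. (LINT z:{0..1}|lborel. f (x, z)) = 0}"

definition horiz_fourier :: "(real \<times> real \<Rightarrow> real) \<Rightarrow> int \<Rightarrow> real \<Rightarrow> complex" where
  "horiz_fourier f k z =
     (LINT x:{0..1}|lborel. complex_of_real (f (x, z)) * cis (- (2 * pi * of_int k * x)))"

text \<open>
  \<open>g\<close> is \<open>\<Lambda>\<^sub>h\<^sup>s f\<close>: on the torus of length 1 the symbol of \<open>(-\<partial>\<^sub>x\<^sup>2)\<^bsup>s/2\<^esup>\<close> is
  \<open>\<bar>2 \<pi> k\<bar>\<^sup>s\<close>. Only \<open>s > 0\<close> is meant (\<open>0 powr 0 = 0\<close> gives the wrong symbol at \<open>k = 0\<close> for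
  \<open>s = 0\<close>).
\<close>
definition is_Lambda_h ::
  "real \<Rightarrow> (real \<times> real \<Rightarrow> real) \<Rightarrow> (real \<times> real \<Rightarrow> real) \<Rightarrow> bool" where
  "is_Lambda_h s f g \<longleftrightarrow> f \<in> L2 \<and> g \<in> L2 \<and>
     (\<forall>k::int. AE z in restrict_space lborel {0..1}.
        horiz_fourier g k z = complex_of_real (\<bar>2 * pi * of_int k\<bar> powr s) * horiz_fourier f k z)"

definition dom_Lambda_h :: "real \<Rightarrow> (real \<times> real \<Rightarrow> real) set" where
  "dom_Lambda_h s = {f. \<exists>g. is_Lambda_h s f g}"

definition Lambda_h :: "real \<Rightarrow> (real \<times> real \<Rightarrow> real) \<Rightarrow> (real \<times> real \<Rightarrow> real)" where
  "Lambda_h s f = (SOME g. is_Lambda_h s f g)"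

text \<open>
  Weak directional derivatives on an open set, tested against compactly supported
  continuously differentiable functions. A periodic function has a weak derivative on the
  torus iff its periodic extension has one on the line, so the test functions need
  not be periodic.
\<close>
definition loc_integrable :: "'a::euclidean_space set \<Rightarrow> ('a \<Rightarrow> real) \<Rightarrow> bool" where
  "loc_integrable U f \<longleftrightarrow> (\<forall>K. compact K \<and> K \<subseteq> U \<longrightarrow> set_integrable lborel K f)"

definition test_fun :: "'a::euclidean_space set \<Rightarrow> ('a \<Rightarrow> real) \<Rightarrow> bool" where
  "test_fun U \<phi> \<longleftrightarrow>
     (\<exists>\<phi>' :: 'a \<Rightarrow> 'a \<Rightarrow>\<^sub>L real. continuous_on UNIV \<phi>' \<and>
        (\<forall>x. (\<phi> has_derivative blinfun_apply (\<phi>' x)) (at x))) \<and>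
     compact (closure {x. \<phi> x \<noteq> 0}) \<and> closure {x. \<phi> x \<noteq> 0} \<subseteq> U"

definition weak_deriv ::
  "'a::euclidean_space set \<Rightarrow> 'a \<Rightarrow> ('a \<Rightarrow> real) \<Rightarrow> ('a \<Rightarrow> real) \<Rightarrow> bool" where
  "weak_deriv U v f g \<longleftrightarrow> loc_integrable U f \<and> loc_integrable U g \<and>
     (\<forall>\<phi>. test_fun U \<phi> \<longrightarrow>
        (LINT y:U|lborel. f y * frechet_derivative \<phi> (at y) v) = - (LINT y:U|lborel. g y * \<phi> y))"

type_synonym field = "real \<Rightarrow> real \<times> real \<Rightarrow> real"

definition torus_field :: "field \<Rightarrow> bool" where
  "torus_field v \<longleftrightarrow> case_prod v \<in> borel_measurable borel \<and>
     (\<forall>t x z. v t (x + 1, z) = v t (x, z))"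

definition space_time :: "real \<Rightarrow> (real \<times> real \<times> real) set" where
  "space_time T = {0<..<T} \<times> UNIV \<times> {0<..<1}"

definition weak_dt :: "real \<Rightarrow> field \<Rightarrow> field \<Rightarrow> bool" where
  "weak_dt T v v' \<longleftrightarrow> torus_field v \<and> torus_field v' \<and>
     weak_deriv (space_time T) (1, 0, 0) (case_prod v) (case_prod v')"

definition weak_dx :: "real \<Rightarrow> field \<Rightarrow> field \<Rightarrow> bool" where
  "weak_dx T v v' \<longleftrightarrow> torus_field v \<and> torus_field v' \<and>
     weak_deriv (space_time T) (0, 1, 0) (case_prod v) (case_prod v')"

definition weak_dz :: "real \<Rightarrow> field \<Rightarrow> field \<Rightarrow> bool" where
  "weak_dz T v v' \<longleftrightarrow> torus_field v \<and> torus_field v' \<and>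
     weak_deriv (space_time T) (0, 0, 1) (case_prod v) (case_prod v')"

definition cont_H :: "real \<Rightarrow> field \<Rightarrow> bool" where
  "cont_H T v \<longleftrightarrow> torus_field v \<and> (\<forall>t\<in>{0..T}. v t \<in> Hspace \<and>
     ((\<lambda>s. L2_norm (\<lambda>y. v s y - v t y)) \<longlongrightarrow> 0) (at t within {0..T}))"

definition Linf_Linf :: "real \<Rightarrow> field \<Rightarrow> bool" where
  "Linf_Linf T v \<longleftrightarrow> torus_field v \<and>
     (\<exists>C. AE t in Itime T. v t \<in> Linf \<and> (AE y in Omega. \<bar>v t y\<bar> \<le> C))"

text \<open>The domain of \<open>\<Lambda>\<^sub>h\<^sup>s\<close> carries the graph norm.\<close>

definition Linf_dom :: "real \<Rightarrow> real \<Rightarrow> field \<Rightarrow> bool" where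
  "Linf_dom T s v \<longleftrightarrow> torus_field v \<and>
     (\<exists>C. AE t in Itime T. v t \<in> dom_Lambda_h s \<and>
        L2_norm (v t) \<le> C \<and> L2_norm (Lambda_h s (v t)) \<le> C)"

definition L2_dom :: "real \<Rightarrow> real \<Rightarrow> field \<Rightarrow> bool" where
  "L2_dom T s v \<longleftrightarrow> torus_field v \<and>
     (AE t in Itime T. v t \<in> dom_Lambda_h s) \<and>
     (\<integral>\<^sup>+ t. ennreal ((L2_norm (v t))\<^sup>2 + (L2_norm (Lambda_h s (v t)))\<^sup>2) \<partial>Itime T) < \<infinity>"

text \<open>
  The fractional primitive equations with all derivatives weak. The integral formula for \<open>w\<close>
  selects the representative that is continuous in \<open>z\<close>, for which the boundary values at
  \<open>z = 0\<close> and \<open>z = 1\<close> are meaningful.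
\<close>
definition fpe_holds :: "real \<Rightarrow> real \<Rightarrow> real \<Rightarrow> field \<Rightarrow> bool" where
  "fpe_holds \<nu> \<alpha> T u \<longleftrightarrow>
     (\<exists>u\<^sub>t u\<^sub>x u\<^sub>z w w\<^sub>z p p\<^sub>x p\<^sub>z \<Lambda>u.
        weak_dt T u u\<^sub>t \<and> weak_dx T u u\<^sub>x \<and> weak_dz T u u\<^sub>z \<and>
        weak_dz T w w\<^sub>z \<and> weak_dx T p p\<^sub>x \<and> weak_dz T p p\<^sub>z \<and>
        torus_field \<Lambda>u \<and> (AE t in Itime T. is_Lambda_h \<alpha> (u t) (\<Lambda>u t)) \<and>
        (AE (t, y) in OmegaT T.
           u\<^sub>t t y + u t y * u\<^sub>x t y + w t y * u\<^sub>z t y + p\<^sub>x t y + \<nu> * \<Lambda>u t y = 0) \<and>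
        (AE (t, y) in OmegaT T. p\<^sub>z t y = 0) \<and>
        (AE (t, y) in OmegaT T. u\<^sub>x t y + w\<^sub>z t y = 0) \<and>
        (AE (t, x) in restrict_space lborel ({0..T} \<times> {0..1}).
           (\<forall>z\<in>{0..1}. w t (x, z) = - (LINT \<zeta>:{0..z}|lborel. u\<^sub>x t (x, \<zeta>))) \<and>
           w t (x, 0) = 0 \<and> w t (x, 1) = 0))"

definition strong_solution ::
  "real \<Rightarrow> real \<Rightarrow> real \<Rightarrow> (real \<times> real \<Rightarrow> real) \<Rightarrow> field \<Rightarrow> bool" where
  "strong_solution \<nu> \<alpha> T u\<^sub>0 u \<longleftrightarrow>
     fpe_holds \<nu> \<alpha> T u \<and>
     (AE y in Omega. u 0 y = u\<^sub>0 y) \<and>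
     cont_H T u \<and> Linf_dom T (\<alpha> / 2) u \<and> Linf_Linf T u \<and> L2_dom T \<alpha> u \<and>
     (\<exists>\<omega>. weak_dz T u \<omega> \<and> Linf_Linf T \<omega> \<and> L2_dom T (\<alpha> / 2) \<omega>)"

end

theory Submission
  imports Defs
begin

text \<open>
  The difference \<open>U = u - v\<close> of two solutions satisfies an \<open>L\<^sup>2\<close> energy identity. It is obtained by
  testing with products whose \<open>z\<close>-factor has mean zero, which removes the pressure, and by the du
  Bois-Reymond lemma in \<open>t\<close>; here \<open>\<integral> U dz = 0\<close> allows to add a function of \<open>(t, x)\<close> to the equation.
  The transport of \<open>U\<close> by the first solution cancels, which leaves \<open>\<integral> (\<partial>\<^sub>x v) U\<^sup>2\<close> and \<open>\<integral> W (\<partial>\<^sub>z v) U\<close>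
  with \<open>\<partial>\<^sub>z W = - \<partial>\<^sub>x U\<close>. In horizontal Fourier modes the second term is a convolution with a loss of
  one derivative; Young's inequality with a frequency cutoff adapted to \<open>\<parallel>\<partial>\<^sub>z v\<parallel>\<close> in
  \<open>D(\<Lambda>\<^bsup>s + \<alpha>/2\<^esup>)\<close>, \<open>s = max 0 (3/2 - \<alpha>)\<close>, bounds it by a fraction of the dissipation plus
  \<open>\<phi>(t) \<parallel>U\<parallel>\<^sup>2\<close> with \<open>\<phi>\<close> integrable in time, and Gronwall's inequality gives \<open>U = 0\<close>.
\<close>

text \<open>The equation cannot simply be multiplied by \<open>U\<close>: the time derivative of a
  solution and its pressure gradient are only locally integrable in the open space-time domain, and
  only their sum is controlled, by the nonlinear and dissipative terms. So time regularity has to be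
  found first: on almost every line in \<open>t\<close> the difference is a primitive of an
  integrable function, and the identity for its square comes from the product rule for primitives.
  Weak derivatives in \<open>x\<close> and \<open>z\<close> become primitives on lines in the same
  way, so that every integration by parts is one-dimensional. The exponent \<open>s\<close> is a
  matter of counting. In the integral with \<open>W\<close> one horizontal derivative is lost, and
  summing a sequence of modes costs another half. The two factors \<open>U\<close> pay \<alpha>/2
  each through the dissipation. What is missing, 3/2 - \<alpha>, must be paid by the vertical
  derivative of \<open>v\<close> uniformly in time; from \<alpha> = 3/2 on nothing is missing and
  boundedness suffices. This count is critical and gives no small factor. The bound at
  \<open>s + \<alpha> / 2\<close>, square integrable in time, provides it: the cutoff may depend on
  this norm.\<close>

section \<open>Lebesgue measure on intervals and boxes\<close>

abbreviation Borel :: "('a::topological_space \<Rightarrow> 'b::topological_space) set" where "Borel \<equiv> borel_measurable borel"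
text \<open>A density instead of \<open>restrict_space\<close> keeps the whole line as the space and
  all Borel sets as measurable sets, so products, sections and permutations of coordinates need no
  side conditions about the interval.\<close>

definition leb_on :: "real \<Rightarrow> real \<Rightarrow> real measure" where
  "leb_on a b = density lborel (indicator {a..b})"

abbreviation "leb2 a b c d \<equiv> leb_on a b \<Otimes>\<^sub>M leb_on c d"
abbreviation "leb3 a b c d e f \<equiv> leb_on a b \<Otimes>\<^sub>M leb2 c d e f"

lemma sets_leb_on [simp, measurable_cong]: "sets (leb_on a b) = sets borel"
  and space_leb_on [simp]: "space (leb_on a b) = UNIV"
  by (simp_all add: leb_on_def)

lemma emeasure_leb_on: "A \<in> sets borel \<Longrightarrow> emeasure (leb_on a b) A = emeasure lborel (A \<inter> {a..b})"
  unfolding leb_on_def by (subst emeasure_density) (auto simp: Int_commute simp flip: indicator_inter_arith)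

lemma measure_leb_on_UNIV [simp]: "a \<le> b \<Longrightarrow> measure (leb_on a b) UNIV = b - a"
  by (simp add: measure_def emeasure_leb_on)

interpretation leb_on: finite_measure "leb_on a b" for a b
  by standard (simp add: emeasure_leb_on emeasure_lborel_Icc_eq)

interpretation leb_pair: pair_sigma_finite "leb_on a b" "leb_on c d" for a b c d ..

lemma AE_leb_on: "(AE x in leb_on a b. P x) \<longleftrightarrow> (AE x in lborel. x \<in> {a..b} \<longrightarrow> P x)"
  unfolding leb_on_def by (subst AE_density) (auto simp: indicator_def)

lemma integral_leb_on:
  fixes f :: "real \<Rightarrow> 'a::{banach, second_countable_topology}"
  assumes "f \<in> Borel"
  shows "integral\<^sup>L (leb_on a b) f = (LINT x:{a..b}|lborel. f x)"
proof -
  have "integral\<^sup>L (density lborel (\<lambda>x. ennreal (indicat_real {a..b} x))) f = (LINT x:{a..b}|lborel. f x)"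
    using assms by (subst integral_density) (auto simp: set_lebesgue_integral_def)
  then show ?thesis by (simp add: leb_on_def ennreal_indicator)
qed

lemma integrable_leb_on:
  fixes f :: "real \<Rightarrow> 'a::{banach, second_countable_topology}"
  assumes "f \<in> Borel"
  shows "integrable (leb_on a b) f \<longleftrightarrow> set_integrable lborel {a..b} f"
proof -
  have "integrable (density lborel (\<lambda>x. ennreal (indicat_real {a..b} x))) f \<longleftrightarrow> set_integrable lborel {a..b} f"
    using assms by (subst integrable_density) (auto simp: set_integrable_def)
  then show ?thesis by (simp add: leb_on_def ennreal_indicator)
qed

lemma borel_Icc_Times [measurable]:
  "{a..b} \<times> {c..d} \<in> sets (borel :: (real \<times> real) measure)"
  "{a..b} \<times> {c..d} \<times> {e..f} \<in> sets (borel :: (real \<times> real \<times> real) measure)"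
  by (intro borel_closed closed_Times closed_atLeastAtMost)+

lemma leb_on_pair:
  "leb2 a b c d = density lborel (indicator ({a..b} \<times> {c..d}))"
proof -
  have "leb2 a b c d = density (lborel \<Otimes>\<^sub>M lborel) (\<lambda>(x,y). indicator {a..b} x * indicator {c..d} y)"
    unfolding leb_on_def
    by (rule pair_measure_density) (use leb_on.sigma_finite_measure_axioms[of c d] in \<open>auto simp: leb_on_def intro: sigma_finite_lborel\<close>)
  also have "\<dots> = density (lborel \<Otimes>\<^sub>M lborel) (indicator ({a..b} \<times> {c..d}))"
    by (intro arg_cong[where f="density _"]) (auto simp: fun_eq_iff indicator_def)
  finally show ?thesis by (simp add: lborel_prod)
qed

lemma leb_on_triple:
  "leb3 a b c d e f = density lborel (indicator ({a..b} \<times> {c..d} \<times> {e..f}))"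
proof -
  have P: "finite_measure (leb2 c d e f)"
    by (rule finite_measure_pair_measure) unfold_locales
  have "leb3 a b c d e f = density (lborel \<Otimes>\<^sub>M lborel) (\<lambda>(x,y). indicator {a..b} x * indicator ({c..d} \<times> {e..f}) y)"
    unfolding leb_on_pair unfolding leb_on_def
    by (rule pair_measure_density) (use finite_measure.axioms(1)[OF P] in \<open>auto simp: leb_on_pair intro: sigma_finite_lborel\<close>)
  also have "\<dots> = density (lborel \<Otimes>\<^sub>M lborel) (indicator ({a..b} \<times> {c..d} \<times> {e..f}))"
    by (intro arg_cong[where f="density _"]) (auto simp: fun_eq_iff indicator_def)
  finally show ?thesis by (simp add: lborel_prod)
qed

text \<open>With the next two lemmas this translates the restricted measures in which the notions
  are stated into the densities used here.\<close>

lemma AE_restrict_density: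
  assumes "A \<in> sets borel"
  shows "(AE x in restrict_space lborel A. P x) \<longleftrightarrow> (AE x in density lborel (indicator A). P x)"
  using assms by (simp add: AE_restrict_space_iff AE_density) (simp add: indicator_def)

lemma integrable_restrict_density:
  fixes f :: "_ \<Rightarrow> 'a::{banach, second_countable_topology}"
  assumes [measurable]: "A \<in> sets borel" "f \<in> Borel"
  shows "integrable (restrict_space lborel A) f \<longleftrightarrow> integrable (density lborel (indicator A)) f"
proof -
  have "integrable (density lborel (\<lambda>x. ennreal (indicat_real A x))) f \<longleftrightarrow> integrable lborel (\<lambda>x. indicator A x *\<^sub>R f x)"
    by (subst integrable_density) auto
  then show ?thesis by (simp add: integrable_restrict_space ennreal_indicator)
qed

lemma integral_restrict_density:
  fixes f :: "_ \<Rightarrow> 'a::{banach, second_countable_topology}"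
  assumes [measurable]: "A \<in> sets borel" "f \<in> Borel"
  shows "integral\<^sup>L (restrict_space lborel A) f = integral\<^sup>L (density lborel (indicator A)) f"
proof -
  have "integral\<^sup>L (density lborel (\<lambda>x. ennreal (indicat_real A x))) f = integral\<^sup>L lborel (\<lambda>x. indicator A x *\<^sub>R f x)"
    by (subst integral_density) auto
  then show ?thesis by (simp add: integral_restrict_space ennreal_indicator)
qed

lemma sets_leb2 [simp]: "sets (leb2 a b c d) = sets borel"
  unfolding leb_on_pair by simp

lemma sets_leb3 [simp]: "sets (leb3 a b c d e f) = sets borel"
  unfolding leb_on_triple by simp

lemma borel_measurable_leb_eq [simp]:
  "borel_measurable (leb_on a b) = Borel"
  "borel_measurable (leb2 a b c d) = Borel"
  "borel_measurable (leb3 a b c d e f) = Borel"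
  by (rule measurable_cong_sets[OF sets_leb_on refl] measurable_cong_sets[OF sets_leb2 refl] measurable_cong_sets[OF sets_leb3 refl])+

lemma finite_measure_leb2: "finite_measure (leb2 a b c d)"
  by (rule finite_measure_pair_measure) unfold_locales

lemma finite_measure_leb3: "finite_measure (leb3 a b c d e f)"
  by (intro finite_measure_pair_measure finite_measure_leb2) unfold_locales

lemma integrable_bounded_AE:
  fixes f :: "'a \<Rightarrow> 'b::{banach, second_countable_topology}"
  assumes "finite_measure M" "f \<in> borel_measurable M" "AE x in M. norm (f x) \<le> C"
  shows "integrable M f"
  using finite_measure.integrable_const_bound[OF assms(1), of f C] assms by auto

lemma integrable_mult_bounded_AE:
  fixes f g :: "'a \<Rightarrow> 'b::{real_normed_algebra,banach, second_countable_topology}"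
  assumes "integrable M f" and g: "g \<in> borel_measurable M" "AE x in M. norm (g x) \<le> C"
  shows "integrable M (\<lambda>x. f x * g x)" "integrable M (\<lambda>x. g x * f x)"
proof -
  note [measurable] = borel_measurable_integrable[OF assms(1)] g(1)
  have i: "integrable M (\<lambda>x. C * norm (f x))" using assms(1) by auto
  show "integrable M (\<lambda>x. f x * g x)"
    by (rule Bochner_Integration.integrable_bound[OF i])
       (use g in \<open>auto elim!: eventually_mono intro!: order_trans[OF norm_mult_ineq] simp: mult.commute[of C] intro!: mult_left_mono order_trans[OF _ abs_ge_self]\<close>)
  show "integrable M (\<lambda>x. g x * f x)"
    by (rule Bochner_Integration.integrable_bound[OF i])
       (use g in \<open>auto elim!: eventually_mono intro!: order_trans[OF norm_mult_ineq] intro!: mult_right_mono order_trans[OF _ abs_ge_self]\<close>)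
qed

subsection \<open>Total families of test functions\<close>

text \<open>The sets over which \<open>h\<close> integrates to zero form a Dynkin system; the
  vanishing integral over the whole space gives closure under complements. So they are all
  measurable sets, and densities are unique almost everywhere.\<close>

lemma AE_zero_if_generator:
  fixes h :: "'a \<Rightarrow> real"
  assumes h: "integrable M h"
    and G: "Int_stable G" "G \<subseteq> Pow (space M)" "sets M = sigma_sets (space M) G"
    and 0: "\<And>A. A \<in> G \<Longrightarrow> (LINT x:A|M. h x) = 0" and sp: "integral\<^sup>L M h = 0"
  shows "AE x in M. h x = 0"
proof (rule density_unique_real[OF h, of "\<lambda>_. 0"])
  fix A assume "A \<in> sets M"
  then have "A \<in> sigma_sets (space M) G" using G by simp
  from G(1,2) this show "(LINT x:A|M. h x) = (LINT x:A|M. 0)"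
  proof (induction rule: sigma_sets_induct_disjoint)
    case (compl A)
    then have A: "A \<in> sets M" using G by simp
    have *: "set_integrable M B h" if "B \<in> sets M" for B
      using integrable_mult_indicator[OF that h] by (simp add: set_integrable_def)
    have "(LINT x:space M|M. h x) = (LINT x:(space M - A) \<union> A|M. h x)"
      using sets.sets_into_space[OF A] by (simp add: Un_absorb2)
    also have "\<dots> = (LINT x:space M - A|M. h x) + (LINT x:A|M. h x)"
      using A by (intro set_integral_Un *) auto
    finally show ?case using compl sp by (simp add: set_integral_space[OF h])
  next
    case (union A)
    then have A: "A i \<in> sets M" for i using G by auto
    have "(LINT x:(\<Union>i. A i)|M. h x) = (\<Sum>i. (LINT x:A i|M. h x))"
      using union A h by (intro lebesgue_integral_countable_add)
        (auto simp: disjoint_family_on_def set_integrable_def intro!: integrable_mult_indicator[where 'b=real, simplified])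
    then show ?case using union by simp
  qed (auto simp: 0, auto simp: set_lebesgue_integral_def)
qed auto

text \<open>Boundedness makes every pairing with an integrable function meaningful. Totality is
  required against integrable functions rather than square-integrable ones because weak derivatives
  are only locally integrable.\<close>

definition total_tests :: "'a measure \<Rightarrow> ('a \<Rightarrow> real) set \<Rightarrow> bool" where
  "total_tests M \<Phi> \<longleftrightarrow> (\<forall>\<phi>\<in>\<Phi>. \<phi> \<in> borel_measurable M \<and> (\<exists>C. \<forall>x. \<bar>\<phi> x\<bar> \<le> C)) \<and>
     (\<forall>h. integrable M h \<longrightarrow> (\<forall>\<phi>\<in>\<Phi>. (\<integral>x. h x * \<phi> x \<partial>M) = 0) \<longrightarrow> (AE x in M. h x = 0))"

lemma total_testsD:
  assumes "total_tests M \<Phi>"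
  shows "integrable M h \<Longrightarrow> (\<And>\<phi>. \<phi> \<in> \<Phi> \<Longrightarrow> (\<integral>x. h x * \<phi> x \<partial>M) = 0) \<Longrightarrow> AE x in M. h x = 0"
    and "\<phi> \<in> \<Phi> \<Longrightarrow> \<phi> \<in> borel_measurable M" and "\<phi> \<in> \<Phi> \<Longrightarrow> \<exists>C. \<forall>x. \<bar>\<phi> x\<bar> \<le> C"
  using assms unfolding total_tests_def by blast+

definition tensor :: "('a \<Rightarrow> real) \<Rightarrow> ('b \<Rightarrow> real) \<Rightarrow> 'a \<times> 'b \<Rightarrow> real" where
  "tensor \<phi> \<psi> = (\<lambda>(x, y). \<phi> x * \<psi> y)"

text \<open>Totality is used once in each variable: pairing with a fixed \<open>\<psi>\<close>
  leaves a function of \<open>x\<close> that vanishes, and after integration in \<open>x\<close>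
  over a measurable set what remains is a function of \<open>y\<close> that vanishes. Rectangles
  then generate the product.\<close>

lemma total_tests_pair:
  assumes M: "finite_measure M" and N: "finite_measure N"
    and \<Phi>: "total_tests M \<Phi>" and \<Psi>: "total_tests N \<Psi>"
  shows "total_tests (M \<Otimes>\<^sub>M N) {tensor \<phi> \<psi> |\<phi> \<psi>. \<phi> \<in> \<Phi> \<and> \<psi> \<in> \<Psi>}"
proof -
  interpret M: finite_measure M by fact
  interpret N: finite_measure N by fact
  interpret pair_sigma_finite M N ..
  note m\<Phi> = total_testsD(2)[OF \<Phi>] and b\<Phi> = total_testsD(3)[OF \<Phi>]
  note m\<Psi> = total_testsD(2)[OF \<Psi>] and b\<Psi> = total_testsD(3)[OF \<Psi>]
  have vanish: "AE p in M \<Otimes>\<^sub>M N. h p = 0"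
    if h: "integrable (M \<Otimes>\<^sub>M N) h"
      and 0: "\<And>\<phi> \<psi>. \<phi> \<in> \<Phi> \<Longrightarrow> \<psi> \<in> \<Psi> \<Longrightarrow> (\<integral>p. h p * tensor \<phi> \<psi> p \<partial>(M \<Otimes>\<^sub>M N)) = 0" for h
  proof -
    note [measurable] = borel_measurable_integrable[OF h]
    have hb: "integrable (M \<Otimes>\<^sub>M N) (\<lambda>(x,y). h (x,y) * (f x * g y))"
      if "f \<in> borel_measurable M" "g \<in> borel_measurable N" "\<And>x. \<bar>f x\<bar> \<le> C" "\<And>x. \<bar>g x\<bar> \<le> D" for f g C D
    proof -
      note [measurable] = that(1,2)
      have "integrable (M \<Otimes>\<^sub>M N) (\<lambda>p. h p * (f (fst p) * g (snd p)))"
        by (rule integrable_mult_bounded_AE(1)[OF h, of _ "C * D"])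
           (use that in \<open>auto simp: abs_mult intro!: AE_I2 mult_mono intro: order_trans[OF abs_ge_zero that(3)]\<close>)
      then show ?thesis by (simp add: case_prod_unfold)
    qed
    have 1: "AE x in M. (\<integral>y. h (x,y) * \<psi> y \<partial>N) = 0" if \<psi>: "\<psi> \<in> \<Psi>" for \<psi>
    proof (rule total_testsD(1)[OF \<Phi>])
      obtain D where D: "\<And>x. \<bar>\<psi> x\<bar> \<le> D" using b\<Psi>[OF \<psi>] by auto
      note [measurable] = m\<Psi>[OF \<psi>]
      have i1: "integrable (M \<Otimes>\<^sub>M N) (\<lambda>(x,y). h (x,y) * (1 * \<psi> y))"
        by (rule hb[of "\<lambda>_. 1" \<psi> 1 D]) (use D in auto)
      then show "integrable M (\<lambda>x. \<integral>y. h (x,y) * \<psi> y \<partial>N)"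
        using integrable_fst'[OF i1] by simp
      fix \<phi> assume \<phi>: "\<phi> \<in> \<Phi>"
      then obtain C where C: "\<And>x. \<bar>\<phi> x\<bar> \<le> C" using b\<Phi> by auto
      have "(\<integral>x. (\<integral>y. h (x,y) * \<psi> y \<partial>N) * \<phi> x \<partial>M) = (\<integral>x. (\<integral>y. h (x,y) * (\<phi> x * \<psi> y) \<partial>N) \<partial>M)"
        by (intro Bochner_Integration.integral_cong refl, subst integral_mult_left_zero[symmetric], intro Bochner_Integration.integral_cong refl, simp only: mult_ac)
      also have "\<dots> = (\<integral>p. h p * tensor \<phi> \<psi> p \<partial>(M \<Otimes>\<^sub>M N))"
        using integral_fst'[OF hb[of \<phi> \<psi> C D]] m\<Phi>[OF \<phi>] C D by (simp add: tensor_def case_prod_unfold)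
      finally show "(\<integral>x. (\<integral>y. h (x,y) * \<psi> y \<partial>N) * \<phi> x \<partial>M) = 0" using 0 \<phi> \<psi> by simp
    qed
    \<comment> \<open>The null set in \<open>1\<close> depends on \<open>\<psi>\<close>, and there
      may be uncountably many tests. Integrating over a measurable set \<open>A\<close> first leaves
      a single function of \<open>y\<close>, to which totality of \<open>\<Psi>\<close>
      applies.\<close>
    have 2: "AE y in N. (\<integral>x. h (x,y) * indicator A x \<partial>M) = 0" if [measurable]: "A \<in> sets M" for A
    proof (rule total_testsD(1)[OF \<Psi>])
      have i1: "integrable (M \<Otimes>\<^sub>M N) (\<lambda>(x,y). h (x,y) * (indicator A x * 1))"
        by (rule hb[of "indicator A" "\<lambda>_. 1" 1 1]) (auto simp: indicator_def)
      then show "integrable N (\<lambda>y. \<integral>x. h (x,y) * indicator A x \<partial>M)"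
        using integrable_snd[OF i1] by simp
      fix \<psi> assume \<psi>: "\<psi> \<in> \<Psi>"
      then obtain D where D: "\<And>x. \<bar>\<psi> x\<bar> \<le> D" using b\<Psi> by auto
      note [measurable] = m\<Psi>[OF \<psi>]
      have i2: "integrable (M \<Otimes>\<^sub>M N) (\<lambda>(x,y). h (x,y) * (indicator A x * \<psi> y))"
        by (rule hb[of "indicator A" \<psi> 1 D]) (auto simp: indicator_def D)
      have "(\<integral>y. (\<integral>x. h (x,y) * indicator A x \<partial>M) * \<psi> y \<partial>N) = (\<integral>y. (\<integral>x. h (x,y) * (indicator A x * \<psi> y) \<partial>M) \<partial>N)"
        by (intro Bochner_Integration.integral_cong refl, subst integral_mult_left_zero[symmetric], intro Bochner_Integration.integral_cong refl, simp only: mult_ac)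
      also have "\<dots> = (\<integral>x. (\<integral>y. h (x,y) * (indicator A x * \<psi> y) \<partial>N) \<partial>M)"
        by (rule Fubini_integral[OF i2])
      also have "\<dots> = (\<integral>x. (\<integral>y. h (x,y) * \<psi> y \<partial>N) * indicator A x \<partial>M)"
        by (intro Bochner_Integration.integral_cong refl) (simp split: split_indicator)
      also have "\<dots> = (\<integral>x. 0 \<partial>M)"
        using 1[OF \<psi>] by (intro integral_cong_AE) auto
      finally show "(\<integral>y. (\<integral>x. h (x,y) * indicator A x \<partial>M) * \<psi> y \<partial>N) = 0" by simp
    qed
    have 3: "(LINT p:A \<times> B|M \<Otimes>\<^sub>M N. h p) = 0" if [measurable]: "A \<in> sets M" "B \<in> sets N" for A B
    proof -
      have i2: "integrable (M \<Otimes>\<^sub>M N) (\<lambda>(x,y). h (x,y) * (indicator A x * indicator B y))"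
        by (rule hb[of "indicator A" "indicator B" 1 1]) (auto simp: indicator_def)
      have "(LINT p:A \<times> B|M \<Otimes>\<^sub>M N. h p) = (\<integral>p. (case p of (x,y) \<Rightarrow> h (x,y) * (indicator A x * indicator B y)) \<partial>(M \<Otimes>\<^sub>M N))"
        unfolding set_lebesgue_integral_def by (intro Bochner_Integration.integral_cong refl) (simp add: indicator_times split: prod.split)
      also have "\<dots> = (\<integral>y. (\<integral>x. h (x,y) * (indicator A x * indicator B y) \<partial>M) \<partial>N)"
        using integral_snd[OF i2] by simp
      also have "\<dots> = (\<integral>y. (\<integral>x. h (x,y) * indicator A x \<partial>M) * indicator B y \<partial>N)"
        by (intro Bochner_Integration.integral_cong refl) (simp split: split_indicator)
      also have "\<dots> = (\<integral>y. 0 \<partial>N)"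
        using 2[OF that(1)] by (intro integral_cong_AE) auto
      finally show ?thesis by simp
    qed
    show ?thesis
    proof (rule AE_zero_if_generator[OF h Int_stable_pair_measure_generator[of M N]])
      show "{a \<times> b |a b. a \<in> sets M \<and> b \<in> sets N} \<subseteq> Pow (space (M \<Otimes>\<^sub>M N))"
        unfolding space_pair_measure by (rule pair_measure_closed)
      show "sets (M \<Otimes>\<^sub>M N) = sigma_sets (space (M \<Otimes>\<^sub>M N)) {a \<times> b |a b. a \<in> sets M \<and> b \<in> sets N}"
        by (simp add: sets_pair_measure space_pair_measure)
      show "integral\<^sup>L (M \<Otimes>\<^sub>M N) h = 0"
        using 3[of "space M" "space N"] h by (simp add: set_integral_space flip: space_pair_measure)
    qed (use 3 in auto)
  qed
  have meas: "tensor \<phi> \<psi> \<in> borel_measurable (M \<Otimes>\<^sub>M N) \<and> (\<exists>C. \<forall>p. \<bar>tensor \<phi> \<psi> p\<bar> \<le> C)"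
    if \<phi>: "\<phi> \<in> \<Phi>" and \<psi>: "\<psi> \<in> \<Psi>" for \<phi> \<psi>
  proof -
    note [measurable] = m\<Phi>[OF \<phi>] m\<Psi>[OF \<psi>]
    obtain C D where "\<And>x. \<bar>\<phi> x\<bar> \<le> C" "\<And>x. \<bar>\<psi> x\<bar> \<le> D" using b\<Phi>[OF \<phi>] b\<Psi>[OF \<psi>] by auto
    then have "\<bar>\<phi> x\<bar> * \<bar>\<psi> y\<bar> \<le> C * D" for x y
      by (meson abs_ge_zero mult_mono order_trans)
    then have "\<bar>tensor \<phi> \<psi> p\<bar> \<le> C * D" for p
      by (cases p) (simp add: tensor_def abs_mult)
    moreover have "tensor \<phi> \<psi> \<in> borel_measurable (M \<Otimes>\<^sub>M N)" unfolding tensor_def by measurable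
    ultimately show ?thesis by blast
  qed
  show ?thesis unfolding total_tests_def
  proof (intro conjI ballI allI impI)
    show "\<theta> \<in> borel_measurable (M \<Otimes>\<^sub>M N)" "\<exists>C. \<forall>p. \<bar>\<theta> p\<bar> \<le> C"
      if "\<theta> \<in> {tensor \<phi> \<psi> |\<phi> \<psi>. \<phi> \<in> \<Phi> \<and> \<psi> \<in> \<Psi>}" for \<theta>
      using meas that by blast+
    show "AE p in M \<Otimes>\<^sub>M N. h p = 0" if "integrable (M \<Otimes>\<^sub>M N) h"
      "\<forall>\<theta>\<in>{tensor \<phi> \<psi> |\<phi> \<psi>. \<phi> \<in> \<Phi> \<and> \<psi> \<in> \<Psi>}. (\<integral>p. h p * \<theta> p \<partial>(M \<Otimes>\<^sub>M N)) = 0" for h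
      by (rule vanish[OF that(1)]) (use that(2) in blast)
  qed
qed

section \<open>Continuously differentiable test functions on an interval\<close>

text \<open>One continuous derivative is what \<open>test_fun\<close> asks for. The support stays at
  a positive distance from both ends, so products of such functions have compact support in an open
  box.\<close>

definition C1c :: "real \<Rightarrow> real \<Rightarrow> (real \<Rightarrow> real) set" where
  "C1c a b = {\<phi>. continuous_on UNIV (deriv \<phi>) \<and> (\<forall>s. (\<phi> has_real_derivative deriv \<phi> s) (at s)) \<and>
     (\<exists>c d. a < c \<and> c < d \<and> d < b \<and> (\<forall>s. s \<notin> {c..d} \<longrightarrow> \<phi> s = 0))}"

lemma C1cI:
  assumes "continuous_on UNIV \<phi>'" "\<And>s. (\<phi> has_real_derivative \<phi>' s) (at s)"
    "a < c" "c < d" "d < b" "\<And>s. s \<notin> {c..d} \<Longrightarrow> \<phi> s = 0"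
  shows "\<phi> \<in> C1c a b"
proof -
  have "deriv \<phi> = \<phi>'" using assms(2) by (auto simp: fun_eq_iff intro!: DERIV_imp_deriv)
  then show ?thesis using assms unfolding C1c_def by auto
qed

lemma C1cE:
  assumes "\<phi> \<in> C1c a b"
  obtains c d where "a < c" "c < d" "d < b" "\<And>s. s \<notin> {c..d} \<Longrightarrow> \<phi> s = 0"
  using assms unfolding C1c_def by blast

lemma C1c_deriv:
  assumes "\<phi> \<in> C1c a b"
  shows "(\<phi> has_real_derivative deriv \<phi> s) (at s)" "continuous_on UNIV (deriv \<phi>)" "continuous_on UNIV \<phi>"
proof -
  show *: "(\<phi> has_real_derivative deriv \<phi> s) (at s)" for s using assms by (simp add: C1c_def)
  show "continuous_on UNIV (deriv \<phi>)" using assms by (simp add: C1c_def)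
  show "continuous_on UNIV \<phi>" using * by (intro continuous_at_imp_continuous_on) (auto intro: DERIV_isCont)
qed

lemma C1c_measurable:
  assumes "\<phi> \<in> C1c a b" shows "\<phi> \<in> Borel" "deriv \<phi> \<in> Borel"
  using C1c_deriv[OF assms] by (auto intro: borel_measurable_continuous_onI)

lemma continuous_cspt_bounded:
  fixes f :: "real \<Rightarrow> real"
  assumes "continuous_on UNIV f" "\<And>s. s \<notin> {c..d} \<Longrightarrow> f s = 0"
  obtains C where "\<And>s. \<bar>f s\<bar> \<le> C"
proof -
  have "compact (f ` {c..d})" using assms(1) by (intro compact_continuous_image) (auto intro: continuous_on_subset)
  then obtain C where C: "\<And>s. s \<in> {c..d} \<Longrightarrow> \<bar>f s\<bar> \<le> C" by (metis bounded_iff compact_imp_bounded image_eqI real_norm_def)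
  have "\<bar>f s\<bar> \<le> max C 0" for s using C[of s] assms(2)[of s] by (cases "s \<in> {c..d}") auto
  then show ?thesis using that by blast
qed

lemma C1c_deriv_0:
  assumes \<phi>: "\<phi> \<in> C1c a b" and 0: "\<And>s. s \<notin> {c..d} \<Longrightarrow> \<phi> s = 0" and s: "s \<notin> {c..d}"
  shows "deriv \<phi> s = 0"
proof -
  have "open (- {c..d})" by (simp add: open_Compl)
  then have "eventually (\<lambda>x. x \<in> - {c..d}) (nhds s)" using s by (intro eventually_nhds_in_open) auto
  then have "eventually (\<lambda>x. \<phi> x = 0) (nhds s)" by (elim eventually_mono) (use 0 in auto)
  then have "deriv \<phi> s = deriv (\<lambda>_. 0) s" by (intro deriv_cong_ev) auto
  then show ?thesis by simp
qed

lemma C1c_bounded: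
  assumes "\<phi> \<in> C1c a b" obtains C where "\<And>s. \<bar>\<phi> s\<bar> \<le> C" "\<And>s. \<bar>deriv \<phi> s\<bar> \<le> C"
proof -
  obtain c d where *: "\<And>s. s \<notin> {c..d} \<Longrightarrow> \<phi> s = 0" using C1cE[OF assms] by metis
  obtain C where C: "\<And>s. \<bar>\<phi> s\<bar> \<le> C" using continuous_cspt_bounded[OF C1c_deriv(3)[OF assms] *] by metis
  obtain D where D: "\<And>s. \<bar>deriv \<phi> s\<bar> \<le> D"
    using continuous_cspt_bounded[OF C1c_deriv(2)[OF assms], of c d] C1c_deriv_0[OF assms, of c d] * by metis
  show ?thesis by (rule that[of "max C D"]) (use C D in \<open>simp_all add: le_max_iff_disj\<close>)
qed

lemma C1c_endpoints: "\<phi> \<in> C1c a b \<Longrightarrow> s \<le> a \<or> s \<ge> b \<Longrightarrow> \<phi> s = 0"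
  by (erule C1cE) auto

lemma C1c_add_scale:
  assumes "\<phi> \<in> C1c a b" "\<psi> \<in> C1c a b" shows "(\<lambda>s. \<phi> s + k * \<psi> s) \<in> C1c a b"
proof -
  obtain c d where 1: "a < c" "c < d" "d < b" "\<And>s. s \<notin> {c..d} \<Longrightarrow> \<phi> s = 0" using C1cE[OF assms(1)] by metis
  obtain c' d' where 2: "a < c'" "c' < d'" "d' < b" "\<And>s. s \<notin> {c'..d'} \<Longrightarrow> \<psi> s = 0" using C1cE[OF assms(2)] by metis
  show ?thesis
    by (rule C1cI[where \<phi>'="\<lambda>s. deriv \<phi> s + k * deriv \<psi> s" and c="min c c'" and d="max d d'"])
       (use 1(1-3) 2(1-3) 1(4) 2(4) C1c_deriv[OF assms(1)] C1c_deriv[OF assms(2)] in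
         \<open>auto intro!: continuous_intros derivative_eq_intros simp: min_le_iff_disj le_max_iff_disj not_le\<close>)
qed

lemma DERIV_pos_part_square: "((\<lambda>s. (max 0 s)\<^sup>2) has_real_derivative 2 * max 0 s) (at (s::real))"
proof (cases s "0::real" rule: linorder_cases)
  case less
  have "((\<lambda>_. 0) has_real_derivative 0) (at s)" by simp
  then show ?thesis
    by (rule has_field_derivative_transform_within_open[of _ _ _ "{..<0}", THEN DERIV_cong]) (use less in auto)
next
  case greater
  have "((\<lambda>s. s\<^sup>2) has_real_derivative 2 * s) (at s)" by (auto intro!: derivative_eq_intros)
  then show ?thesis
    by (rule has_field_derivative_transform_within_open[of _ _ _ "{0<..}", THEN DERIV_cong]) (use greater in auto)
next
  case equal
  have "((\<lambda>h. (max 0 h)\<^sup>2 / h) \<longlongrightarrow> 0) (at (0::real))"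
  proof (rule Lim_null_comparison)
    show "\<forall>\<^sub>F h in at 0. norm ((max 0 h)\<^sup>2 / h) \<le> \<bar>h\<bar>" for h :: real
      by (auto simp: max_def power2_eq_square)
    show "((\<lambda>h. \<bar>h\<bar>) \<longlongrightarrow> 0) (at (0::real))" by (simp add: tendsto_rabs_zero)
  qed
  then show ?thesis using equal by (simp add: DERIV_def)
qed

text \<open>Squares of positive parts are continuously differentiable across their zeros, and
  \<open>p / (1 + p)\<close> pushes the growing multiple \<open>p\<close> of their product towards 1
  without exceeding it.\<close>

definition bump :: "nat \<Rightarrow> real \<Rightarrow> real \<Rightarrow> real \<Rightarrow> real" where
  "bump n c d s = (let p = real n * ((max 0 (s - c))\<^sup>2 * (max 0 (d - s))\<^sup>2) in p / (1 + p))"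

lemma bump_C1c:
  assumes "a < c" "c < d" "d < b" shows "bump n c d \<in> C1c a b"
proof (rule C1cI)
  define p where "p = (\<lambda>s. real n * ((max 0 (s - c))\<^sup>2 * (max 0 (d - s))\<^sup>2))"
  define p' where "p' = (\<lambda>s. real n * (2 * max 0 (s - c) * (max 0 (d - s))\<^sup>2 - (max 0 (s - c))\<^sup>2 * (2 * max 0 (d - s))))"
  have d1: "((\<lambda>s. (max 0 (s - c))\<^sup>2) has_real_derivative 2 * max 0 (s - c)) (at s)" for s
    using DERIV_chain2[where f="\<lambda>s. (max 0 s)\<^sup>2" and g="\<lambda>s. s - c" and x=s and s=UNIV, OF DERIV_pos_part_square, of 1]
    by (simp add: DERIV_diff[OF DERIV_ident DERIV_const, simplified])
  have d2: "((\<lambda>s. (max 0 (d - s))\<^sup>2) has_real_derivative - (2 * max 0 (d - s))) (at s)" for s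
    using DERIV_chain2[where f="\<lambda>s. (max 0 s)\<^sup>2" and g="\<lambda>s. d - s" and x=s and s=UNIV, OF DERIV_pos_part_square, of "-1"]
    by (simp add: DERIV_diff[OF DERIV_const DERIV_ident, simplified])
  have p: "(p has_real_derivative p' s) (at s)" for s
    unfolding p_def p'_def by (rule derivative_eq_intros d1 d2 refl)+ (simp add: algebra_simps)
  have pos: "p s \<ge> 0" for s unfolding p_def by simp
  have ne: "1 + p s \<noteq> 0" for s using pos[of s] by linarith
  have "((\<lambda>s. p s / (1 + p s)) has_real_derivative p' s / (1 + p s)\<^sup>2) (at s)" for s
    by (rule derivative_eq_intros p refl ne)+ (use ne in \<open>simp add: field_simps power2_eq_square\<close>)
  moreover have "bump n c d = (\<lambda>s. p s / (1 + p s))" unfolding bump_def p_def Let_def by simp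
  ultimately show "(bump n c d has_real_derivative p' s / (1 + p s)\<^sup>2) (at s)" for s by simp
  show "continuous_on UNIV (\<lambda>s. p' s / (1 + p s)\<^sup>2)"
    using ne unfolding p_def p'_def by (intro continuous_intros) auto
qed (use assms in \<open>auto simp: bump_def max_def\<close>)

lemma bump_bounds: "0 \<le> bump n c d s" "bump n c d s \<le> 1"
  by (auto simp: bump_def Let_def divide_le_eq_1 add_pos_nonneg)

lemma C1c_approx_indicator:
  assumes "c' < d'" "a \<le> c'" "d' \<le> b"
  obtains \<phi> :: "nat \<Rightarrow> real \<Rightarrow> real" where "\<And>n. \<phi> n \<in> C1c a b" "\<And>n x. 0 \<le> \<phi> n x" "\<And>n x. \<phi> n x \<le> 1"
    "\<And>x. (\<lambda>n. \<phi> n x) \<longlonglongrightarrow> indicator {c'<..<d'} x"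
proof -
  define L where "L = d' - c'"
  \<comment> \<open>The margin is at most a third of the length for every \<open>n\<close>, so the
    support of the bump keeps positive length and lies strictly inside the interval.\<close>
  define e1 where "e1 = (\<lambda>n::nat. L / (real n + 3))"
  define \<phi> where "\<phi> = (\<lambda>n. bump n (c' + e1 n) (d' - e1 n))"
  have L: "L > 0" using assms by (simp add: L_def)
  have e1: "e1 n > 0" "e1 n * 3 \<le> L" for n using L by (auto simp: e1_def field_simps)
  have lim1: "e1 \<longlonglongrightarrow> 0"
    using LIMSEQ_ignore_initial_segment[OF lim_const_over_n[of L], of 3] by (simp add: e1_def)
  have m: "\<phi> n \<in> C1c a b" for n unfolding \<phi>_def using e1[of n] L
    using assms by (intro bump_C1c) (auto simp: L_def)
  have lim: "(\<lambda>n. \<phi> n x) \<longlonglongrightarrow> indicator {c'<..<d'} x" for x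
  proof (cases "x \<in> {c'<..<d'}")
    case False
    then have "\<phi> n x = 0" for n using e1(1)[of n] by (auto simp: \<phi>_def bump_def max_def)
    then show ?thesis using False by simp
  next
    case x: True
    define p where "p = (\<lambda>n. (max 0 (x - (c' + e1 n)))\<^sup>2 * (max 0 ((d' - e1 n) - x))\<^sup>2)"
    have "p \<longlonglongrightarrow> (max 0 (x - (c' + 0)))\<^sup>2 * (max 0 ((d' - 0) - x))\<^sup>2"
      unfolding p_def by (intro tendsto_intros lim1)
    moreover have "(max 0 (x - (c' + 0)))\<^sup>2 * (max 0 ((d' - 0) - x))\<^sup>2 > 0" using x by simp
    ultimately have "filterlim (\<lambda>n. real n * p n) at_top sequentially"
      using filterlim_tendsto_pos_mult_at_top[of p _ sequentially real] filterlim_real_sequentially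
      by (simp add: mult.commute)
    then have "(\<lambda>n. 1 - inverse (1 + real n * p n)) \<longlonglongrightarrow> 1 - 0"
      by (intro tendsto_intros tendsto_inverse_0_at_top filterlim_tendsto_add_at_top[OF tendsto_const])
    moreover have "1 - inverse (1 + real n * p n) = \<phi> n x" for n
    proof -
      have "1 + real n * p n \<noteq> 0" by (simp add: p_def add_nonneg_eq_0_iff)
      then show ?thesis by (simp add: \<phi>_def bump_def p_def Let_def field_simps)
    qed
    ultimately show ?thesis using x by simp
  qed
  show ?thesis by (rule that[of \<phi>]) (use m lim bump_bounds in \<open>auto simp: \<phi>_def\<close>)
qed

text \<open>Bumps tend to the indicator of an open interval, so by dominated convergence
  \<open>h\<close> has integral zero over every open interval, and these form an intersection-stable
  generator of the Borel sets.\<close>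

lemma total_tests_C1c:
  assumes "a < b" shows "total_tests (leb_on a b) (C1c a b)"
  unfolding total_tests_def
proof (intro conjI ballI allI impI)
  fix \<phi> assume "\<phi> \<in> C1c a b"
  then show "\<phi> \<in> borel_measurable (leb_on a b)" "\<exists>C. \<forall>x. \<bar>\<phi> x\<bar> \<le> C"
    using C1c_measurable(1)[of \<phi>] by (simp, meson C1c_bounded[of \<phi> a b])
next
  fix h assume h: "integrable (leb_on a b) h" and 0: "\<forall>\<phi>\<in>C1c a b. (LINT x|leb_on a b. h x * \<phi> x) = 0"
  note [measurable] = borel_measurable_integrable[OF h]
  have eq: "(LINT x:{c<..<d}|leb_on a b. h x) = 0" for c d
  proof -
    \<comment> \<open>The interval is clipped to the range where bumps are available. On
      \<open>[a,b]\<close> this changes its indicator at the two end points at most.\<close>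
    define c' where "c' = max a c"
    define d' where "d' = min b d"
    have ae: "AE x in leb_on a b. indicator {c<..<d} x = (indicator {c'<..<d'} x :: real)"
      unfolding AE_leb_on using AE_lborel_singleton[of a] AE_lborel_singleton[of b]
      by eventually_elim (auto simp: indicator_def c'_def d'_def)
    have e: "(LINT x:{c<..<d}|leb_on a b. h x) = (LINT x|leb_on a b. h x * indicator {c'<..<d'} x)"
      unfolding set_lebesgue_integral_def by (rule integral_cong_AE) (use ae in \<open>auto elim!: eventually_mono\<close>)
    show ?thesis
    proof (cases "c' < d'")
      case False
      then show ?thesis unfolding e by simp
    next
      case True
      then obtain \<phi> where m: "\<And>n. \<phi> n \<in> C1c a b" and \<phi>: "\<And>n x. 0 \<le> \<phi> n x" "\<And>n x. \<phi> n x \<le> 1"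
        and lim: "\<And>x. (\<lambda>n. \<phi> n x) \<longlonglongrightarrow> indicator {c'<..<d'} x"
        using C1c_approx_indicator[of c' d' a b] by (auto simp: c'_def d'_def)
      note [measurable] = C1c_measurable(1)[OF m]
      have "(\<lambda>n. LINT x|leb_on a b. h x * \<phi> n x) \<longlonglongrightarrow> (LINT x|leb_on a b. h x * indicator {c'<..<d'} x)"
      proof (rule integral_dominated_convergence[where w="\<lambda>x. norm (h x)"])
        show "AE x in leb_on a b. (\<lambda>n. h x * \<phi> n x) \<longlonglongrightarrow> h x * indicator {c'<..<d'} x"
          by (intro AE_I2 tendsto_intros lim)
        show "AE x in leb_on a b. norm (h x * \<phi> n x) \<le> norm (h x)" for n
          using \<phi> by (auto simp: abs_mult intro!: AE_I2 mult_left_le)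
      qed (use h in auto)
      moreover have "(LINT x|leb_on a b. h x * \<phi> n x) = 0" for n using 0 m by blast
      ultimately have "(\<lambda>n::nat. 0::real) \<longlonglongrightarrow> (LINT x|leb_on a b. h x * indicator {c'<..<d'} x)" by simp
      then show ?thesis unfolding e by (simp add: LIMSEQ_const_iff)
    qed
  qed
  show "AE x in leb_on a b. h x = 0"
  proof (rule AE_zero_if_generator[OF h, of "range (\<lambda>(c,d). {c<..<d})"])
    show "Int_stable (range (\<lambda>(c,d). {c<..<d::real}))"
    proof -
      have "{c<..<d} \<inter> {c'<..<d'} \<in> range (\<lambda>(c,d). {c<..<d})" for c d c' d' :: real
        by (rule range_eqI[of _ _ "(max c c', min d d')"]) auto
      then show ?thesis unfolding Int_stable_def by (simp add: ball_simps split_paired_all)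

    qed
    show "sets (leb_on a b) = sigma_sets (space (leb_on a b)) (range (\<lambda>(c,d). {c<..<d}))"
      unfolding sets_leb_on space_leb_on borel_eq_box box_real(1) by simp
    have "AE x in leb_on a b. h x = indicator {a-1<..<b+1} x *\<^sub>R h x"
      unfolding AE_leb_on by (auto simp: indicator_def)
    then have "integral\<^sup>L (leb_on a b) h = (LINT x:{a-1<..<b+1}|leb_on a b. h x)"
      unfolding set_lebesgue_integral_def by (intro integral_cong_AE) auto
    then show "integral\<^sup>L (leb_on a b) h = 0" using eq by simp
  qed (use eq in auto)
qed

subsection \<open>Primitives\<close>

text \<open>The primitive that vanishes at \<open>a\<close>, constant outside \<open>[a,b]\<close>.
  The upper limit sits in an indicator, so that the measure is fixed and Fubini, dominated
  convergence and measurability in parameters apply directly.\<close>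

definition prim :: "real \<Rightarrow> real \<Rightarrow> (real \<Rightarrow> real) \<Rightarrow> real \<Rightarrow> real" where
  "prim a b g s = (\<integral>\<sigma>. g \<sigma> * indicator {..s} \<sigma> \<partial>leb_on a b)"

lemma prim_eq:
  assumes [measurable]: "g \<in> Borel" and "s \<le> b"
  shows "prim a b g s = (LINT \<sigma>:{a..s}|lborel. g \<sigma>)"
proof -
  have "prim a b g s = (LINT \<sigma>:{a..b}|lborel. g \<sigma> * indicator {..s} \<sigma>)"
    unfolding prim_def by (rule integral_leb_on) simp
  also have "\<dots> = (LINT \<sigma>:{a..s}|lborel. g \<sigma>)"
    using assms(2) unfolding set_lebesgue_integral_def
    by (intro Bochner_Integration.integral_cong refl) (auto split: split_indicator)
  finally show ?thesis .
qed

lemma prim_upper: "b \<le> s \<Longrightarrow> g \<in> Borel \<Longrightarrow> prim a b g s = integral\<^sup>L (leb_on a b) g"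
  unfolding prim_def by (rule integral_cong_AE) (auto simp: AE_leb_on indicator_def)

lemma prim_lower: "s \<le> a \<Longrightarrow> g \<in> Borel \<Longrightarrow> prim a b g s = 0"
proof -
  assume s: "s \<le> a" and [measurable]: "g \<in> Borel"
  have "prim a b g s = (\<integral>\<sigma>. 0 \<partial>leb_on a b)"
    unfolding prim_def
  proof (rule integral_cong_AE)
    show "AE x in leb_on a b. g x * indicat_real {..s} x = 0"
      unfolding AE_leb_on using AE_lborel_singleton[of a] by eventually_elim (use s in auto)
  qed auto
  then show ?thesis by simp
qed

lemma prim_cong_AE:
  assumes "AE x in leb_on a b. f x = g x" "f \<in> Borel" "g \<in> Borel"
  shows "prim a b f s = prim a b g s"
  unfolding prim_def using assms by (intro integral_cong_AE) auto

lemma integrable_ind: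
  fixes g :: "real \<Rightarrow> real"
  assumes "integrable (leb_on a b) g"
  shows "integrable (leb_on a b) (\<lambda>\<sigma>. g \<sigma> * indicator {..s} \<sigma>)"
  using integrable_mult_indicator[OF _ assms, of "{..s}"] by (simp add: mult.commute)

lemma prim_bound:
  assumes "integrable (leb_on a b) g" shows "\<bar>prim a b g s\<bar> \<le> (\<integral>\<sigma>. \<bar>g \<sigma>\<bar> \<partial>leb_on a b)"
proof -
  have "\<bar>prim a b g s\<bar> \<le> (\<integral>\<sigma>. \<bar>g \<sigma> * indicator {..s} \<sigma>\<bar> \<partial>leb_on a b)"
    unfolding prim_def by (rule integral_abs_bound)
  also have "\<dots> \<le> (\<integral>\<sigma>. \<bar>g \<sigma>\<bar> \<partial>leb_on a b)"
    using integrable_ind[OF assms, of s] assms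
    by (intro integral_mono) (auto simp: indicator_def)
  finally show ?thesis .
qed

lemma prim_measurable [measurable]:
  assumes [measurable]: "(\<lambda>(\<sigma>, y). g \<sigma> y) \<in> borel_measurable (borel \<Otimes>\<^sub>M N)" "h \<in> N \<rightarrow>\<^sub>M borel"
  shows "(\<lambda>y. prim a b (\<lambda>\<sigma>. g \<sigma> y) (h y)) \<in> borel_measurable N"
proof -
  have "(\<lambda>(y, \<sigma>). g \<sigma> y) \<in> borel_measurable (N \<Otimes>\<^sub>M leb_on a b)"
    using measurable_pair_swap[OF assms(1)] by (subst measurable_cong_sets[OF sets_pair_measure_cong[OF refl sets_leb_on] refl]) (simp add: case_prod_unfold)
  moreover have "(\<lambda>(y, \<sigma>). indicator {..h y} \<sigma> :: real) \<in> borel_measurable (N \<Otimes>\<^sub>M leb_on a b)"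
  proof -
    have "(\<lambda>(y, \<sigma>). indicator {..h y} \<sigma> :: real) = (\<lambda>p. if snd p \<le> h (fst p) then 1 else 0)" by (auto simp: fun_eq_iff indicator_def)
    then show ?thesis by simp
  qed
  ultimately have "(\<lambda>(y, \<sigma>). g \<sigma> y * indicator {..h y} \<sigma>) \<in> borel_measurable (N \<Otimes>\<^sub>M leb_on a b)"
    by (auto simp: case_prod_unfold)
  then show ?thesis unfolding prim_def by (rule leb_on.borel_measurable_lebesgue_integral)
qed

lemma prim_measurable1 [measurable]:
  "g \<in> Borel \<Longrightarrow> (\<lambda>s. prim a b g s) \<in> Borel"
  by (rule prim_measurable) auto

lemma prim_add:
  "integrable (leb_on a b) f \<Longrightarrow> integrable (leb_on a b) g \<Longrightarrow>
    prim a b (\<lambda>\<sigma>. f \<sigma> + g \<sigma>) s = prim a b f s + prim a b g s"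
  unfolding prim_def by (simp add: distrib_right integrable_ind)

lemma prim_diff:
  "integrable (leb_on a b) f \<Longrightarrow> integrable (leb_on a b) g \<Longrightarrow>
    prim a b (\<lambda>\<sigma>. f \<sigma> - g \<sigma>) s = prim a b f s - prim a b g s"
  unfolding prim_def by (simp add: left_diff_distrib integrable_ind)

lemma prim_cmult: "prim a b (\<lambda>\<sigma>. c * f \<sigma>) s = c * prim a b f s"
  unfolding prim_def by (simp add: mult.assoc)

lemma prim_continuous:
  assumes g: "integrable (leb_on a b) g" shows "continuous_on UNIV (prim a b g)"
  unfolding continuous_on_sequentially comp_def
proof (intro allI ballI impI, elim conjE)
  fix x :: "nat \<Rightarrow> real" and s assume x: "x \<longlonglongrightarrow> s"
  note [measurable] = borel_measurable_integrable[OF g, simplified]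
  show "(\<lambda>n. prim a b g (x n)) \<longlonglongrightarrow> prim a b g s"
    unfolding prim_def
  proof (rule integral_dominated_convergence[where w="\<lambda>x. norm (g x)"])
    show "AE \<sigma> in leb_on a b. (\<lambda>n. g \<sigma> * indicator {..x n} \<sigma>) \<longlonglongrightarrow> g \<sigma> * indicator {..s} \<sigma>"
      unfolding AE_leb_on using AE_lborel_singleton[of s]
    proof eventually_elim
      case (elim \<sigma>)
      have "eventually (\<lambda>n. indicator {..x n} \<sigma> = (indicator {..s} \<sigma> :: real)) sequentially"
      proof (cases "\<sigma> < s")
        case True
        then show ?thesis using order_tendstoD(1)[OF x True] by (auto elim!: eventually_mono)
      next
        case False
        then have "s < \<sigma>" using elim by auto
        then show ?thesis using order_tendstoD(2)[OF x, of \<sigma>] by (auto elim!: eventually_mono)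
      qed
      then show ?case by (intro impI tendsto_mult tendsto_const tendsto_eventually)
    qed
  qed (use g in \<open>auto simp: indicator_def\<close>)
qed

lemma integrable_tensor:
  fixes f :: "'a \<Rightarrow> 'c::{real_normed_algebra, banach, second_countable_topology}"
  assumes "sigma_finite_measure M" "sigma_finite_measure N" and f: "integrable M f" and g: "integrable N g"
  shows "integrable (M \<Otimes>\<^sub>M N) (\<lambda>(x, y). f x * g y)"
proof -
  interpret M: sigma_finite_measure M by fact
  interpret N: sigma_finite_measure N by fact
  note [measurable] = borel_measurable_integrable[OF f] borel_measurable_integrable[OF g]
  have "(\<integral>\<^sup>+p. norm (case p of (x, y) \<Rightarrow> f x * g y) \<partial>(M \<Otimes>\<^sub>M N)) \<le> (\<integral>\<^sup>+p. ennreal (norm (f (fst p))) * ennreal (norm (g (snd p))) \<partial>(M \<Otimes>\<^sub>M N))"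
    by (intro nn_integral_mono) (auto simp: norm_mult_ineq ennreal_leI simp flip: ennreal_mult)
  also have "\<dots> = (\<integral>\<^sup>+x. ennreal (norm (f x)) * (\<integral>\<^sup>+y. ennreal (norm (g y)) \<partial>N) \<partial>M)"
    by (subst N.nn_integral_fst[symmetric]) (auto simp: nn_integral_cmult)
  also have "\<dots> = (\<integral>\<^sup>+x. ennreal (norm (f x)) \<partial>M) * (\<integral>\<^sup>+y. ennreal (norm (g y)) \<partial>N)"
    by (rule nn_integral_multc) simp
  also have "\<dots> < \<infinity>" using f g by (auto simp: integrable_iff_bounded ennreal_mult_less_top)
  finally show ?thesis by (intro integrableI_bounded) (auto simp: case_prod_unfold)
qed

text \<open>Fubini on the two halves of the square \<open>{..s} \<times> {..s}\<close>.\<close>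

lemma prim_product:
  assumes f: "integrable (leb_on a b) f" and g: "integrable (leb_on a b) g"
  shows "(F0 + prim a b f s) * (G0 + prim a b g s) =
      F0 * G0 + prim a b (\<lambda>\<sigma>. f \<sigma> * (G0 + prim a b g \<sigma>) + (F0 + prim a b f \<sigma>) * g \<sigma>) s"
    and "integrable (leb_on a b) (\<lambda>\<sigma>. f \<sigma> * (G0 + prim a b g \<sigma>) + (F0 + prim a b f \<sigma>) * g \<sigma>)"
proof -
  let ?M = "leb_on a b"
  note [measurable] = borel_measurable_integrable[OF f, simplified] borel_measurable_integrable[OF g, simplified]
  have bd: "AE x in ?M. norm (C0 + prim a b h x) \<le> \<bar>C0\<bar> + (\<integral>\<sigma>. \<bar>h \<sigma>\<bar> \<partial>?M)" if "integrable ?M h" for h C0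
    using prim_bound[OF that] by (auto intro!: AE_I2 order_trans[OF abs_triangle_ineq] add_left_mono)
  have i1: "integrable ?M (\<lambda>\<sigma>. f \<sigma> * (C0 + prim a b g \<sigma>))" for C0
    by (rule integrable_mult_bounded_AE(1)[OF f _ bd[OF g]]) simp
  have i2: "integrable ?M (\<lambda>\<sigma>. (C0 + prim a b f \<sigma>) * g \<sigma>)" for C0
    by (rule integrable_mult_bounded_AE(2)[OF g _ bd[OF f]]) simp
  show "integrable ?M (\<lambda>\<sigma>. f \<sigma> * (G0 + prim a b g \<sigma>) + (F0 + prim a b f \<sigma>) * g \<sigma>)"
    using i1 i2 by auto
  define f1 where "f1 = (\<lambda>\<sigma>. f \<sigma> * indicator {..s} \<sigma>)"
  define g1 where "g1 = (\<lambda>\<sigma>. g \<sigma> * indicator {..s} \<sigma>)"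
  have f1: "integrable ?M f1" and g1: "integrable ?M g1" unfolding f1_def g1_def by (rule integrable_ind f g)+
  note [measurable] = borel_measurable_integrable[OF f1, simplified] borel_measurable_integrable[OF g1, simplified]
  have fg: "integrable (?M \<Otimes>\<^sub>M ?M) (\<lambda>(\<sigma>, \<tau>). f1 \<sigma> * g1 \<tau>)"
    by (rule integrable_tensor) (use f1 g1 in \<open>auto intro: leb_on.sigma_finite_measure_axioms\<close>)
  have ind: "integrable (?M \<Otimes>\<^sub>M ?M) (\<lambda>(\<sigma>, \<tau>). f1 \<sigma> * g1 \<tau> * indicator {..\<sigma>} \<tau>)"
  proof (rule Bochner_Integration.integrable_bound[OF fg])
    have *: "(\<lambda>(\<sigma>, \<tau>). indicator {..\<sigma>} \<tau> :: real) = (\<lambda>p. if snd p \<le> fst p then 1 else 0)" by (auto simp: fun_eq_iff indicator_def)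
    have [measurable]: "(\<lambda>(\<sigma>, \<tau>). indicator {..\<sigma>} \<tau> :: real) \<in> borel_measurable (?M \<Otimes>\<^sub>M ?M)"
      unfolding * by measurable
    have "(\<lambda>p. f1 (fst p) * g1 (snd p) * (case p of (\<sigma>, \<tau>) \<Rightarrow> indicator {..\<sigma>} \<tau>)) \<in> borel_measurable (?M \<Otimes>\<^sub>M ?M)"
      by measurable
    then show "(\<lambda>(\<sigma>, \<tau>). f1 \<sigma> * g1 \<tau> * indicator {..\<sigma>} \<tau>) \<in> borel_measurable (?M \<Otimes>\<^sub>M ?M)"
      by (simp add: case_prod_unfold)
  qed (auto simp: indicator_def)
  have ind2: "integrable (?M \<Otimes>\<^sub>M ?M) (\<lambda>(\<sigma>, \<tau>). f1 \<sigma> * g1 \<tau> * (1 - indicator {..\<sigma>} \<tau>))"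
    using Bochner_Integration.integrable_diff[OF fg ind] by (simp add: case_prod_unfold algebra_simps)
  have "(\<integral>\<sigma>. f1 \<sigma> * prim a b g \<sigma> \<partial>?M) + (\<integral>\<tau>. prim a b f \<tau> * g1 \<tau> \<partial>?M) = integral\<^sup>L ?M f1 * integral\<^sup>L ?M g1"
  proof -
    have "(\<integral>\<sigma>. f1 \<sigma> * prim a b g \<sigma> \<partial>?M) = (\<integral>\<sigma>. (\<integral>\<tau>. f1 \<sigma> * g1 \<tau> * indicator {..\<sigma>} \<tau> \<partial>?M) \<partial>?M)"
    proof (intro Bochner_Integration.integral_cong refl)
      fix \<sigma>
      have "f1 \<sigma> * prim a b g \<sigma> = (\<integral>\<tau>. f1 \<sigma> * (g \<tau> * indicator {..\<sigma>} \<tau>) \<partial>?M)" unfolding prim_def by simp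
      also have "\<dots> = (\<integral>\<tau>. f1 \<sigma> * g1 \<tau> * indicator {..\<sigma>} \<tau> \<partial>?M)"
        by (intro Bochner_Integration.integral_cong refl) (auto simp: f1_def g1_def split: split_indicator)
      finally show "f1 \<sigma> * prim a b g \<sigma> = (\<integral>\<tau>. f1 \<sigma> * g1 \<tau> * indicator {..\<sigma>} \<tau> \<partial>?M)" .
    qed
    also have "\<dots> = integral\<^sup>L (?M \<Otimes>\<^sub>M ?M) (\<lambda>(\<sigma>, \<tau>). f1 \<sigma> * g1 \<tau> * indicator {..\<sigma>} \<tau>)"
      using leb_pair.integral_fst'[OF ind] by simp
    finally have e1: "(\<integral>\<sigma>. f1 \<sigma> * prim a b g \<sigma> \<partial>?M) = integral\<^sup>L (?M \<Otimes>\<^sub>M ?M) (\<lambda>(\<sigma>, \<tau>). f1 \<sigma> * g1 \<tau> * indicator {..\<sigma>} \<tau>)" .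
    have "(\<integral>\<tau>. prim a b f \<tau> * g1 \<tau> \<partial>?M) = (\<integral>\<tau>. (\<integral>\<sigma>. f1 \<sigma> * g1 \<tau> * (1 - indicator {..\<sigma>} \<tau>) \<partial>?M) \<partial>?M)"
    proof (intro Bochner_Integration.integral_cong refl)
      fix \<tau>
      have "prim a b f \<tau> * g1 \<tau> = (\<integral>\<sigma>. (f \<sigma> * indicator {..\<tau>} \<sigma>) * g1 \<tau> \<partial>?M)" unfolding prim_def by simp
      also have "\<dots> = (\<integral>\<sigma>. f1 \<sigma> * g1 \<tau> * (1 - indicator {..\<sigma>} \<tau>) \<partial>?M)"
      proof (rule integral_cong_AE)
        \<comment> \<open>The two closed half squares overlap in the diagonal, which for fixed
          \<open>\<tau>\<close> is a single point.\<close>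
        show "AE \<sigma> in ?M. f \<sigma> * indicator {..\<tau>} \<sigma> * g1 \<tau> = f1 \<sigma> * g1 \<tau> * (1 - indicator {..\<sigma>} \<tau>)"
          unfolding AE_leb_on using AE_lborel_singleton[of \<tau>]
          by eventually_elim (auto simp: f1_def g1_def split: split_indicator)
        have "indicator {..\<sigma>} \<tau> = (indicator {\<tau>..} \<sigma> :: real)" for \<sigma> by (auto simp: indicator_def)
        then show "(\<lambda>\<sigma>. f1 \<sigma> * g1 \<tau> * (1 - indicator {..\<sigma>} \<tau>)) \<in> borel_measurable ?M" by simp
      qed simp
      finally show "prim a b f \<tau> * g1 \<tau> = (\<integral>\<sigma>. f1 \<sigma> * g1 \<tau> * (1 - indicator {..\<sigma>} \<tau>) \<partial>?M)" .
    qed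
    also have "\<dots> = integral\<^sup>L (?M \<Otimes>\<^sub>M ?M) (\<lambda>(\<sigma>, \<tau>). f1 \<sigma> * g1 \<tau> * (1 - indicator {..\<sigma>} \<tau>))"
      using leb_pair.integral_snd[OF ind2] by simp
    finally have e2: "(\<integral>\<tau>. prim a b f \<tau> * g1 \<tau> \<partial>?M) = integral\<^sup>L (?M \<Otimes>\<^sub>M ?M) (\<lambda>(\<sigma>, \<tau>). f1 \<sigma> * g1 \<tau> * (1 - indicator {..\<sigma>} \<tau>))" .
    have "(\<integral>\<sigma>. f1 \<sigma> * prim a b g \<sigma> \<partial>?M) + (\<integral>\<tau>. prim a b f \<tau> * g1 \<tau> \<partial>?M) = integral\<^sup>L (?M \<Otimes>\<^sub>M ?M) (\<lambda>(\<sigma>, \<tau>). f1 \<sigma> * g1 \<tau>)"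
      unfolding e1 e2 by (subst Bochner_Integration.integral_add[OF ind ind2, symmetric])
        (simp add: case_prod_unfold algebra_simps)
    also have "\<dots> = (\<integral>\<sigma>. (\<integral>\<tau>. f1 \<sigma> * g1 \<tau> \<partial>?M) \<partial>?M)"
      using leb_pair.integral_fst'[OF fg] by simp
    finally show ?thesis by simp
  qed
  then have prod: "prim a b (\<lambda>\<sigma>. f \<sigma> * prim a b g \<sigma>) s + prim a b (\<lambda>\<sigma>. prim a b f \<sigma> * g \<sigma>) s = prim a b f s * prim a b g s"
    unfolding prim_def[of a b _ s] f1_def g1_def by (simp add: mult_ac)
  have "prim a b (\<lambda>\<sigma>. f \<sigma> * (G0 + prim a b g \<sigma>) + (F0 + prim a b f \<sigma>) * g \<sigma>) s =
     prim a b (\<lambda>\<sigma>. f \<sigma> * (G0 + prim a b g \<sigma>)) s + prim a b (\<lambda>\<sigma>. (F0 + prim a b f \<sigma>) * g \<sigma>) s"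
    by (rule prim_add[OF i1 i2])
  also have "prim a b (\<lambda>\<sigma>. f \<sigma> * (G0 + prim a b g \<sigma>)) s = prim a b f s * G0 + prim a b (\<lambda>\<sigma>. f \<sigma> * prim a b g \<sigma>) s"
    using prim_add[of a b "\<lambda>\<sigma>. G0 * f \<sigma>" "\<lambda>\<sigma>. f \<sigma> * prim a b g \<sigma>" s] f i1[of 0] by (simp add: prim_cmult algebra_simps)
  also have "prim a b (\<lambda>\<sigma>. (F0 + prim a b f \<sigma>) * g \<sigma>) s = F0 * prim a b g s + prim a b (\<lambda>\<sigma>. prim a b f \<sigma> * g \<sigma>) s"
    using prim_add[of a b "\<lambda>\<sigma>. F0 * g \<sigma>" "\<lambda>\<sigma>. prim a b f \<sigma> * g \<sigma>" s] g i2[of 0] by (simp add: prim_cmult algebra_simps)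
  finally show "(F0 + prim a b f s) * (G0 + prim a b g s) =
      F0 * G0 + prim a b (\<lambda>\<sigma>. f \<sigma> * (G0 + prim a b g \<sigma>) + (F0 + prim a b f \<sigma>) * g \<sigma>) s"
    using prod by (simp add: algebra_simps)
qed

section \<open>Weak derivatives as primitives on lines\<close>

text \<open>\<open>Q\<close> need not be measurable, so the order of the variables is exchanged for
  a measurable null set that contains all failures.\<close>

lemma AE_pair_swap:
  assumes "sigma_finite_measure M" "sigma_finite_measure N" "AE p in M \<Otimes>\<^sub>M N. Q p"
  shows "AE y in N. AE x in M. Q (x, y)"
proof -
  interpret M: sigma_finite_measure M by fact
  interpret N: sigma_finite_measure N by fact
  interpret pair_sigma_finite M N ..
  obtain Z where Z: "{p \<in> space (M \<Otimes>\<^sub>M N). \<not> Q p} \<subseteq> Z" "Z \<in> null_sets (M \<Otimes>\<^sub>M N)"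
    using assms(3) by (auto simp: eventually_ae_filter)
  have m: "{p \<in> space (M \<Otimes>\<^sub>M N). (fst p, snd p) \<notin> Z} \<in> sets (M \<Otimes>\<^sub>M N)"
    using Z(2) by (auto intro!: sets.sets_Collect)
  have "AE p in M \<Otimes>\<^sub>M N. p \<notin> Z" using Z(2) by (rule AE_not_in)
  then have "AE x in M. AE y in N. (x, y) \<notin> Z" by (rule AE_pair)
  then have "AE y in N. AE x in M. (x, y) \<notin> Z" using AE_commute[of "\<lambda>x y. (x, y) \<notin> Z"] m by simp
  with AE_space show ?thesis
  proof eventually_elim
    case (elim y)
    from elim(2) AE_space show ?case
      by eventually_elim (use Z(1) elim(1) in \<open>auto simp: space_pair_measure\<close>)
  qed
qed

lemma C1c_eq_prim:
  assumes "\<phi> \<in> C1c a b" "s \<in> {a..b}" shows "prim a b (deriv \<phi>) s = \<phi> s"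
proof -
  note [measurable] = C1c_measurable[OF assms(1)]
  have "prim a b (deriv \<phi>) s = (LINT \<sigma>:{a..s}|lborel. deriv \<phi> \<sigma>)" using assms(2) by (intro prim_eq) auto
  also have "\<dots> = (\<integral>\<sigma>. deriv \<phi> \<sigma> * indicator {a..s} \<sigma> \<partial>lborel)"
    by (simp add: set_lebesgue_integral_def mult.commute)
  also have "\<dots> = \<phi> s - \<phi> a"
    using assms(2) C1c_deriv[OF assms(1)] by (intro integral_FTC_Icc_real) (auto simp: continuous_on_eq_continuous_at)
  finally show ?thesis using C1c_endpoints[OF assms(1), of a] by simp
qed

text \<open>This is the product rule on the whole interval; the boundary term drops because
  \<open>\<phi>\<close> vanishes at both ends.\<close>

lemma prim_integrate_by_parts:
  assumes \<phi>: "\<phi> \<in> C1c a b" and g: "integrable (leb_on a b) g" and ab: "a < b"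
  shows "(\<integral>s. prim a b g s * deriv \<phi> s \<partial>leb_on a b) = - (\<integral>s. g s * \<phi> s \<partial>leb_on a b)"
proof -
  let ?M = "leb_on a b"
  note [measurable] = C1c_measurable[OF \<phi>] borel_measurable_integrable[OF g, simplified]
  obtain C where C: "\<And>s. \<bar>\<phi> s\<bar> \<le> C" "\<And>s. \<bar>deriv \<phi> s\<bar> \<le> C" using C1c_bounded[OF \<phi>] by metis
  have d: "integrable ?M (deriv \<phi>)" by (rule integrable_bounded_AE[of _ _ C]) (auto simp: C leb_on.finite_measure_axioms)
  have i1: "integrable ?M (\<lambda>s. g s * \<phi> s)" by (rule integrable_mult_bounded_AE(1)[OF g, of _ C]) (auto simp: C)
  have i2: "integrable ?M (\<lambda>s. prim a b g s * deriv \<phi> s)"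
    using prim_product(2)[OF g d, of 0 0] integrable_mult_bounded_AE(2)[OF d, of "prim a b g" "\<integral>\<sigma>. \<bar>g \<sigma>\<bar> \<partial>?M"] prim_bound[OF g] by auto
  have "0 = prim a b g b * prim a b (deriv \<phi>) b"
    using C1c_eq_prim[OF \<phi>, of b] C1c_endpoints[OF \<phi>, of b] ab by simp
  also have "\<dots> = prim a b (\<lambda>\<sigma>. g \<sigma> * prim a b (deriv \<phi>) \<sigma> + prim a b g \<sigma> * deriv \<phi> \<sigma>) b"
    using prim_product(1)[OF g d, of 0 b 0] by simp
  also have "\<dots> = (\<integral>\<sigma>. g \<sigma> * prim a b (deriv \<phi>) \<sigma> + prim a b g \<sigma> * deriv \<phi> \<sigma> \<partial>?M)"
    by (intro prim_upper) auto
  also have "\<dots> = (\<integral>\<sigma>. g \<sigma> * \<phi> \<sigma> + prim a b g \<sigma> * deriv \<phi> \<sigma> \<partial>?M)"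
    by (intro integral_cong_AE) (auto simp: AE_leb_on C1c_eq_prim[OF \<phi>])
  also have "\<dots> = (\<integral>\<sigma>. g \<sigma> * \<phi> \<sigma> \<partial>?M) + (\<integral>\<sigma>. prim a b g \<sigma> * deriv \<phi> \<sigma> \<partial>?M)"
    by (rule Bochner_Integration.integral_add[OF i1 i2])
  finally show ?thesis by simp
qed

text \<open>Mean zero is what makes the antiderivative that vanishes to the left of the support
  vanish to the right of it as well.\<close>

lemma C1c_antiderivative:
  assumes \<xi>: "\<xi> \<in> C1c a b" and 0: "(\<integral>s. \<xi> s \<partial>leb_on a b) = 0" and ab: "a < b"
  obtains \<Phi> where "\<Phi> \<in> C1c a b" "deriv \<Phi> = \<xi>"
proof -
  note [measurable] = C1c_measurable[OF \<xi>]
  obtain c d where cd: "a < c" "c < d" "d < b" "\<And>s. s \<notin> {c..d} \<Longrightarrow> \<xi> s = 0" using C1cE[OF \<xi>] by metis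
  have cont: "continuous_on UNIV \<xi>" by (rule C1c_deriv[OF \<xi>])
  obtain F where F: "\<And>x. (F has_real_derivative \<xi> x) (at x)"
    using einterval_antiderivative[of "-\<infinity>" "\<infinity>" \<xi>] cont
    by (auto simp: has_real_derivative_iff_has_vector_derivative continuous_on_eq_continuous_at)
  have FTC: "(LINT s:{p..q}|lborel. \<xi> s) = F q - F p" if "p \<le> q" for p q
    using integral_FTC_Icc_real[OF that, of F \<xi>] F cont
    by (auto simp: set_lebesgue_integral_def mult.commute continuous_on_eq_continuous_at)
  have int: "(LINT s:{a..b}|lborel. \<xi> s) = 0" using 0 by (simp add: integral_leb_on)
  have "F s = F a" if "s \<notin> {c..d}" for s
  proof (cases "s < c")
    case True
    have "(LINT x:{min s a..max s a}|lborel. \<xi> x) = (LINT x:{min s a..max s a}|lborel. 0)"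
      using cd True by (intro set_lebesgue_integral_cong) (auto simp: max_def min_def split: if_splits)
    then show ?thesis using FTC[of "min s a" "max s a"] by (auto simp: min_def max_def split: if_splits)
  next
    case False
    then have "s > d" using that by auto
    have "(LINT x:{min s b..max s b}|lborel. \<xi> x) = (LINT x:{min s b..max s b}|lborel. 0)"
      using cd \<open>s > d\<close> by (intro set_lebesgue_integral_cong) (auto simp: max_def min_def split: if_splits)
    then have "F s = F b" using FTC[of "min s b" "max s b"] by (auto simp: min_def max_def split: if_splits)
    then show ?thesis using int FTC[of a b] ab by simp
  qed
  then have z: "F s - F a = 0" if "s \<notin> {c..d}" for s using that by simp
  have D: "((\<lambda>s. F s - F a) has_real_derivative \<xi> s) (at s)" for s
    using DERIV_diff[OF F[of s] DERIV_const[of "F a"]] by simp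
  have "(\<lambda>s. F s - F a) \<in> C1c a b"
    by (rule C1cI[OF cont D cd(1-3) z])
  moreover have "deriv (\<lambda>s. F s - F a) = \<xi>"
    by (rule ext) (rule DERIV_imp_deriv[OF D])
  ultimately show ?thesis using that by blast
qed

text \<open>du Bois-Reymond with parameters: subtracting from a test function its mean times a fixed
  normalised bump \<open>\<phi>\<^sub>0\<close> makes it a derivative, so \<open>f - \<integral> g\<close> agrees with its \<open>\<phi>\<^sub>0\<close>-average.\<close>

lemma weak_deriv_slices:
  fixes f g :: "real \<times> 'b \<Rightarrow> real"
  assumes ab: "a < b" and N: "finite_measure N" and \<Psi>: "total_tests N \<Psi>"
    and f: "integrable (leb_on a b \<Otimes>\<^sub>M N) f" and g: "integrable (leb_on a b \<Otimes>\<^sub>M N) g"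
    and weak: "\<And>\<phi> \<psi>. \<phi> \<in> C1c a b \<Longrightarrow> \<psi> \<in> \<Psi> \<Longrightarrow>
      (\<integral>p. f p * (deriv \<phi> (fst p) * \<psi> (snd p)) \<partial>(leb_on a b \<Otimes>\<^sub>M N)) =
      - (\<integral>p. g p * (\<phi> (fst p) * \<psi> (snd p)) \<partial>(leb_on a b \<Otimes>\<^sub>M N))"
  shows "AE y in N. integrable (leb_on a b) (\<lambda>s. g (s, y)) \<and>
    (\<exists>C. AE s in leb_on a b. f (s, y) = C + prim a b (\<lambda>\<sigma>. g (\<sigma>, y)) s)"
proof -
  let ?M = "leb_on a b"
  interpret N: finite_measure N by fact
  interpret pair_sigma_finite ?M N ..
  note [measurable] = borel_measurable_integrable[OF f] borel_measurable_integrable[OF g]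
  have f': "integrable (?M \<Otimes>\<^sub>M N) (\<lambda>(s, y). f (s, y))" and g': "integrable (?M \<Otimes>\<^sub>M N) (\<lambda>(s, y). g (s, y))"
    using f g by simp_all
  have gy: "AE y in N. integrable ?M (\<lambda>s. g (s, y))" using AE_integrable_snd[OF g'] .
  \<comment> \<open>\<open>K\<close> dominates the primitives of \<open>g\<close> uniformly in the
    first variable, which makes the primitive integrable in both variables.\<close>
  define K where "K = (\<lambda>y. \<integral>s. \<bar>g (s, y)\<bar> \<partial>?M)"
  have K: "integrable N K" unfolding K_def using integrable_snd[of "\<lambda>s y. \<bar>g (s, y)\<bar>"] g by (simp add: case_prod_unfold)
  define pg where "pg = (\<lambda>p. prim a b (\<lambda>\<sigma>. g (\<sigma>, snd p)) (fst p))"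
  have [measurable]: "pg \<in> borel_measurable (?M \<Otimes>\<^sub>M N)"
    unfolding pg_def
  proof (rule prim_measurable)
    have "(\<lambda>(\<sigma>, y). g (\<sigma>, snd y)) \<in> borel_measurable (?M \<Otimes>\<^sub>M (?M \<Otimes>\<^sub>M N))" by measurable
    then show "(\<lambda>(\<sigma>, y). g (\<sigma>, snd y)) \<in> borel_measurable (borel \<Otimes>\<^sub>M (?M \<Otimes>\<^sub>M N))"
      by (subst measurable_cong_sets[OF sets_pair_measure_cong[OF sets_leb_on[symmetric] refl] refl])
  qed measurable
  have pgK: "AE p in ?M \<Otimes>\<^sub>M N. norm (pg p) \<le> norm (case p of (s, y) \<Rightarrow> 1 * K y)"
  proof (rule AE_pair_measure)
    note [measurable] = borel_measurable_integrable[OF K]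
    show "{x \<in> space (?M \<Otimes>\<^sub>M N). norm (pg x) \<le> norm (case x of (s, y) \<Rightarrow> 1 * K y)} \<in> sets (?M \<Otimes>\<^sub>M N)"
      by measurable
    show "AE x in ?M. AE y in N. norm (pg (x, y)) \<le> norm (case (x, y) of (s, y) \<Rightarrow> 1 * K y)"
      using gy prim_bound by (auto intro!: AE_I2 elim!: eventually_mono simp: pg_def K_def intro: order_trans[OF _ abs_ge_self])
  qed
  have "integrable (?M \<Otimes>\<^sub>M N) (\<lambda>(s, y). 1 * K y)"
    by (rule integrable_tensor) (use K in \<open>auto intro: leb_on.sigma_finite_measure_axioms N.sigma_finite_measure_axioms\<close>)
  then have pg: "integrable (?M \<Otimes>\<^sub>M N) pg" by (rule Bochner_Integration.integrable_bound[OF _ _ pgK]) simp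
  define r where "r = (\<lambda>p. f p - pg p)"
  have r: "integrable (?M \<Otimes>\<^sub>M N) r" unfolding r_def using f pg by simp
  note [measurable] = borel_measurable_integrable[OF r]
  have hb: "integrable (?M \<Otimes>\<^sub>M N) (\<lambda>p. h p * (\<phi> (fst p) * \<psi> (snd p)))"
    if h: "integrable (?M \<Otimes>\<^sub>M N) h" and \<phi>: "\<phi> \<in> Borel" "\<And>s. \<bar>\<phi> s\<bar> \<le> C" and \<psi>: "\<psi> \<in> \<Psi>" for h \<phi> \<psi> C
  proof -
    note [measurable] = \<phi>(1) total_testsD(2)[OF \<Psi> \<psi>]
    obtain D where D: "\<And>y. \<bar>\<psi> y\<bar> \<le> D" using total_testsD(3)[OF \<Psi> \<psi>] by auto
    have "\<bar>\<phi> s\<bar> * \<bar>\<psi> y\<bar> \<le> C * D" for s y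
      using \<phi>(2) D by (meson abs_ge_zero mult_mono order_trans)
    then show ?thesis by (intro integrable_mult_bounded_AE(1)[OF h, of _ "C * D"]) (auto simp: abs_mult)
  qed
  have iter: "(\<integral>p. h p * (\<phi> (fst p) * \<psi> (snd p)) \<partial>(?M \<Otimes>\<^sub>M N)) = (\<integral>y. (\<integral>s. h (s, y) * \<phi> s \<partial>?M) * \<psi> y \<partial>N)"
    if h: "integrable (?M \<Otimes>\<^sub>M N) h" "\<phi> \<in> Borel" "\<And>s. \<bar>\<phi> s\<bar> \<le> C" "\<psi> \<in> \<Psi>" for h \<phi> \<psi> C
  proof -
    have *: "integrable (?M \<Otimes>\<^sub>M N) (\<lambda>(s, y). h (s, y) * (\<phi> s * \<psi> y))" using hb[OF h] by (simp add: case_prod_unfold)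
    have "(\<integral>p. h p * (\<phi> (fst p) * \<psi> (snd p)) \<partial>(?M \<Otimes>\<^sub>M N)) = (\<integral>y. (\<integral>s. h (s, y) * (\<phi> s * \<psi> y) \<partial>?M) \<partial>N)"
      using integral_snd[OF *] by (simp add: case_prod_unfold)
    then show ?thesis by (simp flip: mult.assoc)
  qed
  \<comment> \<open>\<open>r\<close> is \<open>f\<close> minus the primitive of \<open>g\<close>, so
    its weak derivative in the first variable is zero.\<close>
  have r0: "(\<integral>p. r p * (deriv \<phi> (fst p) * \<psi> (snd p)) \<partial>(?M \<Otimes>\<^sub>M N)) = 0" if \<phi>: "\<phi> \<in> C1c a b" and \<psi>: "\<psi> \<in> \<Psi>" for \<phi> \<psi>
  proof -
    obtain C where C: "\<And>s. \<bar>\<phi> s\<bar> \<le> C" "\<And>s. \<bar>deriv \<phi> s\<bar> \<le> C" using C1c_bounded[OF \<phi>] by metis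
    note m [measurable] = C1c_measurable[OF \<phi>]
    have [measurable]: "\<psi> \<in> borel_measurable N" using total_testsD(2)[OF \<Psi> \<psi>] .
    have "(\<integral>p. pg p * (deriv \<phi> (fst p) * \<psi> (snd p)) \<partial>(?M \<Otimes>\<^sub>M N)) = (\<integral>y. (\<integral>s. pg (s, y) * deriv \<phi> s \<partial>?M) * \<psi> y \<partial>N)"
      by (rule iter[OF pg m(2) C(2) \<psi>])
    also have "\<dots> = (\<integral>y. - ((\<integral>s. g (s, y) * \<phi> s \<partial>?M) * \<psi> y) \<partial>N)"
    proof (rule integral_cong_AE)
      show "AE y in N. (\<integral>s. pg (s, y) * deriv \<phi> s \<partial>?M) * \<psi> y = - ((\<integral>s. g (s, y) * \<phi> s \<partial>?M) * \<psi> y)"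
        using gy by eventually_elim (simp add: pg_def prim_integrate_by_parts[OF \<phi> _ ab])
      have "(\<lambda>y. \<integral>s. pg (s, y) * deriv \<phi> s \<partial>?M) \<in> borel_measurable N" "(\<lambda>y. \<integral>s. g (s, y) * \<phi> s \<partial>?M) \<in> borel_measurable N"
        by (rule leb_on.borel_measurable_lebesgue_integral; measurable)+
      then show "(\<lambda>y. (\<integral>s. pg (s, y) * deriv \<phi> s \<partial>?M) * \<psi> y) \<in> borel_measurable N"
        "(\<lambda>y. - ((\<integral>s. g (s, y) * \<phi> s \<partial>?M) * \<psi> y)) \<in> borel_measurable N" by measurable
    qed
    also have "\<dots> = - (\<integral>p. g p * (\<phi> (fst p) * \<psi> (snd p)) \<partial>(?M \<Otimes>\<^sub>M N))"
      by (subst iter[OF g m(1) C(1) \<psi>]) simp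
    also have "\<dots> = (\<integral>p. f p * (deriv \<phi> (fst p) * \<psi> (snd p)) \<partial>(?M \<Otimes>\<^sub>M N))" using weak[OF \<phi> \<psi>] by simp
    finally show ?thesis unfolding r_def left_diff_distrib
      by (subst Bochner_Integration.integral_diff) (use hb[OF f m(2) C(2) \<psi>] hb[OF pg m(2) C(2) \<psi>] in auto)
  qed
  obtain \<phi>0 where \<phi>0: "\<phi>0 \<in> C1c a b" "(\<integral>s. \<phi>0 s \<partial>?M) = 1"
  proof -
    \<comment> \<open>If all test functions had mean zero, totality would make the constant 1 vanish
      almost everywhere.\<close>
    have "\<exists>\<phi>\<in>C1c a b. (\<integral>s. \<phi> s \<partial>?M) \<noteq> 0"
    proof (rule ccontr)
      assume "\<not> ?thesis"
      then have "AE s in ?M. (1::real) = 0"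
        by (intro total_testsD(1)[OF total_tests_C1c[OF ab]]) auto
      then have "emeasure ?M UNIV = 0" by (simp add: AE_iff_measurable[OF _ refl] )
      then show False using measure_leb_on_UNIV[of a b] ab by (simp add: measure_def)
    qed
    then obtain \<phi> where \<phi>: "\<phi> \<in> C1c a b" "(\<integral>s. \<phi> s \<partial>?M) \<noteq> 0" by blast
    \<comment> \<open>Normalisation by the integral is written as adding a multiple of
      \<open>\<phi>\<close> to itself, so that \<open>C1c_add_scale\<close> covers it.\<close>
    let ?k = "1 / (\<integral>s. \<phi> s \<partial>?M) - 1"
    have "(\<lambda>s. \<phi> s + ?k * \<phi> s) \<in> C1c a b" by (rule C1c_add_scale[OF \<phi>(1) \<phi>(1)])
    moreover have "(\<lambda>s. \<phi> s + ?k * \<phi> s) = (\<lambda>s. (1 + ?k) * \<phi> s)" by (simp add: algebra_simps)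
    then have "(\<integral>s. \<phi> s + ?k * \<phi> s \<partial>?M) = (1 + ?k) * (\<integral>s. \<phi> s \<partial>?M)" by simp
    then have "(\<integral>s. \<phi> s + ?k * \<phi> s \<partial>?M) = 1" using \<phi>(2) by simp
    ultimately show ?thesis using that by blast
  qed
  note m0 [measurable] = C1c_measurable[OF \<phi>0(1)]
  obtain C0 where C0: "\<And>s. \<bar>\<phi>0 s\<bar> \<le> C0" using C1c_bounded[OF \<phi>0(1)] by metis
  define c where "c = (\<lambda>y. \<integral>s. r (s, y) * \<phi>0 s \<partial>?M)"
  have c: "integrable N c"
  proof -
    have "integrable (?M \<Otimes>\<^sub>M N) (\<lambda>p. r p * \<phi>0 (fst p))"
      by (rule integrable_mult_bounded_AE(1)[OF r, of _ C0]) (auto simp: C0)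
    then show ?thesis unfolding c_def using integrable_snd[of "\<lambda>s y. r (s, y) * \<phi>0 s"] by (simp add: case_prod_unfold)
  qed
  have ic: "integrable (?M \<Otimes>\<^sub>M N) (\<lambda>p. c (snd p))"
    using integrable_tensor[OF leb_on.sigma_finite_measure_axioms N.sigma_finite_measure_axioms, of a b "\<lambda>_. 1::real" c] c
    by (simp add: case_prod_unfold)
  have "AE p in ?M \<Otimes>\<^sub>M N. r p - c (snd p) = 0"
  proof (rule total_testsD(1)[OF total_tests_pair[OF _ N total_tests_C1c[OF ab] \<Psi>]])
    show "finite_measure ?M" by unfold_locales
    show i: "integrable (?M \<Otimes>\<^sub>M N) (\<lambda>p. r p - c (snd p))" using r ic by simp
    fix \<theta> assume "\<theta> \<in> {tensor \<phi> \<psi> |\<phi> \<psi>. \<phi> \<in> C1c a b \<and> \<psi> \<in> \<Psi>}"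
    then obtain \<phi> \<psi> where \<theta>: "\<theta> = tensor \<phi> \<psi>" and \<phi>: "\<phi> \<in> C1c a b" and \<psi>: "\<psi> \<in> \<Psi>" by auto
    obtain C where C: "\<And>s. \<bar>\<phi> s\<bar> \<le> C" using C1c_bounded[OF \<phi>] by metis
    note m [measurable] = C1c_measurable[OF \<phi>]
    define k where "k = (\<integral>s. \<phi> s \<partial>?M)"
    have i\<phi>: "integrable ?M \<phi>" by (rule integrable_bounded_AE[of _ _ C]) (auto simp: C leb_on.finite_measure_axioms)
    have i\<phi>0: "integrable ?M \<phi>0" by (rule integrable_bounded_AE[of _ _ C0]) (auto simp: C0 leb_on.finite_measure_axioms)
    have \<xi>: "(\<lambda>s. \<phi> s + (- k) * \<phi>0 s) \<in> C1c a b" by (rule C1c_add_scale[OF \<phi> \<phi>0(1)])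
    have "(\<integral>s. \<phi> s + (- k) * \<phi>0 s \<partial>?M) = 0"
      using i\<phi> i\<phi>0 \<phi>0(2) by (simp add: k_def)
    then obtain \<Phi> where \<Phi>: "\<Phi> \<in> C1c a b" "deriv \<Phi> = (\<lambda>s. \<phi> s + (- k) * \<phi>0 s)"
      using C1c_antiderivative[OF \<xi> _ ab] by metis
    have e1: "(\<integral>p. c (snd p) * (\<phi> (fst p) * \<psi> (snd p)) \<partial>(?M \<Otimes>\<^sub>M N)) = k * (\<integral>p. r p * (\<phi>0 (fst p) * \<psi> (snd p)) \<partial>(?M \<Otimes>\<^sub>M N))"
    proof -
      have "(\<integral>s. c (snd (s, y)) * \<phi> s \<partial>?M) * \<psi> y = k * (c y * \<psi> y)" for y by (simp add: k_def)
      moreover have "(\<integral>s. r (s, y) * \<phi>0 s \<partial>?M) = c y" for y by (simp add: c_def)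
      ultimately show ?thesis unfolding iter[OF ic m(1) C \<psi>] iter[OF r m0(1) C0 \<psi>] by (simp only: integral_mult_right_zero)
    qed
    have "(\<integral>p. (r p - c (snd p)) * \<theta> p \<partial>(?M \<Otimes>\<^sub>M N)) =
        (\<integral>p. r p * (\<phi> (fst p) * \<psi> (snd p)) \<partial>(?M \<Otimes>\<^sub>M N)) - k * (\<integral>p. r p * (\<phi>0 (fst p) * \<psi> (snd p)) \<partial>(?M \<Otimes>\<^sub>M N))"
      unfolding e1[symmetric] \<theta> tensor_def case_prod_unfold left_diff_distrib
      by (subst Bochner_Integration.integral_diff) (use hb[OF r m(1) C \<psi>] hb[OF ic m(1) C \<psi>] in auto)
    also have "\<dots> = (\<integral>p. r p * (deriv \<Phi> (fst p) * \<psi> (snd p)) \<partial>(?M \<Otimes>\<^sub>M N))"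
    proof -
      have "(\<integral>p. r p * (deriv \<Phi> (fst p) * \<psi> (snd p)) \<partial>(?M \<Otimes>\<^sub>M N)) =
        (\<integral>p. r p * (\<phi> (fst p) * \<psi> (snd p)) - k * (r p * (\<phi>0 (fst p) * \<psi> (snd p))) \<partial>(?M \<Otimes>\<^sub>M N))"
        unfolding \<Phi>(2) by (simp add: algebra_simps)
      then show ?thesis
        by (subst (asm) Bochner_Integration.integral_diff) (use hb[OF r m(1) C \<psi>] hb[OF r m0(1) C0 \<psi>] in auto)
    qed
    also have "\<dots> = 0" by (rule r0[OF \<Phi>(1) \<psi>])
    finally show "(\<integral>p. (r p - c (snd p)) * \<theta> p \<partial>(?M \<Otimes>\<^sub>M N)) = 0" .
  qed
  then have "AE y in N. AE s in ?M. r (s, y) - c y = 0"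
    using AE_pair_swap[OF leb_on.sigma_finite_measure_axioms N.sigma_finite_measure_axioms] by fastforce
  then show ?thesis using gy
  proof eventually_elim
    case (elim y)
    then have "AE s in ?M. f (s, y) = c y + prim a b (\<lambda>\<sigma>. g (\<sigma>, y)) s"
      by (auto simp: r_def pg_def elim!: eventually_mono)
    then show ?case using elim by blast
  qed
qed

subsection \<open>Fourier series on the unit interval\<close>

definition chr :: "int \<Rightarrow> real \<Rightarrow> complex" where
  "chr k x = cis (2 * pi * of_int k * x)"

definition fc :: "(real \<Rightarrow> complex) \<Rightarrow> int \<Rightarrow> complex" where
  "fc f k = (\<integral>x. f x * chr (- k) x \<partial>leb_on 0 1)"

lemma chr_simps [simp]:
  "norm (chr k x) = 1" "chr 0 x = 1" "cnj (chr k x) = chr (- k) x"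
  by (simp_all add: chr_def cis_cnj)

lemma chr_add: "chr (j + k) x = chr j x * chr k x"
  by (simp add: chr_def cis_mult algebra_simps)

lemma chr_measurable [measurable]: "chr k \<in> Borel"
  unfolding chr_def by (intro borel_measurable_continuous_onI continuous_intros)

lemma integrable_chr: "integrable (leb_on 0 1) f \<Longrightarrow> integrable (leb_on 0 1) (\<lambda>x. f x * chr k x)"
  by (rule integrable_mult_bounded_AE(1)[where C=1]) auto

lemma integral_chr: "(\<integral>x. chr k x \<partial>leb_on 0 1) = (if k = 0 then 1 else 0)"
proof (cases "k = 0")
  case True then show ?thesis by simp
next
  case False
  define F where "F = (\<lambda>x. chr k x / (2 * pi * of_int k * \<i>))"
  have "(\<integral>x. indicator {0..1} x *\<^sub>R chr k x \<partial>lborel) = F 1 - F 0"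
  proof (rule integral_FTC_Icc)
    fix x :: real
    have "((\<lambda>x. cis (2 * pi * of_int k * x)) has_derivative (\<lambda>t. (2 * pi * of_int k * t) *\<^sub>R (\<i> * cis (2 * pi * of_int k * x)))) (at x within {0..1})"
      by (rule derivative_eq_intros refl | simp)+
    then have "(F has_derivative (\<lambda>t. ((2 * pi * of_int k * t) *\<^sub>R (\<i> * cis (2 * pi * of_int k * x))) / (2 * pi * of_int k * \<i>))) (at x within {0..1})"
      unfolding F_def chr_def by (rule bounded_linear.has_derivative[OF bounded_linear_divide])
    moreover have "(\<lambda>t::real. ((2 * pi * of_int k * t) *\<^sub>R (\<i> * cis (2 * pi * of_int k * x))) / (2 * pi * of_int k * \<i>)) = (\<lambda>t. t *\<^sub>R chr k x)"
      using False by (auto simp: fun_eq_iff chr_def scaleR_conv_of_real mult.left_commute[of "of_real _" "\<i>"])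
    ultimately show "(F has_vector_derivative chr k x) (at x within {0..1})"
      by (simp add: has_vector_derivative_def)
  qed (auto intro!: continuous_intros simp: chr_def)
  moreover have "F 1 = F 0"
    unfolding F_def chr_def by simp
  ultimately show ?thesis using False by (simp add: integral_leb_on set_lebesgue_integral_def)
qed

lemma fc_cong_AE:
  assumes "AE x in leb_on 0 1. f x = g x" "f \<in> Borel" "g \<in> Borel"
  shows "fc f k = fc g k"
  unfolding fc_def using assms by (intro integral_cong_AE) auto

lemma fc_diff:
  "integrable (leb_on 0 1) f \<Longrightarrow> integrable (leb_on 0 1) g \<Longrightarrow> fc (\<lambda>x. f x - g x) k = fc f k - fc g k"
  unfolding fc_def by (simp add: left_diff_distrib integrable_chr)

lemma norm_fc_le: "norm (fc f k) \<le> (\<integral>x. norm (f x) \<partial>leb_on 0 1)"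
  unfolding fc_def using integral_norm_bound[of "leb_on 0 1" "\<lambda>x. f x * chr (- k) x"] by (simp add: norm_mult)

lemma fc_mult_chr: "fc (\<lambda>x. f x * chr j x) k = fc f (k - j)"
  unfolding fc_def by (simp add: mult.assoc flip: chr_add)

text \<open>Multiplying by a linear functional of \<open>cis (2 \<pi> x)\<close> shifts Fourier coefficients by \<open>\<plusminus>1\<close>, so
  vanishing of all of them is inherited by products with polynomials.\<close>

lemma fc_zero_mult_polynomial:
  assumes "real_polynomial_function p" "integrable (leb_on 0 1) f" "\<And>k. fc f k = 0"
  shows "integrable (leb_on 0 1) (\<lambda>x. f x * of_real (p (chr 1 x))) \<and> (\<forall>k. fc (\<lambda>x. f x * of_real (p (chr 1 x))) k = 0)"
  using assms
proof (induction p arbitrary: f rule: real_polynomial_function.induct)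
  case (linear p)
  \<comment> \<open>A real linear functional of a complex number is determined by its values at 1
    and \<open>\<i>\<close>; \<open>A\<close> and \<open>B\<close> are its coefficients with respect
    to the number and its conjugate, which on the unit circle are \<open>chr 1\<close> and
    \<open>chr (-1)\<close>.\<close>
  define A where "A = (of_real (p 1) - \<i> * of_real (p \<i>)) / 2"
  define B where "B = (of_real (p 1) + \<i> * of_real (p \<i>)) / 2"
  have lin: "linear p" using linear.hyps by (rule bounded_linear.linear)
  have "of_real (p (chr 1 x)) = A * chr 1 x + B * chr (-1) x" for x
  proof -
    have "p (chr 1 x) = p (Re (chr 1 x) *\<^sub>R 1 + Im (chr 1 x) *\<^sub>R \<i>)" by (rule arg_cong[of _ _ p]) (simp add: complex_eq_iff)
    also have "\<dots> = Re (chr 1 x) * p 1 + Im (chr 1 x) * p \<i>"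
      by (simp only: linear_add[OF lin] linear_scale[OF lin] real_scaleR_def)
    finally have "p (chr 1 x) = Re (chr 1 x) * p 1 + Im (chr 1 x) * p \<i>" .
    then show ?thesis by (simp add: A_def B_def complex_eq_iff chr_def field_simps)
  qed
  then have eq: "(\<lambda>x. f x * of_real (p (chr 1 x))) = (\<lambda>x. A * (f x * chr 1 x) + B * (f x * chr (-1) x))"
    by (auto simp: fun_eq_iff algebra_simps)
  have i: "integrable (leb_on 0 1) (\<lambda>x. f x * chr j x)" for j using linear.prems by (intro integrable_chr)
  have "fc (\<lambda>x. A * (f x * chr 1 x) + B * (f x * chr (-1) x)) k = A * fc (\<lambda>x. f x * chr 1 x) k + B * fc (\<lambda>x. f x * chr (-1) x) k" for k
    unfolding fc_def using integrable_chr[OF i] by (simp add: distrib_right mult.assoc)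
  then show ?case unfolding eq using i linear.prems by (simp add: fc_mult_chr)
next
  case (const c)
  have "fc (\<lambda>x. f x * of_real c) k = fc f k * of_real c" for k
    unfolding fc_def by (simp add: mult_ac flip: integral_mult_left_zero)
  then show ?case using const by simp
next
  case (add p q)
  have i: "integrable (leb_on 0 1) (\<lambda>x. f x * of_real (p (chr 1 x)))" "integrable (leb_on 0 1) (\<lambda>x. f x * of_real (q (chr 1 x)))"
    using add by blast+
  have "fc (\<lambda>x. f x * of_real (p (chr 1 x)) + f x * of_real (q (chr 1 x))) k =
    fc (\<lambda>x. f x * of_real (p (chr 1 x))) k + fc (\<lambda>x. f x * of_real (q (chr 1 x))) k" for k
    unfolding fc_def using i by (simp add: distrib_right integrable_chr)
  then show ?case using i add by (simp add: distrib_left)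
next
  case (mult p q)
  then show ?case using mult.IH(2)[of "\<lambda>x. f x * of_real (p (chr 1 x))"] by (simp add: mult.assoc)
qed

text \<open>By Stone-Weierstrass \<open>\<phi>\<close> is uniformly close on the unit circle to a
  real polynomial, whose pairing with \<open>f\<close> vanishes; the error is at most
  \<open>e\<close> times the integral of the norm of \<open>f\<close>.\<close>

lemma fc_zero_continuous:
  assumes f: "integrable (leb_on 0 1) f" and 0: "\<And>k. fc f k = 0" and \<phi>: "continuous_on UNIV (\<phi> :: complex \<Rightarrow> real)"
  shows "(\<integral>x. f x * of_real (\<phi> (chr 1 x)) \<partial>leb_on 0 1) = 0"
proof -
  let ?M = "leb_on 0 1"
  note [measurable] = borel_measurable_integrable[OF f, simplified] borel_measurable_continuous_onI[OF \<phi>]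
  have cb: "compact (\<phi> ` sphere 0 1)" using \<phi> by (intro compact_continuous_image) (auto intro: continuous_on_subset)
  then obtain C where C: "\<And>z. z \<in> sphere 0 1 \<Longrightarrow> \<bar>\<phi> z\<bar> \<le> C" by (metis bounded_iff compact_imp_bounded image_eqI real_norm_def)
  have i1: "integrable ?M (\<lambda>x. f x * of_real (\<phi> (chr 1 x)))"
    by (rule integrable_mult_bounded_AE(1)[OF f, of _ C]) (auto simp: C)
  have le: "norm (\<integral>x. f x * of_real (\<phi> (chr 1 x)) \<partial>?M) \<le> e * (\<integral>x. norm (f x) \<partial>?M)" if e: "e > 0" for e
  proof -
    obtain p where p: "real_polynomial_function p" "\<And>z. z \<in> sphere 0 1 \<Longrightarrow> \<bar>\<phi> z - p z\<bar> < e"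
      using Stone_Weierstrass_real_polynomial_function[OF compact_sphere continuous_on_subset[OF \<phi>] e] by (metis subset_UNIV)
    have ip: "integrable ?M (\<lambda>x. f x * of_real (p (chr 1 x)))" and p0: "fc (\<lambda>x. f x * of_real (p (chr 1 x))) 0 = 0"
      using fc_zero_mult_polynomial[OF p(1) f 0] by auto
    have "(\<integral>x. f x * of_real (\<phi> (chr 1 x)) \<partial>?M) = (\<integral>x. f x * of_real (\<phi> (chr 1 x)) - f x * of_real (p (chr 1 x)) \<partial>?M)"
      using p0 Bochner_Integration.integral_diff[OF i1 ip] by (simp add: fc_def)
    also have "norm \<dots> \<le> (\<integral>x. norm (f x * of_real (\<phi> (chr 1 x)) - f x * of_real (p (chr 1 x))) \<partial>?M)"
      by (rule integral_norm_bound)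
    also have "\<dots> \<le> (\<integral>x. e * norm (f x) \<partial>?M)"
    proof (rule integral_mono)
      show "norm (f x * of_real (\<phi> (chr 1 x)) - f x * of_real (p (chr 1 x))) \<le> e * norm (f x)" for x
      proof -
        have "norm (f x * of_real (\<phi> (chr 1 x)) - f x * of_real (p (chr 1 x))) = norm (f x) * \<bar>\<phi> (chr 1 x) - p (chr 1 x)\<bar>"
          by (simp add: norm_mult flip: right_diff_distrib of_real_diff)
        also have "\<dots> \<le> norm (f x) * e" using p(2)[of "chr 1 x"] by (intro mult_left_mono) auto
        finally show ?thesis by (simp add: mult.commute)
      qed
    qed (use i1 ip f in auto)
    finally show ?thesis by simp
  qed
  have "norm (\<integral>x. f x * of_real (\<phi> (chr 1 x)) \<partial>?M) \<le> 0 + e" if "e > 0" for e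
  proof -
    let ?I = "\<integral>x. norm (f x) \<partial>?M"
    have "?I \<ge> 0" by simp
    then have "e / (?I + 1) * ?I \<le> e / (?I + 1) * (?I + 1)" using that by (intro mult_left_mono) auto
    then have "e / (?I + 1) * ?I \<le> e" using \<open>?I \<ge> 0\<close> by simp
    moreover have "e / (?I + 1) > 0" using that \<open>?I \<ge> 0\<close> by (simp add: add_nonneg_pos)
    ultimately show ?thesis using le[of "e / (?I + 1)"] by linarith
  qed
  then have "norm (\<integral>x. f x * of_real (\<phi> (chr 1 x)) \<partial>?M) \<le> 0" by (rule field_le_epsilon)
  then show ?thesis by simp
qed

lemma chr1_inj: "chr 1 x = chr 1 y \<Longrightarrow> 0 \<le> x \<Longrightarrow> x < 1 \<Longrightarrow> 0 \<le> y \<Longrightarrow> y < 1 \<Longrightarrow> x = y"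
proof -
  assume *: "chr 1 x = chr 1 y" and b: "0 \<le> x" "x < 1" "0 \<le> y" "y < 1"
  have "sin (2 * pi * x) = sin (2 * pi * y) \<and> cos (2 * pi * x) = cos (2 * pi * y)"
    using * by (simp add: chr_def complex_eq_iff)
  then obtain n :: int where "2 * pi * x = 2 * pi * y + 2 * pi * n" using sin_cos_eq_iff by blast
  then have "2 * pi * x = 2 * pi * (y + n)" by (simp add: distrib_left)
  then have "x = y + n" by simp
  moreover have "\<bar>x - y\<bar> < 1" using b by linarith
  ultimately have "\<bar>real_of_int n\<bar> < 1" by simp
  then have "n = 0" by linarith
  then show ?thesis using \<open>x = y + n\<close> by simp
qed

lemma fourier_unique:
  assumes f: "integrable (leb_on 0 1) f" and 0: "\<And>k. fc f k = 0"
  shows "AE x in leb_on 0 1. f x = 0"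
proof -
  let ?M = "leb_on 0 1"
  note [measurable] = borel_measurable_integrable[OF f, simplified]
  have closed: "(\<integral>x. f x * indicator A (chr 1 x) \<partial>?M) = 0" if A: "closed A" "A \<noteq> {}" for A
  proof -
    note [measurable] = borel_closed[OF A(1)]
    \<comment> \<open>Continuous functions that decrease to the indicator of the closed set
      \<open>A\<close>.\<close>
    define \<phi> where "\<phi> = (\<lambda>n::nat. \<lambda>z. max 0 (1 - real n * infdist z A))"
    have "(\<lambda>n. \<integral>x. f x * of_real (\<phi> n (chr 1 x)) \<partial>?M) \<longlonglongrightarrow> (\<integral>x. f x * of_real (indicator A (chr 1 x)) \<partial>?M)"
    proof (rule integral_dominated_convergence[where w="\<lambda>x. norm (f x)"])
      show "AE x in ?M. (\<lambda>n. f x * of_real (\<phi> n (chr 1 x))) \<longlonglongrightarrow> f x * of_real (indicator A (chr 1 x))"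
      proof (intro AE_I2 tendsto_intros)
        fix x
        show "(\<lambda>n. \<phi> n (chr 1 x)) \<longlonglongrightarrow> indicator A (chr 1 x)"
        proof (cases "chr 1 x \<in> A")
          case True then show ?thesis by (simp add: \<phi>_def)
        next
          case False
          then have pos: "infdist (chr 1 x) A > 0" using A in_closed_iff_infdist_zero[of A "chr 1 x"] infdist_nonneg[of "chr 1 x" A] by fastforce
          obtain n0 :: nat where "1 / infdist (chr 1 x) A < real n0" using reals_Archimedean2 by blast
          then have n0: "1 < real n0 * infdist (chr 1 x) A" using pos by (simp add: field_simps)
          have "\<phi> n (chr 1 x) = 0" if "n \<ge> n0" for n
          proof -
            have "real n0 * infdist (chr 1 x) A \<le> real n * infdist (chr 1 x) A" using that pos by (intro mult_right_mono) auto
            then show ?thesis using n0 by (simp add: \<phi>_def)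
          qed
          then have "eventually (\<lambda>n. \<phi> n (chr 1 x) = 0) sequentially" by (auto simp: eventually_sequentially)
          then show ?thesis using False by (simp add: tendsto_eventually)
        qed
      qed
      show "AE x in ?M. norm (f x * of_real (\<phi> n (chr 1 x))) \<le> norm (f x)" for n
        by (auto simp: \<phi>_def norm_mult infdist_nonneg intro!: AE_I2 mult_left_le)
      show "(\<lambda>x. f x * of_real (\<phi> n (chr 1 x))) \<in> borel_measurable ?M" for n
      proof -
        have "continuous_on UNIV (\<phi> n)" unfolding \<phi>_def by (intro continuous_intros)
        then have [measurable]: "\<phi> n \<in> Borel" by (rule borel_measurable_continuous_onI)
        show ?thesis by simp
      qed
    qed (use f in auto)
    moreover have "(\<integral>x. f x * of_real (\<phi> n (chr 1 x)) \<partial>?M) = 0" for n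
      by (rule fc_zero_continuous[OF f 0]) (auto simp: \<phi>_def intro!: continuous_intros)
    ultimately have "(\<lambda>n::nat. 0::complex) \<longlonglongrightarrow> (\<integral>x. f x * of_real (indicator A (chr 1 x)) \<partial>?M)" by simp
    then have "(\<integral>x. f x * of_real (indicator A (chr 1 x)) \<partial>?M) = 0" by (simp add: LIMSEQ_const_iff)
    moreover have "of_real (indicator A z) = (indicator A z :: complex)" for z by (simp add: indicator_def)
    ultimately show ?thesis by simp
  qed
  have seg: "(\<integral>x. f x * indicator {..c} x \<partial>?M) = 0" for c
  proof (cases "c < 0 \<or> 1 \<le> c")
    case True
    show ?thesis
    proof (cases "c < 0")
      case True
      have "(\<integral>x. f x * indicator {..c} x \<partial>?M) = (\<integral>x. 0 \<partial>?M)"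
        by (rule integral_cong_AE) (use True in \<open>auto simp: AE_leb_on\<close>)
      then show ?thesis by simp
    next
      case False
      have "(\<integral>x. f x * indicator {..c} x \<partial>?M) = (\<integral>x. f x * chr (- 0) x \<partial>?M)"
        by (rule integral_cong_AE) (use True False in \<open>auto simp: AE_leb_on\<close>)
      then show ?thesis using 0[of 0] by (simp add: fc_def)
    qed
  next
    case False
    \<comment> \<open>The closed arc over \<open>[0,c]\<close>. Since \<open>chr 1\<close> is
      injective on \<open>[0,1)\<close>, its preimage is \<open>{..c}\<close> within the unit
      interval, up to the point 1, which the circle identifies with 0.\<close>
    define A where "A = chr 1 ` {0..c}"
    have "compact A" unfolding A_def chr_def by (intro compact_continuous_image continuous_intros) auto
    then have A: "closed A" "A \<noteq> {}" using False by (auto simp: compact_imp_closed A_def)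
    note [measurable] = borel_closed[OF A(1)]
    have "(\<integral>x. f x * indicator {..c} x \<partial>?M) = (\<integral>x. f x * indicator A (chr 1 x) \<partial>?M)"
    proof (rule integral_cong_AE)
      have *: "x \<in> {..c} \<longleftrightarrow> chr 1 x \<in> A" if "0 \<le> x" "x < 1" for x
        using that False chr1_inj[of x] by (force simp: A_def)
      show "AE x in ?M. f x * indicator {..c} x = f x * indicator A (chr 1 x)"
        unfolding AE_leb_on using AE_lborel_singleton[of 1]
        by eventually_elim (use * in \<open>auto simp: indicator_def\<close>)
    qed auto
    then show ?thesis using closed[OF A] by simp
  qed
  have g: "AE x in ?M. h x = 0"
    if h: "integrable ?M h" "\<And>c. (\<integral>x. h x * indicator {..c} x \<partial>?M) = 0" for h :: "real \<Rightarrow> real"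
  proof (rule AE_zero_if_generator[OF h(1), of "range atMost"])
    show "Int_stable (range (atMost :: real \<Rightarrow> _))"
    proof -
      have "{..a} \<inter> {..b} \<in> range atMost" for a b :: real by (rule range_eqI[of _ _ "min a b"]) auto
      then show ?thesis unfolding Int_stable_def by auto
    qed
    show "sets ?M = sigma_sets (space ?M) (range atMost)"
      unfolding sets_leb_on space_leb_on borel_eq_atMost by simp
    show "(LINT x:A|?M. h x) = 0" if "A \<in> range atMost" for A
      using that h(2) by (auto simp: set_lebesgue_integral_def mult.commute)
    show "integral\<^sup>L ?M h = 0"
    proof -
      note [measurable] = borel_measurable_integrable[OF h(1), simplified]
      have "integral\<^sup>L ?M h = (\<integral>x. h x * indicator {..1} x \<partial>?M)"
        by (rule integral_cong_AE) (auto simp: AE_leb_on)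
      then show ?thesis using h by simp
    qed
  qed auto
  have ii: "integrable ?M (\<lambda>x. f x * indicator {..c} x)" for c
    by (rule integrable_mult_bounded_AE(1)[OF f, of _ 1]) (auto simp: indicator_def)
  have reim: "Re (f x * indicator {..c} x) = Re (f x) * indicator {..c} x" "Im (f x * indicator {..c} x) = Im (f x) * indicator {..c} x" for x c
    by (auto split: split_indicator)
  have "(\<integral>x. Re (f x) * indicator {..c} x \<partial>?M) = 0" for c
    using integral_Re[OF ii[of c]] seg[of c] unfolding reim by simp
  moreover have "(\<integral>x. Im (f x) * indicator {..c} x \<partial>?M) = 0" for c
    using integral_Im[OF ii[of c]] seg[of c] unfolding reim by simp
  ultimately have "AE x in ?M. Re (f x) = 0" "AE x in ?M. Im (f x) = 0"
    using g[of "\<lambda>x. Re (f x)"] g[of "\<lambda>x. Im (f x)"] f seg by auto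
  then show ?thesis by eventually_elim (simp add: complex_eq_iff)
qed

subsection \<open>Absolutely summable Fourier coefficients\<close>

text \<open>Sums over frequencies are treated as integrals for counting measure: absolute
  summability is integrability, and exchanging sums with integrals is Fubini.\<close>

abbreviation cs :: "int measure" where "cs \<equiv> count_space UNIV"

lemma sigma_finite_cs: "sigma_finite_measure cs"
  by (rule sigma_finite_measure_count_space)

interpretation cs_leb: pair_sigma_finite cs "leb_on a b" for a b
  by (intro pair_sigma_finite.intro sigma_finite_cs leb_on.sigma_finite_measure_axioms)

lemma cs_leb_measurable:
  assumes "\<And>k. f k \<in> Borel"
  shows "(\<lambda>(k, x). f k x) \<in> borel_measurable (cs \<Otimes>\<^sub>M leb_on a b)"
  using assms by (intro measurable_pair_measure_countable1) auto

lemma cs_leb_integrable: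
  fixes c :: "int \<Rightarrow> complex"
  assumes "integrable cs c" "integrable (leb_on a b) g" "\<And>k. h k \<in> Borel" "\<And>k x. norm (h k x) \<le> 1"
  shows "integrable (cs \<Otimes>\<^sub>M leb_on a b) (\<lambda>(k, x). c k * (h k x * g x))"
proof -
  note [measurable] = borel_measurable_integrable[OF assms(2), simplified] assms(3)
  have "integrable (cs \<Otimes>\<^sub>M leb_on a b) (\<lambda>(k, x). c k * g x)"
    by (rule integrable_tensor[OF sigma_finite_cs leb_on.sigma_finite_measure_axioms assms(1,2)])
  then show ?thesis
  proof (rule Bochner_Integration.integrable_bound)
    show "(\<lambda>(k, x). c k * (h k x * g x)) \<in> borel_measurable (cs \<Otimes>\<^sub>M leb_on a b)"
      by (rule cs_leb_measurable) simp
    have "norm (h k x) * norm (g x) \<le> norm (g x)" for k x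
      using assms(4)[of k x] by (simp add: mult_left_le_one_le)
    then show "AE p in cs \<Otimes>\<^sub>M leb_on a b. norm (case p of (k, x) \<Rightarrow> c k * (h k x * g x)) \<le> norm (case p of (k, x) \<Rightarrow> c k * g x)"
      by (auto simp: norm_mult intro!: AE_I2 mult_left_mono)
  qed
qed

text \<open>Fubini over frequencies and the interval, where the summable sequence dominates.
  Choosing a character for \<open>g\<close> in the pairing returns the coefficients.\<close>

lemma trig_series:
  assumes c: "integrable cs c"
  defines "S \<equiv> (\<lambda>x. \<integral>k. c k * chr k x \<partial>cs)"
  shows "S \<in> Borel" "norm (S x) \<le> (\<integral>k. norm (c k) \<partial>cs)" "integrable (leb_on 0 1) S"
    and "integrable (leb_on 0 1) g \<Longrightarrow> (\<integral>x. S x * g x \<partial>leb_on 0 1) = (\<integral>k. c k * fc g (- k) \<partial>cs)"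
    and "fc S j = c j"
proof -
  let ?M = "leb_on 0 1"
  have "(\<lambda>(x, k). c k * chr k x) \<in> borel_measurable (?M \<Otimes>\<^sub>M cs)"
    using measurable_pair_swap[OF cs_leb_measurable[of "\<lambda>k x. c k * chr k x" 0 1]] by (simp add: case_prod_unfold)
  then have "S \<in> borel_measurable ?M" unfolding S_def by (rule sigma_finite_measure.borel_measurable_lebesgue_integral[OF sigma_finite_cs])
  then show S [measurable]: "S \<in> Borel" by simp
  have bd: "norm (S x) \<le> (\<integral>k. norm (c k) \<partial>cs)" for x
    using integral_norm_bound[of cs "\<lambda>k. c k * chr k x"] by (simp add: S_def norm_mult)
  then show "norm (S x) \<le> (\<integral>k. norm (c k) \<partial>cs)" .
  show "integrable ?M S"
    by (rule integrable_bounded_AE) (use bd in \<open>auto simp: leb_on.finite_measure_axioms\<close>)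
  have pair: "(\<integral>x. S x * g x \<partial>?M) = (\<integral>k. c k * fc g (- k) \<partial>cs)" if g: "integrable ?M g" for g
  proof -
    note [measurable] = borel_measurable_integrable[OF g, simplified]
    have i: "integrable (cs \<Otimes>\<^sub>M ?M) (\<lambda>(k, x). c k * (chr k x * g x))"
      by (rule cs_leb_integrable[OF c g]) auto
    have "(\<integral>x. S x * g x \<partial>?M) = (\<integral>x. (\<integral>k. c k * (chr k x * g x) \<partial>cs) \<partial>?M)"
    proof (intro Bochner_Integration.integral_cong refl)
      fix x
      have "(\<integral>k. c k * (chr k x * g x) \<partial>cs) = (\<integral>k. c k * chr k x * g x \<partial>cs)" by (simp add: mult.assoc)
      then show "S x * g x = (\<integral>k. c k * (chr k x * g x) \<partial>cs)" unfolding S_def by simp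
    qed
    also have "\<dots> = (\<integral>k. (\<integral>x. c k * (chr k x * g x) \<partial>?M) \<partial>cs)"
      by (rule cs_leb.Fubini_integral[OF i])
    also have "\<dots> = (\<integral>k. c k * fc g (- k) \<partial>cs)" by (simp add: fc_def mult.commute)
    finally show ?thesis .
  qed
  then show "integrable ?M g \<Longrightarrow> (\<integral>x. S x * g x \<partial>?M) = (\<integral>k. c k * fc g (- k) \<partial>cs)" .
  have "fc S j = (\<integral>k. c k * fc (\<lambda>x. chr (- j) x) (- k) \<partial>cs)"
    unfolding fc_def[of S] by (rule pair) (rule integrable_bounded_AE[of _ _ 1]; auto simp: leb_on.finite_measure_axioms)
  also have "\<dots> = (\<integral>k. c k * (if k = j then 1 else 0) \<partial>cs)"
    unfolding fc_def by (simp flip: chr_add add: integral_chr)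
  also have "\<dots> = c j"
  proof -
    have "{a. a = j \<and> c a \<noteq> 0} = (if c j = 0 then {} else {j})" by auto
    then show ?thesis by (subst lebesgue_integral_count_space_finite_support) (auto simp: if_distrib cong: if_cong)
  qed
  finally show "fc S j = c j" .
qed

lemma fourier_inversion:
  assumes f: "integrable (leb_on 0 1) f" and c: "integrable cs (fc f)"
  shows "AE x in leb_on 0 1. f x = (\<integral>k. fc f k * chr k x \<partial>cs)"
proof -
  have "AE x in leb_on 0 1. f x - (\<integral>k. fc f k * chr k x \<partial>cs) = 0"
    by (rule fourier_unique) (use f trig_series[OF c] in \<open>auto simp: fc_diff\<close>)
  then show ?thesis by eventually_elim simp
qed

text \<open>A form of Parseval in which one factor has summable coefficients and the other is merely
  integrable. In the trilinear integrals this leaves one factor free of any summability.\<close>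

lemma fourier_pairing:
  assumes f: "integrable (leb_on 0 1) f" and c: "integrable cs (fc f)" and g: "integrable (leb_on 0 1) g"
  shows "(\<integral>x. f x * g x \<partial>leb_on 0 1) = (\<integral>k. fc f k * fc g (- k) \<partial>cs)"
    and "integrable cs (\<lambda>k. fc f k * fc g (- k))"
    and "integrable (leb_on 0 1) (\<lambda>x. f x * g x)"
    and "AE x in leb_on 0 1. norm (f x) \<le> (\<integral>k. norm (fc f k) \<partial>cs)"
proof -
  note [measurable] = borel_measurable_integrable[OF f, simplified] borel_measurable_integrable[OF g, simplified] trig_series(1)[OF c]
  have "(\<integral>x. f x * g x \<partial>leb_on 0 1) = (\<integral>x. (\<integral>k. fc f k * chr k x \<partial>cs) * g x \<partial>leb_on 0 1)"
    by (rule integral_cong_AE) (use fourier_inversion[OF f c] in \<open>auto elim!: eventually_mono\<close>)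
  then show "(\<integral>x. f x * g x \<partial>leb_on 0 1) = (\<integral>k. fc f k * fc g (- k) \<partial>cs)"
    using trig_series(4)[OF c g] by simp
  show "integrable cs (\<lambda>k. fc f k * fc g (- k))"
    by (rule integrable_mult_bounded_AE(1)[OF c]) (auto intro: norm_fc_le)
  show bd: "AE x in leb_on 0 1. norm (f x) \<le> (\<integral>k. norm (fc f k) \<partial>cs)"
    using fourier_inversion[OF f c] by eventually_elim (use trig_series(2)[OF c] in auto)
  show "integrable (leb_on 0 1) (\<lambda>x. f x * g x)"
    by (rule integrable_mult_bounded_AE(2)[OF g _ bd]) simp
qed

lemma norm_integral_le_nn: "ennreal (norm (integral\<^sup>L M f)) \<le> (\<integral>\<^sup>+x. ennreal (norm (f x)) \<partial>M)"
  for f :: "_ \<Rightarrow> complex"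
  by (cases "integrable M f") (auto simp: integral_norm_bound_ennreal not_integrable_integral_eq)

text \<open>The pairing is applied to \<open>g\<close> and then to \<open>h\<close>; multiplication
  by a character shifts the coefficients of \<open>f\<close>. Only frequencies with sum zero
  interact, whence the index \<open>- (j + l)\<close>.\<close>

lemma fourier_trilinear:
  assumes f: "integrable (leb_on 0 1) f"
    and g: "integrable (leb_on 0 1) g" "integrable cs (fc g)"
    and h: "integrable (leb_on 0 1) h" "integrable cs (fc h)"
  shows "ennreal (norm (\<integral>x. f x * g x * h x \<partial>leb_on 0 1)) \<le>
    (\<integral>\<^sup>+j. \<integral>\<^sup>+l. ennreal (norm (fc f (- (j + l)))) * ennreal (norm (fc g j)) * ennreal (norm (fc h l)) \<partial>cs \<partial>cs)"
proof -
  have hf: "integrable (leb_on 0 1) (\<lambda>x. h x * f x)" by (rule fourier_pairing(3)[OF h f])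
  have 1: "ennreal (norm (fc (\<lambda>x. h x * f x) (- j))) \<le> (\<integral>\<^sup>+l. ennreal (norm (fc f (- (j + l)))) * ennreal (norm (fc h l)) \<partial>cs)" for j
  proof -
    have "fc (\<lambda>x. h x * f x) (- j) = (\<integral>x. h x * (f x * chr j x) \<partial>leb_on 0 1)" by (simp add: fc_def mult.assoc)
    also have "\<dots> = (\<integral>l. fc h l * fc (\<lambda>x. f x * chr j x) (- l) \<partial>cs)"
      by (rule fourier_pairing(1)[OF h integrable_chr[OF f]])
    also have "\<dots> = (\<integral>l. fc h l * fc f (- (j + l)) \<partial>cs)" by (simp add: fc_mult_chr algebra_simps)
    finally have "ennreal (norm (fc (\<lambda>x. h x * f x) (- j))) \<le> (\<integral>\<^sup>+l. ennreal (norm (fc h l * fc f (- (j + l)))) \<partial>cs)"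
      using norm_integral_le_nn by metis
    then show ?thesis by (simp add: norm_mult ennreal_mult mult.commute)
  qed
  have "(\<integral>x. f x * g x * h x \<partial>leb_on 0 1) = (\<integral>x. g x * (h x * f x) \<partial>leb_on 0 1)" by (simp add: mult_ac)
  also have "\<dots> = (\<integral>j. fc g j * fc (\<lambda>x. h x * f x) (- j) \<partial>cs)" by (rule fourier_pairing(1)[OF g hf])
  finally have "ennreal (norm (\<integral>x. f x * g x * h x \<partial>leb_on 0 1)) \<le> (\<integral>\<^sup>+j. ennreal (norm (fc g j * fc (\<lambda>x. h x * f x) (- j))) \<partial>cs)"
    using norm_integral_le_nn by metis
  also have "\<dots> \<le> (\<integral>\<^sup>+j. ennreal (norm (fc g j)) * (\<integral>\<^sup>+l. ennreal (norm (fc f (- (j + l)))) * ennreal (norm (fc h l)) \<partial>cs) \<partial>cs)"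
    by (intro nn_integral_mono) (simp add: norm_mult ennreal_mult mult_left_mono[OF 1] del: minus_add_distrib)
  also have "\<dots> = (\<integral>\<^sup>+j. \<integral>\<^sup>+l. ennreal (norm (fc f (- (j + l)))) * ennreal (norm (fc g j)) * ennreal (norm (fc h l)) \<partial>cs \<partial>cs)"
    by (subst nn_integral_cmult[symmetric]) (auto simp: mult_ac)
  finally show ?thesis .
qed

subsection \<open>Bessel and Riesz--Fischer\<close>

definition tp :: "(int \<Rightarrow> complex) \<Rightarrow> int set \<Rightarrow> real \<Rightarrow> complex" where
  "tp c K x = (\<Sum>k\<in>K. c k * chr k x)"

lemma tp_measurable [measurable]: "tp c K \<in> Borel"
  unfolding tp_def by measurable

lemma tp_bound: "norm (tp c K x) \<le> (\<Sum>k\<in>K. norm (c k))"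
  unfolding tp_def by (rule order_trans[OF norm_sum]) (simp add: norm_mult)

lemma tp_integrable: "integrable (leb_on 0 1) (tp c K)"
  by (rule integrable_bounded_AE) (auto intro: tp_bound simp: leb_on.finite_measure_axioms)

lemma fc_tp: "finite K \<Longrightarrow> fc (tp c K) j = (if j \<in> K then c j else 0)"
proof -
  assume K: "finite K"
  have i: "integrable (leb_on 0 1) (chr k)" for k
    by (rule integrable_bounded_AE[of _ _ 1]) (auto simp: leb_on.finite_measure_axioms)
  have "fc (tp c K) j = (\<integral>x. (\<Sum>k\<in>K. c k * chr (k - j) x) \<partial>leb_on 0 1)"
    unfolding fc_def tp_def sum_distrib_right by (simp add: mult.assoc flip: chr_add)
  also have "\<dots> = (\<Sum>k\<in>K. c k * (\<integral>x. chr (k - j) x \<partial>leb_on 0 1))"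
    using i by (subst Bochner_Integration.integral_sum) auto
  also have "\<dots> = (\<Sum>k\<in>K. if k = j then c k else 0)" by (intro sum.cong) (auto simp: integral_chr)
  finally show ?thesis using K by (simp add: sum.delta)
qed

lemma integral_mult_cnj_tp:
  assumes f: "integrable (leb_on 0 1) f"
  shows "(\<integral>x. f x * cnj (tp c K x) \<partial>leb_on 0 1) = (\<Sum>k\<in>K. cnj (c k) * fc f k)"
proof -
  have "(\<integral>x. f x * cnj (tp c K x) \<partial>leb_on 0 1) = (\<integral>x. (\<Sum>k\<in>K. cnj (c k) * (f x * chr (- k) x)) \<partial>leb_on 0 1)"
    unfolding tp_def by (simp add: sum_distrib_left mult_ac)
  also have "\<dots> = (\<Sum>k\<in>K. cnj (c k) * fc f k)"
    using integrable_chr[OF f] by (subst Bochner_Integration.integral_sum) (auto simp: fc_def)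
  finally show ?thesis .
qed

lemma tp_norm:
  assumes K: "finite K"
  shows "(\<integral>x. (norm (tp c K x))\<^sup>2 \<partial>leb_on 0 1) = (\<Sum>k\<in>K. (norm (c k))\<^sup>2)"
proof -
  have "complex_of_real (\<integral>x. (norm (tp c K x))\<^sup>2 \<partial>leb_on 0 1) = (\<integral>x. tp c K x * cnj (tp c K x) \<partial>leb_on 0 1)"
    by (simp add: complex_norm_square[symmetric] del: of_real_power flip: integral_complex_of_real)
  also have "\<dots> = (\<Sum>k\<in>K. cnj (c k) * fc (tp c K) k)" by (rule integral_mult_cnj_tp[OF tp_integrable])
  also have "\<dots> = (\<Sum>k\<in>K. complex_of_real ((norm (c k))\<^sup>2))"
    by (intro sum.cong) (auto simp: fc_tp[OF K] complex_norm_square[symmetric] mult.commute[of "cnj _"] simp del: of_real_power)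
  finally have "complex_of_real (\<integral>x. (norm (tp c K x))\<^sup>2 \<partial>leb_on 0 1) = complex_of_real (\<Sum>k\<in>K. (norm (c k))\<^sup>2)"
    by (simp only: of_real_sum)
  then show ?thesis by (simp only: of_real_eq_iff)
qed

lemma ennreal_power2_le_imp_le:
  assumes "a\<^sup>2 \<le> (ennreal r)\<^sup>2" "0 \<le> r" shows "a \<le> ennreal r"
proof (cases a)
  case (real x)
  then show ?thesis using assms power2_le_imp_le[of x r] by (simp add: ennreal_power ennreal_le_iff)
next
  case top
  then show ?thesis using assms by (simp add: ennreal_power top_unique)
qed

text \<open>The symmetric ranges exhaust the integers, so monotone convergence carries over a bound
  for partial sums.\<close>

lemma nn_integral_cs_le:
  assumes "\<And>n::nat. (\<Sum>k\<in>{- int n..int n}. F k) \<le> B"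
  shows "(\<integral>\<^sup>+k. F k \<partial>cs) \<le> B"
proof -
  have "(\<integral>\<^sup>+k. F k \<partial>cs) = (\<integral>\<^sup>+k. (SUP n::nat. F k * indicator {- int n..int n} k) \<partial>cs)"
  proof (rule nn_integral_cong)
    fix k
    have "F k \<le> (SUP n::nat. F k * indicator {- int n..int n} k)"
      by (rule SUP_upper2[of "nat \<bar>k\<bar>"]) (auto simp: indicator_def)
    moreover have "(SUP n::nat. F k * indicator {- int n..int n} k) \<le> F k"
      by (rule SUP_least) (auto simp: indicator_def)
    ultimately show "F k = (SUP n::nat. F k * indicator {- int n..int n} k)" by (rule antisym)
  qed
  also have "\<dots> = (SUP n::nat. \<integral>\<^sup>+k. F k * indicator {- int n..int n} k \<partial>cs)"
    by (rule nn_integral_monotone_convergence_SUP) (auto simp: incseq_def le_fun_def indicator_def)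
  also have "\<dots> \<le> B"
  proof (rule SUP_least)
    fix n :: nat
    have "(\<integral>\<^sup>+k. F k * indicator {- int n..int n} k \<partial>cs) = (\<Sum>k\<in>{- int n..int n}. F k * indicator {- int n..int n} k)"
      by (rule nn_integral_count_space') auto
    then show "(\<integral>\<^sup>+k. F k * indicator {- int n..int n} k \<partial>cs) \<le> B" using assms[of n] by simp
  qed
  finally show ?thesis .
qed

text \<open>The squared distance between \<open>f\<close> and its partial sum is nonnegative and
  equals the squared norm of \<open>f\<close> minus the partial sum of the squared
  coefficients.\<close>

lemma bessel:
  assumes f: "integrable (leb_on 0 1) f" and f2: "integrable (leb_on 0 1) (\<lambda>x. (norm (f x))\<^sup>2)"
  shows "(\<integral>\<^sup>+k. ennreal ((norm (fc f k))\<^sup>2) \<partial>cs) \<le> ennreal (\<integral>x. (norm (f x))\<^sup>2 \<partial>leb_on 0 1)"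
proof (rule nn_integral_cs_le)
  fix n :: nat
  let ?K = "{- int n..int n}" and ?M = "leb_on 0 1"
  note [measurable] = borel_measurable_integrable[OF f, simplified]
  define S where "S = tp (fc f) ?K"
  have [measurable]: "S \<in> Borel" unfolding S_def by simp
  have [measurable]: "(\<lambda>x. cnj (S x)) \<in> Borel"
    using borel_measurable_continuous_onI[OF continuous_on_cnj[OF continuous_on_id]] by (rule measurable_compose[rotated]) simp
  have i1: "integrable ?M (\<lambda>x. f x * cnj (S x))"
    by (rule integrable_mult_bounded_AE(1)[OF f]) (simp, use tp_bound[of "fc f" ?K] in \<open>auto simp: S_def\<close>)
  have i2: "integrable ?M (\<lambda>x. (norm (S x))\<^sup>2)"
    by (rule integrable_bounded_AE[where C="(\<Sum>k\<in>?K. norm (fc f k))\<^sup>2"])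
       (auto simp: S_def leb_on.finite_measure_axioms intro!: power_mono tp_bound)
  have "(norm (f x - S x))\<^sup>2 = (norm (f x))\<^sup>2 - 2 * Re (f x * cnj (S x)) + (norm (S x))\<^sup>2" for x
    unfolding cmod_power2 by (simp add: power2_eq_square algebra_simps)
  then have "(\<integral>x. (norm (f x - S x))\<^sup>2 \<partial>?M) = (\<integral>x. (norm (f x))\<^sup>2 - 2 * Re (f x * cnj (S x)) + (norm (S x))\<^sup>2 \<partial>?M)"
    by simp
  also have "\<dots> = (\<integral>x. (norm (f x))\<^sup>2 \<partial>?M) - 2 * Re (\<integral>x. f x * cnj (S x) \<partial>?M) + (\<integral>x. (norm (S x))\<^sup>2 \<partial>?M)"
    using f2 i1 i2 integrable_Re[OF i1] integral_Re[OF i1] by (simp del: times_complex.simps)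
  also have "(\<integral>x. f x * cnj (S x) \<partial>?M) = (\<Sum>k\<in>?K. cnj (fc f k) * fc f k)" unfolding S_def by (rule integral_mult_cnj_tp[OF f])
  also have "\<dots> = (\<Sum>k\<in>?K. complex_of_real ((norm (fc f k))\<^sup>2))"
    by (intro sum.cong) (auto simp: complex_norm_square[symmetric] mult.commute[of "cnj _"] simp del: of_real_power)
  also have "(\<integral>x. (norm (S x))\<^sup>2 \<partial>?M) = (\<Sum>k\<in>?K. (norm (fc f k))\<^sup>2)" unfolding S_def by (rule tp_norm) simp
  finally have "(\<integral>x. (norm (f x - S x))\<^sup>2 \<partial>?M) = (\<integral>x. (norm (f x))\<^sup>2 \<partial>?M) - (\<Sum>k\<in>?K. (norm (fc f k))\<^sup>2)" by simp
  moreover have "(\<integral>x. (norm (f x - S x))\<^sup>2 \<partial>?M) \<ge> 0" by simp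
  ultimately have "(\<Sum>k\<in>?K. (norm (fc f k))\<^sup>2) \<le> (\<integral>x. (norm (f x))\<^sup>2 \<partial>?M)" by linarith
  then show "(\<Sum>k\<in>?K. ennreal ((norm (fc f k))\<^sup>2)) \<le> ennreal (\<integral>x. (norm (f x))\<^sup>2 \<partial>?M)"
    by (subst sum_ennreal) (auto intro: ennreal_leI)
qed

text \<open>Square integrability of \<open>f\<close> is a conclusion here. A subsequence of the
  partial sums converges almost everywhere and under an integrable majorant to a function with the
  same coefficients, which is \<open>f\<close> by \<open>fourier_unique\<close>; Fatou then gives
  the bound. It is needed for the horizontal derivative, which comes as a locally integrable
  function.\<close>

lemma riesz_fischer:
  assumes f: "integrable (leb_on 0 1) f" and B: "(\<integral>\<^sup>+k. ennreal ((norm (fc f k))\<^sup>2) \<partial>cs) \<le> ennreal B" "B \<ge> 0"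
  shows "(\<integral>\<^sup>+x. ennreal ((norm (f x))\<^sup>2) \<partial>leb_on 0 1) \<le> ennreal B"
proof -
  let ?M = "leb_on 0 1"
  note [measurable] = borel_measurable_integrable[OF f, simplified]
  define K where "K = (\<lambda>n::nat. {- int n..int n})"
  define A where "A = (\<lambda>n. \<Sum>k\<in>K n. (norm (fc f k))\<^sup>2)"
  have K: "finite (K n)" "m \<le> n \<Longrightarrow> K m \<subseteq> K n" for m n by (auto simp: K_def)
  have AB: "A n \<le> B" for n
  proof -
    have "ennreal (A n) = (\<Sum>k\<in>K n. ennreal ((norm (fc f k))\<^sup>2))" by (simp add: A_def)
    also have "\<dots> = (\<integral>\<^sup>+k. ennreal ((norm (fc f k))\<^sup>2) * indicator (K n) k \<partial>cs)"
      using K(1)[of n] by (subst nn_integral_count_space'[of "K n"]) auto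
    also have "\<dots> \<le> (\<integral>\<^sup>+k. ennreal ((norm (fc f k))\<^sup>2) \<partial>cs)" by (intro nn_integral_mono) (auto simp: indicator_def)
    also note B(1)
    finally show ?thesis using B(2) by (simp add: ennreal_le_iff)
  qed
  have Amono: "incseq A" unfolding A_def incseq_def using K by (auto intro!: sum_mono2)
  obtain L where L: "A \<longlonglongrightarrow> L" "\<And>n. A n \<le> L" using incseq_convergent[OF Amono, of B] AB by auto
  have "\<exists>n. \<forall>m\<ge>n. L - A m \<le> (1/4) ^ i" for i
  proof -
    have "eventually (\<lambda>m. A m > L - (1/4) ^ i) sequentially" by (rule order_tendstoD(1)[OF L(1)]) simp
    then obtain n where "\<And>m. m \<ge> n \<Longrightarrow> A m > L - (1/4) ^ i" by (auto simp: eventually_sequentially)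
    then show ?thesis by (intro exI[of _ n]) (auto simp: algebra_simps less_imp_le)
  qed
  then obtain N0 where N0: "\<And>i m. m \<ge> N0 i \<Longrightarrow> L - A m \<le> (1/4) ^ i" by metis
  \<comment> \<open>Adding \<open>i\<close> and all earlier thresholds makes the subsequence
    nondecreasing, unbounded and late enough. The tails \<open>(1/4) ^ i\<close> give consecutive
    differences of \<open>L2\<close> norm at most \<open>(1/2) ^ i\<close>; on an interval of
    measure one their \<open>L1\<close> norms are then summable.\<close>
  define N where "N = (\<lambda>i::nat. i + (\<Sum>j\<le>i. N0 j))"
  have Nmono: "N i \<le> N (Suc i)" and N: "N0 i \<le> N i" for i by (auto simp: N_def intro!: trans_le_add2 member_le_sum)
  define S where "S = (\<lambda>i. tp (fc f) (K (N i)))"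
  define D where "D = (\<lambda>i x. S (Suc i) x - S i x)"
  have [measurable]: "S i \<in> Borel" for i unfolding S_def by simp
  have [measurable]: "D i \<in> Borel" for i unfolding D_def by simp
  have iS: "integrable ?M (S i)" for i unfolding S_def by (rule tp_integrable)
  have iD: "integrable ?M (D i)" for i unfolding D_def using iS by simp
  have Dtp: "D i = tp (fc f) (K (N (Suc i)) - K (N i))" for i
    unfolding D_def S_def tp_def using K(1) K(2)[OF Nmono[of i]] by (auto simp: fun_eq_iff sum_diff)
  have D2: "(\<integral>x. (norm (D i x))\<^sup>2 \<partial>?M) \<le> (1/4) ^ i" for i
  proof -
    have "(\<integral>x. (norm (D i x))\<^sup>2 \<partial>?M) = (\<Sum>k\<in>K (N (Suc i)) - K (N i). (norm (fc f k))\<^sup>2)"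
      unfolding Dtp by (rule tp_norm) (simp add: K)
    also have "\<dots> = A (N (Suc i)) - A (N i)" unfolding A_def using K(1) K(2)[OF Nmono[of i]] by (simp add: sum_diff)
    also have "\<dots> \<le> (1/4) ^ i" using N0[OF N[of i]] L(2)[of "N (Suc i)"] by linarith
    finally show ?thesis .
  qed
  have D1: "(\<integral>\<^sup>+x. ennreal (norm (D i x)) \<partial>?M) \<le> ennreal ((1/2) ^ i)" for i
  proof -
    obtain C where C: "\<And>x. norm (D i x) \<le> C" unfolding Dtp using tp_bound by blast
    have i2: "integrable ?M (\<lambda>x. (norm (D i x))\<^sup>2)"
      by (rule integrable_bounded_AE[where C="C\<^sup>2"]) (auto simp: leb_on.finite_measure_axioms intro!: power_mono C)
    have "(\<integral>\<^sup>+x. ennreal (norm (D i x)) \<partial>?M)\<^sup>2 \<le> (\<integral>\<^sup>+x. ennreal (norm (D i x)) ^ 2 \<partial>?M) * (\<integral>\<^sup>+x. 1 ^ 2 \<partial>?M)"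
      using Cauchy_Schwarz_nn_integral[of "\<lambda>x. ennreal (norm (D i x))" ?M "\<lambda>_. 1"] by simp
    also have "\<dots> = ennreal (\<integral>x. (norm (D i x))\<^sup>2 \<partial>?M)"
      using i2 by (simp add: ennreal_power nn_integral_eq_integral emeasure_leb_on)
    also have "\<dots> \<le> ennreal ((1/4) ^ i)" using D2 by (rule ennreal_leI)
    also have "\<dots> = (ennreal ((1/2) ^ i))\<^sup>2" by (simp add: ennreal_power power2_eq_square flip: power_mult_distrib ennreal_mult)
    finally show ?thesis by (rule ennreal_power2_le_imp_le) simp
  qed
  have "(\<integral>\<^sup>+x. (\<Sum>i. ennreal (norm (D i x))) \<partial>?M) = (\<Sum>i. \<integral>\<^sup>+x. ennreal (norm (D i x)) \<partial>?M)"
    by (rule nn_integral_suminf) simp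
  also have "\<dots> \<le> (\<Sum>i. ennreal ((1/2) ^ i))" by (intro suminf_le D1) auto
  also have "\<dots> < \<infinity>" by (subst suminf_ennreal2) (auto intro: summable_geometric)
  finally have fin: "(\<integral>\<^sup>+x. (\<Sum>i. ennreal (norm (D i x))) \<partial>?M) < \<infinity>" .
  then have "AE x in ?M. (\<Sum>i. ennreal (norm (D i x))) \<noteq> \<infinity>"
    by (intro nn_integral_PInf_AE) auto
  then have sm: "AE x in ?M. summable (\<lambda>i. norm (D i x))"
    by eventually_elim (auto intro: summable_suminf_not_top)
  define W where "W = (\<lambda>x. norm (S 0 x) + enn2real (\<Sum>i. ennreal (norm (D i x))))"
  have iW: "integrable ?M W"
  proof -
    have "integrable ?M (\<lambda>x. enn2real (\<Sum>i. ennreal (norm (D i x))))"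
    proof (rule integrableI_nonneg)
      have "(\<integral>\<^sup>+x. ennreal (enn2real (\<Sum>i. ennreal (norm (D i x)))) \<partial>?M) \<le> (\<integral>\<^sup>+x. (\<Sum>i. ennreal (norm (D i x))) \<partial>?M)"
      proof (rule nn_integral_mono)
        have "ennreal (enn2real t) \<le> t" for t :: ennreal by (cases t) auto
        then show "ennreal (enn2real (\<Sum>i. ennreal (norm (D i x)))) \<le> (\<Sum>i. ennreal (norm (D i x)))" for x .
      qed
      then show "(\<integral>\<^sup>+x. ennreal (enn2real (\<Sum>i. ennreal (norm (D i x)))) \<partial>?M) < \<infinity>" using fin by (rule le_less_trans)
    qed auto
    then show ?thesis unfolding W_def using iS by auto
  qed
  define G where "G = (\<lambda>x. lim (\<lambda>i. S i x))"
  have SD: "S n x = S 0 x + (\<Sum>i<n. D i x)" for n x by (induction n) (auto simp: D_def)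
  have conv: "AE x in ?M. (\<lambda>i. S i x) \<longlonglongrightarrow> G x \<and> (\<forall>n. norm (S n x) \<le> W x)"
    using sm
  proof eventually_elim
    case (elim x)
    have "summable (\<lambda>i. D i x)" by (rule summable_norm_cancel[OF elim])
    then have "(\<lambda>n. S 0 x + (\<Sum>i<n. D i x)) \<longlonglongrightarrow> S 0 x + (\<Sum>i. D i x)"
      by (intro tendsto_intros summable_LIMSEQ)
    moreover have "(\<lambda>n. S 0 x + (\<Sum>i<n. D i x)) = (\<lambda>n. S n x)" by (rule ext) (rule SD[symmetric])
    ultimately have "convergent (\<lambda>n. S n x)" unfolding convergent_def by auto
    then have "(\<lambda>i. S i x) \<longlonglongrightarrow> G x" unfolding G_def by (simp add: convergent_LIMSEQ_iff)
    moreover have "norm (S n x) \<le> W x" for n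
    proof -
      have "norm (S n x) \<le> norm (S 0 x) + norm (\<Sum>i<n. D i x)" by (subst SD) (rule norm_triangle_ineq)
      moreover have "norm (\<Sum>i<n. D i x) \<le> (\<Sum>i<n. norm (D i x))" by (rule norm_sum)
      moreover have "(\<Sum>i<n. norm (D i x)) \<le> (\<Sum>i. norm (D i x))" by (rule sum_le_suminf[OF elim]) auto
      moreover have "(\<Sum>i. norm (D i x)) = enn2real (\<Sum>i. ennreal (norm (D i x)))"
        using elim by (subst suminf_ennreal2) (auto simp: suminf_nonneg)
      ultimately show ?thesis unfolding W_def by linarith
    qed
    ultimately show ?case by blast
  qed
  have [measurable]: "G \<in> Borel" unfolding G_def by measurable
  have iG: "integrable ?M G"
  proof (rule integrable_dominated_convergence[where s=S and w=W])
    show "AE x in ?M. (\<lambda>i. S i x) \<longlonglongrightarrow> G x" using conv by eventually_elim blast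
    show "AE x in ?M. norm (S i x) \<le> W x" for i using conv by eventually_elim blast
  qed (use iW in auto)
  \<comment> \<open>For a fixed frequency the coefficients of the partial sums are eventually those
    of \<open>f\<close>, and by dominated convergence they tend to those of
    \<open>G\<close>.\<close>
  have "fc f j - fc G j = 0" for j
  proof -
    have "(\<lambda>i. fc (S i) j) \<longlonglongrightarrow> fc G j"
      unfolding fc_def
    proof (rule integral_dominated_convergence[where w=W])
      show "AE x in ?M. (\<lambda>i. S i x * chr (- j) x) \<longlonglongrightarrow> G x * chr (- j) x"
        using conv by eventually_elim (auto intro!: tendsto_intros)
      show "AE x in ?M. norm (S i x * chr (- j) x) \<le> W x" for i
        using conv by eventually_elim (auto simp: norm_mult)
    qed (use iW in auto)
    moreover have "(\<lambda>i. fc (S i) j) \<longlonglongrightarrow> fc f j"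
    proof (rule tendsto_eventually)
      have "fc (S i) j = fc f j" if "i \<ge> nat \<bar>j\<bar>" for i
      proof -
        have "N i \<ge> i" by (simp add: N_def)
        then have "j \<in> K (N i)" using that by (auto simp: K_def)
        then show ?thesis unfolding S_def by (simp add: fc_tp K)
      qed
      then show "eventually (\<lambda>i. fc (S i) j = fc f j) sequentially" by (auto simp: eventually_sequentially)
    qed
    ultimately show ?thesis using LIMSEQ_unique by fastforce
  qed
  then have "AE x in ?M. f x - G x = 0"
    by (intro fourier_unique) (use f iG in \<open>auto simp: fc_diff\<close>)
  then have "(\<integral>\<^sup>+x. ennreal ((norm (f x))\<^sup>2) \<partial>?M) = (\<integral>\<^sup>+x. liminf (\<lambda>i. ennreal ((norm (S i x))\<^sup>2)) \<partial>?M)"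
    using conv
  proof (intro nn_integral_cong_AE, eventually_elim)
    case (elim x)
    then have "(\<lambda>i. ennreal ((norm (S i x))\<^sup>2)) \<longlonglongrightarrow> ennreal ((norm (f x))\<^sup>2)"
      by (intro tendsto_intros) auto
    then show ?case using lim_imp_Liminf by (metis sequentially_bot)
  qed
  also have "\<dots> \<le> liminf (\<lambda>i. \<integral>\<^sup>+x. ennreal ((norm (S i x))\<^sup>2) \<partial>?M)"
    by (rule nn_integral_liminf) simp
  also have "\<dots> \<le> liminf (\<lambda>i. ennreal B)"
  proof (rule Liminf_mono, intro always_eventually allI)
    fix i
    have "integrable ?M (\<lambda>x. (norm (S i x))\<^sup>2)"
      by (rule integrable_bounded_AE[where C="(\<Sum>k\<in>K (N i). norm (fc f k))\<^sup>2"])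
         (auto simp: leb_on.finite_measure_axioms S_def intro!: power_mono tp_bound)
    then have "(\<integral>\<^sup>+x. ennreal ((norm (S i x))\<^sup>2) \<partial>?M) = ennreal (\<integral>x. (norm (S i x))\<^sup>2 \<partial>?M)"
      by (intro nn_integral_eq_integral) auto
    also have "(\<integral>x. (norm (S i x))\<^sup>2 \<partial>?M) = A (N i)" unfolding S_def A_def by (rule tp_norm) (simp add: K)
    finally show "(\<integral>\<^sup>+x. ennreal ((norm (S i x))\<^sup>2) \<partial>?M) \<le> ennreal B" using AB by (simp add: ennreal_leI)
  qed
  also have "\<dots> = ennreal B" by (simp add: Liminf_const)
  finally show ?thesis .
qed

subsection \<open>Weighted sequence spaces\<close>

text \<open>The maximum with 1 keeps every power harmless at frequency 0 and makes
  \<open>sq s\<close> monotone in \<open>s\<close>; \<open>sq s\<close> is the square of the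
  inhomogeneous Sobolev norm of order \<open>s\<close>.\<close>

definition wt :: "int \<Rightarrow> real" where "wt k = max 1 \<bar>real_of_int k\<bar>"

definition sq :: "real \<Rightarrow> (int \<Rightarrow> real) \<Rightarrow> ennreal" where
  "sq s m = (\<integral>\<^sup>+k. ennreal (wt k powr (2 * s) * (m k)\<^sup>2) \<partial>cs)"

lemma wt_ge1: "wt k \<ge> 1" and wt_pos [simp]: "wt k > 0" "wt k \<ge> 0" "wt k \<noteq> 0"
  by (auto simp: wt_def)

text \<open>The mean value theorem, kept as an equation with an intermediate value because it is
  applied with positive and with negative \<open>p\<close>, where the resulting inequalities point
  in opposite directions.\<close>

lemma powr_diff_step:
  fixes p x :: real
  assumes "p \<le> 1" "x > 0"
  obtains \<xi> where "(x + 1) powr p - x powr p = p * \<xi>" "\<xi> \<ge> (x + 1) powr (p - 1)"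
proof -
  have "\<exists>z. x < z \<and> z < x + 1 \<and> (x + 1) powr p - x powr p = (x + 1 - x) * (p * z powr (p - 1))"
    using assms by (intro MVT2[of x "x + 1" "\<lambda>x. x powr p" "\<lambda>z. p * z powr (p - 1)"]) (auto intro!: derivative_eq_intros)
  then obtain z where z: "x < z" "z < x + 1" "(x + 1) powr p - x powr p = p * z powr (p - 1)" by auto
  moreover have "z powr (p - 1) \<ge> (x + 1) powr (p - 1)"
    using z assms by (intro powr_mono2') auto
  ultimately show ?thesis using that by blast
qed

text \<open>Telescoping comparison with the integral of the power. The induction bounds the sum by
  the value at \<open>min (real n) R\<close>, since nothing is added beyond
  \<open>R\<close>.\<close>

lemma sum_low:
  assumes "0 \<le> a" "a < 1" "R \<ge> 1"
  shows "(\<Sum>j=1..n. if real j \<le> R then real j powr (- a) else 0) \<le> R powr (1 - a) / (1 - a)"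
proof -
  have "(\<Sum>j=1..n. if real j \<le> R then real j powr (- a) else 0) \<le> (min (real n) R) powr (1 - a) / (1 - a)"
  proof (induction n)
    case 0 then show ?case using assms by simp
  next
    case (Suc n)
    show ?case
    proof (cases "real (Suc n) \<le> R")
      case False
      then have "(min (real n) R) powr (1 - a) \<le> (min (real (Suc n)) R) powr (1 - a)" using assms by (intro powr_mono2) auto
      then have "(min (real n) R) powr (1 - a) / (1 - a) \<le> (min (real (Suc n)) R) powr (1 - a) / (1 - a)"
        using assms by (intro divide_right_mono) auto
      then show ?thesis using Suc False by simp
    next
      case True
      have "real (Suc n) powr (- a) \<le> (real (Suc n) powr (1 - a) - real n powr (1 - a)) / (1 - a)"
      proof (cases "n = 0")
        case True then show ?thesis using assms by simp
      next
        case False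
        obtain \<xi> where "(real n + 1) powr (1 - a) - real n powr (1 - a) = (1 - a) * \<xi>" "\<xi> \<ge> (real n + 1) powr (1 - a - 1)"
          using powr_diff_step[of "1 - a" "real n"] assms False by auto
        then show ?thesis using assms by (simp add: add.commute)
      qed
      then show ?thesis using Suc True by (simp add: diff_divide_distrib)
    qed
  qed
  also have "\<dots> \<le> R powr (1 - a) / (1 - a)" using assms by (intro divide_right_mono powr_mono2) auto
  finally show ?thesis .
qed

lemma sum_high:
  assumes "b > 1" "R \<ge> 1"
  shows "(\<Sum>j=1..n. if real j \<le> R then 0 else real j powr (- b)) \<le> (R / 2) powr (1 - b) / (b - 1)"
proof -
  have "(\<Sum>j=1..n. if real j \<le> R then 0 else real j powr (- b)) \<le>
      (if real n \<le> R then 0 else ((R / 2) powr (1 - b) - real n powr (1 - b)) / (b - 1))"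
  proof (induction n)
    case 0 then show ?case using assms by simp
  next
    case (Suc n)
    show ?case
    proof (cases "real (Suc n) \<le> R")
      case True
      then have "real n \<le> R" by simp
      then show ?thesis using Suc True by simp
    next
      case False
      then have n: "n \<ge> 1" using assms by (cases n) auto
      obtain \<xi> where "(real n + 1) powr (1 - b) - real n powr (1 - b) = (1 - b) * \<xi>" "\<xi> \<ge> (real n + 1) powr (1 - b - 1)"
        using powr_diff_step[of "1 - b" "real n"] assms n by auto
      moreover have "(1 - b) * \<xi> = - ((b - 1) * \<xi>)" by (simp add: algebra_simps)
      ultimately have "\<xi> = (real n powr (1 - b) - real (Suc n) powr (1 - b)) / (b - 1)" "\<xi> \<ge> real (Suc n) powr (- b)"
        using assms by (auto simp: field_simps)
      then have step: "real (Suc n) powr (- b) \<le> (real n powr (1 - b) - real (Suc n) powr (1 - b)) / (b - 1)" by simp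
      show ?thesis
      proof (cases "real n \<le> R")
        case True
        \<comment> \<open>The telescoping starts at the last index not above \<open>R\<close>. Its
          successor exceeds \<open>R\<close> and is at most twice as large, which is the origin of
          \<open>R / 2\<close>.\<close>
        have "real n \<ge> R / 2" using False n by simp
        then have "real n powr (1 - b) \<le> (R / 2) powr (1 - b)" using assms by (intro powr_mono2') auto
        then have "(real n powr (1 - b) - real (Suc n) powr (1 - b)) / (b - 1) \<le> ((R / 2) powr (1 - b) - real (Suc n) powr (1 - b)) / (b - 1)"
          using assms by (intro divide_right_mono) auto
        then show ?thesis using Suc True False step by simp
      next
        case F2: False
        then show ?thesis using Suc False step by (simp add: diff_divide_distrib)
      qed
    qed
  qed
  also have "\<dots> \<le> (R / 2) powr (1 - b) / (b - 1)" using assms by (auto intro!: divide_right_mono)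
  finally show ?thesis .
qed

lemma sum_symmetric: "(\<Sum>k\<in>{- int n..int n}. F k) = F 0 + (\<Sum>j=1..n. F (int j) + F (- int j))" for F :: "int \<Rightarrow> real"
proof (induction n)
  case (Suc n)
  have "{- int (Suc n)..int (Suc n)} = insert (int (Suc n)) (insert (- int (Suc n)) {- int n..int n})" by auto
  then show ?case using Suc by simp
qed simp

text \<open>The summand 1 of the constant comes from frequency 0, the 2 from the two signs.\<close>

lemma wt_sum_low:
  assumes "0 \<le> a" "a < 1" "R \<ge> 1"
  shows "(\<integral>\<^sup>+k. ennreal (if wt k \<le> R then wt k powr (- a) else 0) \<partial>cs) \<le> ennreal ((1 + 2 / (1 - a)) * R powr (1 - a))"
proof (rule nn_integral_cs_le)
  fix n :: nat
  let ?F = "\<lambda>k. if wt k \<le> R then wt k powr (- a) else 0"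
  have w: "wt (int j) = real j" "wt (- int j) = real j" if "j \<ge> 1" for j using that by (auto simp: wt_def)
  have "(\<Sum>k\<in>{- int n..int n}. ?F k) = ?F 0 + (\<Sum>j=1..n. ?F (int j) + ?F (- int j))" by (rule sum_symmetric)
  also have "(\<Sum>j=1..n. ?F (int j) + ?F (- int j)) = (\<Sum>j=1..n. 2 * (if real j \<le> R then real j powr (- a) else 0))"
    using w by (intro sum.cong) auto
  also have "\<dots> \<le> 2 * (R powr (1 - a) / (1 - a))" using sum_low[OF assms, of n] by (simp flip: sum_distrib_left)
  also have "?F 0 \<le> R powr (1 - a)" using assms by (simp add: wt_def ge_one_powr_ge_zero)
  finally have "(\<Sum>k\<in>{- int n..int n}. ?F k) \<le> (1 + 2 / (1 - a)) * R powr (1 - a)" by (simp add: algebra_simps)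
  then show "(\<Sum>k\<in>{- int n..int n}. ennreal (?F k)) \<le> ennreal ((1 + 2 / (1 - a)) * R powr (1 - a))"
    by (subst sum_ennreal) (auto intro: ennreal_leI)
qed

lemma wt_sum_high:
  assumes "b > 1" "R \<ge> 1"
  shows "(\<integral>\<^sup>+k. ennreal (if wt k \<le> R then 0 else wt k powr (- b)) \<partial>cs) \<le> ennreal ((2 * 2 powr (b - 1) / (b - 1)) * R powr (1 - b))"
proof (rule nn_integral_cs_le)
  fix n :: nat
  let ?F = "\<lambda>k. if wt k \<le> R then 0 else wt k powr (- b)"
  have w: "wt (int j) = real j" "wt (- int j) = real j" if "j \<ge> 1" for j using that by (auto simp: wt_def)
  have "(\<Sum>k\<in>{- int n..int n}. ?F k) = ?F 0 + (\<Sum>j=1..n. ?F (int j) + ?F (- int j))" by (rule sum_symmetric)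
  also have "(\<Sum>j=1..n. ?F (int j) + ?F (- int j)) = (\<Sum>j=1..n. 2 * (if real j \<le> R then 0 else real j powr (- b)))"
    using w by (intro sum.cong) auto
  also have "\<dots> \<le> 2 * ((R / 2) powr (1 - b) / (b - 1))" using sum_high[OF assms, of n] by (simp flip: sum_distrib_left)
  also have "?F 0 = 0" using assms by (simp add: wt_def)
  also have "(R / 2) powr (1 - b) = 2 powr (b - 1) * R powr (1 - b)"
    using assms by (simp add: powr_divide powr_diff powr_minus field_simps)
  finally have "(\<Sum>k\<in>{- int n..int n}. ?F k) \<le> (2 * 2 powr (b - 1) / (b - 1)) * R powr (1 - b)" by simp
  then show "(\<Sum>k\<in>{- int n..int n}. ennreal (?F k)) \<le> ennreal ((2 * 2 powr (b - 1) / (b - 1)) * R powr (1 - b))"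
    by (subst sum_ennreal) (auto intro: ennreal_leI)
qed

text \<open>Cauchy-Schwarz below and above the frequency \<open>R\<close>: the weights are summable
  with the right power of \<open>R\<close> because 1/2 lies strictly between the two orders.
  \<open>R\<close> is left free instead of being optimised, since the trilinear estimates need one
  common cutoff for several norms.\<close>

lemma carlson:
  assumes "0 \<le> s1" "s1 < 1/2" "1/2 < s2"
  obtains C where "C > 0"
    "\<And>m x y R. (\<And>k. m k \<ge> 0) \<Longrightarrow> R \<ge> 1 \<Longrightarrow> 0 \<le> x \<Longrightarrow> 0 \<le> y \<Longrightarrow> sq s1 m \<le> ennreal x \<Longrightarrow> sq s2 m \<le> ennreal y \<Longrightarrow>
      (\<integral>\<^sup>+k. ennreal (m k) \<partial>cs) \<le> ennreal (C * sqrt (R powr (1 - 2 * s1) * x) + C * sqrt (R powr (1 - 2 * s2) * y))"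
proof -
  define c1 where "c1 = 1 + 2 / (1 - 2 * s1)"
  define c2 where "c2 = 2 * 2 powr (2 * s2 - 1) / (2 * s2 - 1)"
  define C where "C = sqrt c1 + sqrt c2"
  have c: "c1 > 0" "c2 > 0" unfolding c1_def c2_def using assms by (auto intro!: add_pos_pos divide_pos_pos)
  then have C: "C > 0" by (simp add: C_def add_pos_pos)
  moreover have "(\<integral>\<^sup>+k. ennreal (m k) \<partial>cs) \<le> ennreal (C * sqrt (R powr (1 - 2 * s1) * x) + C * sqrt (R powr (1 - 2 * s2) * y))"
    if m: "\<And>k. m k \<ge> 0" and R: "R \<ge> 1" and xy: "0 \<le> x" "0 \<le> y" "sq s1 m \<le> ennreal x" "sq s2 m \<le> ennreal y" for m x y R
  proof -
    have part: "(\<integral>\<^sup>+k. ennreal (if P k then m k else 0) \<partial>cs) \<le> ennreal (sqrt (c * z))"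
      if "sq s m \<le> ennreal z" "z \<ge> 0" "c \<ge> 0" "(\<integral>\<^sup>+k. ennreal (if P k then wt k powr (- (2 * s)) else 0) \<partial>cs) \<le> ennreal c" for s P z c
    proof (rule ennreal_power2_le_imp_le)
      have e: "ennreal (if P k then m k else 0) = ennreal (wt k powr s * m k) * ennreal (if P k then wt k powr (- s) else 0)" for k
        using m by (auto simp: powr_minus simp flip: ennreal_mult)
      have "(\<integral>\<^sup>+k. ennreal (if P k then m k else 0) \<partial>cs)\<^sup>2 \<le>
        (\<integral>\<^sup>+k. (ennreal (wt k powr s * m k))\<^sup>2 \<partial>cs) * (\<integral>\<^sup>+k. (ennreal (if P k then wt k powr (- s) else 0))\<^sup>2 \<partial>cs)"
        unfolding e by (rule Cauchy_Schwarz_nn_integral) auto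
      also have "(\<integral>\<^sup>+k. (ennreal (wt k powr s * m k))\<^sup>2 \<partial>cs) = sq s m"
        unfolding sq_def using m by (intro nn_integral_cong) (simp add: ennreal_power power_mult_distrib powr_power mult.commute)
      also have "(\<integral>\<^sup>+k. (ennreal (if P k then wt k powr (- s) else 0))\<^sup>2 \<partial>cs) = (\<integral>\<^sup>+k. ennreal (if P k then wt k powr (- (2 * s)) else 0) \<partial>cs)"
        by (intro nn_integral_cong) (auto simp: ennreal_power powr_power mult.commute)
      also have "sq s m * (\<integral>\<^sup>+k. ennreal (if P k then wt k powr (- (2 * s)) else 0) \<partial>cs) \<le> ennreal z * ennreal c"
        using that by (intro mult_mono) auto
      also have "\<dots> = (ennreal (sqrt (c * z)))\<^sup>2" using that by (simp add: ennreal_power mult.commute flip: ennreal_mult)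
      finally show "(\<integral>\<^sup>+k. ennreal (if P k then m k else 0) \<partial>cs)\<^sup>2 \<le> (ennreal (sqrt (c * z)))\<^sup>2" .
    qed (use that in simp)
    have "(\<integral>\<^sup>+k. ennreal (m k) \<partial>cs) = (\<integral>\<^sup>+k. ennreal (if wt k \<le> R then m k else 0) + ennreal (if \<not> wt k \<le> R then m k else 0) \<partial>cs)"
      by (intro nn_integral_cong) auto
    also have "\<dots> = (\<integral>\<^sup>+k. ennreal (if wt k \<le> R then m k else 0) \<partial>cs) + (\<integral>\<^sup>+k. ennreal (if \<not> wt k \<le> R then m k else 0) \<partial>cs)"
      by (rule nn_integral_add) auto
    also have "\<dots> \<le> ennreal (sqrt (c1 * R powr (1 - 2 * s1) * x)) + ennreal (sqrt (c2 * R powr (1 - 2 * s2) * y))"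
    proof (intro add_mono part)
      show "(\<integral>\<^sup>+k. ennreal (if wt k \<le> R then wt k powr - (2 * s1) else 0) \<partial>cs) \<le> ennreal (c1 * R powr (1 - 2 * s1))"
        using wt_sum_low[of "2 * s1" R] assms R by (simp add: c1_def)
      have "(\<integral>\<^sup>+k. ennreal (if \<not> wt k \<le> R then wt k powr - (2 * s2) else 0) \<partial>cs) = (\<integral>\<^sup>+k. ennreal (if wt k \<le> R then 0 else wt k powr - (2 * s2)) \<partial>cs)"
        by (intro nn_integral_cong) auto
      then show "(\<integral>\<^sup>+k. ennreal (if \<not> wt k \<le> R then wt k powr - (2 * s2) else 0) \<partial>cs) \<le> ennreal (c2 * R powr (1 - 2 * s2))"
        using wt_sum_high[of "2 * s2" R] assms R by (simp add: c2_def)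
    qed (use xy c in auto)
    also have "\<dots> = ennreal (sqrt c1 * sqrt (R powr (1 - 2 * s1) * x) + sqrt c2 * sqrt (R powr (1 - 2 * s2) * y))"
      using xy c by (simp add: real_sqrt_mult mult.assoc ennreal_plus)
    also have "\<dots> \<le> ennreal (C * sqrt (R powr (1 - 2 * s1) * x) + C * sqrt (R powr (1 - 2 * s2) * y))"
      using xy c by (intro ennreal_leI add_mono mult_right_mono) (auto simp: C_def)
    finally show ?thesis .
  qed
  ultimately show ?thesis using that by blast
qed

text \<open>Frequencies up to \<open>R\<close> are charged to the lower order, the others to the
  higher one. The cutoff stays free for the same reason as in \<open>carlson\<close>.\<close>

lemma sq_interpolate:
  assumes "s1 \<le> s" "s \<le> s2" "R \<ge> 1" "0 \<le> x" "0 \<le> y" "sq s1 m \<le> ennreal x" "sq s2 m \<le> ennreal y"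
  shows "sq s m \<le> ennreal (R powr (2 * s - 2 * s1) * x + R powr (2 * s - 2 * s2) * y)"
proof -
  have pw: "wt k powr (2 * s) \<le> R powr (2 * s - 2 * s1) * wt k powr (2 * s1) + R powr (2 * s - 2 * s2) * wt k powr (2 * s2)" for k
  proof (cases "wt k \<le> R")
    case True
    have "wt k powr (2 * s) = wt k powr (2 * s - 2 * s1) * wt k powr (2 * s1)" by (simp flip: powr_add)
    also have "\<dots> \<le> R powr (2 * s - 2 * s1) * wt k powr (2 * s1)" using True assms by (intro mult_right_mono powr_mono2) auto
    finally show ?thesis by (smt (verit) mult_nonneg_nonneg powr_ge_zero)
  next
    case False
    have "wt k powr (2 * s) = wt k powr (2 * s - 2 * s2) * wt k powr (2 * s2)" by (simp flip: powr_add)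
    also have "\<dots> \<le> R powr (2 * s - 2 * s2) * wt k powr (2 * s2)" using False assms by (intro mult_right_mono powr_mono2') auto
    finally show ?thesis by (smt (verit) mult_nonneg_nonneg powr_ge_zero)
  qed
  have "sq s m \<le> (\<integral>\<^sup>+k. ennreal (R powr (2 * s - 2 * s1)) * ennreal (wt k powr (2 * s1) * (m k)\<^sup>2) +
      ennreal (R powr (2 * s - 2 * s2)) * ennreal (wt k powr (2 * s2) * (m k)\<^sup>2) \<partial>cs)"
    unfolding sq_def
  proof (rule nn_integral_mono)
    fix k
    have "wt k powr (2 * s) * (m k)\<^sup>2 \<le> (R powr (2 * s - 2 * s1) * wt k powr (2 * s1) + R powr (2 * s - 2 * s2) * wt k powr (2 * s2)) * (m k)\<^sup>2"
      by (intro mult_right_mono pw) auto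
    then show "ennreal (wt k powr (2 * s) * (m k)\<^sup>2) \<le> ennreal (R powr (2 * s - 2 * s1)) * ennreal (wt k powr (2 * s1) * (m k)\<^sup>2) +
      ennreal (R powr (2 * s - 2 * s2)) * ennreal (wt k powr (2 * s2) * (m k)\<^sup>2)"
      by (simp add: algebra_simps ennreal_leI flip: ennreal_mult ennreal_plus)
  qed
  also have "\<dots> = ennreal (R powr (2 * s - 2 * s1)) * sq s1 m + ennreal (R powr (2 * s - 2 * s2)) * sq s2 m"
    unfolding sq_def by (simp add: nn_integral_add nn_integral_cmult)
  also have "\<dots> \<le> ennreal (R powr (2 * s - 2 * s1)) * ennreal x + ennreal (R powr (2 * s - 2 * s2)) * ennreal y"
    using assms by (intro add_mono mult_left_mono) auto
  also have "\<dots> = ennreal (R powr (2 * s - 2 * s1) * x + R powr (2 * s - 2 * s2) * y)"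
    using assms by (simp add: ennreal_plus ennreal_mult)
  finally show ?thesis .
qed

section \<open>Trilinear estimates for sequences\<close>

text \<open>With the index of \<open>c\<close> fixed, Cauchy-Schwarz and translation invariance
  bound the sum over the other index, and the sum of \<open>c\<close> remains. The two forms differ
  in which index carries the summable factor.\<close>

lemma young_convolution:
  fixes a b c :: "int \<Rightarrow> ennreal"
  assumes a: "(\<integral>\<^sup>+k. (a k)\<^sup>2 \<partial>cs) \<le> ennreal (p\<^sup>2)" and b: "(\<integral>\<^sup>+k. (b k)\<^sup>2 \<partial>cs) \<le> ennreal (q\<^sup>2)" and pq: "0 \<le> p" "0 \<le> q"
  shows "(\<integral>\<^sup>+j. \<integral>\<^sup>+l. a (j + l) * b j * c l \<partial>cs \<partial>cs) \<le> ennreal (p * q) * (\<integral>\<^sup>+k. c k \<partial>cs)"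
    and "(\<integral>\<^sup>+j. \<integral>\<^sup>+l. a (j + l) * c j * b l \<partial>cs \<partial>cs) \<le> ennreal (p * q) * (\<integral>\<^sup>+k. c k \<partial>cs)"
proof -
  have 1: "(\<integral>\<^sup>+j. a (j + l) * b j \<partial>cs) \<le> ennreal (p * q)" for l
  proof (rule ennreal_power2_le_imp_le)
    have "(\<integral>\<^sup>+j. a (j + l) * b j \<partial>cs)\<^sup>2 \<le> (\<integral>\<^sup>+j. (a (j + l))\<^sup>2 \<partial>cs) * (\<integral>\<^sup>+j. (b j)\<^sup>2 \<partial>cs)"
      by (rule Cauchy_Schwarz_nn_integral) auto
    also have "(\<integral>\<^sup>+j. (a (j + l))\<^sup>2 \<partial>cs) = (\<integral>\<^sup>+j. (a j)\<^sup>2 \<partial>cs)"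
      by (rule nn_integral_bij_count_space[of "\<lambda>j. j + l" UNIV UNIV]) (rule bij_betwI[of _ _ _ "\<lambda>j. j - l"]; auto)
    also have "(\<integral>\<^sup>+j. (a j)\<^sup>2 \<partial>cs) * (\<integral>\<^sup>+j. (b j)\<^sup>2 \<partial>cs) \<le> ennreal (p\<^sup>2) * ennreal (q\<^sup>2)" using a b by (intro mult_mono) auto
    also have "\<dots> = (ennreal (p * q))\<^sup>2" using pq by (simp add: ennreal_power power_mult_distrib ennreal_mult)
    finally show "(\<integral>\<^sup>+j. a (j + l) * b j \<partial>cs)\<^sup>2 \<le> (ennreal (p * q))\<^sup>2" .
  qed (use pq in simp)
  have "(\<integral>\<^sup>+l. \<integral>\<^sup>+j. a (j + l) * b j * c l \<partial>cs \<partial>cs) = (\<integral>\<^sup>+l. (\<integral>\<^sup>+j. a (j + l) * b j \<partial>cs) * c l \<partial>cs)"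
    by (intro nn_integral_cong nn_integral_multc) auto
  also have "\<dots> \<le> (\<integral>\<^sup>+l. ennreal (p * q) * c l \<partial>cs)" by (intro nn_integral_mono mult_right_mono 1) auto
  also have "\<dots> = ennreal (p * q) * (\<integral>\<^sup>+k. c k \<partial>cs)" by (simp add: nn_integral_cmult)
  finally have 2: "(\<integral>\<^sup>+l. \<integral>\<^sup>+j. a (j + l) * b j * c l \<partial>cs \<partial>cs) \<le> ennreal (p * q) * (\<integral>\<^sup>+k. c k \<partial>cs)" .
  have "(\<integral>\<^sup>+j. \<integral>\<^sup>+l. a (j + l) * b j * c l \<partial>cs \<partial>cs) = (\<integral>\<^sup>+l. \<integral>\<^sup>+j. a (j + l) * b j * c l \<partial>cs \<partial>cs)"
    by (rule nn_integral_count_space_nn_integral) auto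
  then show "(\<integral>\<^sup>+j. \<integral>\<^sup>+l. a (j + l) * b j * c l \<partial>cs \<partial>cs) \<le> ennreal (p * q) * (\<integral>\<^sup>+k. c k \<partial>cs)" using 2 by simp
  show "(\<integral>\<^sup>+j. \<integral>\<^sup>+l. a (j + l) * c j * b l \<partial>cs \<partial>cs) \<le> ennreal (p * q) * (\<integral>\<^sup>+k. c k \<partial>cs)"
    using 2 by (simp add: add.commute mult_ac)
qed

lemma powr_half_square: "(x powr (a / 2))\<^sup>2 = x powr a" for x a :: real
  by (simp add: power2_eq_square flip: powr_add)

lemma powr_square: "(x powr a)\<^sup>2 = x powr (2 * a)" for x a :: real
  by (simp add: power2_eq_square flip: powr_add)

lemma sq_0: "sq 0 m = (\<integral>\<^sup>+k. (ennreal (m k))\<^sup>2 \<partial>cs)" if "\<And>k. m k \<ge> 0"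
  unfolding sq_def using that by (simp add: ennreal_power)

lemma sq_weighted: "sq s m = (\<integral>\<^sup>+k. (ennreal (wt k powr s * m k))\<^sup>2 \<partial>cs)" if "\<And>k. m k \<ge> 0"
  unfolding sq_def using that
  by (intro nn_integral_cong) (simp add: ennreal_power power_mult_distrib powr_power mult.commute)

lemma sqrt_powr: "0 < R \<Longrightarrow> sqrt (R powr a) = R powr (a / 2)"
  by (simp add: powr_half_sqrt[symmetric] powr_powr)

lemma young_eps:
  fixes \<epsilon> a b K :: real
  assumes "\<epsilon> > 0" "a \<ge> 0" "b \<ge> 0"
  shows "K * (sqrt a * sqrt b) \<le> \<epsilon> * a + K\<^sup>2 / (4 * \<epsilon>) * b"
proof -
  have "0 \<le> (2 * \<epsilon> * sqrt a - K * sqrt b)\<^sup>2" by simp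
  also have "\<dots> = 4 * \<epsilon>\<^sup>2 * (sqrt a)\<^sup>2 - 4 * \<epsilon> * K * (sqrt a * sqrt b) + K\<^sup>2 * (sqrt b)\<^sup>2"
    by (simp add: power2_eq_square algebra_simps)
  finally have "4 * \<epsilon> * (K * (sqrt a * sqrt b)) \<le> 4 * \<epsilon> * (\<epsilon> * a + K\<^sup>2 / (4 * \<epsilon>) * b)"
    using assms by (simp add: power2_eq_square algebra_simps)
  then show ?thesis using assms by (simp add: mult_le_cancel_left)
qed

text \<open>This serves the integral of the horizontal derivative against the square of the
  difference. The modes \<open>q\<close> of the derivative are only square summable, so one factor
  \<open>m\<close> must be summed by \<open>carlson\<close>, between the orders 0 and
  \<open>\<alpha> / 2\<close>.\<close>

lemma trilinear_transport:
  assumes \<alpha>: "1 < \<alpha>" "\<alpha> < 2" and \<epsilon>: "\<epsilon> > 0"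
  obtains C where "C \<ge> 0"
    "\<And>m q e d A. (\<And>k. m k \<ge> 0) \<Longrightarrow> (\<And>k. q k \<ge> 0) \<Longrightarrow> e \<ge> 0 \<Longrightarrow> d \<ge> 0 \<Longrightarrow> A \<ge> 0 \<Longrightarrow>
      sq 0 m \<le> ennreal e \<Longrightarrow> sq (\<alpha> / 2) m \<le> ennreal d \<Longrightarrow> sq 0 q \<le> ennreal A \<Longrightarrow>
      (\<integral>\<^sup>+j. \<integral>\<^sup>+l. ennreal (q (j + l)) * ennreal (m j) * ennreal (m l) \<partial>cs \<partial>cs) \<le> ennreal (\<epsilon> * d + C * (1 + A) * e)"
proof -
  obtain C0 where C0: "C0 > 0" "\<And>m x y R. (\<And>k. m k \<ge> 0) \<Longrightarrow> R \<ge> 1 \<Longrightarrow> 0 \<le> x \<Longrightarrow> 0 \<le> y \<Longrightarrow> sq 0 m \<le> ennreal x \<Longrightarrow> sq (\<alpha>/2) m \<le> ennreal y \<Longrightarrow>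
      (\<integral>\<^sup>+k. ennreal (m k) \<partial>cs) \<le> ennreal (C0 * sqrt (R powr (1 - 2 * 0) * x) + C0 * sqrt (R powr (1 - 2 * (\<alpha>/2)) * y))"
    using carlson[of 0 "\<alpha>/2"] \<alpha> by auto
  define C where "C = C0 + C0\<^sup>2 / (4 * \<epsilon>)"
  have "(\<integral>\<^sup>+j. \<integral>\<^sup>+l. ennreal (q (j + l)) * ennreal (m j) * ennreal (m l) \<partial>cs \<partial>cs) \<le> ennreal (\<epsilon> * d + C * (1 + A) * e)"
    if m: "\<And>k. m k \<ge> 0" and q: "\<And>k. q k \<ge> 0" and nn: "e \<ge> 0" "d \<ge> 0" "A \<ge> 0"
      and E: "sq 0 m \<le> ennreal e" and D: "sq (\<alpha> / 2) m \<le> ennreal d" and Q: "sq 0 q \<le> ennreal A" for m q e d A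
  proof -
    \<comment> \<open>This makes \<open>sqrt A\<close> at most \<open>R powr (\<alpha> / 2)\<close>.
      The resulting powers \<open>\<alpha> / 2 + 1 / 2\<close> and \<open>1 / 2\<close> of
      \<open>R\<close> are at most \<alpha> and \<open>\<alpha> / 2\<close> because \<alpha> > 1, so
      Young's inequality leaves \<open>R powr \<alpha> = 1 + A\<close> in front of
      \<open>e\<close>.\<close>
    define R where "R = (1 + A) powr (1 / \<alpha>)"
    have R: "R \<ge> 1" unfolding R_def using nn \<alpha> by (simp add: ge_one_powr_ge_zero)
    have Ra: "R powr \<alpha> = 1 + A" unfolding R_def using nn \<alpha> by (simp add: powr_powr)
    define L where "L = C0 * (R powr (1/2) * sqrt e) + C0 * (R powr ((1 - \<alpha>) / 2) * sqrt d)"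
    have L: "(\<integral>\<^sup>+k. ennreal (m k) \<partial>cs) \<le> ennreal L"
      using C0(2)[OF m R nn(1,2) E D] R by (simp add: L_def real_sqrt_mult sqrt_powr powr_half_sqrt)
    have L0: "L \<ge> 0" unfolding L_def using C0(1) by (auto intro!: add_nonneg_nonneg mult_nonneg_nonneg simp: nn)
    have "(\<integral>\<^sup>+j. \<integral>\<^sup>+l. ennreal (q (j + l)) * ennreal (m j) * ennreal (m l) \<partial>cs \<partial>cs) \<le> ennreal (sqrt A * sqrt e) * (\<integral>\<^sup>+k. ennreal (m k) \<partial>cs)"
      using E Q nn m q by (intro young_convolution(1)) (auto simp: sq_0)
    also have "\<dots> \<le> ennreal (sqrt A * sqrt e) * ennreal L" by (intro mult_left_mono L) auto
    also have "\<dots> = ennreal (sqrt A * sqrt e * L)" using nn L0 by (simp add: ennreal_mult)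
    also have "\<dots> \<le> ennreal (\<epsilon> * d + C * (1 + A) * e)"
    proof (rule ennreal_leI)
      have "sqrt A \<le> sqrt (R powr \<alpha>)" unfolding Ra by simp
      then have sA: "sqrt A \<le> R powr (\<alpha> / 2)" using R by (simp add: sqrt_powr)
      have "sqrt A * sqrt e * L \<le> R powr (\<alpha> / 2) * sqrt e * L"
        using sA L0 nn by (intro mult_right_mono) auto
      also have "\<dots> = C0 * (R powr (\<alpha> / 2 + 1/2)) * e + C0 * R powr (\<alpha> / 2 + (1 - \<alpha>) / 2) * (sqrt d * sqrt e)"
        unfolding L_def powr_add using nn by (simp add: algebra_simps)
      also have "\<dots> \<le> C0 * R powr \<alpha> * e + C0 * R powr (\<alpha> / 2) * (sqrt d * sqrt e)"
        using C0(1) R \<alpha> nn by (intro add_mono mult_right_mono mult_left_mono powr_mono) (auto simp: field_simps)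
      also have "C0 * R powr (\<alpha> / 2) * (sqrt d * sqrt e) \<le> \<epsilon> * d + (C0 * R powr (\<alpha> / 2))\<^sup>2 / (4 * \<epsilon>) * e"
        by (rule young_eps[OF \<epsilon> nn(2,1)])
      also have "(C0 * R powr (\<alpha> / 2))\<^sup>2 = C0\<^sup>2 * R powr \<alpha>"
        by (simp add: power_mult_distrib powr_half_square)
      finally show "sqrt A * sqrt e * L \<le> \<epsilon> * d + C * (1 + A) * e"
        unfolding Ra C_def by (simp add: algebra_simps)
    qed
    finally show ?thesis .
  qed
  moreover have "C \<ge> 0" using C0(1) \<epsilon> by (simp add: C_def)
  ultimately show ?thesis using that by blast
qed

text \<open>The larger of the two frequencies carries at least half of the sum; the factor 2 covers
  \<open>2 powr p\<close> for \<open>p\<close> up to 1.\<close>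

lemma wt_add_powr:
  assumes "0 \<le> p" "p \<le> 1"
  shows "wt (j + l) powr p \<le> 2 * (wt j powr p + wt l powr p)"
proof -
  have "wt (j + l) \<le> 2 * max (wt j) (wt l)" by (auto simp: wt_def)
  then have "wt (j + l) powr p \<le> (2 * max (wt j) (wt l)) powr p" using assms by (intro powr_mono2) auto
  also have "\<dots> = 2 powr p * max (wt j) (wt l) powr p" by (rule powr_mult)
  also have "\<dots> \<le> 2 powr 1 * (wt j powr p + wt l powr p)"
    using assms by (intro mult_mono powr_mono) (auto simp: max_def)
  finally show ?thesis by simp
qed

text \<open>The weights on \<open>n\<close> are scaling critical: at the cutoff \<open>R\<close> with \<open>R\<^sup>\<alpha> = 1 + y\<close> every term is
  \<open>R\<^bsup>\<alpha>/2\<^esup> \<surd>e \<surd>d\<close> or \<open>d\<close>, and cutting \<open>m\<close> at \<open>K R\<close> instead makes the coefficient of \<open>d\<close> small.\<close>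

lemma trilinear_vertical:
  assumes \<alpha>: "1 < \<alpha>" "\<alpha> < 2" and s1: "0 \<le> s1" "s1 < 1/2" "3/2 - \<alpha> \<le> s1" "s1 \<le> 1 - \<alpha>/2"
    and \<epsilon>: "\<epsilon> > 0" and X: "X \<ge> 0"
  obtains C where "C \<ge> 0"
    "\<And>m n e d y. (\<And>k. m k \<ge> 0) \<Longrightarrow> (\<And>k. n k \<ge> 0) \<Longrightarrow> e \<ge> 0 \<Longrightarrow> d \<ge> 0 \<Longrightarrow> y \<ge> 0 \<Longrightarrow>
      sq 0 m \<le> ennreal e \<Longrightarrow> sq (\<alpha> / 2) m \<le> ennreal d \<Longrightarrow> sq s1 n \<le> ennreal X \<Longrightarrow> sq (s1 + \<alpha> / 2) n \<le> ennreal y \<Longrightarrow>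
      (\<integral>\<^sup>+j. \<integral>\<^sup>+l. ennreal (wt (j + l) * m (j + l)) * ennreal (n j) * ennreal (m l) \<partial>cs \<partial>cs) \<le> ennreal (\<epsilon> * d + C * (1 + y) * e)"
proof -
  let ?s2 = "s1 + \<alpha> / 2" and ?p = "1 - \<alpha> / 2"
  obtain C0 where C0: "C0 > 0" "\<And>m x y R. (\<And>k. m k \<ge> 0) \<Longrightarrow> R \<ge> 1 \<Longrightarrow> 0 \<le> x \<Longrightarrow> 0 \<le> y \<Longrightarrow> sq 0 m \<le> ennreal x \<Longrightarrow> sq (\<alpha>/2) m \<le> ennreal y \<Longrightarrow>
      (\<integral>\<^sup>+k. ennreal (m k) \<partial>cs) \<le> ennreal (C0 * sqrt (R powr (1 - 2 * 0) * x) + C0 * sqrt (R powr (1 - 2 * (\<alpha>/2)) * y))"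
    using carlson[of 0 "\<alpha>/2"] \<alpha> by auto
  obtain C1 where C1: "C1 > 0" "\<And>m x y R. (\<And>k. m k \<ge> 0) \<Longrightarrow> R \<ge> 1 \<Longrightarrow> 0 \<le> x \<Longrightarrow> 0 \<le> y \<Longrightarrow> sq s1 m \<le> ennreal x \<Longrightarrow> sq ?s2 m \<le> ennreal y \<Longrightarrow>
      (\<integral>\<^sup>+k. ennreal (m k) \<partial>cs) \<le> ennreal (C1 * sqrt (R powr (1 - 2 * s1) * x) + C1 * sqrt (R powr (1 - 2 * ?s2) * y))"
    using carlson[of s1 ?s2] \<alpha> s1 by auto
  \<comment> \<open>\<open>c\<close> collects the constants of \<open>PL\<close> and
    \<open>QN\<close> below, \<open>\<delta>\<close> turns \<open>c * \<delta>\<close> into half of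
    \<open>\<epsilon>\<close>, and \<open>K\<close> is the smallest number from 1 on with
    \<open>K powr ((1 - \<alpha>) / 2) \<le> \<delta>\<close>; the exponent in it is negative as
    \<alpha> > 1.\<close>
  define c where "c = 2 * (C0 * sqrt (X + 1) + C1 * (sqrt X + 1))"
  have "sqrt X + 1 > 0" "sqrt (X + 1) > 0" using X by (auto intro: add_nonneg_pos)
  then have c: "c > 0" unfolding c_def using C0(1) C1(1) by (simp add: add_pos_pos)
  define \<delta> where "\<delta> = \<epsilon> / (2 * c)"
  have \<delta>: "\<delta> > 0" using \<epsilon> c by (simp add: \<delta>_def)
  define K where "K = max 1 (\<delta> powr (2 / (1 - \<alpha>)))"
  have K: "K \<ge> 1" by (simp add: K_def)
  have K\<delta>: "K powr ((1 - \<alpha>) / 2) \<le> \<delta>"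
  proof -
    have "K powr ((1 - \<alpha>) / 2) \<le> (\<delta> powr (2 / (1 - \<alpha>))) powr ((1 - \<alpha>) / 2)"
      using \<delta> \<alpha> by (intro powr_mono2') (auto simp: K_def)
    also have "\<dots> = \<delta> powr (2 / (1 - \<alpha>) * ((1 - \<alpha>) / 2))" by (rule powr_powr)
    also have "2 / (1 - \<alpha>) * ((1 - \<alpha>) / 2) = 1" using \<alpha> by simp
    also have "\<delta> powr 1 = \<delta>" using \<delta> by simp
    finally show ?thesis .
  qed
  \<comment> \<open>What Young's inequality with parameter \<open>\<epsilon> / 2\<close> leaves in
    front of \<open>e\<close>.\<close>
  define C where "C = (c * K)\<^sup>2 / (2 * \<epsilon>)"
  have "(\<integral>\<^sup>+j. \<integral>\<^sup>+l. ennreal (wt (j + l) * m (j + l)) * ennreal (n j) * ennreal (m l) \<partial>cs \<partial>cs) \<le> ennreal (\<epsilon> * d + C * (1 + y) * e)"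
    if m: "\<And>k. m k \<ge> 0" and n: "\<And>k. n k \<ge> 0" and nn: "e \<ge> 0" "d \<ge> 0" "y \<ge> 0"
      and E: "sq 0 m \<le> ennreal e" and D: "sq (\<alpha> / 2) m \<le> ennreal d" and nX: "sq s1 n \<le> ennreal X" and nY: "sq ?s2 n \<le> ennreal y" for m n e d y
  proof -
    define R where "R = (1 + y) powr (1 / \<alpha>)"
    have R: "R \<ge> 1" unfolding R_def using nn \<alpha> by (simp add: ge_one_powr_ge_zero)
    have Ra: "R powr \<alpha> = 1 + y" unfolding R_def using nn \<alpha> by (simp add: powr_powr)
    have KR: "K * R \<ge> 1" using K R by (simp add: mult_ge1_I)
    have KRp: "(K * R) powr t = K powr t * R powr t" for t by (rule powr_mult)
    have Ry: "R powr t * y \<le> R powr (t + \<alpha>)" for t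
      unfolding powr_add Ra using nn by (intro mult_left_mono) auto
    define L where "L = C0 * (K powr (1/2) * R powr (1/2) * sqrt e) + C0 * (K powr ((1 - \<alpha>) / 2) * R powr ((1 - \<alpha>) / 2) * sqrt d)"
    have L: "(\<integral>\<^sup>+k. ennreal (m k) \<partial>cs) \<le> ennreal L"
      using C0(2)[OF m KR nn(1,2) E D] K R by (simp add: L_def KRp real_sqrt_mult sqrt_powr powr_half_sqrt)
    have L0: "L \<ge> 0" unfolding L_def using C0(1) nn by (auto intro!: add_nonneg_nonneg mult_nonneg_nonneg)
    \<comment> \<open>Both parts of the sum of \<open>n\<close> are of order
      \<open>R powr (\<alpha> - 1)\<close>: this is the inequality
      \<open>3/2 - \<alpha> \<le> s1\<close>, once for the bound \<open>X\<close> and once for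
      \<open>y \<le> R powr \<alpha>\<close>.\<close>
    define N1 where "N1 = C1 * (sqrt X + 1) * R powr (\<alpha> - 1)"
    have N1: "(\<integral>\<^sup>+k. ennreal (n k) \<partial>cs) \<le> ennreal N1"
    proof -
      have a: "sqrt (R powr (1 - 2 * s1) * X) \<le> R powr (\<alpha> - 1) * sqrt X"
      proof -
        have "sqrt (R powr (1 - 2 * s1)) \<le> R powr (\<alpha> - 1)"
          using R s1 by (subst sqrt_powr) (auto intro!: powr_mono)
        then show ?thesis using X by (simp add: real_sqrt_mult mult_right_mono)
      qed
      have b: "sqrt (R powr (1 - 2 * ?s2) * y) \<le> R powr (\<alpha> - 1)"
      proof -
        have "R powr (1 - 2 * ?s2) * y \<le> R powr (1 - 2 * ?s2 + \<alpha>)" by (rule Ry)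
        also have "\<dots> \<le> R powr (2 * (\<alpha> - 1))" using R s1 by (intro powr_mono) auto
        finally have "sqrt (R powr (1 - 2 * ?s2) * y) \<le> sqrt (R powr (2 * (\<alpha> - 1)))" by simp
        also have "\<dots> = R powr (\<alpha> - 1)" using R by (subst sqrt_powr) (auto simp: diff_divide_distrib)
        finally show ?thesis .
      qed
      have "C1 * sqrt (R powr (1 - 2 * s1) * X) + C1 * sqrt (R powr (1 - 2 * ?s2) * y) \<le> C1 * (R powr (\<alpha> - 1) * sqrt X) + C1 * R powr (\<alpha> - 1)"
        using C1(1) a b by (intro add_mono mult_left_mono) auto
      also have "\<dots> = N1" by (simp add: N1_def algebra_simps)
      finally show ?thesis using C1(2)[OF n R X nn(3) nX nY] by (meson ennreal_leI order_trans)
    qed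
    have N10: "N1 \<ge> 0" unfolding N1_def using C1(1) X by auto
    \<comment> \<open>Interpolation of \<open>n\<close> to the order
      \<open>1 - \<alpha> / 2\<close>, which is possible as \<open>s1\<close> does not exceed it;
      the exponent is again \<open>3/2 - \<alpha> \<le> s1\<close>.\<close>
    define P where "P = sqrt (X + 1) * R powr ((\<alpha> - 1) / 2)"
    have P: "sq ?p n \<le> ennreal (P\<^sup>2)"
    proof -
      have "sq ?p n \<le> ennreal (R powr (2 * ?p - 2 * s1) * X + R powr (2 * ?p - 2 * ?s2) * y)"
        by (rule sq_interpolate) (use R X nn nX nY s1 \<alpha> in auto)
      also have "\<dots> \<le> ennreal (P\<^sup>2)"
      proof (rule ennreal_leI)
        have "R powr (2 * ?p - 2 * ?s2) * y \<le> R powr (2 * ?p - 2 * ?s2 + \<alpha>)" by (rule Ry)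
        also have "\<dots> \<le> R powr (\<alpha> - 1)" using R s1 by (intro powr_mono) auto
        finally have "R powr (2 * ?p - 2 * ?s2) * y \<le> R powr (\<alpha> - 1)" .
        moreover have "R powr (2 * ?p - 2 * s1) * X \<le> R powr (\<alpha> - 1) * X"
          using R s1 X by (intro mult_right_mono powr_mono) auto
        moreover have "P\<^sup>2 = R powr (\<alpha> - 1) * X + R powr (\<alpha> - 1)"
          using X by (simp add: P_def power_mult_distrib powr_half_square algebra_simps)
        ultimately show "R powr (2 * ?p - 2 * s1) * X + R powr (2 * ?p - 2 * ?s2) * y \<le> P\<^sup>2" by linarith
      qed
      finally show ?thesis .
    qed
    have P0: "P \<ge> 0" using X by (simp add: P_def)
    \<comment> \<open>Interpolation of \<open>m\<close> at the enlarged cutoff \<open>K * R\<close>.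
      The dangerous part with \<open>sqrt d\<close> carries the small factor
      \<open>K powr (1 - \<alpha>)\<close>, at the price of a power of \<open>K\<close> in front of
      \<open>sqrt e\<close>.\<close>
    define Q where "Q = K powr ?p * R powr ?p * sqrt e + K powr (1 - \<alpha>) * R powr (1 - \<alpha>) * sqrt d"
    have Q: "sq ?p m \<le> ennreal (Q\<^sup>2)"
    proof -
      have "sq ?p m \<le> ennreal ((K * R) powr (2 * ?p - 2 * 0) * e + (K * R) powr (2 * ?p - 2 * (\<alpha> / 2)) * d)"
        by (rule sq_interpolate) (use KR nn E D \<alpha> in auto)
      also have "\<dots> \<le> ennreal (Q\<^sup>2)"
      proof (rule ennreal_leI)
        have "(K powr ?p * R powr ?p * sqrt e)\<^sup>2 = (K * R) powr (2 * ?p - 2 * 0) * e"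
          using nn by (simp add: power_mult_distrib powr_square KRp algebra_simps)
        moreover have "(K powr (1 - \<alpha>) * R powr (1 - \<alpha>) * sqrt d)\<^sup>2 = (K * R) powr (2 * ?p - 2 * (\<alpha> / 2)) * d"
          using nn by (simp add: power_mult_distrib powr_square KRp algebra_simps)
        moreover have "(K powr ?p * R powr ?p * sqrt e) * (K powr (1 - \<alpha>) * R powr (1 - \<alpha>) * sqrt d) \<ge> 0"
          using nn by (intro mult_nonneg_nonneg) auto
        ultimately show "(K * R) powr (2 * ?p - 2 * 0) * e + (K * R) powr (2 * ?p - 2 * (\<alpha> / 2)) * d \<le> Q\<^sup>2"
          unfolding Q_def power2_sum by linarith
      qed
      finally show ?thesis .
    qed
    have Q0: "Q \<ge> 0" using nn by (auto simp: Q_def intro!: add_nonneg_nonneg mult_nonneg_nonneg)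
    have D': "(\<integral>\<^sup>+k. (ennreal (wt k powr (\<alpha>/2) * m k))\<^sup>2 \<partial>cs) \<le> ennreal ((sqrt d)\<^sup>2)"
      using D nn by (simp add: sq_weighted[OF m])
    have P': "(\<integral>\<^sup>+k. (ennreal (wt k powr ?p * n k))\<^sup>2 \<partial>cs) \<le> ennreal (P\<^sup>2)" using P by (simp add: sq_weighted[OF n])
    have Q': "(\<integral>\<^sup>+k. (ennreal (wt k powr ?p * m k))\<^sup>2 \<partial>cs) \<le> ennreal (Q\<^sup>2)" using Q by (simp add: sq_weighted[OF m])
    let ?a = "\<lambda>k. ennreal (wt k powr (\<alpha>/2) * m k)"
    \<comment> \<open>The lost derivative is split into the orders \<open>\<alpha> / 2\<close> and
      \<open>1 - \<alpha> / 2\<close>. The first stays on its factor and is paid by the dissipation;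
      the second is distributed over the other two factors, which gives one convolution for each
      form of \<open>young_convolution\<close>.\<close>
    have pw: "ennreal (wt (j + l) * m (j + l)) * ennreal (n j) * ennreal (m l) \<le>
        2 * (?a (j + l) * ennreal (wt j powr ?p * n j) * ennreal (m l)) + 2 * (?a (j + l) * ennreal (n j) * ennreal (wt l powr ?p * m l))" for j l
    proof -
      have "wt (j + l) = wt (j + l) powr (\<alpha>/2) * wt (j + l) powr ?p" by (simp flip: powr_add)
      also have "\<dots> \<le> wt (j + l) powr (\<alpha>/2) * (2 * (wt j powr ?p + wt l powr ?p))"
        using \<alpha> by (intro mult_left_mono wt_add_powr) auto
      finally have "wt (j + l) * (m (j + l) * n j * m l) \<le> wt (j + l) powr (\<alpha>/2) * (2 * (wt j powr ?p + wt l powr ?p)) * (m (j + l) * n j * m l)"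
        using m n by (intro mult_right_mono) auto
      then have "ennreal (wt (j + l) * m (j + l) * n j * m l) \<le>
          ennreal (2 * (wt (j + l) powr (\<alpha>/2) * m (j + l) * (wt j powr ?p * n j) * m l) + 2 * (wt (j + l) powr (\<alpha>/2) * m (j + l) * n j * (wt l powr ?p * m l)))"
        by (intro ennreal_leI) (simp add: algebra_simps)
      then show ?thesis using m n by (simp add: ennreal_mult ennreal_plus)
    qed
    have "(\<integral>\<^sup>+j. \<integral>\<^sup>+l. ennreal (wt (j + l) * m (j + l)) * ennreal (n j) * ennreal (m l) \<partial>cs \<partial>cs) \<le>
       (\<integral>\<^sup>+j. \<integral>\<^sup>+l. 2 * (?a (j + l) * ennreal (wt j powr ?p * n j) * ennreal (m l)) + 2 * (?a (j + l) * ennreal (n j) * ennreal (wt l powr ?p * m l)) \<partial>cs \<partial>cs)"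
      by (intro nn_integral_mono pw)
    also have "\<dots> = 2 * (\<integral>\<^sup>+j. \<integral>\<^sup>+l. ?a (j + l) * ennreal (wt j powr ?p * n j) * ennreal (m l) \<partial>cs \<partial>cs)
        + 2 * (\<integral>\<^sup>+j. \<integral>\<^sup>+l. ?a (j + l) * ennreal (n j) * ennreal (wt l powr ?p * m l) \<partial>cs \<partial>cs)"
      by (simp add: nn_integral_add nn_integral_cmult)
    also have "\<dots> \<le> 2 * (ennreal (sqrt d * P) * (\<integral>\<^sup>+k. ennreal (m k) \<partial>cs)) + 2 * (ennreal (sqrt d * Q) * (\<integral>\<^sup>+k. ennreal (n k) \<partial>cs))"
      using nn P0 Q0 by (intro add_mono mult_left_mono young_convolution D' P' Q') auto
    also have "\<dots> \<le> 2 * (ennreal (sqrt d * P) * ennreal L) + 2 * (ennreal (sqrt d * Q) * ennreal N1)"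
      by (intro add_mono mult_left_mono L N1) auto
    also have "\<dots> = ennreal (2 * (sqrt d * P * L) + 2 * (sqrt d * Q * N1))"
      using nn P0 Q0 L0 N10 by (simp add: ennreal_mult ennreal_plus)
    also have "\<dots> \<le> ennreal (\<epsilon> * d + C * (1 + y) * e)"
    proof (rule ennreal_leI)
      have Rh: "R powr ((\<alpha> - 1) / 2) * R powr (1/2) = R powr (\<alpha> / 2)" "R powr ((\<alpha> - 1) / 2) * R powr ((1 - \<alpha>) / 2) = 1"
        "R powr (\<alpha> - 1) * R powr ?p = R powr (\<alpha> / 2)" "R powr (\<alpha> - 1) * R powr (1 - \<alpha>) = 1"
        using R by (simp_all flip: powr_add add: field_simps)
      have K1: "K powr (1/2) \<le> K" "K powr ?p \<le> K" using K \<alpha> powr_mono[of "1/2" 1 K] powr_mono[of ?p 1 K] by auto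
      have K2: "K powr (1 - \<alpha>) \<le> \<delta>" using K \<alpha> powr_mono[of "1 - \<alpha>" "(1 - \<alpha>) / 2" K] K\<delta> by auto
      have PL: "P * L \<le> C0 * sqrt (X + 1) * (K * R powr (\<alpha> / 2) * sqrt e + \<delta> * sqrt d)"
      proof -
        have "P * L = C0 * sqrt (X + 1) * (K powr (1/2) * (R powr ((\<alpha> - 1) / 2) * R powr (1/2)) * sqrt e
            + K powr ((1 - \<alpha>) / 2) * (R powr ((\<alpha> - 1) / 2) * R powr ((1 - \<alpha>) / 2)) * sqrt d)"
          unfolding P_def L_def by (simp only: algebra_simps)
        also have "\<dots> \<le> C0 * sqrt (X + 1) * (K * R powr (\<alpha> / 2) * sqrt e + \<delta> * sqrt d)"
          unfolding Rh using C0(1) X nn K1 K\<delta> by (intro mult_left_mono add_mono mult_right_mono) auto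
        finally show ?thesis .
      qed
      have QN: "Q * N1 \<le> C1 * (sqrt X + 1) * (K * R powr (\<alpha> / 2) * sqrt e + \<delta> * sqrt d)"
      proof -
        have "Q * N1 = C1 * (sqrt X + 1) * (K powr ?p * (R powr (\<alpha> - 1) * R powr ?p) * sqrt e
            + K powr (1 - \<alpha>) * (R powr (\<alpha> - 1) * R powr (1 - \<alpha>)) * sqrt d)"
          unfolding Q_def N1_def by (simp only: algebra_simps)
        also have "\<dots> \<le> C1 * (sqrt X + 1) * (K * R powr (\<alpha> / 2) * sqrt e + \<delta> * sqrt d)"
          unfolding Rh using C1(1) X nn K1 K2 by (intro mult_left_mono add_mono mult_right_mono) auto
        finally show ?thesis .
      qed
      have "2 * (sqrt d * P * L) + 2 * (sqrt d * Q * N1) = sqrt d * (2 * (P * L + Q * N1))" by (simp add: algebra_simps)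
      also have "\<dots> \<le> sqrt d * (2 * (C0 * sqrt (X + 1) * (K * R powr (\<alpha> / 2) * sqrt e + \<delta> * sqrt d) + C1 * (sqrt X + 1) * (K * R powr (\<alpha> / 2) * sqrt e + \<delta> * sqrt d)))"
        using PL QN nn by (intro mult_left_mono) auto
      also have "\<dots> = c * K * R powr (\<alpha> / 2) * (sqrt d * sqrt e) + c * \<delta> * (sqrt d * sqrt d)"
        unfolding c_def by (simp only: algebra_simps)
      also have "c * \<delta> * (sqrt d * sqrt d) = \<epsilon> / 2 * d" using c nn by (simp add: \<delta>_def)
      also have "c * K * R powr (\<alpha> / 2) * (sqrt d * sqrt e) \<le> \<epsilon> / 2 * d + (c * K * R powr (\<alpha> / 2))\<^sup>2 / (4 * (\<epsilon> / 2)) * e"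
        using \<epsilon> by (intro young_eps nn) auto
      also have "(c * K * R powr (\<alpha> / 2))\<^sup>2 / (4 * (\<epsilon> / 2)) * e = C * (1 + y) * e"
        unfolding Ra[symmetric] C_def by (simp add: power_mult_distrib powr_half_square)
      finally show "2 * (sqrt d * P * L) + 2 * (sqrt d * Q * N1) \<le> \<epsilon> * d + C * (1 + y) * e" by simp
    qed
    finally show ?thesis .
  qed
  moreover have "C \<ge> 0" using \<epsilon> by (simp add: C_def)
  ultimately show ?thesis using that by blast
qed

subsection \<open>Horizontal Fourier modes of functions on the square\<close>

abbreviation I1 :: "real measure" where "I1 \<equiv> leb_on 0 1"
abbreviation O2 :: "(real \<times> real) measure" where "O2 \<equiv> leb2 0 1 0 1"

definition hf :: "(real \<times> real \<Rightarrow> real) \<Rightarrow> int \<Rightarrow> real \<Rightarrow> complex" where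
  "hf f k z = fc (\<lambda>x. complex_of_real (f (x, z))) k"

text \<open>The \<open>L2\<close> norm in \<open>z\<close> of a horizontal mode. With two factors
  measured in this way and the third by a bound uniform in \<open>z\<close>, integrals over the
  square become sums over frequencies.\<close>

definition nz :: "(real \<times> real \<Rightarrow> real) \<Rightarrow> int \<Rightarrow> real" where
  "nz f k = sqrt (\<integral>z. (norm (hf f k z))\<^sup>2 \<partial>I1)"

lemma nz_nonneg [simp]: "nz f k \<ge> 0" by (simp add: nz_def)

lemma borel_section:
  fixes f :: "real \<times> real \<Rightarrow> 'a::{second_countable_topology, t2_space}"
  assumes "f \<in> Borel"
  shows "(\<lambda>x. f (x, z)) \<in> Borel" "(\<lambda>z. f (x, z)) \<in> Borel"
proof -
  have "(\<lambda>x. (x, z)) \<in> borel \<rightarrow>\<^sub>M borel" by (intro borel_measurable_continuous_onI continuous_intros)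
  from measurable_compose[OF this assms] show "(\<lambda>x. f (x, z)) \<in> Borel" .
  have "(\<lambda>z. (x, z)) \<in> borel \<rightarrow>\<^sub>M borel" by (intro borel_measurable_continuous_onI continuous_intros)
  from measurable_compose[OF this assms] show "(\<lambda>z. f (x, z)) \<in> Borel" .
qed

lemma hf_eq: "f \<in> Borel \<Longrightarrow> horiz_fourier f k z = hf f k z"
proof -
  assume "f \<in> Borel"
  note [measurable] = borel_section(1)[OF this, of z]
  have "cis (- (2 * pi * of_int k * x)) = chr (- k) x" for x by (simp add: chr_def)
  then show ?thesis unfolding horiz_fourier_def hf_def fc_def by (simp add: integral_leb_on)
qed

lemma hf_measurable [measurable]: "f \<in> Borel \<Longrightarrow> hf f k \<in> Borel"
proof -
  assume f: "f \<in> Borel"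
  have "(\<lambda>p. f (snd p, fst p)) \<in> borel_measurable (I1 \<Otimes>\<^sub>M I1)"
    using f by (intro measurable_compose[OF _ f] borel_measurable_Pair) (simp_all del: borel_measurable_leb_eq)
  then have "(\<lambda>(z, x). complex_of_real (f (x, z)) * chr (- k) x) \<in> borel_measurable (I1 \<Otimes>\<^sub>M I1)"
    by (simp add: case_prod_unfold del: borel_measurable_leb_eq)
  then have "(\<lambda>z. \<integral>x. complex_of_real (f (x, z)) * chr (- k) x \<partial>I1) \<in> borel_measurable I1"
    by (rule leb_on.borel_measurable_lebesgue_integral)
  then show ?thesis unfolding hf_def fc_def by simp
qed

lemma hf_minus: "hf f (- k) z = cnj (hf f k z)"
proof -
  have "cnj (hf f k z) = (\<integral>x. cnj (complex_of_real (f (x, z)) * chr (- k) x) \<partial>I1)"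
    unfolding hf_def fc_def by (rule Bochner_Integration.integral_cnj[symmetric])
  then show ?thesis by (simp add: hf_def fc_def)
qed

lemma nz_minus: "nz f (- k) = nz f k" by (simp add: nz_def hf_minus)

lemma O2_sections:
  fixes f :: "real \<times> real \<Rightarrow> 'a::{banach, second_countable_topology}"
  assumes "integrable O2 f"
  shows "AE z in I1. integrable I1 (\<lambda>x. f (x, z))" "AE x in I1. integrable I1 (\<lambda>z. f (x, z))"
    "integrable I1 (\<lambda>z. \<integral>x. f (x, z) \<partial>I1)" "integrable I1 (\<lambda>x. \<integral>z. f (x, z) \<partial>I1)"
    "(\<integral>p. f p \<partial>O2) = (\<integral>z. \<integral>x. f (x, z) \<partial>I1 \<partial>I1)" "(\<integral>p. f p \<partial>O2) = (\<integral>x. \<integral>z. f (x, z) \<partial>I1 \<partial>I1)"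
proof -
  have f: "integrable O2 (\<lambda>(x, z). f (x, z))" using assms by simp
  show "AE z in I1. integrable I1 (\<lambda>x. f (x, z))" by (rule leb_pair.AE_integrable_snd[OF f])
  show "AE x in I1. integrable I1 (\<lambda>z. f (x, z))" by (rule leb_pair.AE_integrable_fst[OF f])
  show "integrable I1 (\<lambda>z. \<integral>x. f (x, z) \<partial>I1)" by (rule leb_pair.integrable_snd[OF f])
  show "integrable I1 (\<lambda>x. \<integral>z. f (x, z) \<partial>I1)" by (rule leb_pair.integrable_fst[OF f])
  show "(\<integral>p. f p \<partial>O2) = (\<integral>z. \<integral>x. f (x, z) \<partial>I1 \<partial>I1)" using leb_pair.integral_snd[OF f] by simp
  show "(\<integral>p. f p \<partial>O2) = (\<integral>x. \<integral>z. f (x, z) \<partial>I1 \<partial>I1)" using leb_pair.integral_fst[OF f] by simp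
qed

lemma AE_O2:
  assumes "AE p in O2. P p"
  shows "AE x in I1. AE z in I1. P (x, z)" "AE z in I1. AE x in I1. P (x, z)"
  using leb_pair.AE_pair[OF assms] AE_pair_swap[OF _ _ assms] leb_on.sigma_finite_measure_axioms by auto

lemma square_integrable_imp_integrable':
  fixes f :: "'a \<Rightarrow> real"
  assumes "finite_measure M" "f \<in> borel_measurable M" "integrable M (\<lambda>x. (f x)\<^sup>2)"
  shows "integrable M f"
  using finite_measure.square_integrable_imp_integrable[OF assms(1,2)] assms(3) by simp

text \<open>Bessel's inequality on almost every horizontal line, integrated in \<open>z\<close> with
  Tonelli for the sum over frequencies.\<close>

lemma bessel_O2:
  assumes f [measurable]: "f \<in> Borel" and f2: "integrable O2 (\<lambda>p. (f p)\<^sup>2)"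
  shows "integrable I1 (\<lambda>z. (norm (hf f k z))\<^sup>2)"
    and "(nz f k)\<^sup>2 = (\<integral>z. (norm (hf f k z))\<^sup>2 \<partial>I1)"
    and "sq 0 (nz f) \<le> ennreal (\<integral>p. (f p)\<^sup>2 \<partial>O2)"
proof -
  have b: "AE z in I1. (\<integral>\<^sup>+k. ennreal ((norm (hf f k z))\<^sup>2) \<partial>cs) \<le> ennreal (\<integral>x. (f (x, z))\<^sup>2 \<partial>I1)"
    using O2_sections(1)[OF f2]
  proof eventually_elim
    case (elim z)
    note [measurable] = borel_section(1)[OF f, of z]
    have "integrable I1 (\<lambda>x. f (x, z))" by (rule square_integrable_imp_integrable'[OF leb_on.finite_measure_axioms _ elim]) simp
    then show ?case unfolding hf_def using bessel[of "\<lambda>x. complex_of_real (f (x, z))"] elim by simp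
  qed
  have "(\<integral>\<^sup>+k. \<integral>\<^sup>+z. ennreal ((norm (hf f k z))\<^sup>2) \<partial>I1 \<partial>cs) = (\<integral>\<^sup>+z. \<integral>\<^sup>+k. ennreal ((norm (hf f k z))\<^sup>2) \<partial>cs \<partial>I1)"
    by (rule nn_integral_count_space_nn_integral[symmetric]) auto
  also have "\<dots> \<le> (\<integral>\<^sup>+z. ennreal (\<integral>x. (f (x, z))\<^sup>2 \<partial>I1) \<partial>I1)" using b by (rule nn_integral_mono_AE)
  also have "\<dots> = ennreal (\<integral>p. (f p)\<^sup>2 \<partial>O2)"
    unfolding O2_sections(5)[OF f2] using O2_sections(3)[OF f2] by (intro nn_integral_eq_integral) auto
  finally have tot: "(\<integral>\<^sup>+k. \<integral>\<^sup>+z. ennreal ((norm (hf f k z))\<^sup>2) \<partial>I1 \<partial>cs) \<le> ennreal (\<integral>p. (f p)\<^sup>2 \<partial>O2)" .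
  have int: "integrable I1 (\<lambda>z. (norm (hf f k z))\<^sup>2)" for k
  proof (rule integrableI_nonneg)
    have "(\<integral>\<^sup>+z. ennreal ((norm (hf f k z))\<^sup>2) \<partial>I1) \<le> (\<integral>\<^sup>+k. \<integral>\<^sup>+z. ennreal ((norm (hf f k z))\<^sup>2) \<partial>I1 \<partial>cs)"
      by (rule nn_integral_ge_point) simp
    from order_trans[OF this tot] show "(\<integral>\<^sup>+z. ennreal ((norm (hf f k z))\<^sup>2) \<partial>I1) < \<infinity>"
      by (rule le_less_trans) simp
  qed auto
  show "integrable I1 (\<lambda>z. (norm (hf f k z))\<^sup>2)" by (rule int)
  show nz2: "(nz f k)\<^sup>2 = (\<integral>z. (norm (hf f k z))\<^sup>2 \<partial>I1)" for k by (simp add: nz_def)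
  show "sq 0 (nz f) \<le> ennreal (\<integral>p. (f p)\<^sup>2 \<partial>O2)"
    using tot int by (simp add: sq_def nz2 nn_integral_eq_integral)
qed

lemma nz_multiplier:
  assumes "\<And>k. AE z in I1. hf g k z = complex_of_real (mu k) * hf f k z" and "\<And>k. mu k \<ge> 0"
    and [measurable]: "f \<in> Borel" "g \<in> Borel"
  shows "nz g k = mu k * nz f k"
proof -
  have "(\<integral>z. (norm (hf g k z))\<^sup>2 \<partial>I1) = (\<integral>z. (mu k)\<^sup>2 * (norm (hf f k z))\<^sup>2 \<partial>I1)"
    by (rule integral_cong_AE) (use assms(1)[of k] in \<open>auto simp: norm_mult power_mult_distrib elim!: eventually_mono\<close>)
  then show ?thesis using assms(2) by (simp add: nz_def real_sqrt_mult)
qed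

text \<open>The symbol dominates \<open>wt\<close> away from frequency 0 because
  \<open>2 * pi \<ge> 1\<close>; frequency 0 is covered by the norm of \<open>f\<close>
  itself.\<close>

lemma sq_multiplier:
  assumes f [measurable]: "f \<in> Borel" "integrable O2 (\<lambda>p. (f p)\<^sup>2)"
    and g [measurable]: "g \<in> Borel" "integrable O2 (\<lambda>p. (g p)\<^sup>2)"
    and "s \<ge> 0" and m: "\<And>k. AE z in I1. hf g k z = complex_of_real (\<bar>2 * pi * of_int k\<bar> powr s) * hf f k z"
  shows "sq s (nz f) \<le> ennreal ((\<integral>p. (f p)\<^sup>2 \<partial>O2) + (\<integral>p. (g p)\<^sup>2 \<partial>O2))"
proof -
  have n: "nz g k = \<bar>2 * pi * of_int k\<bar> powr s * nz f k" for k
    by (rule nz_multiplier[OF m]) auto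
  have w: "wt k powr (2 * s) \<le> 1 + (\<bar>2 * pi * of_int k\<bar> powr s)\<^sup>2" for k
  proof (cases "k = 0")
    case False
    then have "\<bar>real_of_int k\<bar> \<ge> 1" by simp
    moreover have "1 * \<bar>real_of_int k\<bar> \<le> (2 * pi) * \<bar>real_of_int k\<bar>" using pi_gt3 by (intro mult_right_mono) auto
    ultimately have "wt k \<le> \<bar>2 * pi * of_int k\<bar>" by (simp add: wt_def abs_mult)
    then have "wt k powr (2 * s) \<le> \<bar>2 * pi * of_int k\<bar> powr (2 * s)" using assms by (intro powr_mono2) auto
    then show ?thesis by (simp add: powr_square)
  qed (simp add: wt_def)
  have "sq s (nz f) \<le> (\<integral>\<^sup>+k. ennreal (wt k powr (2 * 0) * (nz f k)\<^sup>2) + ennreal (wt k powr (2 * 0) * (nz g k)\<^sup>2) \<partial>cs)"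
    unfolding sq_def
  proof (rule nn_integral_mono)
    fix k
    have "wt k powr (2 * s) * (nz f k)\<^sup>2 \<le> (1 + (\<bar>2 * pi * of_int k\<bar> powr s)\<^sup>2) * (nz f k)\<^sup>2" by (intro mult_right_mono w) auto
    then have "wt k powr (2 * s) * (nz f k)\<^sup>2 \<le> (nz f k)\<^sup>2 + (nz g k)\<^sup>2" unfolding n by (simp add: algebra_simps power_mult_distrib)
    then show "ennreal (wt k powr (2 * s) * (nz f k)\<^sup>2) \<le> ennreal (wt k powr (2 * 0) * (nz f k)\<^sup>2) + ennreal (wt k powr (2 * 0) * (nz g k)\<^sup>2)"
      by (simp add: ennreal_leI flip: ennreal_plus)
  qed
  also have "\<dots> = sq 0 (nz f) + sq 0 (nz g)" unfolding sq_def by (rule nn_integral_add) auto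
  also have "\<dots> \<le> ennreal (\<integral>p. (f p)\<^sup>2 \<partial>O2) + ennreal (\<integral>p. (g p)\<^sup>2 \<partial>O2)"
    by (intro add_mono bessel_O2 f g)
  finally show ?thesis by simp
qed

lemma sq_mono: "s \<le> s' \<Longrightarrow> sq s m \<le> sq s' m"
  unfolding sq_def by (intro nn_integral_mono ennreal_leI mult_right_mono powr_mono) (auto simp: wt_ge1)

lemma nn_norm_hf_le_nz:
  assumes [measurable]: "f \<in> Borel" and "integrable O2 (\<lambda>p. (f p)\<^sup>2)"
  shows "(\<integral>\<^sup>+z. ennreal (norm (hf f k z)) \<partial>I1) \<le> ennreal (nz f k)"
proof (rule ennreal_power2_le_imp_le)
  have "(\<integral>\<^sup>+z. ennreal (norm (hf f k z)) * 1 \<partial>I1)\<^sup>2 \<le> (\<integral>\<^sup>+z. (ennreal (norm (hf f k z)))\<^sup>2 \<partial>I1) * (\<integral>\<^sup>+z. 1\<^sup>2 \<partial>I1)"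
    by (rule Cauchy_Schwarz_nn_integral) auto
  also have "\<dots> = (ennreal (nz f k))\<^sup>2"
    using bessel_O2[OF assms] by (simp add: ennreal_power nn_integral_eq_integral emeasure_leb_on)
  finally show "(\<integral>\<^sup>+z. ennreal (norm (hf f k z)) \<partial>I1)\<^sup>2 \<le> (ennreal (nz f k))\<^sup>2" by simp
qed simp

lemma nn_norm_hf_mult_le_nz:
  assumes [measurable]: "f \<in> Borel" and f2: "integrable O2 (\<lambda>p. (f p)\<^sup>2)"
    and [measurable]: "g \<in> Borel" and g2: "integrable O2 (\<lambda>p. (g p)\<^sup>2)"
  shows "(\<integral>\<^sup>+z. ennreal (norm (hf f j z)) * ennreal (norm (hf g l z)) \<partial>I1) \<le> ennreal (nz f j) * ennreal (nz g l)"
proof -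
  have "(\<integral>\<^sup>+z. ennreal (norm (hf f j z)) * ennreal (norm (hf g l z)) \<partial>I1) \<le> ennreal (nz f j * nz g l)"
  proof (rule ennreal_power2_le_imp_le)
    have "(\<integral>\<^sup>+z. ennreal (norm (hf f j z)) * ennreal (norm (hf g l z)) \<partial>I1)\<^sup>2 \<le>
        (\<integral>\<^sup>+z. (ennreal (norm (hf f j z)))\<^sup>2 \<partial>I1) * (\<integral>\<^sup>+z. (ennreal (norm (hf g l z)))\<^sup>2 \<partial>I1)"
      by (rule Cauchy_Schwarz_nn_integral) auto
    also have "\<dots> = ennreal ((nz f j)\<^sup>2) * ennreal ((nz g l)\<^sup>2)"
      using bessel_O2[of f] bessel_O2[of g] f2 g2 by (simp add: ennreal_power nn_integral_eq_integral)
    also have "\<dots> = (ennreal (nz f j * nz g l))\<^sup>2" by (simp add: ennreal_power power_mult_distrib ennreal_mult)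
    finally show "(\<integral>\<^sup>+z. ennreal (norm (hf f j z)) * ennreal (norm (hf g l z)) \<partial>I1)\<^sup>2 \<le> (ennreal (nz f j * nz g l))\<^sup>2" .
  qed simp
  then show ?thesis by (simp add: ennreal_mult)
qed

text \<open>An order above 1/2 makes \<open>nz f\<close> summable by \<open>carlson\<close>. On an
  interval of measure one \<open>nz f k\<close> dominates the integral of the mode in
  \<open>z\<close>, so Tonelli gives summable coefficients on almost every horizontal line.\<close>

lemma hf_summable:
  assumes f [measurable]: "f \<in> Borel" and f2: "integrable O2 (\<lambda>p. (f p)\<^sup>2)"
    and s: "s > 1/2" "sq s (nz f) < \<infinity>"
  shows "AE z in I1. integrable I1 (\<lambda>x. complex_of_real (f (x, z))) \<and> integrable cs (fc (\<lambda>x. complex_of_real (f (x, z))))"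
proof -
  obtain C where C: "C > 0" "\<And>m x y R. (\<And>k. m k \<ge> 0) \<Longrightarrow> R \<ge> 1 \<Longrightarrow> 0 \<le> x \<Longrightarrow> 0 \<le> y \<Longrightarrow> sq 0 m \<le> ennreal x \<Longrightarrow> sq s m \<le> ennreal y \<Longrightarrow>
      (\<integral>\<^sup>+k. ennreal (m k) \<partial>cs) \<le> ennreal (C * sqrt (R powr (1 - 2 * 0) * x) + C * sqrt (R powr (1 - 2 * s) * y))"
    using carlson[of 0 s] s by auto
  obtain y where y: "y \<ge> 0" "sq s (nz f) = ennreal y" using s(2) by (cases "sq s (nz f)") auto
  have "(\<integral>\<^sup>+k. ennreal (nz f k) \<partial>cs) < \<infinity>"
    using C(2)[of "nz f" 1 "\<integral>p. (f p)\<^sup>2 \<partial>O2" y] bessel_O2(3)[OF f f2] y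
    by (simp add: order.strict_trans1[OF _ ennreal_less_top])
  moreover have "(\<integral>\<^sup>+z. \<integral>\<^sup>+k. ennreal (norm (hf f k z)) \<partial>cs \<partial>I1) = (\<integral>\<^sup>+k. \<integral>\<^sup>+z. ennreal (norm (hf f k z)) \<partial>I1 \<partial>cs)"
    by (rule nn_integral_count_space_nn_integral) auto
  moreover have "\<dots> \<le> (\<integral>\<^sup>+k. ennreal (nz f k) \<partial>cs)"
    by (intro nn_integral_mono nn_norm_hf_le_nz f f2)
  ultimately have "(\<integral>\<^sup>+z. \<integral>\<^sup>+k. ennreal (norm (hf f k z)) \<partial>cs \<partial>I1) < \<infinity>" by simp
  moreover have "(\<lambda>z. \<integral>\<^sup>+k. ennreal (norm (hf f k z)) \<partial>cs) \<in> borel_measurable I1"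
  proof -
    have "(\<lambda>(k, z). ennreal (norm (hf f k z))) \<in> borel_measurable (cs \<Otimes>\<^sub>M I1)"
      by (intro measurable_pair_measure_countable1) auto
    then have "(\<lambda>(z, k). ennreal (norm (hf f k z))) \<in> borel_measurable (I1 \<Otimes>\<^sub>M cs)"
      using measurable_pair_swap[of "\<lambda>(k, z). ennreal (norm (hf f k z))" cs I1 borel] by (simp add: case_prod_unfold)
    then show ?thesis by (rule sigma_finite_measure.borel_measurable_nn_integral[OF sigma_finite_cs])
  qed
  ultimately have "AE z in I1. (\<integral>\<^sup>+k. ennreal (norm (hf f k z)) \<partial>cs) \<noteq> \<infinity>"
    by (intro nn_integral_PInf_AE) auto
  then show ?thesis using O2_sections(1)[OF f2]
  proof eventually_elim
    case (elim z)
    note [measurable] = borel_section(1)[OF f, of z]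
    have "integrable I1 (\<lambda>x. f (x, z))" by (rule square_integrable_imp_integrable'[OF leb_on.finite_measure_axioms _ elim(2)]) simp
    moreover have "integrable cs (fc (\<lambda>x. complex_of_real (f (x, z))))"
      using elim(1) by (intro integrableI_bounded) (auto simp: hf_def top.not_eq_extremum)
    ultimately show ?case by simp
  qed
qed

text \<open>\<open>fourier_trilinear\<close> on almost every horizontal line, then Cauchy-Schwarz in
  \<open>z\<close> for \<open>g\<close> and \<open>h\<close>. The modes of \<open>f\<close> are
  bounded uniformly in \<open>z\<close> by \<open>q\<close>; evenness of \<open>q\<close> absorbs
  the sign of the index \<open>- (j + l)\<close>.\<close>

lemma trilinear_O2:
  assumes f [measurable]: "f \<in> Borel" and f1: "integrable O2 f"
    and g [measurable]: "g \<in> Borel" and g2: "integrable O2 (\<lambda>p. (g p)\<^sup>2)" and gs: "s > 1/2" "sq s (nz g) < \<infinity>"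
    and h [measurable]: "h \<in> Borel" and h2: "integrable O2 (\<lambda>p. (h p)\<^sup>2)" and hs: "s' > 1/2" "sq s' (nz h) < \<infinity>"
    and q: "\<And>k. AE z in I1. norm (hf f k z) \<le> q k" "\<And>k. q k \<ge> 0" "\<And>k. q (- k) = q k"
    and i: "integrable O2 (\<lambda>p. f p * g p * h p)"
  shows "ennreal \<bar>\<integral>p. f p * g p * h p \<partial>O2\<bar> \<le> (\<integral>\<^sup>+j. \<integral>\<^sup>+l. ennreal (q (j + l)) * ennreal (nz g j) * ennreal (nz h l) \<partial>cs \<partial>cs)"
proof -
  have q': "AE z in I1. \<forall>k. norm (hf f k z) \<le> q k" using q(1) by (simp add: AE_all_countable)
  have "ennreal \<bar>\<integral>p. f p * g p * h p \<partial>O2\<bar> = ennreal \<bar>\<integral>z. (\<integral>x. f (x, z) * g (x, z) * h (x, z) \<partial>I1) \<partial>I1\<bar>"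
    using O2_sections(5)[OF i] by simp
  also have "\<dots> \<le> (\<integral>\<^sup>+z. ennreal \<bar>\<integral>x. f (x, z) * g (x, z) * h (x, z) \<partial>I1\<bar> \<partial>I1)"
    using integral_norm_bound_ennreal[OF O2_sections(3)[OF i]] by simp
  also have "\<dots> \<le> (\<integral>\<^sup>+z. \<integral>\<^sup>+j. \<integral>\<^sup>+l. ennreal (q (j + l)) * (ennreal (norm (hf g j z)) * ennreal (norm (hf h l z))) \<partial>cs \<partial>cs \<partial>I1)"
  proof (rule nn_integral_mono_AE)
    show "AE z in I1. ennreal \<bar>\<integral>x. f (x, z) * g (x, z) * h (x, z) \<partial>I1\<bar> \<le>
       (\<integral>\<^sup>+j. \<integral>\<^sup>+l. ennreal (q (j + l)) * (ennreal (norm (hf g j z)) * ennreal (norm (hf h l z))) \<partial>cs \<partial>cs)"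
      using q' O2_sections(1)[OF f1] hf_summable[OF g g2 gs] hf_summable[OF h h2 hs]
    proof eventually_elim
      case (elim z)
      have f: "integrable I1 (\<lambda>x. complex_of_real (f (x, z)))" using elim(2) by simp
      have "ennreal (norm (\<integral>x. complex_of_real (f (x, z)) * complex_of_real (g (x, z)) * complex_of_real (h (x, z)) \<partial>I1)) \<le>
        (\<integral>\<^sup>+j. \<integral>\<^sup>+l. ennreal (norm (hf f (- (j + l)) z)) * ennreal (norm (hf g j z)) * ennreal (norm (hf h l z)) \<partial>cs \<partial>cs)"
        unfolding hf_def by (rule fourier_trilinear[OF f]) (use elim in auto)
      also have "(\<integral>x. complex_of_real (f (x, z)) * complex_of_real (g (x, z)) * complex_of_real (h (x, z)) \<partial>I1) =
          complex_of_real (\<integral>x. f (x, z) * g (x, z) * h (x, z) \<partial>I1)"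
        by (simp flip: of_real_mult)
      also have "(\<integral>\<^sup>+j. \<integral>\<^sup>+l. ennreal (norm (hf f (- (j + l)) z)) * ennreal (norm (hf g j z)) * ennreal (norm (hf h l z)) \<partial>cs \<partial>cs) \<le>
          (\<integral>\<^sup>+j. \<integral>\<^sup>+l. ennreal (q (j + l)) * (ennreal (norm (hf g j z)) * ennreal (norm (hf h l z))) \<partial>cs \<partial>cs)"
        unfolding mult.assoc
      proof (intro nn_integral_mono mult_right_mono ennreal_leI)
        fix j l
        show "norm (hf f (- (j + l)) z) \<le> q (j + l)" using elim(1) q(3)[of "j + l"] by metis
      qed auto
      finally show ?case by simp
    qed
  qed
  also have "\<dots> = (\<integral>\<^sup>+j. \<integral>\<^sup>+z. \<integral>\<^sup>+l. ennreal (q (j + l)) * (ennreal (norm (hf g j z)) * ennreal (norm (hf h l z))) \<partial>cs \<partial>I1 \<partial>cs)"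
  proof (rule nn_integral_count_space_nn_integral)
    fix j
    have "(\<lambda>(l, z). ennreal (q (j + l)) * (ennreal (norm (hf g j z)) * ennreal (norm (hf h l z)))) \<in> borel_measurable (cs \<Otimes>\<^sub>M I1)"
      by (intro measurable_pair_measure_countable1) auto
    then have "(\<lambda>(z, l). ennreal (q (j + l)) * (ennreal (norm (hf g j z)) * ennreal (norm (hf h l z)))) \<in> borel_measurable (I1 \<Otimes>\<^sub>M cs)"
      using measurable_pair_swap[of "\<lambda>(l, z). ennreal (q (j + l)) * (ennreal (norm (hf g j z)) * ennreal (norm (hf h l z)))" cs I1 borel]
      by (simp add: case_prod_unfold)
    then show "(\<lambda>z. \<integral>\<^sup>+l. ennreal (q (j + l)) * (ennreal (norm (hf g j z)) * ennreal (norm (hf h l z))) \<partial>cs) \<in> borel_measurable I1"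
      by (rule sigma_finite_measure.borel_measurable_nn_integral[OF sigma_finite_cs])
  qed auto
  also have "\<dots> = (\<integral>\<^sup>+j. \<integral>\<^sup>+l. \<integral>\<^sup>+z. ennreal (q (j + l)) * (ennreal (norm (hf g j z)) * ennreal (norm (hf h l z))) \<partial>I1 \<partial>cs \<partial>cs)"
    by (intro nn_integral_cong nn_integral_count_space_nn_integral) auto
  also have "\<dots> = (\<integral>\<^sup>+j. \<integral>\<^sup>+l. ennreal (q (j + l)) * (\<integral>\<^sup>+z. ennreal (norm (hf g j z)) * ennreal (norm (hf h l z)) \<partial>I1) \<partial>cs \<partial>cs)"
    by (intro nn_integral_cong nn_integral_cmult) auto
  also have "\<dots> \<le> (\<integral>\<^sup>+j. \<integral>\<^sup>+l. ennreal (q (j + l)) * (ennreal (nz g j) * ennreal (nz h l)) \<partial>cs \<partial>cs)"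
    by (intro nn_integral_mono mult_left_mono nn_norm_hf_mult_le_nz g2 h2 g h) auto
  finally show ?thesis by (simp add: mult.assoc)
qed

section \<open>One-dimensional calculus for primitives and modes\<close>

lemma cauchy_schwarz_real:
  fixes f g :: "'a \<Rightarrow> real"
  assumes [measurable]: "f \<in> borel_measurable M" "g \<in> borel_measurable M"
    and f2: "integrable M (\<lambda>x. (f x)\<^sup>2)" and g2: "integrable M (\<lambda>x. (g x)\<^sup>2)"
  shows "integrable M (\<lambda>x. f x * g x)" "(\<integral>x. \<bar>f x * g x\<bar> \<partial>M) \<le> sqrt (\<integral>x. (f x)\<^sup>2 \<partial>M) * sqrt (\<integral>x. (g x)\<^sup>2 \<partial>M)"
proof -
  let ?B = "sqrt (\<integral>x. (f x)\<^sup>2 \<partial>M) * sqrt (\<integral>x. (g x)\<^sup>2 \<partial>M)"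
  have "(\<integral>\<^sup>+x. ennreal \<bar>f x\<bar> * ennreal \<bar>g x\<bar> \<partial>M) \<le> ennreal ?B"
  proof (rule ennreal_power2_le_imp_le)
    have "(\<integral>\<^sup>+x. ennreal \<bar>f x\<bar> * ennreal \<bar>g x\<bar> \<partial>M)\<^sup>2 \<le> (\<integral>\<^sup>+x. (ennreal \<bar>f x\<bar>)\<^sup>2 \<partial>M) * (\<integral>\<^sup>+x. (ennreal \<bar>g x\<bar>)\<^sup>2 \<partial>M)"
      by (rule Cauchy_Schwarz_nn_integral) auto
    also have "\<dots> = ennreal (\<integral>x. (f x)\<^sup>2 \<partial>M) * ennreal (\<integral>x. (g x)\<^sup>2 \<partial>M)"
      using f2 g2 by (simp add: ennreal_power nn_integral_eq_integral)
    also have "\<dots> = (ennreal ?B)\<^sup>2" by (simp add: ennreal_power power_mult_distrib ennreal_mult)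
    finally show "(\<integral>\<^sup>+x. ennreal \<bar>f x\<bar> * ennreal \<bar>g x\<bar> \<partial>M)\<^sup>2 \<le> (ennreal ?B)\<^sup>2" .
  qed simp
  then have b: "(\<integral>\<^sup>+x. ennreal \<bar>f x * g x\<bar> \<partial>M) \<le> ennreal ?B" by (simp add: abs_mult ennreal_mult)
  have "(\<integral>\<^sup>+x. ennreal (norm (f x * g x)) \<partial>M) < \<infinity>" unfolding real_norm_def by (rule le_less_trans[OF b]) simp
  then show i: "integrable M (\<lambda>x. f x * g x)" by (intro integrableI_bounded) auto
  have "ennreal (\<integral>x. \<bar>f x * g x\<bar> \<partial>M) = (\<integral>\<^sup>+x. ennreal \<bar>f x * g x\<bar> \<partial>M)"
    using i by (intro nn_integral_eq_integral[symmetric]) auto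
  then have "ennreal (\<integral>x. \<bar>f x * g x\<bar> \<partial>M) \<le> ennreal ?B" using b by (simp only:)
  then show "(\<integral>x. \<bar>f x * g x\<bar> \<partial>M) \<le> ?B" by (subst (asm) ennreal_le_iff) auto
qed

text \<open>The product rule twice, for the square of the second primitive and for its product with
  the first. It is the integration by parts behind the cancellation of transport.\<close>

lemma prim_triple:
  assumes f: "integrable (leb_on a b) f" and g: "integrable (leb_on a b) g" and ab: "a \<le> b"
  shows "(c + (\<integral>x. f x \<partial>leb_on a b)) * (d + (\<integral>x. g x \<partial>leb_on a b))\<^sup>2 - c * d\<^sup>2 =
    (\<integral>x. f x * (d + prim a b g x)\<^sup>2 + 2 * ((c + prim a b f x) * (d + prim a b g x) * g x) \<partial>leb_on a b)"
proof -
  note [measurable] = borel_measurable_integrable[OF f, simplified] borel_measurable_integrable[OF g, simplified]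
  define h where "h = (\<lambda>\<sigma>. g \<sigma> * (d + prim a b g \<sigma>) + (d + prim a b g \<sigma>) * g \<sigma>)"
  have h: "integrable (leb_on a b) h" unfolding h_def by (rule prim_product(2)[OF g g])
  have [measurable]: "h \<in> Borel" unfolding h_def by measurable
  have G2: "(d + prim a b g s)\<^sup>2 = d\<^sup>2 + prim a b h s" for s
    unfolding h_def power2_eq_square by (rule prim_product(1)[OF g g])
  have "(c + prim a b f b) * (d\<^sup>2 + prim a b h b) = c * d\<^sup>2 + prim a b (\<lambda>\<sigma>. f \<sigma> * (d\<^sup>2 + prim a b h \<sigma>) + (c + prim a b f \<sigma>) * h \<sigma>) b"
    by (rule prim_product(1)[OF f h])
  also have "prim a b (\<lambda>\<sigma>. f \<sigma> * (d\<^sup>2 + prim a b h \<sigma>) + (c + prim a b f \<sigma>) * h \<sigma>) b =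
      (\<integral>x. f x * (d\<^sup>2 + prim a b h x) + (c + prim a b f x) * h x \<partial>leb_on a b)"
    by (rule prim_upper) auto
  also have "\<dots> = (\<integral>x. f x * (d + prim a b g x)\<^sup>2 + 2 * ((c + prim a b f x) * (d + prim a b g x) * g x) \<partial>leb_on a b)"
    unfolding G2 h_def by (intro Bochner_Integration.integral_cong refl) (simp add: algebra_simps)
  finally show ?thesis unfolding G2[symmetric] by (simp add: prim_upper)
qed

lemma prim_FTC:
  assumes "\<And>x. (F has_real_derivative f x) (at x)" "continuous_on UNIV f" "x \<in> {a..b}"
  shows "prim a b f x = F x - F a"
proof -
  note [measurable] = borel_measurable_continuous_onI[OF assms(2)]
  have "(\<integral>y. f y * indicator {a..x} y \<partial>lborel) = F x - F a"
    using assms by (intro integral_FTC_Icc_real) (auto simp: continuous_on_eq_continuous_at)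
  then show ?thesis using assms(3) by (simp add: prim_eq set_lebesgue_integral_def mult.commute)
qed

lemma trig_prim:
  assumes "x \<in> {0..1}"
  shows "cos (w * x) = 1 + prim 0 1 (\<lambda>x. - (w * sin (w * x))) x" "sin (w * x) = prim 0 1 (\<lambda>x. w * cos (w * x)) x"
proof -
  have "prim 0 1 (\<lambda>x. - (w * sin (w * x))) x = cos (w * x) - cos (w * 0)"
    by (rule prim_FTC[OF _ _ assms]) (auto intro!: derivative_eq_intros continuous_intros)
  then show "cos (w * x) = 1 + prim 0 1 (\<lambda>x. - (w * sin (w * x))) x" by simp
  have "prim 0 1 (\<lambda>x. w * cos (w * x)) x = sin (w * x) - sin (w * 0)"
    by (rule prim_FTC[OF _ _ assms]) (auto intro!: derivative_eq_intros continuous_intros)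
  then show "sin (w * x) = prim 0 1 (\<lambda>x. w * cos (w * x)) x" by simp
qed

text \<open>Integration by parts against cosine and sine separately, because \<open>prim\<close> is
  real valued. Mean zero of \<open>f\<close> gives its primitive equal values at 0 and 1, so no
  boundary term appears.\<close>

lemma fc_deriv:
  assumes f: "integrable I1 f" and 0: "(\<integral>x. f x \<partial>I1) = 0"
    and F: "AE x in I1. F x = c + prim 0 1 f x" and [measurable]: "F \<in> Borel"
  shows "fc (\<lambda>x. complex_of_real (f x)) k = 2 * pi * \<i> * of_int k * fc (\<lambda>x. complex_of_real (F x)) k"
proof -
  note [measurable] = borel_measurable_integrable[OF f, simplified]
  define w where "w = 2 * pi * real_of_int k"
  have m [measurable]: "(\<lambda>x. sin (w * x)) \<in> Borel" "(\<lambda>x. cos (w * x)) \<in> Borel"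
    by (intro borel_measurable_continuous_onI continuous_intros)+
  have bF: "AE x in I1. norm (F x) \<le> \<bar>c\<bar> + (\<integral>\<sigma>. \<bar>f \<sigma>\<bar> \<partial>I1)"
    using F by eventually_elim (use prim_bound[OF f] in \<open>auto intro!: order_trans[OF abs_triangle_ineq] add_left_mono\<close>)
  have iF: "integrable I1 F" by (rule integrable_bounded_AE[OF leb_on.finite_measure_axioms _ bF]) simp
  have trig: "integrable I1 (\<lambda>x. h x * sin (w * x))" "integrable I1 (\<lambda>x. h x * cos (w * x))" if "integrable I1 h" for h :: "real \<Rightarrow> real"
    by (rule integrable_mult_bounded_AE(1)[OF that, of _ 1]; simp)+
  have ip: "integrable I1 (\<lambda>x. - (w * sin (w * x)))" "integrable I1 (\<lambda>x. w * cos (w * x))"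
    using trig[of "\<lambda>_. 1"] by auto
  have c1: "cos w = 1" "sin w = 0" unfolding w_def by (simp_all add: cos_int_2pin sin_int_2pin)
  have P1: "prim 0 1 f 1 = 0" using 0 by (simp add: prim_upper)
  have P2: "prim 0 1 (\<lambda>x. - (w * sin (w * x))) 1 = 0" and P3: "prim 0 1 (\<lambda>x. w * cos (w * x)) 1 = 0"
    using trig_prim[of 1 w] c1 by simp_all
  have "(c + prim 0 1 f 1) * (1 + prim 0 1 (\<lambda>x. - (w * sin (w * x))) 1) =
     c * 1 + prim 0 1 (\<lambda>x. f x * (1 + prim 0 1 (\<lambda>x. - (w * sin (w * x))) x) + (c + prim 0 1 f x) * (- (w * sin (w * x)))) 1"
    by (rule prim_product(1)[OF f ip(1)])
  then have "0 = prim 0 1 (\<lambda>x. f x * (1 + prim 0 1 (\<lambda>x. - (w * sin (w * x))) x) + (c + prim 0 1 f x) * (- (w * sin (w * x)))) 1"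
    using P1 P2 by simp
  also have "\<dots> = (\<integral>x. f x * (1 + prim 0 1 (\<lambda>x. - (w * sin (w * x))) x) + (c + prim 0 1 f x) * (- (w * sin (w * x))) \<partial>I1)"
    by (rule prim_upper) auto
  also have "\<dots> = (\<integral>x. f x * cos (w * x) - w * (F x * sin (w * x)) \<partial>I1)"
  proof (rule integral_cong_AE)
    have "AE x in I1. cos (w * x) = 1 + prim 0 1 (\<lambda>x. - (w * sin (w * x))) x" unfolding AE_leb_on by (intro AE_I2 impI trig_prim(1))
    then show "AE x in I1. f x * (1 + prim 0 1 (\<lambda>x. - (w * sin (w * x))) x) + (c + prim 0 1 f x) * - (w * sin (w * x)) = f x * cos (w * x) - w * (F x * sin (w * x))"
      using F by eventually_elim (simp add: algebra_simps)
  qed auto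
  finally have A: "(\<integral>x. f x * cos (w * x) \<partial>I1) = w * (\<integral>x. F x * sin (w * x) \<partial>I1)"
    using trig[OF f] trig[OF iF] by simp
  have "(c + prim 0 1 f 1) * (0 + prim 0 1 (\<lambda>x. w * cos (w * x)) 1) =
     c * 0 + prim 0 1 (\<lambda>x. f x * (0 + prim 0 1 (\<lambda>x. w * cos (w * x)) x) + (c + prim 0 1 f x) * (w * cos (w * x))) 1"
    by (rule prim_product(1)[OF f ip(2)])
  then have "0 = prim 0 1 (\<lambda>x. f x * (0 + prim 0 1 (\<lambda>x. w * cos (w * x)) x) + (c + prim 0 1 f x) * (w * cos (w * x))) 1"
    using P1 P3 by simp
  also have "\<dots> = (\<integral>x. f x * (0 + prim 0 1 (\<lambda>x. w * cos (w * x)) x) + (c + prim 0 1 f x) * (w * cos (w * x)) \<partial>I1)"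
    by (rule prim_upper) auto
  also have "\<dots> = (\<integral>x. f x * sin (w * x) + w * (F x * cos (w * x)) \<partial>I1)"
  proof (rule integral_cong_AE)
    have "AE x in I1. sin (w * x) = prim 0 1 (\<lambda>x. w * cos (w * x)) x" unfolding AE_leb_on by (intro AE_I2 impI trig_prim(2))
    then show "AE x in I1. f x * (0 + prim 0 1 (\<lambda>x. w * cos (w * x)) x) + (c + prim 0 1 f x) * (w * cos (w * x)) = f x * sin (w * x) + w * (F x * cos (w * x))"
      using F by eventually_elim (simp add: algebra_simps)
  qed auto
  finally have B: "(\<integral>x. f x * sin (w * x) \<partial>I1) = - (w * (\<integral>x. F x * cos (w * x) \<partial>I1))"
    using trig[OF f] trig[OF iF] by simp
  have fcr: "fc (\<lambda>x. complex_of_real (h x)) k = complex_of_real (\<integral>x. h x * cos (w * x) \<partial>I1) - \<i> * complex_of_real (\<integral>x. h x * sin (w * x) \<partial>I1)"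
    if "integrable I1 h" for h
  proof -
    have "complex_of_real (h x) * chr (- k) x = complex_of_real (h x * cos (w * x)) - \<i> * complex_of_real (h x * sin (w * x))" for x
      by (simp add: chr_def w_def complex_eq_iff)
    then have "fc (\<lambda>x. complex_of_real (h x)) k = (\<integral>x. complex_of_real (h x * cos (w * x)) - \<i> * complex_of_real (h x * sin (w * x)) \<partial>I1)"
      unfolding fc_def by simp
    also have "\<dots> = (\<integral>x. complex_of_real (h x * cos (w * x)) \<partial>I1) - \<i> * (\<integral>x. complex_of_real (h x * sin (w * x)) \<partial>I1)"
      using trig[OF that] by (subst Bochner_Integration.integral_diff) (auto simp del: of_real_mult)
    finally show ?thesis by (simp only: integral_complex_of_real)
  qed
  show ?thesis unfolding fcr[OF f] fcr[OF iF] A B by (simp add: w_def algebra_simps complex_eq_iff)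
qed

text \<open>The primitive acts in \<open>z\<close> and the transform in \<open>x\<close>, so Fubini
  exchanges them.\<close>

lemma hf_prim:
  assumes f [measurable]: "f \<in> Borel" and f1: "integrable O2 f"
  shows "hf (\<lambda>p. prim 0 1 (\<lambda>\<zeta>. f (fst p, \<zeta>)) (snd p)) k z = (\<integral>\<zeta>. hf f k \<zeta> * complex_of_real (indicator {..z} \<zeta>) \<partial>I1)"
proof -
  have ind: "(\<lambda>p. complex_of_real (indicator {..z} (snd p)) * chr (- k) (fst p)) \<in> borel_measurable O2"
    by (simp del: borel_measurable_leb_eq)
  have i: "integrable O2 (\<lambda>p. complex_of_real (f p) * (complex_of_real (indicator {..z} (snd p)) * chr (- k) (fst p)))"
    by (rule integrable_mult_bounded_AE(1)[of _ _ _ 1]) (use f1 ind in \<open>auto simp: norm_mult indicator_def simp del: borel_measurable_leb_eq\<close>)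
  have i': "integrable O2 (\<lambda>(x, \<zeta>). complex_of_real (f (x, \<zeta>)) * (complex_of_real (indicator {..z} \<zeta>) * chr (- k) x))"
    using i by (simp add: case_prod_unfold)
  have "hf (\<lambda>p. prim 0 1 (\<lambda>\<zeta>. f (fst p, \<zeta>)) (snd p)) k z =
      (\<integral>x. (\<integral>\<zeta>. complex_of_real (f (x, \<zeta>)) * (complex_of_real (indicator {..z} \<zeta>) * chr (- k) x) \<partial>I1) \<partial>I1)"
    unfolding hf_def fc_def prim_def
  proof (intro Bochner_Integration.integral_cong refl)
    fix x
    have "complex_of_real (\<integral>\<sigma>. f (fst (x, z), \<sigma>) * indicator {..snd (x, z)} \<sigma> \<partial>I1) * chr (- k) x =
      (\<integral>\<sigma>. complex_of_real (f (x, \<sigma>) * indicator {..z} \<sigma>) \<partial>I1) * chr (- k) x" by (simp only: integral_complex_of_real fst_conv snd_conv)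
    also have "\<dots> = (\<integral>\<sigma>. complex_of_real (f (x, \<sigma>) * indicator {..z} \<sigma>) * chr (- k) x \<partial>I1)" by (simp only: integral_mult_left_zero)
    finally show "complex_of_real (\<integral>\<sigma>. f (fst (x, z), \<sigma>) * indicator {..snd (x, z)} \<sigma> \<partial>I1) * chr (- k) x =
      (\<integral>\<sigma>. complex_of_real (f (x, \<sigma>)) * (complex_of_real (indicator {..z} \<sigma>) * chr (- k) x) \<partial>I1)" by (simp add: mult.assoc)
  qed
  also have "\<dots> = (\<integral>\<zeta>. (\<integral>x. complex_of_real (f (x, \<zeta>)) * (complex_of_real (indicator {..z} \<zeta>) * chr (- k) x) \<partial>I1) \<partial>I1)"
    by (rule leb_pair.Fubini_integral[OF i', symmetric])
  also have "\<dots> = (\<integral>\<zeta>. hf f k \<zeta> * complex_of_real (indicator {..z} \<zeta>) \<partial>I1)"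
  proof (intro Bochner_Integration.integral_cong refl)
    fix \<zeta>
    have "hf f k \<zeta> * complex_of_real (indicator {..z} \<zeta>) = (\<integral>x. complex_of_real (f (x, \<zeta>)) * chr (- k) x * complex_of_real (indicator {..z} \<zeta>) \<partial>I1)"
      unfolding hf_def fc_def by (simp only: integral_mult_left_zero)
    then show "(\<integral>x. complex_of_real (f (x, \<zeta>)) * (complex_of_real (indicator {..z} \<zeta>) * chr (- k) x) \<partial>I1) = hf f k \<zeta> * complex_of_real (indicator {..z} \<zeta>)"
      by (simp only: mult_ac)
  qed
  finally show ?thesis .
qed

lemma prim_diff_le:
  assumes "integrable (leb_on a b) g" shows "prim a b g s - prim a b g r \<le> (\<integral>x. \<bar>g x\<bar> \<partial>leb_on a b)"
proof -
  have "prim a b g s - prim a b g r = (\<integral>x. g x * indicator {..s} x - g x * indicator {..r} x \<partial>leb_on a b)"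
    unfolding prim_def using integrable_ind[OF assms] by simp
  also have "\<dots> \<le> (\<integral>x. \<bar>g x\<bar> \<partial>leb_on a b)"
    using integrable_ind[OF assms] assms by (intro integral_mono) (auto simp: indicator_def)
  finally show ?thesis .
qed

text \<open>The one-dimensional Agmon inequality: the squared modulus is a constant plus the
  primitive of twice the real part of \<open>H\<close> times the conjugate of \<open>\<phi>\<close>.
  Real and imaginary parts are squared separately because \<open>prim\<close> is real
  valued.\<close>

lemma sup_bound_complex:
  assumes [measurable]: "H \<in> Borel" "\<phi> \<in> Borel"
    and H2: "integrable I1 (\<lambda>z. (norm (H z))\<^sup>2)" and \<phi>2: "integrable I1 (\<lambda>z. (norm (\<phi> z))\<^sup>2)"
    and H: "AE z in I1. H z = c + (\<integral>\<zeta>. \<phi> \<zeta> * complex_of_real (indicator {..z} \<zeta>) \<partial>I1)"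
  shows "AE z in I1. (norm (H z))\<^sup>2 \<le> (\<integral>z. (norm (H z))\<^sup>2 \<partial>I1) + 2 * (sqrt (\<integral>z. (norm (H z))\<^sup>2 \<partial>I1) * sqrt (\<integral>z. (norm (\<phi> z))\<^sup>2 \<partial>I1))"
proof -
  let ?r = "\<lambda>z. Re (\<phi> z)" and ?i = "\<lambda>z. Im (\<phi> z)"
  have "integrable I1 (\<lambda>z. norm (\<phi> z))"
    by (rule square_integrable_imp_integrable'[OF leb_on.finite_measure_axioms _ \<phi>2]) simp
  then have \<phi>1: "integrable I1 \<phi>" by (simp add: integrable_norm_iff)
  have r: "integrable I1 ?r" and i: "integrable I1 ?i" using \<phi>1 by auto
  define h1 where "h1 = (\<lambda>z. Re c + prim 0 1 ?r z)"
  define h2 where "h2 = (\<lambda>z. Im c + prim 0 1 ?i z)"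
  have [measurable]: "h1 \<in> Borel" "h2 \<in> Borel" unfolding h1_def h2_def by measurable
  have \<phi>ind: "integrable I1 (\<lambda>\<zeta>. \<phi> \<zeta> * complex_of_real (indicator {..z} \<zeta>))" for z
    by (rule integrable_mult_bounded_AE(1)[OF \<phi>1, of _ 1]) (auto simp: indicator_def)
  have Hh: "AE z in I1. Re (H z) = h1 z \<and> Im (H z) = h2 z"
    using H
  proof eventually_elim
    case (elim z)
    have "Re (H z) = Re c + (\<integral>\<zeta>. Re (\<phi> \<zeta> * complex_of_real (indicator {..z} \<zeta>)) \<partial>I1)" unfolding elim using integral_Re[OF \<phi>ind] by simp
    moreover have "Im (H z) = Im c + (\<integral>\<zeta>. Im (\<phi> \<zeta> * complex_of_real (indicator {..z} \<zeta>)) \<partial>I1)" unfolding elim using integral_Im[OF \<phi>ind] by simp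
    ultimately show ?case by (simp add: h1_def h2_def prim_def)
  qed
  define G1 where "G1 = (\<lambda>\<sigma>. ?r \<sigma> * h1 \<sigma> + h1 \<sigma> * ?r \<sigma>)"
  define G2 where "G2 = (\<lambda>\<sigma>. ?i \<sigma> * h2 \<sigma> + h2 \<sigma> * ?i \<sigma>)"
  have G1: "integrable I1 G1" unfolding G1_def h1_def by (rule prim_product(2)[OF r r])
  have G2: "integrable I1 G2" unfolding G2_def h2_def by (rule prim_product(2)[OF i i])
  define G where "G = (\<lambda>\<sigma>. G1 \<sigma> + G2 \<sigma>)"
  have G: "integrable I1 G" unfolding G_def using G1 G2 by simp
  have sq: "h1 z * h1 z + h2 z * h2 z = (Re c * Re c + Im c * Im c) + prim 0 1 G z" for z
    using prim_product(1)[OF r r, of "Re c" z "Re c"] prim_product(1)[OF i i, of "Im c" z "Im c"] prim_add[OF G1 G2, of z]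
    unfolding G_def G1_def G2_def h1_def h2_def by simp
  define B where "B = sqrt (\<integral>z. (norm (H z))\<^sup>2 \<partial>I1) * sqrt (\<integral>z. (norm (\<phi> z))\<^sup>2 \<partial>I1)"
  have GB: "(\<integral>x. \<bar>G x\<bar> \<partial>I1) \<le> 2 * B"
  proof -
    have cs: "integrable I1 (\<lambda>z. norm (H z) * norm (\<phi> z))" "(\<integral>z. \<bar>norm (H z) * norm (\<phi> z)\<bar> \<partial>I1) \<le> B"
      unfolding B_def by (rule cauchy_schwarz_real; use H2 \<phi>2 in simp)+
    have "(\<integral>x. \<bar>G x\<bar> \<partial>I1) \<le> (\<integral>z. 2 * \<bar>norm (H z) * norm (\<phi> z)\<bar> \<partial>I1)"
    proof (rule integral_mono_AE)
      show "AE z in I1. \<bar>G z\<bar> \<le> 2 * \<bar>norm (H z) * norm (\<phi> z)\<bar>"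
        using Hh
      proof eventually_elim
        case (elim z)
        have "G z = 2 * Re (H z * cnj (\<phi> z))" using elim by (simp add: G_def G1_def G2_def algebra_simps)
        then have "\<bar>G z\<bar> = 2 * \<bar>Re (H z * cnj (\<phi> z))\<bar>" by (simp add: abs_mult del: times_complex.simps)
        also have "\<dots> \<le> 2 * norm (H z * cnj (\<phi> z))" using abs_Re_le_cmod[of "H z * cnj (\<phi> z)"] by (simp del: times_complex.simps)
        finally show ?case by (simp add: norm_mult)
      qed
    qed (use G cs in auto)
    also have "\<dots> \<le> 2 * B" using cs(2) by simp
    finally show ?thesis .
  qed
  define P where "P = (\<lambda>z. (Re c * Re c + Im c * Im c) + prim 0 1 G z)"
  have PH: "AE z in I1. (norm (H z))\<^sup>2 = P z"
    using Hh by eventually_elim (simp only: cmod_power2, simp add: P_def power2_eq_square sq)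
  note [measurable] = borel_measurable_integrable[OF G, simplified]
  have [measurable]: "P \<in> Borel" unfolding P_def by measurable
  have iP: "integrable I1 P" and eP: "(\<integral>z. P z \<partial>I1) = (\<integral>z. (norm (H z))\<^sup>2 \<partial>I1)"
    using PH H2 integrable_cong_AE[of "\<lambda>z. (norm (H z))\<^sup>2" I1 P] integral_cong_AE[of "\<lambda>z. (norm (H z))\<^sup>2" I1 P] by auto
  have "P z \<le> (\<integral>z. (norm (H z))\<^sup>2 \<partial>I1) + 2 * B" for z
  proof -
    \<comment> \<open>The constant of integration is unknown. Comparing with the value at
      \<open>r\<close> and averaging over \<open>r\<close> replaces it by the mean.\<close>
    have "P z = (\<integral>r. P z \<partial>I1)" by simp
    also have "\<dots> \<le> (\<integral>r. P r + 2 * B \<partial>I1)"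
    proof (rule integral_mono)
      show "P z \<le> P r + 2 * B" for r using prim_diff_le[OF G, of z r] GB unfolding P_def by linarith
    qed (use iP in auto)
    also have "\<dots> = (\<integral>z. (norm (H z))\<^sup>2 \<partial>I1) + 2 * B" using iP eP by simp
    finally show ?thesis .
  qed
  then show ?thesis using PH unfolding B_def by (auto elim!: eventually_mono)
qed

subsection \<open>The energy estimate at a fixed time\<close>

text \<open>The data of a solution at one time: horizontal derivative, vertical derivative, vertical
  velocity and fractional Laplacian. Derivatives are encoded by primitives on almost every line, the
  form in which the product rule applies. Mean zero of \<open>ux\<close> in \<open>x\<close> encodes
  periodicity; mean zero in \<open>z\<close> encodes that \<open>w\<close> vanishes at the upper
  boundary.\<close>

definition slice :: "real \<Rightarrow> real \<Rightarrow> (real \<times> real \<Rightarrow> real) \<Rightarrow> (real \<times> real \<Rightarrow> real) \<Rightarrow> (real \<times> real \<Rightarrow> real) \<Rightarrow>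
    (real \<times> real \<Rightarrow> real) \<Rightarrow> (real \<times> real \<Rightarrow> real) \<Rightarrow> bool" where
  "slice \<alpha> C u ux om w g \<longleftrightarrow>
    u \<in> Borel \<and> ux \<in> Borel \<and> om \<in> Borel \<and>
    w \<in> Borel \<and> g \<in> Borel \<and>
    (AE p in O2. \<bar>u p\<bar> \<le> C) \<and> (AE p in O2. \<bar>om p\<bar> \<le> C) \<and>
    integrable O2 (\<lambda>p. (ux p)\<^sup>2) \<and> integrable O2 (\<lambda>p. (g p)\<^sup>2) \<and>
    (AE z in I1. (\<integral>x. ux (x, z) \<partial>I1) = 0 \<and> (\<exists>c. AE x in I1. u (x, z) = c + prim 0 1 (\<lambda>\<xi>. ux (\<xi>, z)) x)) \<and>
    (AE x in I1. \<exists>c. AE z in I1. u (x, z) = c + prim 0 1 (\<lambda>\<zeta>. om (x, \<zeta>)) z) \<and>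
    (AE x in I1. (\<integral>z. ux (x, z) \<partial>I1) = 0 \<and> (AE z in I1. w (x, z) = - prim 0 1 (\<lambda>\<zeta>. ux (x, \<zeta>)) z)) \<and>
    (\<forall>k. AE z in I1. hf g k z = complex_of_real (\<bar>2 * pi * of_int k\<bar> powr \<alpha>) * hf u k z)"

lemma finite_O2: "finite_measure O2" by (rule finite_measure_leb2)

lemma integrable_O2_bounded:
  fixes f :: "real \<times> real \<Rightarrow> real"
  assumes "f \<in> Borel" "AE p in O2. \<bar>f p\<bar> \<le> C" shows "integrable O2 f" "integrable O2 (\<lambda>p. (f p)\<^sup>2)"
proof -
  show "integrable O2 f" by (rule integrable_bounded_AE[OF finite_O2, of _ C]) (use assms in auto)
  have "AE p in O2. norm ((f p)\<^sup>2) \<le> C\<^sup>2"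
    using assms(2) by eventually_elim (metis abs_power2 power2_abs power_mono abs_ge_zero real_norm_def)
  then show "integrable O2 (\<lambda>p. (f p)\<^sup>2)" by (rule integrable_bounded_AE[OF finite_O2, rotated]) (use assms in auto)
qed

lemma integrable_O2_mult:
  fixes f g :: "real \<times> real \<Rightarrow> real"
  assumes "integrable O2 f" "g \<in> Borel" "AE p in O2. \<bar>g p\<bar> \<le> C"
  shows "integrable O2 (\<lambda>p. f p * g p)"
  by (rule integrable_mult_bounded_AE(1)[OF assms(1), of _ C]) (use assms in auto)

lemma AE_O2_swapI:
  assumes "AE x in I1. AE z in I1. P (x, z)" "{p. P p} \<in> sets borel"
  shows "AE p in O2. P p"
proof (rule leb_pair.AE_pair_measure)
  show "{x \<in> space O2. P x} \<in> sets O2" unfolding sets_leb2 space_pair_measure using assms(2) by simp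
qed (fact assms(1))

lemma prim_section_measurable:
  fixes f :: "real \<times> real \<Rightarrow> real"
  assumes [measurable]: "f \<in> Borel"
  shows "(\<lambda>p. prim 0 1 (\<lambda>\<zeta>. f (fst p, \<zeta>)) (snd p)) \<in> Borel"
proof -
  have "(\<lambda>p. f (fst (snd p), fst p)) \<in> borel_measurable (borel \<Otimes>\<^sub>M (I1 \<Otimes>\<^sub>M I1))"
    by (intro measurable_compose[OF _ assms] borel_measurable_Pair) (simp_all del: borel_measurable_leb_eq)
  then have "(\<lambda>p. prim 0 1 (\<lambda>\<zeta>. f (fst p, \<zeta>)) (snd p)) \<in> borel_measurable O2"
    by (intro prim_measurable) (simp_all add: case_prod_unfold del: borel_measurable_leb_eq)
  then show ?thesis by simp
qed

context
  fixes \<alpha> C :: real and u ux om w g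
  assumes slice: "slice \<alpha> C u ux om w g"
begin

lemma sl_meas: "u \<in> Borel" "ux \<in> Borel" "om \<in> Borel"
    "w \<in> Borel" "g \<in> Borel"
  and sl_bd: "AE p in O2. \<bar>u p\<bar> \<le> C" "AE p in O2. \<bar>om p\<bar> \<le> C"
  and sl_sq: "integrable O2 (\<lambda>p. (ux p)\<^sup>2)" "integrable O2 (\<lambda>p. (g p)\<^sup>2)"
  and sl_x: "AE z in I1. (\<integral>x. ux (x, z) \<partial>I1) = 0 \<and> (\<exists>c. AE x in I1. u (x, z) = c + prim 0 1 (\<lambda>\<xi>. ux (\<xi>, z)) x)"
  and sl_z: "AE x in I1. \<exists>c. AE z in I1. u (x, z) = c + prim 0 1 (\<lambda>\<zeta>. om (x, \<zeta>)) z"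
  and sl_w: "AE x in I1. (\<integral>z. ux (x, z) \<partial>I1) = 0 \<and> (AE z in I1. w (x, z) = - prim 0 1 (\<lambda>\<zeta>. ux (x, \<zeta>)) z)"
  and sl_g: "AE z in I1. hf g k z = complex_of_real (\<bar>2 * pi * of_int k\<bar> powr \<alpha>) * hf u k z"
  using slice unfolding slice_def by blast+

lemma sl_int: "integrable O2 u" "integrable O2 (\<lambda>p. (u p)\<^sup>2)" "integrable O2 om" "integrable O2 (\<lambda>p. (om p)\<^sup>2)"
    "integrable O2 ux" "integrable O2 g"
proof -
  show "integrable O2 u" "integrable O2 (\<lambda>p. (u p)\<^sup>2)" by (rule integrable_O2_bounded[OF sl_meas(1) sl_bd(1)])+
  show "integrable O2 om" "integrable O2 (\<lambda>p. (om p)\<^sup>2)" by (rule integrable_O2_bounded[OF sl_meas(3) sl_bd(2)])+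
  show "integrable O2 ux" by (rule square_integrable_imp_integrable'[OF finite_O2 _ sl_sq(1)]) (simp add: sl_meas)
  show "integrable O2 g" by (rule square_integrable_imp_integrable'[OF finite_O2 _ sl_sq(2)]) (simp add: sl_meas)
qed

lemma sl_w_eq: "AE p in O2. w p = - prim 0 1 (\<lambda>\<zeta>. ux (fst p, \<zeta>)) (snd p)"
proof (rule AE_O2_swapI)
  show "AE x in I1. AE z in I1. w (x, z) = - prim 0 1 (\<lambda>\<zeta>. ux (fst (x, z), \<zeta>)) (snd (x, z))"
    using sl_w by eventually_elim simp
  note [measurable] = sl_meas prim_section_measurable[OF sl_meas(2)]
  show "{p. w p = - prim 0 1 (\<lambda>\<zeta>. ux (fst p, \<zeta>)) (snd p)} \<in> sets borel"
    using borel_measurable_eq[of w borel "\<lambda>p. - prim 0 1 (\<lambda>\<zeta>. ux (fst p, \<zeta>)) (snd p)"] by simp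
qed

text \<open>On almost every vertical line \<open>w\<close> is bounded by the integral of the
  absolute value of \<open>ux\<close> over that line.\<close>

lemma sl_w_int: "integrable O2 w" and sl_w_L1: "(\<integral>p. \<bar>w p\<bar> \<partial>O2) \<le> (\<integral>p. \<bar>ux p\<bar> \<partial>O2)"
proof -
  note [measurable] = sl_meas prim_section_measurable[OF sl_meas(2)]
  define K where "K = (\<lambda>x. \<integral>\<zeta>. \<bar>ux (x, \<zeta>)\<bar> \<partial>I1)"
  have K: "integrable I1 K" unfolding K_def using O2_sections(4)[of "\<lambda>p. \<bar>ux p\<bar>"] sl_int(5) by simp
  note [measurable] = borel_measurable_integrable[OF K, simplified]
  have "integrable O2 (\<lambda>(x, z). K x * 1)"
    by (rule integrable_tensor[OF leb_on.sigma_finite_measure_axioms leb_on.sigma_finite_measure_axioms K]) simp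
  then have KO: "integrable O2 (\<lambda>p. K (fst p))" by (simp add: case_prod_unfold)
  have bd: "AE p in O2. norm (w p) \<le> norm (K (fst p))"
  proof (rule AE_O2_swapI)
    show "AE x in I1. AE z in I1. norm (w (x, z)) \<le> norm (K (fst (x, z)))"
      using sl_w O2_sections(2)[OF sl_int(5)]
    proof eventually_elim
      case (elim x)
      have "AE z in I1. w (x, z) = - prim 0 1 (\<lambda>\<zeta>. ux (x, \<zeta>)) z" using elim by simp
      then show ?case
        by eventually_elim (use prim_bound[OF elim(2)] in \<open>auto simp: K_def intro: order_trans[OF _ abs_ge_self]\<close>)
    qed
    note [measurable] = borel_measurable_integrable[OF KO, simplified]
    show "{p. norm (w p) \<le> norm (K (fst p))} \<in> sets borel"
      using borel_measurable_le[of "\<lambda>p. norm (w p)" borel "\<lambda>p. norm (K (fst p))"] by simp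
  qed
  then show w: "integrable O2 w" by (rule Bochner_Integration.integrable_bound[OF KO, rotated]) (simp add: sl_meas)
  have "(\<integral>p. \<bar>w p\<bar> \<partial>O2) \<le> (\<integral>p. K (fst p) \<partial>O2)"
    by (rule integral_mono_AE) (use w KO bd in \<open>auto simp: K_def\<close>)
  also have "\<dots> = (\<integral>p. \<bar>ux p\<bar> \<partial>O2)"
    using O2_sections(6)[OF KO] O2_sections(6)[of "\<lambda>p. \<bar>ux p\<bar>"] sl_int(5) by (simp add: K_def)
  finally show "(\<integral>p. \<bar>w p\<bar> \<partial>O2) \<le> (\<integral>p. \<bar>ux p\<bar> \<partial>O2)" .
qed

lemma sl_hf_ux: "AE z in I1. hf ux k z = 2 * pi * \<i> * of_int k * hf u k z"
  using sl_x O2_sections(1)[OF sl_int(5)]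
proof eventually_elim
  case (elim z)
  then obtain c where "AE x in I1. u (x, z) = c + prim 0 1 (\<lambda>\<xi>. ux (\<xi>, z)) x" by blast
  then show ?case unfolding hf_def using elim by (intro fc_deriv) (auto intro: borel_section(1)[OF sl_meas(1)])
qed

text \<open>\<open>slice\<close> provides an unrelated constant on each vertical line. Recovering it
  as a mean in \<open>z\<close> makes it an integrable function of \<open>x\<close>, whose transform
  can then be taken.\<close>

lemma sl_hf_u_primitive:
  "\<exists>c. AE z in I1. hf u k z = c + (\<integral>\<zeta>. hf om k \<zeta> * complex_of_real (indicator {..z} \<zeta>) \<partial>I1)"
proof -
  note [measurable] = sl_meas prim_section_measurable[OF sl_meas(3)]
  define P where "P = (\<lambda>p. prim 0 1 (\<lambda>\<zeta>. om (fst p, \<zeta>)) (snd p))"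
  define c where "c = (\<lambda>x. \<integral>z. u (x, z) - P (x, z) \<partial>I1)"
  have P [measurable]: "P \<in> Borel" unfolding P_def by (rule prim_section_measurable) (rule sl_meas)
  have Pb: "AE p in O2. \<bar>P p\<bar> \<le> \<bar>C\<bar>"
  proof (rule AE_O2_swapI)
    show "AE x in I1. AE z in I1. \<bar>P (x, z)\<bar> \<le> \<bar>C\<bar>"
      using AE_O2(1)[OF sl_bd(2)] O2_sections(2)[OF sl_int(3)]
    proof eventually_elim
      case (elim x)
      have "\<bar>P (x, z)\<bar> \<le> \<bar>C\<bar>" for z
      proof -
        have "\<bar>P (x, z)\<bar> \<le> (\<integral>\<sigma>. \<bar>om (x, \<sigma>)\<bar> \<partial>I1)" unfolding P_def using prim_bound[OF elim(2), of z] by simp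
        also have "\<dots> \<le> (\<integral>\<sigma>. \<bar>C\<bar> \<partial>I1)" by (rule integral_mono_AE) (use elim in \<open>auto elim!: eventually_mono\<close>)
        finally show ?thesis by simp
      qed
      then show ?case by simp
    qed
    show "{p. \<bar>P p\<bar> \<le> \<bar>C\<bar>} \<in> sets borel" using borel_measurable_le[of "\<lambda>p. \<bar>P p\<bar>" borel "\<lambda>_. \<bar>C\<bar>"] by simp
  qed
  have iP: "integrable O2 P" by (rule integrable_O2_bounded(1)[OF P Pb])
  have ic: "integrable I1 c" unfolding c_def using O2_sections(4)[of "\<lambda>p. u p - P p"] sl_int(1) iP by simp
  note [measurable] = borel_measurable_integrable[OF ic, simplified]
  have cO: "integrable O2 (\<lambda>p. c (fst p))"
    using integrable_tensor[OF leb_on.sigma_finite_measure_axioms leb_on.sigma_finite_measure_axioms ic, of 0 1 "\<lambda>_. 1::real"] by (simp add: case_prod_unfold)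
  note [measurable] = borel_measurable_integrable[OF cO, simplified]
  have "AE p in O2. u p = c (fst p) + P p"
  proof (rule AE_O2_swapI)
    show "AE x in I1. AE z in I1. u (x, z) = c (fst (x, z)) + P (x, z)"
      using sl_z
    proof eventually_elim
      case (elim x)
      then obtain d where d: "AE z in I1. u (x, z) = d + prim 0 1 (\<lambda>\<zeta>. om (x, \<zeta>)) z" by blast
      have "c x = (\<integral>z. d \<partial>I1)" unfolding c_def
        using d borel_section(2)[OF sl_meas(1)] borel_section(2)[OF P]
        by (intro integral_cong_AE) (auto simp: P_def elim!: eventually_mono)
      then have "c x = d" by simp
      then show ?case using d by (auto simp: P_def elim!: eventually_mono)
    qed
    show "{p. u p = c (fst p) + P p} \<in> sets borel" using borel_measurable_eq[of u borel "\<lambda>p. c (fst p) + P p"] by simp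
  qed
  from AE_O2(2)[OF this] O2_sections(1)[OF iP] have "AE z in I1. hf u k z = fc (\<lambda>x. complex_of_real (c x)) k + (\<integral>\<zeta>. hf om k \<zeta> * complex_of_real (indicator {..z} \<zeta>) \<partial>I1)"
  proof eventually_elim
    case (elim z)
    note [measurable] = borel_section(1)[OF sl_meas(1), of z] borel_section(1)[OF P, of z]
    have "hf u k z = fc (\<lambda>x. complex_of_real (c x) - (- complex_of_real (P (x, z)))) k"
      unfolding hf_def using elim(1) by (intro fc_cong_AE) (auto elim!: eventually_mono)
    also have "\<dots> = fc (\<lambda>x. complex_of_real (c x)) k - fc (\<lambda>x. - complex_of_real (P (x, z))) k"
      using ic elim(2) by (intro fc_diff) auto
    also have "fc (\<lambda>x. - complex_of_real (P (x, z))) k = - hf P k z" by (simp add: fc_def hf_def)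
    also have "hf P k z = (\<integral>\<zeta>. hf om k \<zeta> * complex_of_real (indicator {..z} \<zeta>) \<partial>I1)"
      unfolding P_def by (rule hf_prim[OF sl_meas(3) sl_int(3)])
    finally show ?case by simp
  qed
  then show ?thesis by blast
qed

lemma sl_sup_u: "AE z in I1. (norm (hf u k z))\<^sup>2 \<le> (nz u k)\<^sup>2 + 2 * (nz u k * nz om k)"
proof -
  note [measurable] = sl_meas
  obtain c where "AE z in I1. hf u k z = c + (\<integral>\<zeta>. hf om k \<zeta> * complex_of_real (indicator {..z} \<zeta>) \<partial>I1)"
    using sl_hf_u_primitive by blast
  from sup_bound_complex[OF _ _ bessel_O2(1)[OF sl_meas(1) sl_int(2)] bessel_O2(1)[OF sl_meas(3) sl_int(4)] this]
  show ?thesis by (simp add: nz_def)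
qed

text \<open>The symbol of the horizontal derivative times the Agmon bound for the mode of
  \<open>u\<close>, hence a bound for the mode of \<open>ux\<close> at almost every height.\<close>

definition "qmode k = 2 * pi * \<bar>real_of_int k\<bar> * sqrt ((nz u k)\<^sup>2 + 2 * (nz u k * nz om k))"

lemma qmode: "qmode k \<ge> 0" "qmode (- k) = qmode k" "AE z in I1. norm (hf ux k z) \<le> qmode k"
proof -
  show "qmode k \<ge> 0" "qmode (- k) = qmode k" by (auto simp: qmode_def nz_minus)
  show "AE z in I1. norm (hf ux k z) \<le> qmode k"
    using sl_hf_ux[of k] sl_sup_u[of k]
  proof eventually_elim
    case (elim z)
    have "norm (hf u k z) \<le> sqrt ((nz u k)\<^sup>2 + 2 * (nz u k * nz om k))" using elim(2) by (rule real_le_rsqrt)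
    then show ?case unfolding elim(1) qmode_def by (simp add: norm_mult mult_left_mono)
  qed
qed

text \<open>In the mixed term two derivatives are available to distribute: \<alpha> of them go to
  \<open>u\<close> and \<open>2 - \<alpha>\<close> to \<open>om\<close>. Hence the condition on
  \<open>s\<close>.\<close>

lemma sq_qmode:
  assumes \<alpha>: "1 < \<alpha>" and s: "2 - \<alpha> \<le> s" and a: "sq \<alpha> (nz u) \<le> ennreal a" "a \<ge> 0" and y: "sq s (nz om) \<le> ennreal y" "y \<ge> 0"
  shows "sq 0 qmode \<le> ennreal (4 * pi\<^sup>2 * (2 * a + y))"
proof -
  have pw: "(qmode k)\<^sup>2 \<le> 4 * pi\<^sup>2 * (2 * (wt k powr (2 * \<alpha>) * (nz u k)\<^sup>2) + wt k powr (2 * (2 - \<alpha>)) * (nz om k)\<^sup>2)" for k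
  proof -
    have k2: "(real_of_int k)\<^sup>2 \<le> (wt k)\<^sup>2" by (rule power2_le_iff_abs_le[THEN iffD2]) (auto simp: wt_def)
    have e: "wt k * wt k = wt k powr \<alpha> * wt k powr (2 - \<alpha>)" by (simp flip: powr_add add: powr_numeral power2_eq_square)
    have "(wt k)\<^sup>2 * (2 * (nz u k * nz om k)) = 2 * ((wt k powr \<alpha> * nz u k) * (wt k powr (2 - \<alpha>) * nz om k))"
      unfolding power2_eq_square e by (simp add: algebra_simps)
    also have "\<dots> \<le> (wt k powr \<alpha> * nz u k)\<^sup>2 + (wt k powr (2 - \<alpha>) * nz om k)\<^sup>2"
      using sum_squares_bound[of "wt k powr \<alpha> * nz u k" "wt k powr (2 - \<alpha>) * nz om k"] by simp
    finally have A: "(wt k)\<^sup>2 * (2 * (nz u k * nz om k)) \<le> wt k powr (2 * \<alpha>) * (nz u k)\<^sup>2 + wt k powr (2 * (2 - \<alpha>)) * (nz om k)\<^sup>2"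
      by (simp add: power_mult_distrib powr_square)
    have "(wt k)\<^sup>2 = wt k powr 2" by (simp add: powr_numeral)
    also have "\<dots> \<le> wt k powr (2 * \<alpha>)" using \<alpha> by (intro powr_mono) (auto simp: wt_ge1)
    finally have B: "(wt k)\<^sup>2 * (nz u k)\<^sup>2 \<le> wt k powr (2 * \<alpha>) * (nz u k)\<^sup>2" by (intro mult_right_mono) auto
    have "(qmode k)\<^sup>2 = 4 * pi\<^sup>2 * ((real_of_int k)\<^sup>2 * ((nz u k)\<^sup>2 + 2 * (nz u k * nz om k)))"
      unfolding qmode_def by (simp add: power_mult_distrib)
    also have "\<dots> \<le> 4 * pi\<^sup>2 * ((wt k)\<^sup>2 * ((nz u k)\<^sup>2 + 2 * (nz u k * nz om k)))"
      using k2 by (intro mult_left_mono mult_right_mono) auto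
    also have "\<dots> \<le> 4 * pi\<^sup>2 * (2 * (wt k powr (2 * \<alpha>) * (nz u k)\<^sup>2) + wt k powr (2 * (2 - \<alpha>)) * (nz om k)\<^sup>2)"
      using A B by (intro mult_left_mono) (auto simp: distrib_left)
    finally show ?thesis .
  qed
  have "sq 0 qmode \<le> (\<integral>\<^sup>+k. ennreal (8 * pi\<^sup>2) * ennreal (wt k powr (2 * \<alpha>) * (nz u k)\<^sup>2) + ennreal (4 * pi\<^sup>2) * ennreal (wt k powr (2 * (2 - \<alpha>)) * (nz om k)\<^sup>2) \<partial>cs)"
    unfolding sq_def
  proof (rule nn_integral_mono)
    fix k
    have "wt k powr (2 * 0) * (qmode k)\<^sup>2 \<le> 8 * pi\<^sup>2 * (wt k powr (2 * \<alpha>) * (nz u k)\<^sup>2) + 4 * pi\<^sup>2 * (wt k powr (2 * (2 - \<alpha>)) * (nz om k)\<^sup>2)"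
      using pw[of k] by (simp add: algebra_simps)
    then have "ennreal (wt k powr (2 * 0) * (qmode k)\<^sup>2) \<le> ennreal (8 * pi\<^sup>2 * (wt k powr (2 * \<alpha>) * (nz u k)\<^sup>2) + 4 * pi\<^sup>2 * (wt k powr (2 * (2 - \<alpha>)) * (nz om k)\<^sup>2))"
      by (rule ennreal_leI)
    also have "\<dots> = ennreal (8 * pi\<^sup>2 * (wt k powr (2 * \<alpha>) * (nz u k)\<^sup>2)) + ennreal (4 * pi\<^sup>2 * (wt k powr (2 * (2 - \<alpha>)) * (nz om k)\<^sup>2))"
      by (rule ennreal_plus) auto
    also have "\<dots> = ennreal (8 * pi\<^sup>2) * ennreal (wt k powr (2 * \<alpha>) * (nz u k)\<^sup>2) + ennreal (4 * pi\<^sup>2) * ennreal (wt k powr (2 * (2 - \<alpha>)) * (nz om k)\<^sup>2)"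
      by (intro arg_cong2[where f=plus] ennreal_mult) auto
    finally show "ennreal (wt k powr (2 * 0) * (qmode k)\<^sup>2) \<le> ennreal (8 * pi\<^sup>2) * ennreal (wt k powr (2 * \<alpha>) * (nz u k)\<^sup>2) + ennreal (4 * pi\<^sup>2) * ennreal (wt k powr (2 * (2 - \<alpha>)) * (nz om k)\<^sup>2)" .
  qed
  also have "\<dots> = ennreal (8 * pi\<^sup>2) * sq \<alpha> (nz u) + ennreal (4 * pi\<^sup>2) * sq (2 - \<alpha>) (nz om)"
    unfolding sq_def by (simp add: nn_integral_add nn_integral_cmult)
  also have "\<dots> \<le> ennreal (8 * pi\<^sup>2) * ennreal a + ennreal (4 * pi\<^sup>2) * ennreal y"
    using a y order_trans[OF sq_mono[OF s] y(1)] by (intro add_mono mult_left_mono) auto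
  also have "\<dots> = ennreal (4 * pi\<^sup>2 * (2 * a + y))"
    using a y by (simp add: ennreal_plus[symmetric] ennreal_mult[symmetric] algebra_simps del: ennreal_plus)
  finally show ?thesis .
qed

text \<open>Integration in \<open>z\<close> does not regularise in \<open>x\<close>, so the
  derivative in \<open>ux\<close> appears as the factor \<open>wt k\<close>: the loss of one
  derivative. In exchange the bound is uniform in \<open>z\<close>.\<close>

lemma sl_hf_w: "AE z in I1. norm (hf w k z) \<le> 2 * pi * (wt k * nz u k)"
  using AE_O2(2)[OF sl_w_eq]
proof eventually_elim
  case (elim z)
  note [measurable] = sl_meas prim_section_measurable[OF sl_meas(2)] borel_section(1)[OF sl_meas(4), of z]
    borel_section(1)[OF prim_section_measurable[OF sl_meas(2)], of z]
  have "hf w k z = fc (\<lambda>x. - complex_of_real (prim 0 1 (\<lambda>\<zeta>. ux (fst (x, z), \<zeta>)) (snd (x, z)))) k"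
    unfolding hf_def using elim by (intro fc_cong_AE) (auto elim!: eventually_mono)
  also have "\<dots> = - hf (\<lambda>p. prim 0 1 (\<lambda>\<zeta>. ux (fst p, \<zeta>)) (snd p)) k z" by (simp add: fc_def hf_def)
  also have "hf (\<lambda>p. prim 0 1 (\<lambda>\<zeta>. ux (fst p, \<zeta>)) (snd p)) k z = (\<integral>\<zeta>. hf ux k \<zeta> * complex_of_real (indicator {..z} \<zeta>) \<partial>I1)"
    by (rule hf_prim[OF sl_meas(2) sl_int(5)])
  finally have "ennreal (norm (hf w k z)) \<le> (\<integral>\<^sup>+\<zeta>. ennreal (norm (hf ux k \<zeta> * complex_of_real (indicator {..z} \<zeta>))) \<partial>I1)"
    using norm_integral_le_nn[of I1 "\<lambda>\<zeta>. hf ux k \<zeta> * complex_of_real (indicator {..z} \<zeta>)"] by simp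
  also have "\<dots> \<le> (\<integral>\<^sup>+\<zeta>. ennreal (2 * pi * \<bar>real_of_int k\<bar>) * ennreal (norm (hf u k \<zeta>)) \<partial>I1)"
    by (rule nn_integral_mono_AE, use sl_hf_ux[of k] in eventually_elim)
       (auto simp: norm_mult indicator_def simp flip: ennreal_mult)
  also have "\<dots> = ennreal (2 * pi * \<bar>real_of_int k\<bar>) * (\<integral>\<^sup>+\<zeta>. ennreal (norm (hf u k \<zeta>)) \<partial>I1)" by (rule nn_integral_cmult) simp
  also have "\<dots> \<le> ennreal (2 * pi * \<bar>real_of_int k\<bar>) * ennreal (nz u k)"
    by (intro mult_left_mono nn_norm_hf_le_nz sl_meas sl_int) auto
  also have "\<dots> = ennreal (2 * pi * \<bar>real_of_int k\<bar> * nz u k)" by (simp add: ennreal_mult)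
  finally have "norm (hf w k z) \<le> 2 * pi * \<bar>real_of_int k\<bar> * nz u k" by (subst (asm) ennreal_le_iff) auto
  also have "\<dots> \<le> 2 * pi * wt k * nz u k" by (intro mult_right_mono mult_left_mono) (auto simp: wt_def)
  finally show ?case by (simp add: mult.assoc)
qed

lemma sl_sobolev: "\<alpha> \<ge> 0 \<Longrightarrow> sq \<alpha> (nz u) \<le> ennreal ((\<integral>p. (u p)\<^sup>2 \<partial>O2) + (\<integral>p. (g p)\<^sup>2 \<partial>O2))"
  by (rule sq_multiplier[OF sl_meas(1) sl_int(2) sl_meas(5) sl_sq(2) _ sl_g])

text \<open>Parseval on horizontal lines turns the product with the fractional Laplacian into a sum
  with nonnegative symbol. The coefficients of \<open>u\<close> are summable since
  \<open>\<alpha> / 2\<close> exceeds 1/2, so \<open>g\<close> needs no more than integrability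
  there. The energy is added because the symbol vanishes at frequency 0.\<close>

lemma sl_dissipation:
  assumes \<alpha>: "1 < \<alpha>"
  shows "integrable O2 (\<lambda>p. u p * g p)"
    and "sq (\<alpha> / 2) (nz u) \<le> ennreal ((\<integral>p. u p * g p \<partial>O2) + (\<integral>p. (u p)\<^sup>2 \<partial>O2))" "(\<integral>p. u p * g p \<partial>O2) \<ge> 0"
proof -
  note [measurable] = sl_meas
  show i: "integrable O2 (\<lambda>p. u p * g p)"
    using integrable_O2_mult[OF sl_int(6) sl_meas(1) sl_bd(1)] by (simp add: mult.commute)
  have "sq \<alpha> (nz u) < \<infinity>" using sl_sobolev \<alpha> by (auto intro: le_less_trans)
  then have sa: "sq (\<alpha> / 2) (nz u) < \<infinity>" using sq_mono[of "\<alpha>/2" \<alpha> "nz u"] \<alpha> by (auto intro: le_less_trans)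
  have half: "1/2 < \<alpha> / 2" using \<alpha> by simp
  let ?l = "\<lambda>k::int. \<bar>2 * pi * real_of_int k\<bar> powr \<alpha>"
  have g_all: "AE z in I1. \<forall>k. hf g k z = complex_of_real (?l k) * hf u k z" using sl_g by (simp add: AE_all_countable)
  have key: "AE z in I1. ennreal (\<integral>x. u (x, z) * g (x, z) \<partial>I1) = (\<integral>\<^sup>+k. ennreal (?l k * (norm (hf u k z))\<^sup>2) \<partial>cs) \<and> (\<integral>x. u (x, z) * g (x, z) \<partial>I1) \<ge> 0"
    using hf_summable[OF sl_meas(1) sl_int(2) half sa] g_all O2_sections(1)[OF sl_int(6)]
  proof eventually_elim
    case (elim z)
    let ?t = "\<lambda>k. ?l k * (norm (hf u k z))\<^sup>2"
    have gi: "integrable I1 (\<lambda>x. complex_of_real (g (x, z)))" using elim by simp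
    have "complex_of_real (\<integral>x. u (x, z) * g (x, z) \<partial>I1) = (\<integral>x. complex_of_real (u (x, z)) * complex_of_real (g (x, z)) \<partial>I1)"
      by (simp flip: of_real_mult)
    also have "\<dots> = (\<integral>k. fc (\<lambda>x. complex_of_real (u (x, z))) k * fc (\<lambda>x. complex_of_real (g (x, z))) (- k) \<partial>cs)"
      by (rule fourier_pairing(1)[OF _ _ gi]) (use elim in auto)
    also have "\<dots> = (\<integral>k. complex_of_real (?t k) \<partial>cs)"
    proof (intro Bochner_Integration.integral_cong refl)
      fix k
      have "fc (\<lambda>x. complex_of_real (g (x, z))) (- k) = complex_of_real (?l k) * cnj (hf u k z)"
        using elim(2) hf_minus[of u k z] by (simp add: hf_def[symmetric])
      then show "fc (\<lambda>x. complex_of_real (u (x, z))) k * fc (\<lambda>x. complex_of_real (g (x, z))) (- k) = complex_of_real (?t k)"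
        unfolding of_real_mult complex_norm_square by (simp add: hf_def mult_ac)
    qed
    finally have e: "(\<integral>x. u (x, z) * g (x, z) \<partial>I1) = (\<integral>k. ?t k \<partial>cs)"
      unfolding integral_complex_of_real of_real_eq_iff .
    have "integrable cs (\<lambda>k. fc (\<lambda>x. complex_of_real (u (x, z))) k * fc (\<lambda>x. complex_of_real (g (x, z))) (- k))"
      by (rule fourier_pairing(2)[OF _ _ gi]) (use elim in auto)
    then have "integrable cs (\<lambda>k. norm (fc (\<lambda>x. complex_of_real (u (x, z))) k * fc (\<lambda>x. complex_of_real (g (x, z))) (- k)))" by simp
    moreover have "norm (fc (\<lambda>x. complex_of_real (u (x, z))) k * fc (\<lambda>x. complex_of_real (g (x, z))) (- k)) = ?t k" for k
    proof -
      have "norm (hf u k z * hf g (- k) z) = ?t k" using elim(2) by (simp add: norm_mult hf_minus[of u] power2_eq_square)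
      then show ?thesis by (simp only: hf_def)
    qed
    ultimately have it: "integrable cs ?t" by simp
    show ?case unfolding e using it by (auto simp: nn_integral_eq_integral)
  qed
  have I: "(\<integral>p. u p * g p \<partial>O2) = (\<integral>z. \<integral>x. u (x, z) * g (x, z) \<partial>I1 \<partial>I1)" by (rule O2_sections(5)[OF i])
  show nn: "(\<integral>p. u p * g p \<partial>O2) \<ge> 0" unfolding I by (rule integral_nonneg_AE) (use key in \<open>auto elim!: eventually_mono\<close>)
  have "ennreal (\<integral>p. u p * g p \<partial>O2) = (\<integral>\<^sup>+z. ennreal (\<integral>x. u (x, z) * g (x, z) \<partial>I1) \<partial>I1)"
    unfolding I using O2_sections(3)[OF i] key by (intro nn_integral_eq_integral[symmetric]) (auto elim!: eventually_mono)
  also have "\<dots> = (\<integral>\<^sup>+z. \<integral>\<^sup>+k. ennreal (?l k * (norm (hf u k z))\<^sup>2) \<partial>cs \<partial>I1)"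
    by (rule nn_integral_cong_AE) (use key in \<open>auto elim!: eventually_mono\<close>)
  also have "\<dots> = (\<integral>\<^sup>+k. \<integral>\<^sup>+z. ennreal (?l k * (norm (hf u k z))\<^sup>2) \<partial>I1 \<partial>cs)"
    by (rule nn_integral_count_space_nn_integral) auto
  also have "\<dots> = (\<integral>\<^sup>+k. ennreal (?l k * (nz u k)\<^sup>2) \<partial>cs)"
    using bessel_O2[OF sl_meas(1) sl_int(2)] by (intro nn_integral_cong) (simp add: nn_integral_eq_integral)
  finally have L: "ennreal (\<integral>p. u p * g p \<partial>O2) = (\<integral>\<^sup>+k. ennreal (?l k * (nz u k)\<^sup>2) \<partial>cs)" .
  have "sq (\<alpha> / 2) (nz u) \<le> (\<integral>\<^sup>+k. ennreal (?l k * (nz u k)\<^sup>2) + ennreal (wt k powr (2 * 0) * (nz u k)\<^sup>2) \<partial>cs)"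
    unfolding sq_def
  proof (rule nn_integral_mono)
    fix k
    have "wt k powr \<alpha> \<le> ?l k + 1"
    proof (cases "k = 0")
      case False
      have "1 * \<bar>real_of_int k\<bar> \<le> (2 * pi) * \<bar>real_of_int k\<bar>" using pi_gt3 by (intro mult_right_mono) auto
      moreover have "\<bar>real_of_int k\<bar> \<ge> 1" using False by simp
      ultimately have "wt k \<le> \<bar>2 * pi * of_int k\<bar>" by (simp add: wt_def abs_mult)
      then have "wt k powr \<alpha> \<le> ?l k" using \<alpha> by (intro powr_mono2) auto
      then show ?thesis by simp
    qed (simp add: wt_def)
    then have "wt k powr (2 * (\<alpha> / 2)) * (nz u k)\<^sup>2 \<le> (?l k + 1) * (nz u k)\<^sup>2" by (intro mult_right_mono) auto
    then show "ennreal (wt k powr (2 * (\<alpha> / 2)) * (nz u k)\<^sup>2) \<le> ennreal (?l k * (nz u k)\<^sup>2) + ennreal (wt k powr (2 * 0) * (nz u k)\<^sup>2)"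
      by (simp add: algebra_simps ennreal_leI flip: ennreal_plus)
  qed
  also have "\<dots> = ennreal (\<integral>p. u p * g p \<partial>O2) + sq 0 (nz u)" unfolding L sq_def by (rule nn_integral_add) auto
  also have "\<dots> \<le> ennreal (\<integral>p. u p * g p \<partial>O2) + ennreal (\<integral>p. (u p)\<^sup>2 \<partial>O2)"
    by (intro add_left_mono bessel_O2 sl_meas sl_int)
  also have "\<dots> = ennreal ((\<integral>p. u p * g p \<partial>O2) + (\<integral>p. (u p)\<^sup>2 \<partial>O2))" using nn by (simp add: ennreal_plus)
  finally show "sq (\<alpha> / 2) (nz u) \<le> ennreal ((\<integral>p. u p * g p \<partial>O2) + (\<integral>p. (u p)\<^sup>2 \<partial>O2))" .
qed

end

lemma slice_diff:
  assumes 1: "slice \<alpha> C1 u1 ux1 om1 w1 g1" and 2: "slice \<alpha> C2 u2 ux2 om2 w2 g2"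
  shows "slice \<alpha> (C1 + C2) (\<lambda>p. u1 p - u2 p) (\<lambda>p. ux1 p - ux2 p) (\<lambda>p. om1 p - om2 p) (\<lambda>p. w1 p - w2 p) (\<lambda>p. g1 p - g2 p)"
proof -
  note [measurable] = sl_meas[OF 1] sl_meas[OF 2]
  have bd: "AE p in O2. \<bar>f p - h p\<bar> \<le> C1 + C2" if "AE p in O2. \<bar>f p\<bar> \<le> C1" "AE p in O2. \<bar>h p\<bar> \<le> C2" for f h :: "real \<times> real \<Rightarrow> real"
    using that by eventually_elim linarith
  have sq: "integrable O2 (\<lambda>p. (f p - h p)\<^sup>2)" if "integrable O2 (\<lambda>p. (f p)\<^sup>2)" "integrable O2 (\<lambda>p. (h p)\<^sup>2)"
    and [measurable]: "f \<in> Borel" "h \<in> Borel" for f h :: "real \<times> real \<Rightarrow> real"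
  proof -
    have "integrable O2 (\<lambda>p. f p * h p)" by (rule cauchy_schwarz_real) (use that in auto)
    moreover have "(\<lambda>p. (f p - h p)\<^sup>2) = (\<lambda>p. (f p)\<^sup>2 - 2 * (f p * h p) + (h p)\<^sup>2)" by (auto simp: power2_eq_square algebra_simps)
    ultimately show ?thesis using that by simp
  qed
  have x: "AE z in I1. (\<integral>x. ux1 (x, z) - ux2 (x, z) \<partial>I1) = 0 \<and> (\<exists>c. AE x in I1. u1 (x, z) - u2 (x, z) = c + prim 0 1 (\<lambda>\<xi>. ux1 (\<xi>, z) - ux2 (\<xi>, z)) x)"
    using sl_x[OF 1] sl_x[OF 2] O2_sections(1)[OF sl_int(5)[OF 1]] O2_sections(1)[OF sl_int(5)[OF 2]]
  proof eventually_elim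
    case (elim z)
    then obtain c d where "AE x in I1. u1 (x, z) = c + prim 0 1 (\<lambda>\<xi>. ux1 (\<xi>, z)) x" "AE x in I1. u2 (x, z) = d + prim 0 1 (\<lambda>\<xi>. ux2 (\<xi>, z)) x" by blast
    then have "AE x in I1. u1 (x, z) - u2 (x, z) = (c - d) + prim 0 1 (\<lambda>\<xi>. ux1 (\<xi>, z) - ux2 (\<xi>, z)) x"
      by eventually_elim (simp add: prim_diff[OF elim(3,4)])
    then show ?case using elim by auto
  qed
  have z: "AE x in I1. \<exists>c. AE z in I1. u1 (x, z) - u2 (x, z) = c + prim 0 1 (\<lambda>\<zeta>. om1 (x, \<zeta>) - om2 (x, \<zeta>)) z"
    using sl_z[OF 1] sl_z[OF 2] O2_sections(2)[OF sl_int(3)[OF 1]] O2_sections(2)[OF sl_int(3)[OF 2]]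
  proof eventually_elim
    case (elim x)
    then obtain c d where "AE z in I1. u1 (x, z) = c + prim 0 1 (\<lambda>\<zeta>. om1 (x, \<zeta>)) z" "AE z in I1. u2 (x, z) = d + prim 0 1 (\<lambda>\<zeta>. om2 (x, \<zeta>)) z" by blast
    then have "AE z in I1. u1 (x, z) - u2 (x, z) = (c - d) + prim 0 1 (\<lambda>\<zeta>. om1 (x, \<zeta>) - om2 (x, \<zeta>)) z"
      by eventually_elim (simp add: prim_diff[OF elim(3,4)])
    then show ?case by blast
  qed
  have w: "AE x in I1. (\<integral>z. ux1 (x, z) - ux2 (x, z) \<partial>I1) = 0 \<and> (AE z in I1. w1 (x, z) - w2 (x, z) = - prim 0 1 (\<lambda>\<zeta>. ux1 (x, \<zeta>) - ux2 (x, \<zeta>)) z)"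
    using sl_w[OF 1] sl_w[OF 2] O2_sections(2)[OF sl_int(5)[OF 1]] O2_sections(2)[OF sl_int(5)[OF 2]]
  proof eventually_elim
    case (elim x)
    have "AE z in I1. w1 (x, z) = - prim 0 1 (\<lambda>\<zeta>. ux1 (x, \<zeta>)) z" "AE z in I1. w2 (x, z) = - prim 0 1 (\<lambda>\<zeta>. ux2 (x, \<zeta>)) z" using elim by auto
    then have "AE z in I1. w1 (x, z) - w2 (x, z) = - prim 0 1 (\<lambda>\<zeta>. ux1 (x, \<zeta>) - ux2 (x, \<zeta>)) z"
      by eventually_elim (simp add: prim_diff[OF elim(3,4)])
    then show ?case using elim by auto
  qed
  have hfd: "AE z in I1. hf (\<lambda>p. f p - h p) k z = hf f k z - hf h k z" if "integrable O2 f" "integrable O2 h" for f h k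
    using O2_sections(1)[OF that(1)] O2_sections(1)[OF that(2)]
  proof eventually_elim
    case (elim z)
    then show ?case unfolding hf_def using fc_diff[of "\<lambda>x. complex_of_real (f (x, z))" "\<lambda>x. complex_of_real (h (x, z))" k] by simp
  qed
  have g: "AE z in I1. hf (\<lambda>p. g1 p - g2 p) k z = complex_of_real (\<bar>2 * pi * of_int k\<bar> powr \<alpha>) * hf (\<lambda>p. u1 p - u2 p) k z" for k
    using sl_g[OF 1, of k] sl_g[OF 2, of k] hfd[OF sl_int(1)[OF 1] sl_int(1)[OF 2], of k] hfd[OF sl_int(6)[OF 1] sl_int(6)[OF 2], of k]
    by eventually_elim (simp only: right_diff_distrib)
  show ?thesis unfolding slice_def
    using bd[OF sl_bd(1)[OF 1] sl_bd(1)[OF 2]] bd[OF sl_bd(2)[OF 1] sl_bd(2)[OF 2]]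
      sq[OF sl_sq(1)[OF 1] sl_sq(1)[OF 2]] sq[OF sl_sq(2)[OF 1] sl_sq(2)[OF 2]] x z w g by simp
qed

section \<open>Cancellation of transport and the energy estimate\<close>

text \<open>On horizontal lines \<open>prim_triple\<close> turns twice the first term into minus the
  integral of \<open>ux1\<close> times the square of \<open>U\<close>, by periodicity; on vertical
  lines it turns twice the second into plus the same integral, because \<open>w1\<close> vanishes at
  both ends and has derivative \<open>- ux1\<close>.\<close>

lemma transport_cancels:
  assumes 1: "slice \<alpha> C1 u1 ux1 om1 w1 g1" and U: "slice \<alpha> C2 U Ux Om W G"
  shows "(\<integral>p. u1 p * Ux p * U p + w1 p * Om p * U p \<partial>O2) = 0"
    and "integrable O2 (\<lambda>p. u1 p * Ux p * U p)" "integrable O2 (\<lambda>p. w1 p * Om p * U p)"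
proof -
  note [measurable] = sl_meas[OF 1] sl_meas[OF U]
  have m: "integrable O2 (\<lambda>p. f p * U p)" if "integrable O2 f" for f
    by (rule integrable_O2_mult[OF that sl_meas(1)[OF U] sl_bd(1)[OF U]])
  show i1: "integrable O2 (\<lambda>p. u1 p * Ux p * U p)"
    using m[OF integrable_O2_mult[OF sl_int(5)[OF U] sl_meas(1)[OF 1] sl_bd(1)[OF 1]]] by (simp add: mult_ac)
  show i2: "integrable O2 (\<lambda>p. w1 p * Om p * U p)"
    by (rule m[OF integrable_O2_mult[OF sl_w_int[OF 1] sl_meas(3)[OF U] sl_bd(2)[OF U]]])
  have i3: "integrable O2 (\<lambda>p. ux1 p * (U p)\<^sup>2)"
    using m[OF m[OF sl_int(5)[OF 1]]] by (simp add: power2_eq_square mult_ac)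
  have x: "AE z in I1. (\<integral>x. ux1 (x, z) * (U (x, z))\<^sup>2 + 2 * (u1 (x, z) * Ux (x, z) * U (x, z)) \<partial>I1) = 0"
    using sl_x[OF 1] sl_x[OF U] O2_sections(1)[OF sl_int(5)[OF 1]] O2_sections(1)[OF sl_int(5)[OF U]]
  proof eventually_elim
    case (elim z)
    note [measurable] = borel_section(1)[OF sl_meas(1)[OF 1], of z] borel_section(1)[OF sl_meas(2)[OF 1], of z]
      borel_section(1)[OF sl_meas(1)[OF U], of z] borel_section(1)[OF sl_meas(2)[OF U], of z]
    obtain c d where c: "AE x in I1. u1 (x, z) = c + prim 0 1 (\<lambda>\<xi>. ux1 (\<xi>, z)) x" and d: "AE x in I1. U (x, z) = d + prim 0 1 (\<lambda>\<xi>. Ux (\<xi>, z)) x"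
      using elim by blast
    have "(\<integral>x. ux1 (x, z) * (U (x, z))\<^sup>2 + 2 * (u1 (x, z) * Ux (x, z) * U (x, z)) \<partial>I1) =
        (\<integral>x. ux1 (x, z) * (d + prim 0 1 (\<lambda>\<xi>. Ux (\<xi>, z)) x)\<^sup>2 + 2 * ((c + prim 0 1 (\<lambda>\<xi>. ux1 (\<xi>, z)) x) * (d + prim 0 1 (\<lambda>\<xi>. Ux (\<xi>, z)) x) * Ux (x, z)) \<partial>I1)"
      by (rule integral_cong_AE) (simp, simp, use c d in eventually_elim, simp add: mult_ac)
    also have "\<dots> = 0" using prim_triple[OF elim(3,4), of c d] elim by simp
    finally show ?case .
  qed
  have z: "AE x in I1. (\<integral>z. - ux1 (x, z) * (U (x, z))\<^sup>2 + 2 * (w1 (x, z) * Om (x, z) * U (x, z)) \<partial>I1) = 0"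
    using sl_w[OF 1] sl_z[OF U] O2_sections(2)[OF sl_int(5)[OF 1]] O2_sections(2)[OF sl_int(3)[OF U]]
  proof eventually_elim
    case (elim x)
    note [measurable] = borel_section(2)[OF sl_meas(4)[OF 1], of x] borel_section(2)[OF sl_meas(2)[OF 1], of x]
      borel_section(2)[OF sl_meas(1)[OF U], of x] borel_section(2)[OF sl_meas(3)[OF U], of x]
    obtain d where d: "AE z in I1. U (x, z) = d + prim 0 1 (\<lambda>\<zeta>. Om (x, \<zeta>)) z" using elim by blast
    have c: "AE z in I1. w1 (x, z) = 0 + prim 0 1 (\<lambda>\<zeta>. - ux1 (x, \<zeta>)) z"
      using elim(1) prim_cmult[of 0 1 "-1" "\<lambda>\<zeta>. ux1 (x, \<zeta>)"] by (auto elim!: eventually_mono)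
    have "(\<integral>z. - ux1 (x, z) * (U (x, z))\<^sup>2 + 2 * (w1 (x, z) * Om (x, z) * U (x, z)) \<partial>I1) =
        (\<integral>z. - ux1 (x, z) * (d + prim 0 1 (\<lambda>\<zeta>. Om (x, \<zeta>)) z)\<^sup>2 + 2 * ((0 + prim 0 1 (\<lambda>\<zeta>. - ux1 (x, \<zeta>)) z) * (d + prim 0 1 (\<lambda>\<zeta>. Om (x, \<zeta>)) z) * Om (x, z)) \<partial>I1)"
      by (rule integral_cong_AE) (simp, simp, use c d in eventually_elim, simp add: mult_ac)
    also have "\<dots> = 0" using prim_triple[of 0 1 "\<lambda>\<zeta>. - ux1 (x, \<zeta>)" "\<lambda>\<zeta>. Om (x, \<zeta>)" 0 d] elim by simp
    finally show ?case .
  qed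
  have "(\<integral>p. ux1 p * (U p)\<^sup>2 + 2 * (u1 p * Ux p * U p) \<partial>O2) = (\<integral>z. 0 \<partial>I1)"
    by (subst O2_sections(5)) (use i1 i3 in simp, rule integral_cong_AE, use O2_sections(3)[of "\<lambda>p. ux1 p * (U p)\<^sup>2 + 2 * (u1 p * Ux p * U p)"] i1 i3 x in auto)
  then have e1: "(\<integral>p. ux1 p * (U p)\<^sup>2 \<partial>O2) + 2 * (\<integral>p. u1 p * Ux p * U p \<partial>O2) = 0" using i1 i3 by simp
  have "(\<integral>p. - ux1 p * (U p)\<^sup>2 + 2 * (w1 p * Om p * U p) \<partial>O2) = (\<integral>x. 0 \<partial>I1)"
    by (subst O2_sections(6)) (use i2 i3 in simp, rule integral_cong_AE, use O2_sections(4)[of "\<lambda>p. - ux1 p * (U p)\<^sup>2 + 2 * (w1 p * Om p * U p)"] i2 i3 z in auto)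
  then have e2: "- (\<integral>p. ux1 p * (U p)\<^sup>2 \<partial>O2) + 2 * (\<integral>p. w1 p * Om p * U p \<partial>O2) = 0" using i2 i3 by simp
  show "(\<integral>p. u1 p * Ux p * U p + w1 p * Om p * U p \<partial>O2) = 0" using e1 e2 i1 i2 by simp
qed

text \<open>After the cancellation two integrals remain. Each may use half of the dissipation, so
  what is left is a multiple of the energy, with \<open>a\<close> and \<open>y\<close> entering
  linearly and hence integrable in time.\<close>

lemma energy_estimate:
  assumes \<alpha>: "1 < \<alpha>" "\<alpha> < 2" and s1: "0 \<le> s1" "s1 < 1/2" "3/2 - \<alpha> \<le> s1" "s1 \<le> 1 - \<alpha>/2"
    and \<nu>: "\<nu> > 0" and X: "X \<ge> 0"
  obtains K where "K \<ge> 0"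
    "\<And>C1 C2 u1 ux1 om1 w1 g1 u2 ux2 om2 w2 g2 a y.
      slice \<alpha> C1 u1 ux1 om1 w1 g1 \<Longrightarrow> slice \<alpha> C2 u2 ux2 om2 w2 g2 \<Longrightarrow>
      sq s1 (nz om2) \<le> ennreal X \<Longrightarrow> sq (s1 + \<alpha> / 2) (nz om2) \<le> ennreal y \<Longrightarrow> sq \<alpha> (nz u2) \<le> ennreal a \<Longrightarrow> a \<ge> 0 \<Longrightarrow> y \<ge> 0 \<Longrightarrow>
      - (\<integral>p. (u1 p - u2 p) * ((u1 p * ux1 p + w1 p * om1 p + \<nu> * g1 p) - (u2 p * ux2 p + w2 p * om2 p + \<nu> * g2 p)) \<partial>O2)
        \<le> K * (1 + a + y) * (\<integral>p. (u1 p - u2 p)\<^sup>2 \<partial>O2)"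
proof -
  obtain Ca where Ca: "Ca \<ge> 0" "\<And>m q e d A. (\<And>k. m k \<ge> 0) \<Longrightarrow> (\<And>k. q k \<ge> 0) \<Longrightarrow> e \<ge> 0 \<Longrightarrow> d \<ge> 0 \<Longrightarrow> A \<ge> 0 \<Longrightarrow>
      sq 0 m \<le> ennreal e \<Longrightarrow> sq (\<alpha> / 2) m \<le> ennreal d \<Longrightarrow> sq 0 q \<le> ennreal A \<Longrightarrow>
      (\<integral>\<^sup>+j. \<integral>\<^sup>+l. ennreal (q (j + l)) * ennreal (m j) * ennreal (m l) \<partial>cs \<partial>cs) \<le> ennreal (\<nu> / 2 * d + Ca * (1 + A) * e)"
    using trilinear_transport[OF \<alpha>, of "\<nu> / 2"] \<nu> by auto
  \<comment> \<open>The bound for the modes of \<open>W\<close> brings a factor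
    \<open>2 * pi\<close>; \<open>\<nu> / (4 * pi)\<close> turns it into the second half of the
    dissipation.\<close>
  obtain Cb where Cb: "Cb \<ge> 0" "\<And>m n e d y. (\<And>k. m k \<ge> 0) \<Longrightarrow> (\<And>k. n k \<ge> 0) \<Longrightarrow> e \<ge> 0 \<Longrightarrow> d \<ge> 0 \<Longrightarrow> y \<ge> 0 \<Longrightarrow>
      sq 0 m \<le> ennreal e \<Longrightarrow> sq (\<alpha> / 2) m \<le> ennreal d \<Longrightarrow> sq s1 n \<le> ennreal X \<Longrightarrow> sq (s1 + \<alpha> / 2) n \<le> ennreal y \<Longrightarrow>
      (\<integral>\<^sup>+j. \<integral>\<^sup>+l. ennreal (wt (j + l) * m (j + l)) * ennreal (n j) * ennreal (m l) \<partial>cs \<partial>cs) \<le> ennreal (\<nu> / (4 * pi) * d + Cb * (1 + y) * e)"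
    using trilinear_vertical[OF \<alpha> s1 _ X, of "\<nu> / (4 * pi)"] \<nu> by auto
  define K where "K = \<nu> + Ca * (1 + 8 * pi\<^sup>2) + 2 * pi * Cb"
  have main: "- (\<integral>p. (u1 p - u2 p) * ((u1 p * ux1 p + w1 p * om1 p + \<nu> * g1 p) - (u2 p * ux2 p + w2 p * om2 p + \<nu> * g2 p)) \<partial>O2)
        \<le> K * (1 + a + y) * (\<integral>p. (u1 p - u2 p)\<^sup>2 \<partial>O2)"
    if 1: "slice \<alpha> C1 u1 ux1 om1 w1 g1" and 2: "slice \<alpha> C2 u2 ux2 om2 w2 g2"
      and nX: "sq s1 (nz om2) \<le> ennreal X" and nY: "sq (s1 + \<alpha> / 2) (nz om2) \<le> ennreal y" and nA: "sq \<alpha> (nz u2) \<le> ennreal a" and ay: "a \<ge> 0" "y \<ge> 0"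
    for C1 C2 u1 ux1 om1 w1 g1 u2 ux2 om2 w2 g2 a y
  proof -
    define U where "U = (\<lambda>p. u1 p - u2 p)"
    define Ux where "Ux = (\<lambda>p. ux1 p - ux2 p)"
    define Om where "Om = (\<lambda>p. om1 p - om2 p)"
    define W where "W = (\<lambda>p. w1 p - w2 p)"
    define G where "G = (\<lambda>p. g1 p - g2 p)"
    have U: "slice \<alpha> (C1 + C2) U Ux Om W G" unfolding U_def Ux_def Om_def W_def G_def by (rule slice_diff[OF 1 2])
    note [measurable] = sl_meas[OF 1] sl_meas[OF 2] sl_meas[OF U]
    define E where "E = (\<integral>p. (U p)\<^sup>2 \<partial>O2)"
    define I where "I = (\<integral>p. U p * G p \<partial>O2)"
    have E0: "E \<ge> 0" by (simp add: E_def)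
    note dis = sl_dissipation[OF U \<alpha>(1)]
    have I0: "I \<ge> 0" unfolding I_def by (rule dis(3))
    have sD: "sq (\<alpha> / 2) (nz U) \<le> ennreal (I + E)" unfolding I_def E_def by (rule dis(2))
    have sE: "sq 0 (nz U) \<le> ennreal E" unfolding E_def by (rule bessel_O2(3)[OF sl_meas(1)[OF U] sl_int(2)[OF U]])
    have fin: "sq (\<alpha> / 2) (nz U) < \<infinity>" "sq (s1 + \<alpha> / 2) (nz om2) < \<infinity>"
      using le_less_trans[OF sD ennreal_less_top] le_less_trans[OF nY ennreal_less_top] by auto
    have half: "1/2 < \<alpha> / 2" "1/2 < s1 + \<alpha> / 2" using \<alpha> s1 by auto
    have mU: "integrable O2 (\<lambda>p. f p * U p)" if "integrable O2 f" for f
      by (rule integrable_O2_mult[OF that sl_meas(1)[OF U] sl_bd(1)[OF U]])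
    have i1: "integrable O2 (\<lambda>p. ux2 p * U p * U p)" by (intro mU sl_int(5)[OF 2])
    have i2: "integrable O2 (\<lambda>p. W p * om2 p * U p)"
      by (rule mU[OF integrable_O2_mult[OF sl_w_int[OF U] sl_meas(3)[OF 2] sl_bd(2)[OF 2]]])
    \<comment> \<open>The order required of the vertical derivative is \<open>2 - \<alpha>\<close>,
      and it lies below \<open>s1 + \<alpha> / 2\<close> because
      \<open>3/2 - \<alpha> \<le> s1\<close> and \<alpha> > 1.\<close>
    have sq_q: "sq 0 (qmode u2 om2) \<le> ennreal (4 * pi\<^sup>2 * (2 * a + y))"
      by (rule sq_qmode[OF 2 \<alpha>(1) _ nA ay(1) nY ay(2)]) (use \<alpha> s1 in auto)
    have T1: "\<bar>\<integral>p. ux2 p * U p * U p \<partial>O2\<bar> \<le> \<nu> / 2 * (I + E) + Ca * (1 + 4 * pi\<^sup>2 * (2 * a + y)) * E"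
    proof -
      have "ennreal \<bar>\<integral>p. ux2 p * U p * U p \<partial>O2\<bar> \<le> (\<integral>\<^sup>+j. \<integral>\<^sup>+l. ennreal (qmode u2 om2 (j + l)) * ennreal (nz U j) * ennreal (nz U l) \<partial>cs \<partial>cs)"
        by (rule trilinear_O2[OF sl_meas(2)[OF 2] sl_int(5)[OF 2] sl_meas(1)[OF U] sl_int(2)[OF U] half(1) fin(1) sl_meas(1)[OF U] sl_int(2)[OF U] half(1) fin(1)
              qmode(3)[OF 2] qmode(1)[OF 2] qmode(2)[OF 2] i1])
      also have "\<dots> \<le> ennreal (\<nu> / 2 * (I + E) + Ca * (1 + 4 * pi\<^sup>2 * (2 * a + y)) * E)"
        by (rule Ca(2)) (use qmode(1)[OF 2] E0 I0 ay sE sD sq_q in auto)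
      finally show ?thesis using Ca(1) E0 I0 ay \<nu> by (subst (asm) ennreal_le_iff) (auto intro!: add_nonneg_nonneg mult_nonneg_nonneg)
    qed
    have T2: "\<bar>\<integral>p. W p * om2 p * U p \<partial>O2\<bar> \<le> \<nu> / 2 * (I + E) + 2 * pi * Cb * (1 + y) * E"
    proof -
      have "ennreal \<bar>\<integral>p. W p * om2 p * U p \<partial>O2\<bar> \<le> (\<integral>\<^sup>+j. \<integral>\<^sup>+l. ennreal (2 * pi * (wt (j + l) * nz U (j + l))) * ennreal (nz om2 j) * ennreal (nz U l) \<partial>cs \<partial>cs)"
        by (rule trilinear_O2[OF sl_meas(4)[OF U] sl_w_int[OF U] sl_meas(3)[OF 2] sl_int(4)[OF 2] half(2) fin(2) sl_meas(1)[OF U] sl_int(2)[OF U] half(1) fin(1)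
              sl_hf_w[OF U] _ _ i2]) (auto simp: nz_minus wt_def)
      also have "\<dots> = ennreal (2 * pi) * (\<integral>\<^sup>+j. \<integral>\<^sup>+l. ennreal (wt (j + l) * nz U (j + l)) * ennreal (nz om2 j) * ennreal (nz U l) \<partial>cs \<partial>cs)"
      proof -
        have "ennreal (2 * pi * (wt (j + l) * nz U (j + l))) = ennreal (2 * pi) * ennreal (wt (j + l) * nz U (j + l))" for j l
          by (rule ennreal_mult) auto
        then show ?thesis by (simp only: mult.assoc[of "ennreal (2 * pi)"] nn_integral_cmult borel_measurable_count_space)
      qed
      also have "\<dots> \<le> ennreal (2 * pi) * ennreal (\<nu> / (4 * pi) * (I + E) + Cb * (1 + y) * E)"
        by (intro mult_left_mono Cb(2)) (use E0 I0 ay sE sD nX nY in auto)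
      also have "\<dots> = ennreal (2 * pi * (\<nu> / (4 * pi) * (I + E) + Cb * (1 + y) * E))"
        using Cb(1) E0 I0 ay \<nu> by (intro ennreal_mult[symmetric]) (auto intro!: add_nonneg_nonneg mult_nonneg_nonneg)
      also have "2 * pi * (\<nu> / (4 * pi) * (I + E) + Cb * (1 + y) * E) = \<nu> / 2 * (I + E) + 2 * pi * Cb * (1 + y) * E"
        by (simp add: field_simps)
      finally show ?thesis using Cb(1) E0 I0 ay \<nu> by (subst (asm) ennreal_le_iff) (auto intro!: add_nonneg_nonneg mult_nonneg_nonneg)
    qed
    note tc = transport_cancels[OF 1 U]
    have h: "\<nu> / 2 * (I + E) + \<nu> / 2 * (I + E) = \<nu> * I + \<nu> * E" by (simp add: algebra_simps)
    \<comment> \<open>The differences of products are expanded so that the velocity of the first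
      solution transports the difference and the derivatives of the second one multiply
      \<open>U\<close> and \<open>W\<close>.\<close>
    have "(\<integral>p. (u1 p - u2 p) * ((u1 p * ux1 p + w1 p * om1 p + \<nu> * g1 p) - (u2 p * ux2 p + w2 p * om2 p + \<nu> * g2 p)) \<partial>O2)
       = (\<integral>p. (u1 p * Ux p * U p + w1 p * Om p * U p) + (ux2 p * U p * U p + W p * om2 p * U p + \<nu> * (U p * G p)) \<partial>O2)"
      unfolding U_def Ux_def Om_def W_def G_def by (intro Bochner_Integration.integral_cong refl) (simp add: algebra_simps)
    also have "\<dots> = (\<integral>p. u1 p * Ux p * U p + w1 p * Om p * U p \<partial>O2) + (\<integral>p. ux2 p * U p * U p \<partial>O2) + (\<integral>p. W p * om2 p * U p \<partial>O2) + \<nu> * I"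
      using tc(2,3) i1 i2 dis(1) unfolding I_def by simp
    also have "\<dots> = (\<integral>p. ux2 p * U p * U p \<partial>O2) + (\<integral>p. W p * om2 p * U p \<partial>O2) + \<nu> * I" using tc(1) by simp
    finally have "- (\<integral>p. (u1 p - u2 p) * ((u1 p * ux1 p + w1 p * om1 p + \<nu> * g1 p) - (u2 p * ux2 p + w2 p * om2 p + \<nu> * g2 p)) \<partial>O2)
        \<le> \<nu> * E + Ca * (1 + 4 * pi\<^sup>2 * (2 * a + y)) * E + 2 * pi * Cb * (1 + y) * E"
      using T1 T2 h by linarith
    also have "\<dots> = (\<nu> + Ca * (1 + 4 * pi\<^sup>2 * (2 * a + y)) + 2 * pi * Cb * (1 + y)) * E" by (simp add: algebra_simps)
    also have "\<dots> \<le> (K * (1 + a + y)) * E"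
    proof (rule mult_right_mono[OF _ E0])
      have "Ca * (1 + 4 * pi\<^sup>2 * (2 * a + y)) \<le> Ca * ((1 + 8 * pi\<^sup>2) * (1 + a + y))"
        using Ca(1) ay by (intro mult_left_mono) (auto simp: algebra_simps intro!: add_nonneg_nonneg)
      moreover have "2 * pi * Cb * (1 + y) \<le> 2 * pi * Cb * (1 + a + y)" using Cb(1) ay by (intro mult_left_mono) auto
      moreover have "\<nu> * 1 \<le> \<nu> * (1 + a + y)" using \<nu> ay by (intro mult_left_mono) auto
      ultimately show "\<nu> + Ca * (1 + 4 * pi\<^sup>2 * (2 * a + y)) + 2 * pi * Cb * (1 + y) \<le> K * (1 + a + y)"
        unfolding K_def by (simp add: algebra_simps)
    qed
    finally show ?thesis unfolding E_def U_def .
  qed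
  have "K \<ge> 0" using Ca(1) Cb(1) \<nu> by (auto simp: K_def intro!: add_nonneg_nonneg)
  then show ?thesis by (rule that[OF _ main])
qed

subsection \<open>Permuting coordinates and product test functions\<close>

lemma sigma_finite_leb: "sigma_finite_measure (leb_on a b)" "sigma_finite_measure (leb2 a b c d)"
  by (rule leb_on.sigma_finite_measure_axioms, rule finite_measure.axioms(1)[OF finite_measure_leb2])

lemma nn_integral_leb3:
  assumes [measurable]: "F \<in> borel_measurable (borel :: (real \<times> real \<times> real) measure)"
  shows "(\<integral>\<^sup>+p. F p \<partial>(leb3 a b c d e f)) = (\<integral>\<^sup>+t. \<integral>\<^sup>+x. \<integral>\<^sup>+z. F (t, x, z) \<partial>leb_on e f \<partial>leb_on c d \<partial>leb_on a b)"
proof -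
  have m: "F \<in> borel_measurable (leb3 a b c d e f)" using assms by simp
  have "(\<integral>\<^sup>+p. F p \<partial>(leb3 a b c d e f)) = (\<integral>\<^sup>+t. \<integral>\<^sup>+q. F (t, q) \<partial>(leb2 c d e f) \<partial>leb_on a b)"
    by (rule sigma_finite_measure.nn_integral_fst[OF sigma_finite_leb(2) m, symmetric])
  also have "\<dots> = (\<integral>\<^sup>+t. \<integral>\<^sup>+x. \<integral>\<^sup>+z. F (t, x, z) \<partial>leb_on e f \<partial>leb_on c d \<partial>leb_on a b)"
  proof (rule nn_integral_cong)
    fix t
    have "(\<lambda>q. F (t, q)) \<in> borel_measurable (leb2 c d e f)" using m by (rule measurable_Pair2) simp
    then show "(\<integral>\<^sup>+q. F (t, q) \<partial>(leb2 c d e f)) = (\<integral>\<^sup>+x. \<integral>\<^sup>+z. F (t, x, z) \<partial>leb_on e f \<partial>leb_on c d)"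
      by (rule leb_on.nn_integral_fst[symmetric])
  qed
  finally show ?thesis .
qed

text \<open>\<open>weak_deriv_slices\<close> differentiates in the first coordinate; these maps
  bring \<open>x\<close> or \<open>z\<close> there.\<close>

definition perm_x :: "real \<times> real \<times> real \<Rightarrow> real \<times> real \<times> real" where "perm_x = (\<lambda>(t, x, z). (x, t, z))"
definition perm_z :: "real \<times> real \<times> real \<Rightarrow> real \<times> real \<times> real" where "perm_z = (\<lambda>(t, x, z). (z, t, x))"

lemma perm_measurable [measurable]: "perm_x \<in> Borel" "perm_z \<in> Borel"
  unfolding perm_x_def perm_z_def case_prod_unfold by (intro borel_measurable_continuous_onI continuous_intros)+

text \<open>Both sides are evaluated as iterated integrals. \<open>perm_x\<close> needs one exchange
  of neighbouring integrals, \<open>perm_z\<close> needs two.\<close>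

lemma distr_perm:
  "distr (leb3 a b c d e f) borel perm_x = leb3 c d a b e f"
  "distr (leb3 a b c d e f) borel perm_z = leb3 e f a b c d"
proof -
  let ?M = "leb3 a b c d e f"
  have pm: "perm_x \<in> ?M \<rightarrow>\<^sub>M borel" "perm_z \<in> ?M \<rightarrow>\<^sub>M borel" by simp_all
  have emd: "emeasure (distr ?M borel \<pi>) S = (\<integral>\<^sup>+t. \<integral>\<^sup>+x. \<integral>\<^sup>+z. indicator S (\<pi> (t, x, z)) \<partial>leb_on e f \<partial>leb_on c d \<partial>leb_on a b)"
    if S: "S \<in> sets borel" and \<pi>: "\<pi> \<in> Borel" for S and \<pi> :: "real \<times> real \<times> real \<Rightarrow> real \<times> real \<times> real"
  proof -
    note [measurable] = S \<pi>
    have "emeasure (distr ?M borel \<pi>) S = (\<integral>\<^sup>+p. indicator S p \<partial>distr ?M borel \<pi>)" using S by simp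
    also have "\<dots> = (\<integral>\<^sup>+p. indicator S (\<pi> p) \<partial>?M)" by (rule nn_integral_distr) (use \<pi> S in auto)
    also have "\<dots> = (\<integral>\<^sup>+t. \<integral>\<^sup>+x. \<integral>\<^sup>+z. indicator S (\<pi> (t, x, z)) \<partial>leb_on e f \<partial>leb_on c d \<partial>leb_on a b)"
      by (rule nn_integral_leb3) simp
    finally show ?thesis .
  qed
  have em: "emeasure (leb3 a' b' c' d' e' f') S = (\<integral>\<^sup>+t. \<integral>\<^sup>+x. \<integral>\<^sup>+z. indicator S (t, x, z) \<partial>leb_on e' f' \<partial>leb_on c' d' \<partial>leb_on a' b')"
    if S: "S \<in> sets borel" for S a' b' c' d' e' f'
  proof -
    have "S \<in> sets (leb3 a' b' c' d' e' f')" using S unfolding sets_leb3 .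
    from nn_integral_indicator[OF this, symmetric] show ?thesis
      using nn_integral_leb3[of "indicator S" a' b' c' d' e' f'] S by (simp only: borel_measurable_indicator)
  qed
  show "distr ?M borel perm_x = leb3 c d a b e f"
  proof (rule measure_eqI)
    fix S :: "(real \<times> real \<times> real) set" assume "S \<in> sets (distr ?M borel perm_x)"
    then have S [measurable]: "S \<in> sets borel" by simp
    have "(\<lambda>(q, z). indicator S (snd q, fst q, z) :: ennreal) \<in> borel_measurable ((leb2 a b c d) \<Otimes>\<^sub>M leb_on e f)"
      by (intro measurable_compose[OF _ borel_measurable_indicator[OF S]] | simp add: case_prod_unfold)+
    then have m: "(\<lambda>q. \<integral>\<^sup>+z. indicator S (snd q, fst q, z) \<partial>leb_on e f) \<in> borel_measurable (leb2 a b c d)"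
      by (rule leb_on.borel_measurable_nn_integral)
    have "emeasure (distr ?M borel perm_x) S = (\<integral>\<^sup>+t. \<integral>\<^sup>+x. \<integral>\<^sup>+z. indicator S (x, t, z) \<partial>leb_on e f \<partial>leb_on c d \<partial>leb_on a b)"
      using emd[OF S perm_measurable(1)] by (simp add: perm_x_def)
    also have "\<dots> = (\<integral>\<^sup>+x. \<integral>\<^sup>+t. \<integral>\<^sup>+z. indicator S (x, t, z) \<partial>leb_on e f \<partial>leb_on a b \<partial>leb_on c d)"
      using leb_pair.Fubini[OF m] by simp
    finally show "emeasure (distr ?M borel perm_x) S = emeasure (leb3 c d a b e f) S"
      using em[OF S] by simp
  qed (simp only: sets_distr sets_leb3)
  show "distr ?M borel perm_z = leb3 e f a b c d"
  proof (rule measure_eqI)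
    fix S :: "(real \<times> real \<times> real) set" assume "S \<in> sets (distr ?M borel perm_z)"
    then have S [measurable]: "S \<in> sets borel" by simp
    have "(\<lambda>(q, x). indicator S (snd q, fst q, x) :: ennreal) \<in> borel_measurable ((leb2 a b e f) \<Otimes>\<^sub>M leb_on c d)"
      by (intro measurable_compose[OF _ borel_measurable_indicator[OF S]] | simp add: case_prod_unfold)+
    then have m: "(\<lambda>q. \<integral>\<^sup>+x. indicator S (snd q, fst q, x) \<partial>leb_on c d) \<in> borel_measurable (leb2 a b e f)"
      by (rule leb_on.borel_measurable_nn_integral)
    have m2: "(\<lambda>q. indicator S (snd q, t, fst q) :: ennreal) \<in> borel_measurable (leb2 c d e f)" for t
      by (intro measurable_compose[OF _ borel_measurable_indicator[OF S]] borel_measurable_Pair; simp del: borel_measurable_leb_eq)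
    have "emeasure (distr ?M borel perm_z) S = (\<integral>\<^sup>+t. \<integral>\<^sup>+x. \<integral>\<^sup>+z. indicator S (z, t, x) \<partial>leb_on e f \<partial>leb_on c d \<partial>leb_on a b)"
      using emd[OF S perm_measurable(2)] by (simp add: perm_z_def)
    also have "\<dots> = (\<integral>\<^sup>+t. \<integral>\<^sup>+z. \<integral>\<^sup>+x. indicator S (z, t, x) \<partial>leb_on c d \<partial>leb_on e f \<partial>leb_on a b)"
      using leb_pair.Fubini[OF m2] by (intro nn_integral_cong) simp
    also have "\<dots> = (\<integral>\<^sup>+z. \<integral>\<^sup>+t. \<integral>\<^sup>+x. indicator S (z, t, x) \<partial>leb_on c d \<partial>leb_on a b \<partial>leb_on e f)"
      using leb_pair.Fubini[OF m] by simp
    finally show "emeasure (distr ?M borel perm_z) S = emeasure (leb3 e f a b c d) S"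
      using em[OF S] by simp
  qed (simp only: sets_distr sets_leb3)
qed

lemma perm_integral:
  fixes F :: "real \<times> real \<times> real \<Rightarrow> real"
  assumes F [measurable]: "F \<in> Borel"
  shows "(\<integral>p. F p \<partial>(leb3 c d a b e f)) = (\<integral>p. F (perm_x p) \<partial>(leb3 a b c d e f))"
    "integrable (leb3 c d a b e f) F \<longleftrightarrow> integrable (leb3 a b c d e f) (\<lambda>p. F (perm_x p))"
    "(\<integral>p. F p \<partial>(leb3 e f a b c d)) = (\<integral>p. F (perm_z p) \<partial>(leb3 a b c d e f))"
    "integrable (leb3 e f a b c d) F \<longleftrightarrow> integrable (leb3 a b c d e f) (\<lambda>p. F (perm_z p))"
proof -
  let ?M = "leb3 a b c d e f"
  have m: "perm_x \<in> ?M \<rightarrow>\<^sub>M borel" "perm_z \<in> ?M \<rightarrow>\<^sub>M borel" by simp_all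
  show "(\<integral>p. F p \<partial>(leb3 c d a b e f)) = (\<integral>p. F (perm_x p) \<partial>?M)"
    using integral_distr[OF m(1) F] unfolding distr_perm(1) .
  show "integrable (leb3 c d a b e f) F \<longleftrightarrow> integrable ?M (\<lambda>p. F (perm_x p))"
    using integrable_distr_eq[OF m(1) F] unfolding distr_perm(1) .
  show "(\<integral>p. F p \<partial>(leb3 e f a b c d)) = (\<integral>p. F (perm_z p) \<partial>?M)"
    using integral_distr[OF m(2) F] unfolding distr_perm(2) .
  show "integrable (leb3 e f a b c d) F \<longleftrightarrow> integrable ?M (\<lambda>p. F (perm_z p))"
    using integrable_distr_eq[OF m(2) F] unfolding distr_perm(2) .
qed

definition ptest :: "(real \<Rightarrow> real) \<Rightarrow> (real \<Rightarrow> real) \<Rightarrow> (real \<Rightarrow> real) \<Rightarrow> real \<times> real \<times> real \<Rightarrow> real" where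
  "ptest \<phi> \<psi> \<xi> = (\<lambda>(t, x, z). \<phi> t * \<psi> x * \<xi> z)"

lemma ptest_test_fun:
  assumes \<phi>: "\<phi> \<in> C1c t0 t1" and \<psi>: "\<psi> \<in> C1c x0 x1" and \<xi>: "\<xi> \<in> C1c z0 z1"
    and U: "{t0<..<t1} \<times> {x0<..<x1} \<times> {z0<..<z1} \<subseteq> U"
  shows "test_fun U (ptest \<phi> \<psi> \<xi>)"
    and "frechet_derivative (ptest \<phi> \<psi> \<xi>) (at (t, x, z)) h =
      deriv \<phi> t * \<psi> x * \<xi> z * fst h + \<phi> t * deriv \<psi> x * \<xi> z * fst (snd h) + \<phi> t * \<psi> x * deriv \<xi> z * snd (snd h)"
proof -
  define B1 :: "(real \<times> real \<times> real) \<Rightarrow>\<^sub>L real" where "B1 = Blinfun fst"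
  define B2 :: "(real \<times> real \<times> real) \<Rightarrow>\<^sub>L real" where "B2 = Blinfun (\<lambda>h. fst (snd h))"
  define B3 :: "(real \<times> real \<times> real) \<Rightarrow>\<^sub>L real" where "B3 = Blinfun (\<lambda>h. snd (snd h))"
  have B: "blinfun_apply B1 = fst" "blinfun_apply B2 = (\<lambda>h. fst (snd h))" "blinfun_apply B3 = (\<lambda>h. snd (snd h))"
    unfolding B1_def B2_def B3_def by (rule bounded_linear_Blinfun_apply; intro bounded_linear_intros bounded_linear_fst bounded_linear_snd bounded_linear_fst_comp bounded_linear_snd_comp)+
  define D where "D = (\<lambda>p. (deriv \<phi> (fst p) * \<psi> (fst (snd p)) * \<xi> (snd (snd p))) *\<^sub>R B1 +
    (\<phi> (fst p) * deriv \<psi> (fst (snd p)) * \<xi> (snd (snd p))) *\<^sub>R B2 + (\<phi> (fst p) * \<psi> (fst (snd p)) * deriv \<xi> (snd (snd p))) *\<^sub>R B3)"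
  have co: "continuous_on UNIV (\<lambda>p::real\<times>real\<times>real. f (fst p))" "continuous_on UNIV (\<lambda>p::real\<times>real\<times>real. f (fst (snd p)))"
    "continuous_on UNIV (\<lambda>p::real\<times>real\<times>real. f (snd (snd p)))" if "continuous_on UNIV f" for f :: "real \<Rightarrow> real"
    by (rule continuous_on_compose2[OF that]; auto intro!: continuous_intros)+
  have cont: "continuous_on UNIV D"
    unfolding D_def by (intro continuous_intros co C1c_deriv[OF \<phi>] C1c_deriv[OF \<psi>] C1c_deriv[OF \<xi>])
  have hd: "(f has_derivative (\<lambda>h. deriv f y * h)) (at y)" if "f \<in> C1c a b" for f a b y
    using C1c_deriv(1)[OF that, of y] by (simp add: has_field_derivative_def)
  have der: "(ptest \<phi> \<psi> \<xi> has_derivative blinfun_apply (D p)) (at p)" for p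
  proof -
    have "((\<lambda>p. \<phi> (fst p)) has_derivative (\<lambda>h. deriv \<phi> (fst p) * fst h)) (at p)"
      by (rule has_derivative_compose[OF _ hd[OF \<phi>]]) (rule derivative_intros)+
    moreover have "((\<lambda>p. \<psi> (fst (snd p))) has_derivative (\<lambda>h. deriv \<psi> (fst (snd p)) * fst (snd h))) (at p)"
      by (rule has_derivative_compose[OF _ hd[OF \<psi>]]) (rule derivative_intros)+
    moreover have "((\<lambda>p. \<xi> (snd (snd p))) has_derivative (\<lambda>h. deriv \<xi> (snd (snd p)) * snd (snd h))) (at p)"
      by (rule has_derivative_compose[OF _ hd[OF \<xi>]]) (rule derivative_intros)+
    ultimately have "((\<lambda>p. \<phi> (fst p) * \<psi> (fst (snd p)) * \<xi> (snd (snd p))) has_derivative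
      (\<lambda>h. \<phi> (fst p) * \<psi> (fst (snd p)) * (deriv \<xi> (snd (snd p)) * snd (snd h)) +
        (\<phi> (fst p) * (deriv \<psi> (fst (snd p)) * fst (snd h)) + deriv \<phi> (fst p) * fst h * \<psi> (fst (snd p))) * \<xi> (snd (snd p)))) (at p)"
      by (intro has_derivative_mult)
    moreover have "ptest \<phi> \<psi> \<xi> = (\<lambda>p. \<phi> (fst p) * \<psi> (fst (snd p)) * \<xi> (snd (snd p)))"
      by (auto simp: ptest_def case_prod_unfold)
    moreover have "(\<lambda>h. \<phi> (fst p) * \<psi> (fst (snd p)) * (deriv \<xi> (snd (snd p)) * snd (snd h)) +
        (\<phi> (fst p) * (deriv \<psi> (fst (snd p)) * fst (snd h)) + deriv \<phi> (fst p) * fst h * \<psi> (fst (snd p))) * \<xi> (snd (snd p))) = blinfun_apply (D p)"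
      by (simp add: D_def B blinfun.add_left blinfun.scaleR_left fun_eq_iff algebra_simps)
    ultimately show ?thesis by (simp only:)
  qed
  obtain a1 b1 where 1: "t0 < a1" "b1 < t1" "\<And>s. s \<notin> {a1..b1} \<Longrightarrow> \<phi> s = 0" using C1cE[OF \<phi>] by metis
  obtain a2 b2 where 2: "x0 < a2" "b2 < x1" "\<And>s. s \<notin> {a2..b2} \<Longrightarrow> \<psi> s = 0" using C1cE[OF \<psi>] by metis
  obtain a3 b3 where 3: "z0 < a3" "b3 < z1" "\<And>s. s \<notin> {a3..b3} \<Longrightarrow> \<xi> s = 0" using C1cE[OF \<xi>] by metis
  let ?K = "{a1..b1} \<times> {a2..b2} \<times> {a3..b3}"
  have K: "compact ?K" by (intro compact_Times compact_Icc)
  have "{p. ptest \<phi> \<psi> \<xi> p \<noteq> 0} \<subseteq> ?K"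
  proof -
    have "s \<in> {a1..b1}" if "\<phi> s \<noteq> 0" for s using 1(3) that by blast
    moreover have "s \<in> {a2..b2}" if "\<psi> s \<noteq> 0" for s using 2(3) that by blast
    moreover have "s \<in> {a3..b3}" if "\<xi> s \<noteq> 0" for s using 3(3) that by blast
    ultimately show ?thesis by (auto simp: ptest_def simp del: atLeastAtMost_iff)
  qed
  then have cl: "closure {p. ptest \<phi> \<psi> \<xi> p \<noteq> 0} \<subseteq> ?K" by (rule closure_minimal) (simp add: K compact_imp_closed)
  moreover have "?K \<subseteq> {t0<..<t1} \<times> {x0<..<x1} \<times> {z0<..<z1}" using 1 2 3 by auto
  moreover have "compact (closure {p. ptest \<phi> \<psi> \<xi> p \<noteq> 0})"
    using cl K by (metis bounded_subset closed_closure compact_eq_bounded_closed)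
  ultimately show "test_fun U (ptest \<phi> \<psi> \<xi>)"
    unfolding test_fun_def using cont der U by blast
  have "frechet_derivative (ptest \<phi> \<psi> \<xi>) (at (t, x, z)) = blinfun_apply (D (t, x, z))"
    by (rule frechet_derivative_at[symmetric]) (rule der)
  then show "frechet_derivative (ptest \<phi> \<psi> \<xi>) (at (t, x, z)) h =
      deriv \<phi> t * \<psi> x * \<xi> z * fst h + \<phi> t * deriv \<psi> x * \<xi> z * fst (snd h) + \<phi> t * \<psi> x * deriv \<xi> z * snd (snd h)"
    by (simp add: D_def B blinfun.add_left blinfun.scaleR_left)
qed

text \<open>An integrand that vanishes off the open box does not distinguish the domain
  \<open>U\<close> from the closed box, on which the measure is a product.\<close>

lemma integral_box:
  fixes F :: "real \<times> real \<times> real \<Rightarrow> real"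
  assumes [measurable]: "F \<in> Borel"
    and z: "\<And>t x z. \<not> (t0 < t \<and> t < t1 \<and> x0 < x \<and> x < x1 \<and> z0 < z \<and> z < z1) \<Longrightarrow> F (t, x, z) = 0"
    and U: "{t0<..<t1} \<times> {x0<..<x1} \<times> {z0<..<z1} \<subseteq> U"
  shows "(LINT y:U|lborel. F y) = (\<integral>p. F p \<partial>(leb3 t0 t1 x0 x1 z0 z1))"
proof -
  let ?B = "{t0..t1} \<times> {x0..x1} \<times> {z0..z1}"
  have "indicator U p *\<^sub>R F p = indicator ?B p *\<^sub>R F p" for p
  proof (cases p)
    case (fields t x z)
    show ?thesis
    proof (cases "t0 < t \<and> t < t1 \<and> x0 < x \<and> x < x1 \<and> z0 < z \<and> z < z1")
      case True
      then have "p \<in> U" "p \<in> ?B" using U fields by auto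
      then show ?thesis by simp
    next
      case False
      then show ?thesis using z[OF False] fields by simp
    qed
  qed
  then have "(LINT y:U|lborel. F y) = (\<integral>p. indicator ?B p *\<^sub>R F p \<partial>lborel)" unfolding set_lebesgue_integral_def by (simp only:)
  also have "\<dots> = integral\<^sup>L (restrict_space lborel ?B) F" by (subst integral_restrict_space) auto
  also have "\<dots> = (\<integral>p. F p \<partial>(leb3 t0 t1 x0 x1 z0 z1))"
    unfolding leb_on_triple by (rule integral_restrict_density) auto
  finally show ?thesis .
qed

lemma C1c_outside:
  assumes "\<phi> \<in> C1c a b" "\<not> (a < s \<and> s < b)" shows "\<phi> s = 0" "deriv \<phi> s = 0"
proof -
  obtain c d where cd: "a < c" "d < b" "\<And>s. s \<notin> {c..d} \<Longrightarrow> \<phi> s = 0" using C1cE[OF assms(1)] by metis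
  then have s: "s \<notin> {c..d}" using assms(2) by auto
  show "\<phi> s = 0" using cd(3)[OF s] .
  show "deriv \<phi> s = 0" by (rule C1c_deriv_0[OF assms(1) cd(3) s])
qed

lemma weak_box:
  assumes w: "weak_deriv U v f g" and [measurable]: "f \<in> Borel" "g \<in> Borel"
    and \<phi>: "\<phi> \<in> C1c t0 t1" and \<psi>: "\<psi> \<in> C1c x0 x1" and \<xi>: "\<xi> \<in> C1c z0 z1"
    and U: "{t0<..<t1} \<times> {x0<..<x1} \<times> {z0<..<z1} \<subseteq> U"
  shows "(\<integral>p. f p * (case p of (t, x, z) \<Rightarrow> deriv \<phi> t * \<psi> x * \<xi> z * fst v + \<phi> t * deriv \<psi> x * \<xi> z * fst (snd v) + \<phi> t * \<psi> x * deriv \<xi> z * snd (snd v)) \<partial>(leb3 t0 t1 x0 x1 z0 z1))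
    = - (\<integral>p. g p * (case p of (t, x, z) \<Rightarrow> \<phi> t * \<psi> x * \<xi> z) \<partial>(leb3 t0 t1 x0 x1 z0 z1))"
proof -
  have cb: "(\<lambda>p::real\<times>real\<times>real. h (fst p)) \<in> Borel" "(\<lambda>p::real\<times>real\<times>real. h (fst (snd p))) \<in> Borel"
    "(\<lambda>p::real\<times>real\<times>real. h (snd (snd p))) \<in> Borel" if "h \<in> Borel" for h :: "real \<Rightarrow> real"
    by (rule measurable_compose[OF borel_measurable_continuous_onI that]; intro continuous_intros)+
  note [measurable] = cb[OF C1c_measurable(1)[OF \<phi>]] cb[OF C1c_measurable(2)[OF \<phi>]] cb[OF C1c_measurable(1)[OF \<psi>]] cb[OF C1c_measurable(2)[OF \<psi>]]
    cb[OF C1c_measurable(1)[OF \<xi>]] cb[OF C1c_measurable(2)[OF \<xi>]]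
  let ?D = "\<lambda>p. case p of (t, x, z) \<Rightarrow> deriv \<phi> t * \<psi> x * \<xi> z * fst v + \<phi> t * deriv \<psi> x * \<xi> z * fst (snd v) + \<phi> t * \<psi> x * deriv \<xi> z * snd (snd v)"
  have "frechet_derivative (ptest \<phi> \<psi> \<xi>) (at p) v = ?D p" for p
    using ptest_test_fun(2)[OF \<phi> \<psi> \<xi> U] by (cases p) auto
  then have "(LINT p:U|lborel. f p * ?D p) = (LINT p:U|lborel. f p * frechet_derivative (ptest \<phi> \<psi> \<xi>) (at p) v)" by simp
  also have "\<dots> = - (LINT p:U|lborel. g p * ptest \<phi> \<psi> \<xi> p)"
    using w ptest_test_fun(1)[OF \<phi> \<psi> \<xi> U] unfolding weak_deriv_def by blast
  finally have e: "(LINT p:U|lborel. f p * ?D p) = - (LINT p:U|lborel. g p * (case p of (t, x, z) \<Rightarrow> \<phi> t * \<psi> x * \<xi> z))"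
    by (simp add: ptest_def)
  have "(LINT p:U|lborel. f p * ?D p) = (\<integral>p. f p * ?D p \<partial>(leb3 t0 t1 x0 x1 z0 z1))"
    by (rule integral_box[OF _ _ U]) (simp add: case_prod_unfold, use C1c_outside[OF \<phi>] C1c_outside[OF \<psi>] C1c_outside[OF \<xi>] in auto)
  moreover have "(LINT p:U|lborel. g p * (case p of (t, x, z) \<Rightarrow> \<phi> t * \<psi> x * \<xi> z)) = (\<integral>p. g p * (case p of (t, x, z) \<Rightarrow> \<phi> t * \<psi> x * \<xi> z) \<partial>(leb3 t0 t1 x0 x1 z0 z1))"
    by (rule integral_box[OF _ _ U]) (simp add: case_prod_unfold, use C1c_outside[OF \<phi>] C1c_outside[OF \<psi>] C1c_outside[OF \<xi>] in auto)
  ultimately show ?thesis using e by simp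
qed

lemma total_tests_box:
  assumes "a < b" "c < d"
  shows "total_tests (leb2 a b c d) {tensor \<phi> \<psi> |\<phi> \<psi>. \<phi> \<in> C1c a b \<and> \<psi> \<in> C1c c d}"
  by (intro total_tests_pair total_tests_C1c assms leb_on.finite_measure_axioms)

text \<open>du Bois-Reymond in the vertical variable; the tests in the other two variables are
  products, which are total on a rectangle.\<close>

lemma slices_z:
  fixes f g :: "real \<times> real \<times> real \<Rightarrow> real"
  assumes w: "weak_deriv U (0, 0, 1) f g" and f [measurable]: "f \<in> Borel" and g [measurable]: "g \<in> Borel"
    and U: "{t0<..<t1} \<times> {x0<..<x1} \<times> {z0<..<z1} \<subseteq> U" and le: "t0 < t1" "x0 < x1" "z0 < z1"
    and fi: "integrable (leb3 t0 t1 x0 x1 z0 z1) f"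
    and gi: "integrable (leb3 t0 t1 x0 x1 z0 z1) g"
  shows "AE q in leb2 t0 t1 x0 x1. integrable (leb_on z0 z1) (\<lambda>z. g (fst q, snd q, z)) \<and>
    (\<exists>C. AE z in leb_on z0 z1. f (fst q, snd q, z) = C + prim z0 z1 (\<lambda>\<zeta>. g (fst q, snd q, \<zeta>)) z)"
proof -
  define \<pi> where "\<pi> = (\<lambda>(z, t, x). (t, x, z) :: real \<times> real \<times> real)"
  have [measurable]: "\<pi> \<in> Borel" unfolding \<pi>_def case_prod_unfold by (intro borel_measurable_continuous_onI continuous_intros)
  have \<pi>: "\<pi> (perm_z p) = p" for p by (simp add: \<pi>_def perm_z_def case_prod_unfold)
  have "AE q in leb2 t0 t1 x0 x1. integrable (leb_on z0 z1) (\<lambda>z. g (\<pi> (z, q))) \<and>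
    (\<exists>C. AE z in leb_on z0 z1. f (\<pi> (z, q)) = C + prim z0 z1 (\<lambda>\<zeta>. g (\<pi> (\<zeta>, q))) z)"
  proof (rule weak_deriv_slices[OF le(3) finite_measure_leb2 total_tests_box[OF le(1,2)]])
    show "integrable (leb3 z0 z1 t0 t1 x0 x1) (\<lambda>p. f (\<pi> p))"
      "integrable (leb3 z0 z1 t0 t1 x0 x1) (\<lambda>p. g (\<pi> p))"
      using fi gi perm_integral(4)[of "\<lambda>p. f (\<pi> p)" z0 z1 t0 t1 x0 x1] perm_integral(4)[of "\<lambda>p. g (\<pi> p)" z0 z1 t0 t1 x0 x1] by (simp_all add: \<pi>)
    fix \<xi> \<theta> assume \<xi>: "\<xi> \<in> C1c z0 z1" and "\<theta> \<in> {tensor \<phi> \<psi> |\<phi> \<psi>. \<phi> \<in> C1c t0 t1 \<and> \<psi> \<in> C1c x0 x1}"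
    then obtain \<phi> \<psi> where \<theta>: "\<theta> = tensor \<phi> \<psi>" and \<phi>: "\<phi> \<in> C1c t0 t1" and \<psi>: "\<psi> \<in> C1c x0 x1" by auto
    have cb: "(\<lambda>p::real\<times>real\<times>real. h (fst p)) \<in> Borel" "(\<lambda>p::real\<times>real\<times>real. h (fst (snd p))) \<in> Borel"
      "(\<lambda>p::real\<times>real\<times>real. h (snd (snd p))) \<in> Borel" if "h \<in> Borel" for h :: "real \<Rightarrow> real"
      by (rule measurable_compose[OF borel_measurable_continuous_onI that]; intro continuous_intros)+
    note [measurable] = cb[OF C1c_measurable(1)[OF \<phi>]] cb[OF C1c_measurable(1)[OF \<psi>]] cb[OF C1c_measurable(1)[OF \<xi>]] cb[OF C1c_measurable(2)[OF \<xi>]]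
    have m: "(\<lambda>p. f (\<pi> p) * (deriv \<xi> (fst p) * \<theta> (snd p))) \<in> Borel" "(\<lambda>p. g (\<pi> p) * (\<xi> (fst p) * \<theta> (snd p))) \<in> Borel"
      unfolding \<theta> tensor_def case_prod_unfold by measurable
    show "(\<integral>p. f (\<pi> p) * (deriv \<xi> (fst p) * \<theta> (snd p)) \<partial>(leb3 z0 z1 t0 t1 x0 x1)) =
      - (\<integral>p. g (\<pi> p) * (\<xi> (fst p) * \<theta> (snd p)) \<partial>(leb3 z0 z1 t0 t1 x0 x1))"
      unfolding perm_integral(3)[OF m(1)] perm_integral(3)[OF m(2)] \<pi>
      using weak_box[OF w f g \<phi> \<psi> \<xi> U] by (simp add: \<theta> tensor_def perm_z_def case_prod_unfold mult_ac)
  qed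
  then show ?thesis by (simp add: \<pi>_def case_prod_unfold)
qed

lemma slices_x:
  fixes f g :: "real \<times> real \<times> real \<Rightarrow> real"
  assumes w: "weak_deriv U (0, 1, 0) f g" and f [measurable]: "f \<in> Borel" and g [measurable]: "g \<in> Borel"
    and U: "{t0<..<t1} \<times> {x0<..<x1} \<times> {z0<..<z1} \<subseteq> U" and le: "t0 < t1" "x0 < x1" "z0 < z1"
    and fi: "integrable (leb3 t0 t1 x0 x1 z0 z1) f"
    and gi: "integrable (leb3 t0 t1 x0 x1 z0 z1) g"
  shows "AE q in leb2 t0 t1 z0 z1. integrable (leb_on x0 x1) (\<lambda>x. g (fst q, x, snd q)) \<and>
    (\<exists>C. AE x in leb_on x0 x1. f (fst q, x, snd q) = C + prim x0 x1 (\<lambda>\<xi>. g (fst q, \<xi>, snd q)) x)"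
proof -
  define \<pi> where "\<pi> = (\<lambda>(x, t, z). (t, x, z) :: real \<times> real \<times> real)"
  have [measurable]: "\<pi> \<in> Borel" unfolding \<pi>_def case_prod_unfold by (intro borel_measurable_continuous_onI continuous_intros)
  have \<pi>: "\<pi> (perm_x p) = p" for p by (simp add: \<pi>_def perm_x_def case_prod_unfold)
  have "AE q in leb2 t0 t1 z0 z1. integrable (leb_on x0 x1) (\<lambda>x. g (\<pi> (x, q))) \<and>
    (\<exists>C. AE x in leb_on x0 x1. f (\<pi> (x, q)) = C + prim x0 x1 (\<lambda>\<xi>. g (\<pi> (\<xi>, q))) x)"
  proof (rule weak_deriv_slices[OF le(2) finite_measure_leb2 total_tests_box[OF le(1,3)]])
    show "integrable (leb3 x0 x1 t0 t1 z0 z1) (\<lambda>p. f (\<pi> p))"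
      "integrable (leb3 x0 x1 t0 t1 z0 z1) (\<lambda>p. g (\<pi> p))"
      using fi gi perm_integral(2)[of "\<lambda>p. f (\<pi> p)" x0 x1 t0 t1 z0 z1] perm_integral(2)[of "\<lambda>p. g (\<pi> p)" x0 x1 t0 t1 z0 z1] by (simp_all add: \<pi>)
    fix \<psi> \<theta> assume \<psi>: "\<psi> \<in> C1c x0 x1" and "\<theta> \<in> {tensor \<phi> \<psi> |\<phi> \<psi>. \<phi> \<in> C1c t0 t1 \<and> \<psi> \<in> C1c z0 z1}"
    then obtain \<phi> \<xi> where \<theta>: "\<theta> = tensor \<phi> \<xi>" and \<phi>: "\<phi> \<in> C1c t0 t1" and \<xi>: "\<xi> \<in> C1c z0 z1" by auto
    have cb: "(\<lambda>p::real\<times>real\<times>real. h (fst p)) \<in> Borel" "(\<lambda>p::real\<times>real\<times>real. h (fst (snd p))) \<in> Borel"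
      "(\<lambda>p::real\<times>real\<times>real. h (snd (snd p))) \<in> Borel" if "h \<in> Borel" for h :: "real \<Rightarrow> real"
      by (rule measurable_compose[OF borel_measurable_continuous_onI that]; intro continuous_intros)+
    note [measurable] = cb[OF C1c_measurable(1)[OF \<phi>]] cb[OF C1c_measurable(1)[OF \<psi>]] cb[OF C1c_measurable(1)[OF \<xi>]] cb[OF C1c_measurable(2)[OF \<psi>]]
    have m: "(\<lambda>p. f (\<pi> p) * (deriv \<psi> (fst p) * \<theta> (snd p))) \<in> Borel" "(\<lambda>p. g (\<pi> p) * (\<psi> (fst p) * \<theta> (snd p))) \<in> Borel"
      unfolding \<theta> tensor_def case_prod_unfold by measurable
    show "(\<integral>p. f (\<pi> p) * (deriv \<psi> (fst p) * \<theta> (snd p)) \<partial>(leb3 x0 x1 t0 t1 z0 z1)) =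
      - (\<integral>p. g (\<pi> p) * (\<psi> (fst p) * \<theta> (snd p)) \<partial>(leb3 x0 x1 t0 t1 z0 z1))"
      unfolding perm_integral(1)[OF m(1)] perm_integral(1)[OF m(2)] \<pi>
      using weak_box[OF w f g \<phi> \<psi> \<xi> U] by (simp add: \<theta> tensor_def perm_x_def case_prod_unfold mult_ac)
  qed
  then show ?thesis by (simp add: \<pi>_def case_prod_unfold)
qed

section \<open>Inner boxes, dense sets and periodicity\<close>

lemma AE_leb3_iff: "(AE p in leb3 a b c d e f. P p) \<longleftrightarrow> (AE p in lborel. p \<in> {a..b} \<times> {c..d} \<times> {e..f} \<longrightarrow> P p)"
  unfolding leb_on_triple by (subst AE_density) (auto simp: indicator_def)

lemma AE_leb2_iff: "(AE p in leb2 a b c d. P p) \<longleftrightarrow> (AE p in lborel. p \<in> {a..b} \<times> {c..d} \<longrightarrow> P p)"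
  unfolding leb_on_pair by (subst AE_density) (auto simp: indicator_def)

lemma AE_fst_snd:
  assumes M: "sigma_finite_measure M" and N: "sigma_finite_measure N"
  shows "(AE x in M. P x) \<Longrightarrow> AE p in M \<Otimes>\<^sub>M N. P (fst p)" "(AE y in N. Q y) \<Longrightarrow> AE p in M \<Otimes>\<^sub>M N. Q (snd p)"
proof -
  interpret N: sigma_finite_measure N by fact
  { assume "AE x in M. P x"
    then obtain Z where Z: "{x \<in> space M. \<not> P x} \<subseteq> Z" "Z \<in> null_sets M" by (auto simp: eventually_ae_filter)
    have "Z \<times> space N \<in> null_sets (M \<Otimes>\<^sub>M N)" using Z(2) by (auto simp: null_sets_def N.emeasure_pair_measure_Times)
    then show "AE p in M \<Otimes>\<^sub>M N. P (fst p)" by (rule AE_I') (use Z(1) in \<open>auto simp: space_pair_measure\<close>) }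
  { assume "AE x in N. Q x"
    then obtain Z where Z: "{x \<in> space N. \<not> Q x} \<subseteq> Z" "Z \<in> null_sets N" by (auto simp: eventually_ae_filter)
    have "space M \<times> Z \<in> null_sets (M \<Otimes>\<^sub>M N)" using Z(2) by (auto simp: null_sets_def N.emeasure_pair_measure_Times)
    then show "AE p in M \<Otimes>\<^sub>M N. Q (snd p)" by (rule AE_I') (use Z(1) in \<open>auto simp: space_pair_measure\<close>) }
qed

lemma AE_interior: "AE x in leb_on a b. a < x \<and> x < b"
  unfolding AE_leb_on using AE_lborel_singleton[of a] AE_lborel_singleton[of b] by eventually_elim auto

lemma interior_index:
  fixes t T :: real
  assumes "0 < t" "t < T"
  obtains n0 where "\<And>n. n \<ge> n0 \<Longrightarrow> T / (real n + 3) \<le> t \<and> t \<le> T - T / (real n + 3)"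
proof -
  obtain n0 :: nat where n0: "T / min t (T - t) < real n0" using reals_Archimedean2 by blast
  define m where "m = min t (T - t)"
  have m: "m > 0" using assms by (simp add: m_def)
  have "T / (real n + 3) \<le> min t (T - t)" if "n \<ge> n0" for n
  proof -
    have "T / m \<le> real n + 3" using n0 that unfolding m_def by linarith
    then show ?thesis using m unfolding m_def[symmetric] by (simp add: pos_divide_le_eq mult.commute)
  qed
  note le = this
  have "T / (real n + 3) \<le> t \<and> t \<le> T - T / (real n + 3)" if "n \<ge> n0" for n
    using le[OF that] by auto
  then show ?thesis by (rule that)
qed

text \<open>Weak derivatives are integrable on compact parts of the open domain, so identities are
  proved on inner boxes. Countably many of these cover the full box except for faces of measure
  zero. No shrinking happens in \<open>x\<close>, where the domain is the whole line.\<close>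

lemma exhaust3:
  assumes T: "T > 0" and P: "\<And>t0 t1 z0 z1. 0 < t0 \<Longrightarrow> t0 < t1 \<Longrightarrow> t1 < T \<Longrightarrow> 0 < z0 \<Longrightarrow> z0 < z1 \<Longrightarrow> z1 < 1 \<Longrightarrow>
      AE p in leb_on t0 t1 \<Otimes>\<^sub>M (I1 \<Otimes>\<^sub>M leb_on z0 z1). P p"
  shows "AE p in leb_on 0 T \<Otimes>\<^sub>M (I1 \<Otimes>\<^sub>M I1). P p"
proof -
  define e where "e = (\<lambda>(L::real) n. L / (real n + 3))"
  have e: "0 < e L n" "e L n < L - e L n" "L - e L n < L" if "L > 0" for L n
  proof -
    have "L / (real n + 3) \<le> L / 3" using that by (intro divide_left_mono) auto
    moreover have "0 < L / (real n + 3)" using that by simp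
    ultimately show "0 < e L n" "e L n < L - e L n" "L - e L n < L" using that by (auto simp: e_def)
  qed
  have "AE p in lborel. \<forall>n. p \<in> {e T n..T - e T n} \<times> {0..1} \<times> {e 1 n..1 - e 1 n} \<longrightarrow> P p"
    unfolding AE_all_countable using P[OF e[OF T] e[of 1]] by (simp add: AE_leb3_iff)
  then have 1: "AE p in leb_on 0 T \<Otimes>\<^sub>M (I1 \<Otimes>\<^sub>M I1). \<forall>n. p \<in> {e T n..T - e T n} \<times> {0..1} \<times> {e 1 n..1 - e 1 n} \<longrightarrow> P p"
    unfolding AE_leb3_iff by eventually_elim blast
  have 2: "AE p in leb_on 0 T \<Otimes>\<^sub>M (I1 \<Otimes>\<^sub>M I1). 0 < fst p \<and> fst p < T" by (rule AE_fst_snd(1)[OF sigma_finite_leb AE_interior])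
  have 3: "AE p in leb_on 0 T \<Otimes>\<^sub>M (I1 \<Otimes>\<^sub>M I1). 0 < snd (snd p) \<and> snd (snd p) < 1"
    by (rule AE_fst_snd(2)[OF sigma_finite_leb]) (rule AE_fst_snd(2)[OF sigma_finite_leb(1) sigma_finite_leb(1) AE_interior])
  have 4: "AE p in leb_on 0 T \<Otimes>\<^sub>M (I1 \<Otimes>\<^sub>M I1). 0 \<le> fst (snd p) \<and> fst (snd p) \<le> 1"
    unfolding AE_leb3_iff by auto
  from 1 2 3 4 show ?thesis
  proof eventually_elim
    case (elim p)
    obtain n0 where n0: "\<And>n. n \<ge> n0 \<Longrightarrow> e T n \<le> fst p \<and> fst p \<le> T - e T n" using interior_index[of "fst p" T] elim by (auto simp: e_def)
    obtain n1 where n1: "\<And>n. n \<ge> n1 \<Longrightarrow> e 1 n \<le> snd (snd p) \<and> snd (snd p) \<le> 1 - e 1 n" using interior_index[of "snd (snd p)" 1] elim by (auto simp: e_def)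
    have "p \<in> {e T (max n0 n1)..T - e T (max n0 n1)} \<times> {0..1} \<times> {e 1 (max n0 n1)..1 - e 1 (max n0 n1)}"
      using n0[of "max n0 n1"] n1[of "max n0 n1"] elim(4) by (cases p) auto
    then show ?case using elim(1) by blast
  qed
qed

lemma exhaust2:
  assumes T: "T > 0" and P: "\<And>t0 t1 z0 z1. 0 < t0 \<Longrightarrow> t0 < t1 \<Longrightarrow> t1 < T \<Longrightarrow> 0 < z0 \<Longrightarrow> z0 < z1 \<Longrightarrow> z1 < 1 \<Longrightarrow>
      AE q in leb2 t0 t1 z0 z1. P q"
  shows "AE q in leb_on 0 T \<Otimes>\<^sub>M I1. P q"
proof -
  define e where "e = (\<lambda>(L::real) n. L / (real n + 3))"
  have e: "0 < e L n" "e L n < L - e L n" "L - e L n < L" if "L > 0" for L n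
  proof -
    have "L / (real n + 3) \<le> L / 3" using that by (intro divide_left_mono) auto
    moreover have "0 < L / (real n + 3)" using that by simp
    ultimately show "0 < e L n" "e L n < L - e L n" "L - e L n < L" using that by (auto simp: e_def)
  qed
  have "AE p in lborel. \<forall>n. p \<in> {e T n..T - e T n} \<times> {e 1 n..1 - e 1 n} \<longrightarrow> P p"
    unfolding AE_all_countable using P[OF e[OF T] e[of 1]] by (simp add: AE_leb2_iff)
  then have 1: "AE p in leb_on 0 T \<Otimes>\<^sub>M I1. \<forall>n. p \<in> {e T n..T - e T n} \<times> {e 1 n..1 - e 1 n} \<longrightarrow> P p"
    unfolding AE_leb2_iff by eventually_elim blast
  have 2: "AE p in leb_on 0 T \<Otimes>\<^sub>M I1. 0 < fst p \<and> fst p < T" by (rule AE_fst_snd(1)[OF sigma_finite_leb(1) sigma_finite_leb(1) AE_interior])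
  have 3: "AE p in leb_on 0 T \<Otimes>\<^sub>M I1. 0 < snd p \<and> snd p < 1" by (rule AE_fst_snd(2)[OF sigma_finite_leb(1) sigma_finite_leb(1) AE_interior])
  from 1 2 3 show ?thesis
  proof eventually_elim
    case (elim p)
    obtain n0 where n0: "\<And>n. n \<ge> n0 \<Longrightarrow> e T n \<le> fst p \<and> fst p \<le> T - e T n" using interior_index[of "fst p" T] elim by (auto simp: e_def)
    obtain n1 where n1: "\<And>n. n \<ge> n1 \<Longrightarrow> e 1 n \<le> snd p \<and> snd p \<le> 1 - e 1 n" using interior_index[of "snd p" 1] elim by (auto simp: e_def)
    have "p \<in> {e T (max n0 n1)..T - e T (max n0 n1)} \<times> {e 1 (max n0 n1)..1 - e 1 (max n0 n1)}"
      using n0[of "max n0 n1"] n1[of "max n0 n1"] by (cases p) auto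
    then show ?case using elim(1) by blast
  qed
qed

text \<open>A set of full measure is dense. With continuity this carries statements from almost
  every time to a prescribed one.\<close>

lemma AE_leb_on_dense:
  assumes ab: "a < b" and P: "AE x in leb_on a b. P x" and s: "s \<in> {a..b}"
  obtains x :: "nat \<Rightarrow> real" where "\<And>n. P (x n)" "\<And>n. x n \<in> {a..b}" "x \<longlonglongrightarrow> s"
proof -
  have "\<exists>x. P x \<and> x \<in> {a..b} \<and> \<bar>x - s\<bar> \<le> \<delta>" if \<delta>: "\<delta> > 0" for \<delta>
  proof (rule ccontr)
    assume no: "\<not> ?thesis"
    let ?A = "{max a (s - \<delta>)..min b (s + \<delta>)}"
    have "AE x in lborel. x \<notin> ?A" using P unfolding AE_leb_on by eventually_elim (use no in auto)
    then have "?A \<in> null_sets lborel" by (subst AE_iff_null_sets) auto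
    moreover have "max a (s - \<delta>) < min b (s + \<delta>)" using ab s \<delta> by auto
    then have "emeasure lborel ?A > 0" by (subst emeasure_lborel_Icc) (auto simp del: max_less_iff_conj min_less_iff_conj)
    ultimately show False by (simp only: null_sets_def mem_Collect_eq less_irrefl)
  qed
  then have "\<exists>x. P x \<and> x \<in> {a..b} \<and> \<bar>x - s\<bar> \<le> 1 / (real n + 1)" for n by simp
  then obtain x where x: "\<And>n. P (x n) \<and> x n \<in> {a..b} \<and> \<bar>x n - s\<bar> \<le> 1 / (real n + 1)" by metis
  have "(\<lambda>n. x n - s) \<longlonglongrightarrow> 0"
  proof (rule Lim_null_comparison)
    show "eventually (\<lambda>n. norm (x n - s) \<le> 1 / (real n + 1)) sequentially" using x by simp
    show "(\<lambda>n. 1 / (real n + 1)) \<longlonglongrightarrow> 0" using LIMSEQ_inverse_real_of_nat by (simp add: inverse_eq_divide add.commute)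
  qed
  then have "x \<longlonglongrightarrow> s" by (simp add: LIM_zero_iff)
  then show ?thesis using that x by blast
qed

text \<open>On \<open>[0,1]\<close> alone a weak derivative cannot detect a jump between the two
  ends. The continuous representative on \<open>[-1,2]\<close> satisfies the periodicity almost
  everywhere on \<open>[-1,1]\<close>, so it takes the same value at 0 and 1, which is the mean zero
  of \<open>g\<close>.\<close>

lemma periodic_slice:
  assumes per: "\<And>x. f (x + 1) = f x" and [measurable]: "f \<in> Borel" and g: "integrable (leb_on (-1) 2) g"
    and rep: "AE x in leb_on (-1) 2. f x = C + prim (-1) 2 g x"
  shows "integrable I1 g" "(\<integral>x. g x \<partial>I1) = 0" "\<exists>c. AE x in I1. f x = c + prim 0 1 g x"
proof -
  note [measurable] = borel_measurable_integrable[OF g, simplified]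
  have gs: "set_integrable lborel {-1..2} g" using g by (simp add: integrable_leb_on)
  show gi: "integrable I1 g" using set_integrable_subset[OF gs, of "{0..1}"] by (simp add: integrable_leb_on)
  have split: "prim (-1) 2 g x = prim (-1) 2 g 0 + prim 0 1 g x" if "x \<in> {0..1}" for x
  proof -
    have "(LINT \<sigma>:{-1..x}|lborel. g \<sigma>) = (LINT \<sigma>:{-1..<0} \<union> {0..x}|lborel. g \<sigma>)"
      using that by (intro arg_cong[where f="\<lambda>A. set_lebesgue_integral lborel A g"]) auto
    also have "\<dots> = (LINT \<sigma>:{-1..<0}|lborel. g \<sigma>) + (LINT \<sigma>:{0..x}|lborel. g \<sigma>)"
      using that by (intro set_integral_Un set_integrable_subset[OF gs]) auto
    also have "(LINT \<sigma>:{-1..<0}|lborel. g \<sigma>) = (LINT \<sigma>:{-1..0}|lborel. g \<sigma>)"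
      by (rule set_integral_cong_set) (use AE_lborel_singleton[of 0] in \<open>auto elim!: eventually_mono simp: set_borel_measurable_def\<close>)
    finally show ?thesis using that by (simp add: prim_eq)
  qed
  define H where "H = (\<lambda>x. C + prim (-1) 2 g x)"
  have H: "continuous_on UNIV H" unfolding H_def by (intro continuous_intros prim_continuous g)
  have ae: "AE x in lborel. x \<in> {-1..2} \<longrightarrow> f x = H x" using rep by (simp add: AE_leb_on H_def)
  have ae1: "AE x in lborel. x + 1 \<in> {-1..2} \<longrightarrow> f (x + 1) = H (x + 1)"
  proof -
    have [measurable]: "H \<in> Borel" by (rule borel_measurable_continuous_onI[OF H])
    have "AE x in distr lborel borel ((+) 1). x \<in> {-1..2} \<longrightarrow> f x = H x" using ae by (subst lborel_distr_plus) simp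
    then have "AE x in lborel. 1 + x \<in> {-1..2} \<longrightarrow> f (1 + x) = H (1 + x)" by (subst (asm) AE_distr_iff) auto
    then show ?thesis by (simp add: add.commute)
  qed
  have k: "AE x in leb_on (-1) 1. H (x + 1) = H x"
    unfolding AE_leb_on using ae ae1 by eventually_elim (use per in auto)
  have "H 1 = H 0"
  proof -
    have "(-1::real) < 1" "(0::real) \<in> {-1..1}" by auto
    then obtain x where x: "\<And>n. H (x n + 1) = H (x n)" "\<And>n. x n \<in> {-1..1}" "x \<longlonglongrightarrow> 0"
      by (rule AE_leb_on_dense[OF _ k]) (rule that; assumption)
    have "(\<lambda>n. x n + 1) \<longlonglongrightarrow> 0 + 1" by (intro tendsto_add x(3) tendsto_const)
    then have "(\<lambda>n. H (x n)) \<longlonglongrightarrow> H 0" "(\<lambda>n. H (x n + 1)) \<longlonglongrightarrow> H (0 + 1)"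
      using continuous_on_tendsto_compose[OF H x(3)] continuous_on_tendsto_compose[OF H, of "\<lambda>n. x n + 1" "0 + 1"] by simp_all
    then have "(\<lambda>n. H (x n)) \<longlonglongrightarrow> H 0" "(\<lambda>n. H (x n)) \<longlonglongrightarrow> H 1" unfolding x(1) by simp_all
    then show ?thesis using LIMSEQ_unique by blast
  qed
  then show "(\<integral>x. g x \<partial>I1) = 0" using split[of 1] by (simp add: H_def prim_upper)
  have "AE x in I1. f x = H 0 + prim 0 1 g x"
    unfolding AE_leb_on using ae
  proof eventually_elim
    case (elim x)
    then show ?case using split[of x] by (auto simp: H_def)
  qed
  then show "\<exists>c. AE x in I1. f x = c + prim 0 1 g x" by blast
qed

subsection \<open>From strong solutions to time slices\<close>

abbreviation OT :: "real \<Rightarrow> (real \<times> real \<times> real) measure" where "OT T \<equiv> leb3 0 T 0 1 0 1"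

lemma AE_Omega: "(AE y in Omega. P y) \<longleftrightarrow> (AE y in O2. P y)"
  unfolding Omega_def leb_on_pair by (rule AE_restrict_density) simp

lemma AE_Itime: "(AE t in Itime T. P t) \<longleftrightarrow> (AE t in leb_on 0 T. P t)"
  unfolding Itime_def leb_on_def by (rule AE_restrict_density) simp

lemma AE_OmegaT: "(AE p in OmegaT T. P p) \<longleftrightarrow> (AE p in OT T. P p)"
  unfolding OmegaT_def leb_on_triple by (rule AE_restrict_density) simp

lemma integrable_Omega: "f \<in> Borel \<Longrightarrow> integrable Omega f \<longleftrightarrow> integrable O2 f"
  and integral_Omega: "f \<in> Borel \<Longrightarrow> integral\<^sup>L Omega f = integral\<^sup>L O2 f" for f :: "real \<times> real \<Rightarrow> real"
  unfolding Omega_def leb_on_pair by (rule integrable_restrict_density integral_restrict_density; simp)+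

lemma nn_integral_Itime: "f \<in> Borel \<Longrightarrow> (\<integral>\<^sup>+t. f t \<partial>Itime T) = (\<integral>\<^sup>+t. f t \<partial>leb_on 0 T)"
  unfolding Itime_def leb_on_def by (simp add: nn_integral_restrict_space nn_integral_density mult.commute)

lemma L2_O2: "f \<in> L2 \<longleftrightarrow> torus_fun f \<and> integrable O2 (\<lambda>y. (f y)\<^sup>2)"
  unfolding L2_def using integrable_Omega[of "\<lambda>y. (f y)\<^sup>2"] by (auto simp: torus_fun_def)

lemma L2_meas: "f \<in> L2 \<Longrightarrow> f \<in> Borel" by (simp add: L2_def torus_fun_def)

lemma L2_norm_sq: "f \<in> Borel \<Longrightarrow> (L2_norm f)\<^sup>2 = (\<integral>y. (f y)\<^sup>2 \<partial>O2)"
  unfolding L2_norm_def using integral_Omega[of "\<lambda>y. (f y)\<^sup>2"] by simp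

lemma is_Lambda_hD:
  assumes "is_Lambda_h s f g"
  shows "f \<in> L2" "g \<in> L2" "AE z in I1. hf g k z = complex_of_real (\<bar>2 * pi * of_int k\<bar> powr s) * hf f k z"
proof -
  show L: "f \<in> L2" "g \<in> L2" using assms by (auto simp: is_Lambda_h_def)
  have "AE z in Itime 1. horiz_fourier g k z = complex_of_real (\<bar>2 * pi * of_int k\<bar> powr s) * horiz_fourier f k z"
    using assms unfolding is_Lambda_h_def Itime_def by blast
  then show "AE z in I1. hf g k z = complex_of_real (\<bar>2 * pi * of_int k\<bar> powr s) * hf f k z"
    using L[THEN L2_meas] by (simp add: AE_Itime hf_eq)
qed

lemma Lambda_h_is: "f \<in> dom_Lambda_h s \<Longrightarrow> is_Lambda_h s f (Lambda_h s f)"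
proof -
  assume "f \<in> dom_Lambda_h s"
  then have "\<exists>g. is_Lambda_h s f g" by (simp add: dom_Lambda_h_def)
  then show ?thesis unfolding Lambda_h_def by (rule someI_ex)
qed

lemma sq_dom_Lambda_h:
  assumes "f \<in> dom_Lambda_h s" "s \<ge> 0"
  shows "sq s (nz f) \<le> ennreal ((L2_norm f)\<^sup>2 + (L2_norm (Lambda_h s f))\<^sup>2)"
proof -
  note L = is_Lambda_hD[OF Lambda_h_is[OF assms(1)]]
  have "sq s (nz f) \<le> ennreal ((\<integral>p. (f p)\<^sup>2 \<partial>O2) + (\<integral>p. (Lambda_h s f p)\<^sup>2 \<partial>O2))"
    using L(1,2) assms(2) by (intro sq_multiplier L(3)) (auto simp: L2_O2 L2_meas)
  then show ?thesis using L by (simp add: L2_norm_sq L2_meas)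
qed

text \<open>\<open>f\<close> is only integrable on lines beforehand. Comparison of coefficients with
  Bessel for \<open>g\<close> and \<open>riesz_fischer\<close> for \<open>f\<close> gives its square
  integrability together with the bound.\<close>

lemma plancherel_le:
  assumes f [measurable]: "f \<in> Borel" and f1: "AE z in I1. integrable I1 (\<lambda>x. f (x, z))"
    and g [measurable]: "g \<in> Borel" and g2: "integrable O2 (\<lambda>p. (g p)\<^sup>2)"
    and le: "\<And>k. AE z in I1. norm (hf f k z) \<le> norm (hf g k z)"
  shows "integrable O2 (\<lambda>p. (f p)\<^sup>2)" "(\<integral>p. (f p)\<^sup>2 \<partial>O2) \<le> (\<integral>p. (g p)\<^sup>2 \<partial>O2)"
proof -
  have le': "AE z in I1. \<forall>k. norm (hf f k z) \<le> norm (hf g k z)" using le by (simp add: AE_all_countable)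
  have "AE z in I1. (\<integral>\<^sup>+x. ennreal ((f (x, z))\<^sup>2) \<partial>I1) \<le> ennreal (\<integral>x. (g (x, z))\<^sup>2 \<partial>I1)"
    using le' f1 O2_sections(1)[OF g2]
  proof eventually_elim
    case (elim z)
    note [measurable] = borel_section(1)[OF g, of z]
    have gi: "integrable I1 (\<lambda>x. g (x, z))" by (rule square_integrable_imp_integrable'[OF leb_on.finite_measure_axioms _ elim(3)]) simp
    have "(\<integral>\<^sup>+k. ennreal ((norm (hf f k z))\<^sup>2) \<partial>cs) \<le> (\<integral>\<^sup>+k. ennreal ((norm (hf g k z))\<^sup>2) \<partial>cs)"
      using elim(1) by (intro nn_integral_mono ennreal_leI power_mono) auto
    also have "\<dots> \<le> ennreal (\<integral>x. (g (x, z))\<^sup>2 \<partial>I1)"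
      unfolding hf_def using bessel[of "\<lambda>x. complex_of_real (g (x, z))"] gi elim(3) by simp
    finally have "(\<integral>\<^sup>+x. ennreal ((norm (complex_of_real (f (x, z))))\<^sup>2) \<partial>I1) \<le> ennreal (\<integral>x. (g (x, z))\<^sup>2 \<partial>I1)"
      unfolding hf_def using elim(2) by (intro riesz_fischer) auto
    then show ?case by simp
  qed
  then have "(\<integral>\<^sup>+z. \<integral>\<^sup>+x. ennreal ((f (x, z))\<^sup>2) \<partial>I1 \<partial>I1) \<le> (\<integral>\<^sup>+z. ennreal (\<integral>x. (g (x, z))\<^sup>2 \<partial>I1) \<partial>I1)"
    by (rule nn_integral_mono_AE)
  also have "\<dots> = ennreal (\<integral>p. (g p)\<^sup>2 \<partial>O2)"
    unfolding O2_sections(5)[OF g2] using O2_sections(3)[OF g2] by (intro nn_integral_eq_integral) auto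
  also have "(\<integral>\<^sup>+z. \<integral>\<^sup>+x. ennreal ((f (x, z))\<^sup>2) \<partial>I1 \<partial>I1) = (\<integral>\<^sup>+p. ennreal ((f p)\<^sup>2) \<partial>O2)"
    using leb_pair.nn_integral_snd[of "\<lambda>p. ennreal ((f p)\<^sup>2)"] f by simp
  finally have b: "(\<integral>\<^sup>+p. ennreal ((f p)\<^sup>2) \<partial>O2) \<le> ennreal (\<integral>p. (g p)\<^sup>2 \<partial>O2)" .
  show i: "integrable O2 (\<lambda>p. (f p)\<^sup>2)"
    by (rule integrableI_nonneg) (use b in \<open>auto intro: le_less_trans\<close>)
  have "ennreal (\<integral>p. (f p)\<^sup>2 \<partial>O2) \<le> ennreal (\<integral>p. (g p)\<^sup>2 \<partial>O2)" using b i by (simp add: nn_integral_eq_integral)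
  then show "(\<integral>p. (f p)\<^sup>2 \<partial>O2) \<le> (\<integral>p. (g p)\<^sup>2 \<partial>O2)" by (subst (asm) ennreal_le_iff) auto
qed

lemma field_section:
  assumes "case_prod v \<in> borel_measurable (borel :: (real \<times> real \<times> real) measure)"
  shows "v t \<in> Borel" "(\<lambda>p. v (fst p) (snd p)) \<in> Borel"
proof -
  have "Pair t \<in> borel_measurable (borel :: (real \<times> real) measure)" by (intro borel_measurable_continuous_onI continuous_intros)
  from measurable_compose[OF this assms] show "v t \<in> Borel" by simp
  show "(\<lambda>p. v (fst p) (snd p)) \<in> Borel" using assms by (simp add: case_prod_unfold)
qed

lemma AE_OT:
  assumes "AE p in OT T. P p" shows "AE t in leb_on 0 T. AE y in O2. P (t, y)"
proof -
  interpret pair_sigma_finite "leb_on 0 T" O2 by (intro pair_sigma_finite.intro sigma_finite_leb)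
  show ?thesis by (rule AE_pair[OF assms])
qed

lemma AE_OTI:
  assumes "AE t in leb_on 0 T. AE y in O2. P (t, y)" "{p. P p} \<in> sets borel" shows "AE p in OT T. P p"
proof -
  interpret pair_sigma_finite "leb_on 0 T" O2 by (intro pair_sigma_finite.intro sigma_finite_leb)
  show ?thesis
  proof (rule AE_pair_measure)
    show "{x \<in> space (OT T). P x} \<in> sets (OT T)" unfolding sets_leb3 space_pair_measure using assms(2) by simp
  qed (fact assms(1))
qed

lemma AE_leb2_fst: "(AE q in leb2 a b c d. P q) \<Longrightarrow> AE t in leb_on a b. AE x in leb_on c d. P (t, x)"
  by (rule leb_pair.AE_pair)

lemma OT_sections:
  fixes f :: "real \<times> real \<times> real \<Rightarrow> real"
  assumes "integrable (OT T) f"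
  shows "AE t in leb_on 0 T. integrable O2 (\<lambda>y. f (t, y))" "integrable (leb_on 0 T) (\<lambda>t. \<integral>y. f (t, y) \<partial>O2)"
    "(\<integral>p. f p \<partial>OT T) = (\<integral>t. \<integral>y. f (t, y) \<partial>O2 \<partial>leb_on 0 T)"
    "AE y in O2. integrable (leb_on 0 T) (\<lambda>t. f (t, y))" "integrable O2 (\<lambda>y. \<integral>t. f (t, y) \<partial>leb_on 0 T)"
    "(\<integral>p. f p \<partial>OT T) = (\<integral>y. \<integral>t. f (t, y) \<partial>leb_on 0 T \<partial>O2)"
proof -
  interpret pair_sigma_finite "leb_on 0 T" O2 by (intro pair_sigma_finite.intro sigma_finite_leb)
  have f: "integrable (OT T) (\<lambda>(t, y). f (t, y))" using assms by simp
  show "AE t in leb_on 0 T. integrable O2 (\<lambda>y. f (t, y))" by (rule AE_integrable_fst[OF f])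
  show "integrable (leb_on 0 T) (\<lambda>t. \<integral>y. f (t, y) \<partial>O2)" by (rule integrable_fst[OF f])
  show "(\<integral>p. f p \<partial>OT T) = (\<integral>t. \<integral>y. f (t, y) \<partial>O2 \<partial>leb_on 0 T)" using integral_fst[OF f] by simp
  show "AE y in O2. integrable (leb_on 0 T) (\<lambda>t. f (t, y))" by (rule AE_integrable_snd[OF f])
  show "integrable O2 (\<lambda>y. \<integral>t. f (t, y) \<partial>leb_on 0 T)" by (rule integrable_snd[OF f])
  show "(\<integral>p. f p \<partial>OT T) = (\<integral>y. \<integral>t. f (t, y) \<partial>leb_on 0 T \<partial>O2)" using integral_snd[OF f] by simp
qed

lemma integrable_OT_nonneg:
  assumes f: "f \<in> Borel" "\<And>p. 0 \<le> f p" and s: "AE t in leb_on 0 T. integrable O2 (\<lambda>y. f (t, y))"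
    and fin: "(\<integral>\<^sup>+t. ennreal (\<integral>y. f (t, y) \<partial>O2) \<partial>leb_on 0 T) < \<infinity>"
  shows "integrable (OT T) f"
proof (rule integrableI_nonneg)
  have "(\<integral>\<^sup>+p. ennreal (f p) \<partial>OT T) = (\<integral>\<^sup>+t. \<integral>\<^sup>+y. ennreal (f (t, y)) \<partial>O2 \<partial>leb_on 0 T)"
    by (rule sigma_finite_measure.nn_integral_fst[OF sigma_finite_leb(2), symmetric]) (use f in simp)
  also have "\<dots> = (\<integral>\<^sup>+t. ennreal (\<integral>y. f (t, y) \<partial>O2) \<partial>leb_on 0 T)"
  proof (rule nn_integral_cong_AE)
    show "AE t in leb_on 0 T. (\<integral>\<^sup>+y. ennreal (f (t, y)) \<partial>O2) = ennreal (\<integral>y. f (t, y) \<partial>O2)"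
      using s
    proof eventually_elim
      case (elim t) show ?case by (rule nn_integral_eq_integral[OF elim]) (simp add: f(2))
    qed
  qed
  finally show "(\<integral>\<^sup>+p. ennreal (f p) \<partial>OT T) < \<infinity>" using fin by simp
qed (use f in auto)

lemma integrable_box_iff:
  fixes f :: "real \<times> real \<times> real \<Rightarrow> real"
  assumes "f \<in> Borel"
  shows "integrable (leb3 a b c d e g) f \<longleftrightarrow> set_integrable lborel ({a..b} \<times> {c..d} \<times> {e..g}) f"
proof -
  have "integrable (leb3 a b c d e g) f \<longleftrightarrow> integrable (restrict_space lborel ({a..b} \<times> {c..d} \<times> {e..g})) f"
    unfolding leb_on_triple by (rule integrable_restrict_density[symmetric]) (use assms in auto)
  also have "\<dots> \<longleftrightarrow> set_integrable lborel ({a..b} \<times> {c..d} \<times> {e..g}) f"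
    unfolding set_integrable_def by (rule integrable_restrict_space) simp
  finally show ?thesis .
qed

lemma loc_integrable_box:
  assumes "loc_integrable U f" "f \<in> Borel" "{a..b} \<times> {c..d} \<times> {e..g} \<subseteq> U"
  shows "integrable (leb3 a b c d e g) f"
  using assms unfolding integrable_box_iff[OF assms(2)] loc_integrable_def
  by (auto intro!: compact_Times)

lemma integrable_box_subset:
  fixes f :: "real \<times> real \<times> real \<Rightarrow> real"
  assumes "integrable (leb3 a b c d e g) f" "f \<in> Borel"
    "a \<le> a'" "b' \<le> b" "c \<le> c'" "d' \<le> d" "e \<le> e'" "g' \<le> g"
  shows "integrable (leb3 a' b' c' d' e' g') f"
proof -
  have s: "{a'..b'} \<times> {c'..d'} \<times> {e'..g'} \<subseteq> {a..b} \<times> {c..d} \<times> {e..g}" using assms(3-8) by (auto simp: subset_iff)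
  show ?thesis using assms(1) unfolding integrable_box_iff[OF assms(2)] by (rule set_integrable_subset) (use s in auto)
qed

lemma C1c_shrink:
  assumes "\<phi> \<in> C1c a b" obtains a' b' where "a < a'" "a' < b'" "b' < b" "\<phi> \<in> C1c a' b'"
proof -
  obtain c d where cd: "a < c" "c < d" "d < b" "\<And>s. s \<notin> {c..d} \<Longrightarrow> \<phi> s = 0" using C1cE[OF assms] by metis
  have "\<phi> \<in> C1c ((a + c) / 2) ((d + b) / 2)"
    by (rule C1cI[OF C1c_deriv(2)[OF assms] C1c_deriv(1)[OF assms], of _ c d]) (use cd in \<open>auto simp: field_simps\<close>)
  then show ?thesis by (rule that[rotated -1]) (use cd in \<open>auto simp: field_simps\<close>)
qed

lemma space_time_box: "0 < t0 \<Longrightarrow> t1 < T \<Longrightarrow> 0 < z0 \<Longrightarrow> z1 < 1 \<Longrightarrow> {t0..t1} \<times> {x0..x1} \<times> {z0..z1} \<subseteq> space_time T"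
  and space_time_open_box: "0 \<le> t0 \<Longrightarrow> t1 \<le> T \<Longrightarrow> 0 \<le> z0 \<Longrightarrow> z1 \<le> 1 \<Longrightarrow> {t0<..<t1} \<times> {x0<..<x1} \<times> {z0<..<z1} \<subseteq> space_time T"
  by (auto simp: space_time_def)

text \<open>The vertical derivatives in the equation, in the definition of a strong solution and in
  the additional regularity condition are separately quantified; this identifies them. On an inner
  box their difference annihilates a total family.\<close>

lemma weak_dz_unique:
  assumes T: "T > 0" and 1: "weak_dz T u om" and 2: "weak_dz T u om'"
  shows "AE p in OT T. case_prod om p = case_prod om' p"
proof (rule exhaust3[OF T])
  fix t0 t1 z0 z1 :: real assume b: "0 < t0" "t0 < t1" "t1 < T" "0 < z0" "z0 < z1" "z1 < 1"
  let ?S = "leb_on t0 t1 \<Otimes>\<^sub>M (I1 \<Otimes>\<^sub>M leb_on z0 z1)"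
  have m [measurable]: "case_prod u \<in> Borel" "case_prod om \<in> Borel" "case_prod om' \<in> Borel"
    using 1 2 by (auto simp: weak_dz_def torus_field_def)
  have w: "weak_deriv (space_time T) (0, 0, 1) (case_prod u) (case_prod om)" "weak_deriv (space_time T) (0, 0, 1) (case_prod u) (case_prod om')"
    using 1 2 by (auto simp: weak_dz_def)
  have i: "integrable ?S (case_prod om)" "integrable ?S (case_prod om')"
    by (rule loc_integrable_box[OF _ _ space_time_box[OF b(1,3,4,6)]]; use w m in \<open>simp add: weak_deriv_def\<close>)+
  have "AE p in ?S. case_prod om p - case_prod om' p = 0"
  proof (rule total_testsD(1)[OF total_tests_pair[OF leb_on.finite_measure_axioms finite_measure_leb2 total_tests_C1c[OF b(2)] total_tests_box[of 0 1 z0 z1]]])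
    show "integrable ?S (\<lambda>p. case_prod om p - case_prod om' p)" by (intro Bochner_Integration.integrable_diff i)
    fix \<theta> assume "\<theta> \<in> {tensor \<phi> \<psi> |\<phi> \<psi>. \<phi> \<in> C1c t0 t1 \<and> \<psi> \<in> {tensor \<phi> \<psi> |\<phi> \<psi>. \<phi> \<in> C1c 0 1 \<and> \<psi> \<in> C1c z0 z1}}"
    then obtain \<phi> \<psi> \<xi> where \<theta>: "\<theta> = tensor \<phi> (tensor \<psi> \<xi>)" and t: "\<phi> \<in> C1c t0 t1" "\<psi> \<in> C1c 0 1" "\<xi> \<in> C1c z0 z1" by auto
    have U: "{t0<..<t1} \<times> {0<..<1} \<times> {z0<..<z1} \<subseteq> space_time T" using b by (intro space_time_open_box) auto
    have "total_tests ?S {tensor \<phi> \<psi> |\<phi> \<psi>. \<phi> \<in> C1c t0 t1 \<and> \<psi> \<in> {tensor \<phi> \<psi> |\<phi> \<psi>. \<phi> \<in> C1c 0 1 \<and> \<psi> \<in> C1c z0 z1}}"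
      using b by (intro total_tests_pair total_tests_box total_tests_C1c leb_on.finite_measure_axioms finite_measure_leb2) auto
    then have \<theta>b: "\<theta> \<in> borel_measurable ?S" "\<exists>C. \<forall>p. \<bar>\<theta> p\<bar> \<le> C" using t \<theta> by (blast intro: total_testsD(2,3))+
    then obtain C where C: "\<And>p. \<bar>\<theta> p\<bar> \<le> C" by blast
    have ii: "integrable ?S (\<lambda>p. case_prod om p * \<theta> p)" "integrable ?S (\<lambda>p. case_prod om' p * \<theta> p)"
      by (rule integrable_mult_bounded_AE(1)[OF i(1), of _ C] integrable_mult_bounded_AE(1)[OF i(2), of _ C]; use \<theta>b C in simp)+
    have \<theta>e: "\<theta> = (\<lambda>(t, x, z). \<phi> t * \<psi> x * \<xi> z)" by (auto simp: \<theta> tensor_def)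
    have "(\<integral>p. case_prod om p * \<theta> p \<partial>?S) = (\<integral>p. case_prod om' p * \<theta> p \<partial>?S)"
      using weak_box[OF w(1) m(1,2) t U] weak_box[OF w(2) m(1,3) t U] unfolding \<theta>e by simp
    then show "(\<integral>p. (case_prod om p - case_prod om' p) * \<theta> p \<partial>?S) = 0" 
      unfolding left_diff_distrib Bochner_Integration.integral_diff[OF ii] by (simp only: right_minus_eq)
  qed (use b in auto)
  then show "AE p in ?S. case_prod om p = case_prod om' p" by eventually_elim (simp only: right_minus_eq)
qed

lemma x_slices:
  assumes T: "T > 0" and w: "weak_dx T u ux"
  shows "AE q in leb_on 0 T \<Otimes>\<^sub>M I1. integrable I1 (\<lambda>x. ux (fst q) (x, snd q)) \<and> (\<integral>x. ux (fst q) (x, snd q) \<partial>I1) = 0 \<and>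
    (\<exists>c. AE x in I1. u (fst q) (x, snd q) = c + prim 0 1 (\<lambda>\<xi>. ux (fst q) (\<xi>, snd q)) x)"
proof (rule exhaust2[OF T])
  fix t0 t1 z0 z1 :: real assume b: "0 < t0" "t0 < t1" "t1 < T" "0 < z0" "z0 < z1" "z1 < 1"
  have m [measurable]: "case_prod u \<in> Borel" "case_prod ux \<in> Borel"
    using w by (auto simp: weak_dx_def torus_field_def)
  have wd: "weak_deriv (space_time T) (0, 1, 0) (case_prod u) (case_prod ux)" using w by (simp add: weak_dx_def)
  have i: "integrable (leb3 t0 t1 (-1) 2 z0 z1) (case_prod u)"
    "integrable (leb3 t0 t1 (-1) 2 z0 z1) (case_prod ux)"
    by (rule loc_integrable_box[OF _ _ space_time_box[OF b(1,3,4,6)]]; use wd m in \<open>simp add: weak_deriv_def\<close>)+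
  have U: "{t0<..<t1} \<times> {-1<..<2} \<times> {z0<..<z1} \<subseteq> space_time T" using b by (intro space_time_open_box) auto
  have per: "u t (x + 1, z) = u t (x, z)" for t x z using w by (auto simp: weak_dx_def torus_field_def)
  have "AE q in leb2 t0 t1 z0 z1. integrable (leb_on (-1) 2) (\<lambda>x. case_prod ux (fst q, x, snd q)) \<and>
    (\<exists>C. AE x in leb_on (-1) 2. case_prod u (fst q, x, snd q) = C + prim (-1) 2 (\<lambda>\<xi>. case_prod ux (fst q, \<xi>, snd q)) x)"
    by (rule slices_x[OF wd m U b(2) _ b(5) i]) simp
  then show "AE q in leb2 t0 t1 z0 z1. integrable I1 (\<lambda>x. ux (fst q) (x, snd q)) \<and> (\<integral>x. ux (fst q) (x, snd q) \<partial>I1) = 0 \<and>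
    (\<exists>c. AE x in I1. u (fst q) (x, snd q) = c + prim 0 1 (\<lambda>\<xi>. ux (fst q) (\<xi>, snd q)) x)"
  proof eventually_elim
    case (elim q)
    then obtain C where C: "AE x in leb_on (-1) 2. u (fst q) (x, snd q) = C + prim (-1) 2 (\<lambda>\<xi>. ux (fst q) (\<xi>, snd q)) x" by auto
    have gi: "integrable (leb_on (-1) 2) (\<lambda>x. ux (fst q) (x, snd q))" using elim by simp
    have mm: "(\<lambda>x. u (fst q) (x, snd q)) \<in> Borel" by (rule borel_section(1)[OF field_section(1)[OF m(1)]])
    show ?case using periodic_slice[OF per mm gi C] by blast
  qed
qed

lemma O2_integral_measurable:
  fixes f :: "real \<times> real \<times> real \<Rightarrow> real"
  assumes "f \<in> Borel" shows "(\<lambda>t. \<integral>y. f (t, y) \<partial>O2) \<in> Borel"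
proof -
  have "(\<lambda>(t, y). f (t, y)) \<in> borel_measurable (leb_on 0 1 \<Otimes>\<^sub>M O2)" using assms by simp
  from sigma_finite_measure.borel_measurable_lebesgue_integral[OF sigma_finite_leb(2) this] show ?thesis by simp
qed

lemma Collect_le_borel:
  fixes f :: "real \<times> real \<times> real \<Rightarrow> real"
  assumes [measurable]: "f \<in> Borel" shows "{p. \<bar>f p\<bar> \<le> C} \<in> sets borel"
  using borel_measurable_le[of "\<lambda>p. \<bar>f p\<bar>" borel "\<lambda>p. C"] by simp

lemma deriv_symbol_le:
  assumes "1 \<le> \<alpha>" shows "2 * pi * \<bar>real_of_int k\<bar> \<le> \<bar>2 * pi * real_of_int k\<bar> powr \<alpha>"
proof (cases "k = 0")
  case False
  then have "1 \<le> \<bar>real_of_int k\<bar>" by linarith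
  then have "1 * 1 \<le> (2 * pi) * \<bar>real_of_int k\<bar>" using pi_gt3 by (intro mult_mono) auto
  then have "1 \<le> \<bar>2 * pi * real_of_int k\<bar>" by (simp add: abs_mult)
  then have "\<bar>2 * pi * real_of_int k\<bar> powr 1 \<le> \<bar>2 * pi * real_of_int k\<bar> powr \<alpha>" using assms by (intro powr_mono)
  then show ?thesis by (simp add: abs_mult)
qed simp

lemma sl_ux_le_g:
  assumes s: "slice \<alpha> C u ux om w g" and \<alpha>: "1 \<le> \<alpha>"
  shows "(\<integral>p. (ux p)\<^sup>2 \<partial>O2) \<le> (\<integral>p. (g p)\<^sup>2 \<partial>O2)"
proof (rule plancherel_le(2)[OF sl_meas(2)[OF s] O2_sections(1)[OF sl_int(5)[OF s]] sl_meas(5)[OF s] sl_sq(2)[OF s]])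
  fix k show "AE z in I1. norm (hf ux k z) \<le> norm (hf g k z)"
    using sl_hf_ux[OF s, of k] sl_g[OF s, of k] by eventually_elim (use deriv_symbol_le[OF \<alpha>] in \<open>simp add: norm_mult mult_right_mono\<close>)
qed

text \<open>The slices of a solution with a bound \<open>C\<close> uniform in time. Space-time
  square integrability is recorded for \<open>g\<close>, from which that of \<open>ux\<close>
  follows.\<close>

definition flow :: "real \<Rightarrow> real \<Rightarrow> real \<Rightarrow> (real \<times> real \<times> real \<Rightarrow> real) \<Rightarrow> (real \<times> real \<times> real \<Rightarrow> real) \<Rightarrow> (real \<times> real \<times> real \<Rightarrow> real) \<Rightarrow>
    (real \<times> real \<times> real \<Rightarrow> real) \<Rightarrow> (real \<times> real \<times> real \<Rightarrow> real) \<Rightarrow> bool" where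
  "flow \<alpha> T C u ux om w g \<longleftrightarrow>
    u \<in> Borel \<and> ux \<in> Borel \<and> om \<in> Borel \<and>
    w \<in> Borel \<and> g \<in> Borel \<and>
    (AE t in leb_on 0 T. slice \<alpha> C (\<lambda>y. u (t, y)) (\<lambda>y. ux (t, y)) (\<lambda>y. om (t, y)) (\<lambda>y. w (t, y)) (\<lambda>y. g (t, y))) \<and>
    integrable (OT T) (\<lambda>p. (g p)\<^sup>2)"

text \<open>The last claim is the aim: the nonlinear and dissipative terms are integrable up to the
  boundary of space-time. \<open>g\<close> dominates \<open>ux\<close> in \<open>L2\<close>, which
  dominates \<open>w\<close> in \<open>L1\<close>, and in the products the other factors
  \<open>u\<close> and \<open>om\<close> are bounded.\<close>

lemma flow_integrable:
  assumes F: "flow \<alpha> T C u ux om w g" and \<alpha>: "1 \<le> \<alpha>"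
  shows "u \<in> Borel" "ux \<in> Borel" "om \<in> Borel" "w \<in> Borel" "g \<in> Borel"
    and "AE p in OT T. \<bar>u p\<bar> \<le> C" "AE p in OT T. \<bar>om p\<bar> \<le> C" "integrable (OT T) u" "integrable (OT T) (\<lambda>p. (u p)\<^sup>2)"
    and "integrable (OT T) (\<lambda>p. u p * ux p + w p * om p + \<nu> * g p)"
proof -
  show m [measurable]: "u \<in> Borel" "ux \<in> Borel" "om \<in> Borel" "w \<in> Borel" "g \<in> Borel"
    using F by (auto simp: flow_def)
  have sl: "AE t in leb_on 0 T. slice \<alpha> C (\<lambda>y. u (t, y)) (\<lambda>y. ux (t, y)) (\<lambda>y. om (t, y)) (\<lambda>y. w (t, y)) (\<lambda>y. g (t, y))"
    and g2: "integrable (OT T) (\<lambda>p. (g p)\<^sup>2)" using F by (auto simp: flow_def)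
  show bu: "AE p in OT T. \<bar>u p\<bar> \<le> C" by (rule AE_OTI[OF _ Collect_le_borel[OF m(1)]]) (use sl in eventually_elim, rule sl_bd(1))
  show bom: "AE p in OT T. \<bar>om p\<bar> \<le> C" by (rule AE_OTI[OF _ Collect_le_borel[OF m(3)]]) (use sl in eventually_elim, rule sl_bd(2))
  show "integrable (OT T) u" by (rule integrable_bounded_AE[OF finite_measure_leb3, where C=C]) (use bu in auto)
  have "AE p in OT T. norm ((u p)\<^sup>2) \<le> C\<^sup>2"
    using bu by eventually_elim (metis abs_power2 power2_abs power_mono abs_ge_zero real_norm_def)
  then show "integrable (OT T) (\<lambda>p. (u p)\<^sup>2)" by (rule integrable_bounded_AE[OF finite_measure_leb3, rotated]) auto
  have fin: "(\<integral>\<^sup>+t. ennreal (\<integral>y. f (t, y) \<partial>O2) \<partial>leb_on 0 T) < \<infinity>" if f: "integrable (OT T) f" and f0: "\<And>p. f p \<ge> 0" for f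
    using OT_sections(2)[OF f] f0 by (subst nn_integral_eq_integral) auto
  have ux2: "integrable (OT T) (\<lambda>p. (ux p)\<^sup>2)"
  proof (rule integrable_OT_nonneg)
    show "AE t in leb_on 0 T. integrable O2 (\<lambda>y. (ux (t, y))\<^sup>2)" using sl by eventually_elim (rule sl_sq(1))
    have "(\<integral>\<^sup>+t. ennreal (\<integral>y. (ux (t, y))\<^sup>2 \<partial>O2) \<partial>leb_on 0 T) \<le> (\<integral>\<^sup>+t. ennreal (\<integral>y. (g (t, y))\<^sup>2 \<partial>O2) \<partial>leb_on 0 T)"
      by (rule nn_integral_mono_AE) (use sl in eventually_elim, rule ennreal_leI, rule sl_ux_le_g[OF _ \<alpha>])
    also have "\<dots> < \<infinity>" by (rule fin[OF g2]) simp
    finally show "(\<integral>\<^sup>+t. ennreal (\<integral>y. (ux (t, y))\<^sup>2 \<partial>O2) \<partial>leb_on 0 T) < \<infinity>" .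
  qed auto
  have ux: "integrable (OT T) ux" by (rule square_integrable_imp_integrable'[OF finite_measure_leb3 _ ux2]) simp
  have g: "integrable (OT T) g" by (rule square_integrable_imp_integrable'[OF finite_measure_leb3 _ g2]) simp
  have "integrable (OT T) (\<lambda>p. \<bar>w p\<bar>)"
  proof (rule integrable_OT_nonneg)
    show "AE t in leb_on 0 T. integrable O2 (\<lambda>y. \<bar>w (t, y)\<bar>)" using sl by eventually_elim (intro integrable_abs sl_w_int)
    have "(\<integral>\<^sup>+t. ennreal (\<integral>y. \<bar>w (t, y)\<bar> \<partial>O2) \<partial>leb_on 0 T) \<le> (\<integral>\<^sup>+t. ennreal (\<integral>y. \<bar>ux (t, y)\<bar> \<partial>O2) \<partial>leb_on 0 T)"
      by (rule nn_integral_mono_AE) (use sl in eventually_elim, rule ennreal_leI, rule sl_w_L1)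
    also have "\<dots> < \<infinity>" by (rule fin[OF integrable_abs[OF ux]]) simp
    finally show "(\<integral>\<^sup>+t. ennreal (\<integral>y. \<bar>w (t, y)\<bar> \<partial>O2) \<partial>leb_on 0 T) < \<infinity>" .
  qed auto
  then have w: "integrable (OT T) w" by (simp add: integrable_abs_iff)
  have "integrable (OT T) (\<lambda>p. u p * ux p)" by (rule integrable_mult_bounded_AE(2)[OF ux, of _ C]) (use bu in auto)
  moreover have "integrable (OT T) (\<lambda>p. w p * om p)" by (rule integrable_mult_bounded_AE(1)[OF w, of _ C]) (use bom in auto)
  ultimately show "integrable (OT T) (\<lambda>p. u p * ux p + w p * om p + \<nu> * g p)" using g by simp
qed

text \<open>Every clause of the definition is moved to almost every time slice. The vertical
  derivative is the prescribed \<open>om\<close>, so that the regularity known for it enters the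
  equation.\<close>

lemma strong_solution_flow:
  fixes u om :: field
  assumes T: "T > 0" and \<alpha>: "1 < \<alpha>" and S: "strong_solution \<nu> \<alpha> T u0 u" and om: "weak_dz T u om" and bom: "AE p in OT T. \<bar>case_prod om p\<bar> \<le> C0"
  obtains C ux w g ut P px pz where "flow \<alpha> T C (case_prod u) ux (case_prod om) w g"
    "weak_deriv (space_time T) (1, 0, 0) (case_prod u) ut" "weak_deriv (space_time T) (0, 1, 0) P px" "weak_deriv (space_time T) (0, 0, 1) P pz"
    "ut \<in> Borel" "P \<in> Borel" "px \<in> Borel" "pz \<in> Borel"
    "AE p in OT T. ut p + (case_prod u p * ux p + w p * case_prod om p + \<nu> * g p) + px p = 0" "AE p in OT T. pz p = 0"
proof -
  obtain ut ux uz w wz P px pz g where *: "weak_dt T u ut" "weak_dx T u ux" "weak_dz T u uz" "weak_dx T P px" "weak_dz T P pz" "weak_dz T w wz"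
      "torus_field g" "AE t in Itime T. is_Lambda_h \<alpha> (u t) (g t)"
    and eq: "AE (t, y) in OmegaT T. ut t y + u t y * ux t y + w t y * uz t y + px t y + \<nu> * g t y = 0"
    and pz0: "AE (t, y) in OmegaT T. pz t y = 0"
    and wf: "AE (t, x) in restrict_space lborel ({0..T} \<times> {0..1}).
       (\<forall>z\<in>{0..1}. w t (x, z) = - (LINT \<zeta>:{0..z}|lborel. ux t (x, \<zeta>))) \<and> w t (x, 0) = 0 \<and> w t (x, 1) = 0"
    using S unfolding strong_solution_def fpe_holds_def by blast
  have m [measurable]: "case_prod u \<in> Borel" "case_prod ux \<in> Borel" "case_prod om \<in> Borel"
    "case_prod w \<in> Borel" "case_prod g \<in> Borel"
    using * om by (auto simp: weak_dt_def weak_dx_def weak_dz_def torus_field_def)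
  note ms = field_section(1)[OF m(1)] field_section(1)[OF m(2)] field_section(1)[OF m(3)] field_section(1)[OF m(4)] field_section(1)[OF m(5)]
  obtain Cu where "AE t in Itime T. u t \<in> Linf \<and> (AE y in Omega. \<bar>u t y\<bar> \<le> Cu)" using S unfolding strong_solution_def Linf_Linf_def by blast
  then have bu: "AE t in leb_on 0 T. AE y in O2. \<bar>u t y\<bar> \<le> Cu" unfolding AE_Itime AE_Omega by eventually_elim blast
  have buT: "AE p in OT T. \<bar>case_prod u p\<bar> \<le> Cu" by (rule AE_OTI[OF _ Collect_le_borel[OF m(1)]]) (use bu in simp)
  have iu: "integrable (OT T) (case_prod u)" by (rule integrable_bounded_AE[OF finite_measure_leb3, where C=Cu]) (use buT in simp_all)
  have io: "integrable (OT T) (case_prod om)" by (rule integrable_bounded_AE[OF finite_measure_leb3, where C=C0]) (use bom in simp_all)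
  define C where "C = max Cu C0"
  have xs: "AE t in leb_on 0 T. AE z in I1. integrable I1 (\<lambda>x. ux t (x, z)) \<and> (\<integral>x. ux t (x, z) \<partial>I1) = 0 \<and>
      (\<exists>c. AE x in I1. u t (x, z) = c + prim 0 1 (\<lambda>\<xi>. ux t (\<xi>, z)) x)"
    using AE_leb2_fst[OF x_slices[OF T *(2)]] by simp
  have wom: "weak_deriv (space_time T) (0, 0, 1) (case_prod u) (case_prod om)" using om by (simp add: weak_dz_def)
  have U: "{0<..<T} \<times> {0<..<1} \<times> {0<..<1} \<subseteq> space_time T" by (rule space_time_open_box) simp_all
  have "AE q in leb_on 0 T \<Otimes>\<^sub>M I1. integrable I1 (\<lambda>z. case_prod om (fst q, snd q, z)) \<and>
      (\<exists>C. AE z in I1. case_prod u (fst q, snd q, z) = C + prim 0 1 (\<lambda>\<zeta>. case_prod om (fst q, snd q, \<zeta>)) z)"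
    by (rule slices_z[OF wom m(1,3) U T _ _ iu io]) simp_all
  from AE_leb2_fst[OF this] have zs: "AE t in leb_on 0 T. AE x in I1. \<exists>c. AE z in I1. u t (x, z) = c + prim 0 1 (\<lambda>\<zeta>. om t (x, \<zeta>)) z"
    by simp
  have "AE q in leb_on 0 T \<Otimes>\<^sub>M I1. (\<forall>z\<in>{0..1}. w (fst q) (snd q, z) = - (LINT \<zeta>:{0..z}|lborel. ux (fst q) (snd q, \<zeta>))) \<and> w (fst q) (snd q, 1) = 0"
    using wf unfolding leb_on_pair by (subst (asm) AE_restrict_density) (auto elim!: eventually_mono)
  from AE_leb2_fst[OF this] have ws: "AE t in leb_on 0 T. AE x in I1. (\<integral>z. ux t (x, z) \<partial>I1) = 0 \<and> (AE z in I1. w t (x, z) = - prim 0 1 (\<lambda>\<zeta>. ux t (x, \<zeta>)) z)"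
  proof (rule eventually_mono)
    fix t assume A: "AE x in I1. (\<forall>z\<in>{0..1}. w (fst (t, x)) (snd (t, x), z) = - (LINT \<zeta>:{0..z}|lborel. ux (fst (t, x)) (snd (t, x), \<zeta>))) \<and> w (fst (t, x)) (snd (t, x), 1) = 0"
    show "AE x in I1. (\<integral>z. ux t (x, z) \<partial>I1) = 0 \<and> (AE z in I1. w t (x, z) = - prim 0 1 (\<lambda>\<zeta>. ux t (x, \<zeta>)) z)"
      using A
    proof eventually_elim
      case (elim x)
      note uxm = borel_section(2)[OF ms(2)[of t], of x]
      have a: "w t (x, z) = - (LINT \<zeta>:{0..z}|lborel. ux t (x, \<zeta>))" if "z \<in> {0..1}" for z using elim that by simp
      \<comment> \<open>The formula for \<open>w\<close> at \<open>z = 1\<close> meets the boundary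
        value there.\<close>
      have "(\<integral>z. ux t (x, z) \<partial>I1) = 0" using a[of 1] elim integral_leb_on[OF uxm, of 0 1] by simp
      moreover have "AE z in I1. w t (x, z) = - prim 0 1 (\<lambda>\<zeta>. ux t (x, \<zeta>)) z"
        unfolding AE_leb_on by (intro AE_I2 impI) (use a prim_eq[OF uxm] in simp)
      ultimately show ?case by blast
    qed
  qed
  have gl: "AE t in leb_on 0 T. is_Lambda_h \<alpha> (u t) (g t)" using *(8) by (simp add: AE_Itime)
  have ob: "AE t in leb_on 0 T. AE y in O2. \<bar>om t y\<bar> \<le> C0" using AE_OT[OF bom] by simp
  have sl: "AE t in leb_on 0 T. slice \<alpha> C (u t) (ux t) (om t) (w t) (g t)"
    using bu ob xs zs ws gl
  proof eventually_elim
    case (elim t)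
    note L = is_Lambda_hD[OF elim(6)]
    have g2: "integrable O2 (\<lambda>y. (g t y)\<^sup>2)" using L(2) by (simp add: L2_O2)
    \<comment> \<open>At integer frequencies the symbol of the derivative is at most that of order
      \<alpha>, so \<open>ux\<close> inherits square integrability from \<open>g\<close>.\<close>
    have le: "AE z in I1. norm (hf (ux t) k z) \<le> norm (hf (g t) k z)" for k
      using elim(3) L(3)[of k]
    proof eventually_elim
      case (elim z)
      then obtain c where c: "AE x in I1. u t (x, z) = c + prim 0 1 (\<lambda>\<xi>. ux t (\<xi>, z)) x" by blast
      have "hf (ux t) k z = 2 * pi * \<i> * of_int k * hf (u t) k z"
        unfolding hf_def by (rule fc_deriv[OF _ _ c]) (use elim(1) borel_section(1)[OF ms(1)] in auto)
      then show ?case unfolding elim(2) using deriv_symbol_le[of \<alpha> k] \<alpha> by (simp add: norm_mult mult_right_mono)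
    qed
    have xi: "AE z in I1. integrable I1 (\<lambda>x. ux t (x, z))" using elim(3) by eventually_elim blast
    have ux2: "integrable O2 (\<lambda>y. (ux t y)\<^sup>2)" by (rule plancherel_le(1)[OF ms(2) xi ms(5) g2 le])
    have xx: "AE z in I1. (\<integral>x. ux t (x, z) \<partial>I1) = 0 \<and> (\<exists>c. AE x in I1. u t (x, z) = c + prim 0 1 (\<lambda>\<xi>. ux t (\<xi>, z)) x)"
      using elim(3) by eventually_elim blast
    have b: "AE y in O2. \<bar>u t y\<bar> \<le> C" "AE y in O2. \<bar>om t y\<bar> \<le> C" 
      by (use elim(1) in eventually_elim, simp add: C_def) (use elim(2) in eventually_elim, simp add: C_def)
    show ?case unfolding slice_def by (intro conjI ms b ux2 g2 xx elim(4,5) allI L(3))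
  qed
  have g2T: "integrable (OT T) (\<lambda>p. (case_prod g p)\<^sup>2)"
  proof (rule integrable_OT_nonneg)
    show "AE t in leb_on 0 T. integrable O2 (\<lambda>y. (case_prod g (t, y))\<^sup>2)" using sl by eventually_elim (simp add: sl_sq(2))
    have mg: "(\<lambda>t. \<integral>y. (case_prod g (t, y))\<^sup>2 \<partial>O2) \<in> Borel" by (rule O2_integral_measurable) (rule borel_measurable_power[OF m(5)])
    then have mg': "(\<lambda>t. ennreal (\<integral>y. (case_prod g (t, y))\<^sup>2 \<partial>O2)) \<in> Borel" by measurable
    have d: "AE t in Itime T. u t \<in> dom_Lambda_h \<alpha>" and f: "(\<integral>\<^sup>+ t. ennreal ((L2_norm (u t))\<^sup>2 + (L2_norm (Lambda_h \<alpha> (u t)))\<^sup>2) \<partial>Itime T) < \<infinity>"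
      using S unfolding strong_solution_def L2_dom_def by auto
    have "(\<integral>\<^sup>+t. ennreal (\<integral>y. (case_prod g (t, y))\<^sup>2 \<partial>O2) \<partial>leb_on 0 T) = (\<integral>\<^sup>+t. ennreal (\<integral>y. (case_prod g (t, y))\<^sup>2 \<partial>O2) \<partial>Itime T)"
      by (rule nn_integral_Itime[OF mg', symmetric])
    also have "\<dots> \<le> (\<integral>\<^sup>+ t. ennreal ((L2_norm (u t))\<^sup>2 + (L2_norm (Lambda_h \<alpha> (u t)))\<^sup>2) \<partial>Itime T)"
    proof (rule nn_integral_mono_AE)
      show "AE t in Itime T. ennreal (\<integral>y. (case_prod g (t, y))\<^sup>2 \<partial>O2) \<le> ennreal ((L2_norm (u t))\<^sup>2 + (L2_norm (Lambda_h \<alpha> (u t)))\<^sup>2)"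
        using d *(8)
      proof eventually_elim
        case (elim t)
        note L = is_Lambda_hD[OF elim(2)] and M = is_Lambda_hD[OF Lambda_h_is[OF elim(1)]]
        have gi: "integrable O2 (g t)"
          by (rule square_integrable_imp_integrable'[OF finite_measure_leb2]) (use L(2) ms(5) in \<open>simp_all add: L2_O2\<close>)
        \<comment> \<open>\<open>g t\<close> and the chosen representative
          \<open>Lambda_h \<alpha> (u t)\<close> are related only through their coefficients, so
          their norms are compared by \<open>plancherel_le\<close>.\<close>
        have "(\<integral>y. (g t y)\<^sup>2 \<partial>O2) \<le> (\<integral>y. (Lambda_h \<alpha> (u t) y)\<^sup>2 \<partial>O2)"
        proof (rule plancherel_le(2)[OF ms(5) O2_sections(1)[OF gi] L2_meas[OF M(2)]])
          show "integrable O2 (\<lambda>p. (Lambda_h \<alpha> (u t) p)\<^sup>2)" using M(2) by (simp add: L2_O2)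
          show "AE z in I1. norm (hf (g t) k z) \<le> norm (hf (Lambda_h \<alpha> (u t)) k z)" for k
            using L(3)[of k] M(3)[of k] by eventually_elim simp
        qed
        also have "\<dots> = (L2_norm (Lambda_h \<alpha> (u t)))\<^sup>2" by (rule L2_norm_sq[OF L2_meas[OF M(2)], symmetric])
        also have "\<dots> \<le> (L2_norm (u t))\<^sup>2 + (L2_norm (Lambda_h \<alpha> (u t)))\<^sup>2" by simp
        finally show ?case by (intro ennreal_leI) simp
      qed
    qed
    finally show "(\<integral>\<^sup>+t. ennreal (\<integral>y. (case_prod g (t, y))\<^sup>2 \<partial>O2) \<partial>leb_on 0 T) < \<infinity>" using f by (rule le_less_trans)
  qed (rule borel_measurable_power[OF m(5)], rule zero_le_power2)
  have fl: "flow \<alpha> T C (case_prod u) (case_prod ux) (case_prod om) (case_prod w) (case_prod g)"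
    unfolding flow_def using sl g2T m by (intro conjI) (simp_all only: prod.case)
  have eq': "AE p in OT T. case_prod ut p + (case_prod u p * case_prod ux p + case_prod w p * case_prod om p + \<nu> * case_prod g p) + case_prod px p = 0"
    using eq[unfolded AE_OmegaT] weak_dz_unique[OF T *(3) om] by eventually_elim (auto simp: case_prod_unfold)
  have pz0': "AE p in OT T. case_prod pz p = 0" using pz0[unfolded AE_OmegaT] by eventually_elim auto
  show ?thesis
    by (rule that[OF fl _ _ _ _ _ _ _ eq' pz0'])
       (use *(1,4,5) in \<open>auto simp: weak_dt_def weak_dx_def weak_dz_def torus_field_def\<close>)
qed

section \<open>Elimination of the pressure\<close>

lemma C1c_integral_shrink:
  assumes c: "c \<in> C1c z0 z1" and z: "0 \<le> z0" "z1 \<le> 1" shows "(\<integral>z. c z \<partial>leb_on z0 z1) = (\<integral>z. c z \<partial>I1)"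
proof -
  have m: "c \<in> Borel" by (rule C1c_measurable[OF c])
  have "indicator {z0..z1} z *\<^sub>R c z = indicator {0..1} z *\<^sub>R c z" for z
    using C1c_outside(1)[OF c, of z] z by (cases "z0 < z \<and> z < z1") auto
  then show ?thesis unfolding integral_leb_on[OF m] set_lebesgue_integral_def by (simp only:)
qed

abbreviation prod_test :: "(real \<Rightarrow> real) \<Rightarrow> (real \<Rightarrow> real) \<Rightarrow> (real \<Rightarrow> real) \<Rightarrow> real \<times> real \<times> real \<Rightarrow> real" where
  "prod_test a b c p \<equiv> a (fst p) * (b (fst (snd p)) * c (snd (snd p)))"

lemma prod_test_integrable:
  fixes f :: "real \<times> real \<times> real \<Rightarrow> real"
  assumes f: "integrable M f" and M: "sets M = sets borel" and m: "a \<in> Borel" "b \<in> Borel" "c \<in> Borel"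
    and K: "\<And>s. \<bar>a s\<bar> \<le> Ka" "\<And>s. \<bar>b s\<bar> \<le> Kb" "\<And>s. \<bar>c s\<bar> \<le> Kc"
  shows "integrable M (\<lambda>p. f p * prod_test a b c p)"
proof (rule integrable_mult_bounded_AE(1)[OF f, where C="Ka * (Kb * Kc)"])
  have [measurable]: "(\<lambda>p::real\<times>real\<times>real. a (fst p)) \<in> Borel" "(\<lambda>p::real\<times>real\<times>real. b (fst (snd p))) \<in> Borel"
    "(\<lambda>p::real\<times>real\<times>real. c (snd (snd p))) \<in> Borel"
    by (rule measurable_compose[OF borel_measurable_continuous_onI m(1)] measurable_compose[OF borel_measurable_continuous_onI m(2)]
        measurable_compose[OF borel_measurable_continuous_onI m(3)]; intro continuous_intros)+
  have "(\<lambda>p. prod_test a b c p) \<in> Borel" by measurable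
  then show "(\<lambda>p. prod_test a b c p) \<in> borel_measurable M" using measurable_cong_sets[OF M refl] by blast
  have "\<bar>prod_test a b c p\<bar> \<le> Ka * (Kb * Kc)" for p
    unfolding abs_mult using K by (intro mult_mono) (auto intro: order_trans[OF abs_ge_zero])
  then show "AE p in M. norm (prod_test a b c p) \<le> Ka * (Kb * Kc)" by simp
qed

text \<open>Test functions in \<open>z\<close> with mean zero remove the pressure, which does not depend on \<open>z\<close>.\<close>

lemma weak_form_without_pressure:
  fixes u N ut P px pz :: "real \<times> real \<times> real \<Rightarrow> real"
  assumes T: "T > 0" and m [measurable]: "u \<in> Borel" "N \<in> Borel" "ut \<in> Borel" "P \<in> Borel"
      "px \<in> Borel" "pz \<in> Borel"
    and w: "weak_deriv (space_time T) (1, 0, 0) u ut" "weak_deriv (space_time T) (0, 1, 0) P px" "weak_deriv (space_time T) (0, 0, 1) P pz"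
    and eq: "AE p in OT T. ut p + N p + px p = 0" and pz0: "AE p in OT T. pz p = 0" and Ni: "integrable (OT T) N"
    and a0: "a \<in> C1c 0 T" and b: "b \<in> C1c 0 1" and c0: "c \<in> C1c 0 1" and cz: "(\<integral>z. c z \<partial>I1) = 0"
  shows "(\<integral>p. u p * prod_test (deriv a) b c p \<partial>OT T) = (\<integral>p. N p * prod_test a b c p \<partial>OT T)"
proof -
  \<comment> \<open>The tests live in a smaller box away from the initial and final time and from
    the horizontal boundaries; there \<open>ut\<close>, \<open>P\<close>, \<open>px\<close> and
    \<open>pz\<close> are integrable and the equation can be split into its terms.\<close>
  obtain t0 t1 where t: "0 < t0" "t0 < t1" "t1 < T" and a: "a \<in> C1c t0 t1" using C1c_shrink[OF a0] by metis
  obtain z0 z1 where z: "0 < z0" "z0 < z1" "z1 < 1" and c: "c \<in> C1c z0 z1" using C1c_shrink[OF c0] by metis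
  let ?S = "leb_on t0 t1 \<Otimes>\<^sub>M (I1 \<Otimes>\<^sub>M leb_on z0 z1)"
  have U: "{t0<..<t1} \<times> {0<..<1} \<times> {z0<..<z1} \<subseteq> space_time T" by (rule space_time_open_box) (use t z in auto)
  have UT: "{0<..<T} \<times> {0<..<1} \<times> {0<..<1} \<subseteq> space_time T" by (rule space_time_open_box) auto
  have cb: "(\<lambda>p::real\<times>real\<times>real. h (fst p)) \<in> Borel" "(\<lambda>p::real\<times>real\<times>real. h (fst (snd p))) \<in> Borel"
    "(\<lambda>p::real\<times>real\<times>real. h (snd (snd p))) \<in> Borel" if "h \<in> Borel" for h :: "real \<Rightarrow> real"
    by (rule measurable_compose[OF borel_measurable_continuous_onI that]; intro continuous_intros)+
  note [measurable] = cb[OF C1c_measurable(1)[OF a]] cb[OF C1c_measurable(2)[OF a]] cb[OF C1c_measurable(1)[OF b]] cb[OF C1c_measurable(2)[OF b]]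
    cb[OF C1c_measurable(1)[OF c]]
  obtain Ka where Ka: "\<And>s. \<bar>a s\<bar> \<le> Ka" "\<And>s. \<bar>deriv a s\<bar> \<le> Ka" using C1c_bounded[OF a] by metis
  obtain Kb where Kb: "\<And>s. \<bar>b s\<bar> \<le> Kb" "\<And>s. \<bar>deriv b s\<bar> \<le> Kb" using C1c_bounded[OF b] by metis
  obtain Kc where Kc: "\<And>s. \<bar>c s\<bar> \<le> Kc" using C1c_bounded[OF c] by metis
  note ti = prod_test_integrable[OF _ sets_leb3 C1c_measurable(1)[OF a] _ C1c_measurable(1)[OF c] Ka(1) _ Kc]
  have conv: "(\<integral>p. f p * prod_test a' b c p \<partial>OT T) = (\<integral>p. f p * prod_test a' b c p \<partial>?S)"
    if [measurable]: "f \<in> Borel" and a': "a' \<in> {a, deriv a}" for f a'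
  proof -
    have ma: "(\<lambda>p::real\<times>real\<times>real. a' (fst p)) \<in> Borel" using a' cb[OF C1c_measurable(1)[OF a]] cb[OF C1c_measurable(2)[OF a]] by auto
    note [measurable] = ma
    have mm: "(\<lambda>p. f p * prod_test a' b c p) \<in> Borel" by measurable
    have van: "f (t, x, z) * (a' (fst (t, x, z)) * (b (fst (snd (t, x, z))) * c (snd (snd (t, x, z))))) = 0"
      if "\<not> (t0 < t \<and> t < t1 \<and> 0 < x \<and> x < 1 \<and> z0 < z \<and> z < z1)" for t x z
      using that a' C1c_outside[OF a, of t] C1c_outside[OF b, of x] C1c_outside[OF c, of z] by auto
    have "(LINT p:space_time T|lborel. f p * prod_test a' b c p) = (\<integral>p. f p * prod_test a' b c p \<partial>OT T)"
      by (rule integral_box[OF mm van UT]) (use t z in auto)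
    moreover have "(LINT p:space_time T|lborel. f p * prod_test a' b c p) = (\<integral>p. f p * prod_test a' b c p \<partial>?S)"
      by (rule integral_box[OF mm van U])
    ultimately show ?thesis by simp
  qed
  have toS: "AE p in ?S. Q p" if "AE p in OT T. Q p" for Q
    using that unfolding AE_leb3_iff by eventually_elim (use t z in auto)
  have box: "{t0..t1} \<times> {x0..x1} \<times> {z0..z1} \<subseteq> space_time T" for x0 x1 by (rule space_time_box) (use t z in auto)
  have Pi: "integrable ?S P" by (rule loc_integrable_box[OF _ _ box]) (use w in \<open>auto simp: weak_deriv_def\<close>)
  have pxi: "integrable ?S px" by (rule loc_integrable_box[OF _ _ box]) (use w in \<open>auto simp: weak_deriv_def\<close>)
  have pzi: "integrable ?S pz" by (rule loc_integrable_box[OF _ _ box]) (use w in \<open>auto simp: weak_deriv_def\<close>)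
  have NS: "integrable ?S N" by (rule integrable_box_subset[OF Ni]) (use t z in auto)
  have 1: "(\<integral>p. u p * prod_test (deriv a) b c p \<partial>?S) = - (\<integral>p. ut p * prod_test a b c p \<partial>?S)"
    using weak_box[OF w(1) m(1,3) a b c U] by (simp add: case_prod_unfold mult.assoc)
  have 2: "(\<integral>p. P p * prod_test a (deriv b) c p \<partial>?S) = - (\<integral>p. px p * prod_test a b c p \<partial>?S)"
    using weak_box[OF w(2) m(4,5) a b c U] by (simp add: case_prod_unfold mult.assoc)
  have "(\<integral>p. ut p * prod_test a b c p \<partial>?S) =
      (\<integral>p. - (N p * prod_test a b c p) - px p * prod_test a b c p \<partial>?S)"
  proof (rule integral_cong_AE)
    show "AE p in ?S. ut p * prod_test a b c p = - (N p * prod_test a b c p) - px p * prod_test a b c p"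
      using toS[OF eq]
    proof eventually_elim
      case (elim p)
      then have e: "ut p = - N p - px p" by linarith
      show ?case unfolding e by (simp add: left_diff_distrib)
    qed
  qed simp_all
  also have "\<dots> = - (\<integral>p. N p * prod_test a b c p \<partial>?S) - (\<integral>p. px p * prod_test a b c p \<partial>?S)"
    using ti[OF NS C1c_measurable(1)[OF b] Kb(1)] ti[OF pxi C1c_measurable(1)[OF b] Kb(1)] by simp
  finally have 3: "(\<integral>p. ut p * prod_test a b c p \<partial>?S) = - (\<integral>p. N p * prod_test a b c p \<partial>?S) - (\<integral>p. px p * prod_test a b c p \<partial>?S)" .
  \<comment> \<open>Since \<open>pz\<close> vanishes, \<open>P\<close> is constant on almost every
    vertical line, and the factor \<open>c\<close> integrates it to zero.\<close>
  have 4: "(\<integral>p. P p * prod_test a (deriv b) c p \<partial>?S) = 0"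
  proof -
    define \<pi> where "\<pi> = (\<lambda>(z, t, x). (t, x, z) :: real \<times> real \<times> real)"
    have \<pi>m [measurable]: "\<pi> \<in> Borel" unfolding \<pi>_def case_prod_unfold by (intro borel_measurable_continuous_onI continuous_intros)
    have \<pi>: "\<pi> (perm_z p) = p" for p by (simp add: \<pi>_def perm_z_def case_prod_unfold)
    let ?R = "leb_on z0 z1 \<Otimes>\<^sub>M (leb_on t0 t1 \<Otimes>\<^sub>M I1)"
    have pm: "perm_z \<in> ?S \<rightarrow>\<^sub>M borel" by simp
    have st: "{r \<in> space borel. pz (\<pi> r) = 0} \<in> sets borel" by measurable
    have "AE r in ?R. pz (\<pi> r) = 0"
      unfolding distr_perm(2)[of t0 t1 0 1 z0 z1, symmetric] AE_distr_iff[OF pm st] \<pi> by (rule toS[OF pz0])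
    from AE_pair_swap[OF sigma_finite_leb(1) sigma_finite_leb(2) this] have p0: "AE q in leb_on t0 t1 \<Otimes>\<^sub>M I1. AE z in leb_on z0 z1. pz (fst q, snd q, z) = 0"
      by (simp add: \<pi>_def case_prod_unfold)
    have sl: "AE q in leb_on t0 t1 \<Otimes>\<^sub>M I1. integrable (leb_on z0 z1) (\<lambda>z. pz (fst q, snd q, z)) \<and>
        (\<exists>C. AE z in leb_on z0 z1. P (fst q, snd q, z) = C + prim z0 z1 (\<lambda>\<zeta>. pz (fst q, snd q, \<zeta>)) z)"
      by (rule slices_z[OF w(3) m(4,6) U t(2) _ z(2) Pi pzi]) simp
    define F where "F = (\<lambda>p. P p * prod_test a (deriv b) c p)"
    have [measurable]: "F \<in> Borel" unfolding F_def by measurable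
    have Fm: "(\<lambda>r. F (\<pi> r)) \<in> Borel" by measurable
    have Fi: "integrable ?S F" unfolding F_def by (rule ti[OF Pi C1c_measurable(2)[OF b] Kb(2)])
    have "integrable ?R (\<lambda>r. F (\<pi> r))" using perm_integral(4)[OF Fm, of z0 z1 t0 t1 0 1] Fi by (simp add: \<pi>)
    then have FR: "integrable ?R (\<lambda>(z, q). F (\<pi> (z, q)))" by (simp only: case_prod_unfold prod.collapse)
    interpret Q: pair_sigma_finite "leb_on z0 z1" "leb_on t0 t1 \<Otimes>\<^sub>M I1" by (intro pair_sigma_finite.intro sigma_finite_leb)
    have "(\<integral>p. F p \<partial>?S) = (\<integral>r. F (\<pi> r) \<partial>?R)" using perm_integral(3)[OF Fm, of z0 z1 t0 t1 0 1] by (simp add: \<pi>)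
    also have "\<dots> = (\<integral>q. \<integral>z. F (\<pi> (z, q)) \<partial>leb_on z0 z1 \<partial>(leb_on t0 t1 \<Otimes>\<^sub>M I1))" by (subst Q.integral_snd[OF FR]) (simp only: case_prod_unfold prod.collapse)
    also have "\<dots> = (\<integral>q. 0 \<partial>(leb_on t0 t1 \<Otimes>\<^sub>M I1))"
    proof (rule integral_cong_AE)
      show "(\<lambda>q. \<integral>z. F (\<pi> (z, q)) \<partial>leb_on z0 z1) \<in> borel_measurable (leb_on t0 t1 \<Otimes>\<^sub>M I1)"
        by (rule borel_measurable_integrable[OF Q.integrable_snd[OF FR]])
      show "AE q in leb_on t0 t1 \<Otimes>\<^sub>M I1. (\<integral>z. F (\<pi> (z, q)) \<partial>leb_on z0 z1) = 0"
        using sl p0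
      proof eventually_elim
        case (elim q)
        then obtain C where C: "AE z in leb_on z0 z1. P (fst q, snd q, z) = C + prim z0 z1 (\<lambda>\<zeta>. pz (fst q, snd q, \<zeta>)) z" by blast
        have sec: "(\<lambda>z. (fst q, snd q, z)) \<in> Borel" by (intro borel_measurable_continuous_onI continuous_intros)
        note mz = measurable_compose[OF sec m(6)]
        have pr: "prim z0 z1 (\<lambda>\<zeta>. pz (fst q, snd q, \<zeta>)) s = 0" for s
          using prim_cong_AE[OF elim(2) mz, of s] by (simp add: prim_def)
        have "(\<integral>z. F (\<pi> (z, q)) \<partial>leb_on z0 z1) = (\<integral>z. (C * a (fst q) * deriv b (snd q)) * c z \<partial>leb_on z0 z1)"
        proof (rule integral_cong_AE)
          have "(\<lambda>z. F (fst q, snd q, z)) \<in> Borel" by (rule measurable_compose[OF sec]) simp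
          then show "(\<lambda>z. F (\<pi> (z, q))) \<in> borel_measurable (leb_on z0 z1)" by (simp add: \<pi>_def case_prod_unfold)
          show "(\<lambda>z. (C * a (fst q) * deriv b (snd q)) * c z) \<in> borel_measurable (leb_on z0 z1)" using C1c_measurable(1)[OF c] by simp
          show "AE z in leb_on z0 z1. F (\<pi> (z, q)) = (C * a (fst q) * deriv b (snd q)) * c z"
            using C by eventually_elim (simp add: F_def \<pi>_def case_prod_unfold pr)
        qed
        also have "\<dots> = (C * a (fst q) * deriv b (snd q)) * (\<integral>z. c z \<partial>leb_on z0 z1)" by simp
        also have "\<dots> = 0" using C1c_integral_shrink[OF c] cz z by simp
        finally show ?case .
      qed
    qed simp
    finally show ?thesis by (simp add: F_def)
  qed
  show ?thesis unfolding conv[OF m(1), of "deriv a", simplified] conv[OF m(2), of a, simplified] using 1 2 3 4 by simp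
qed

subsection \<open>The energy identity and Gronwall's inequality\<close>

lemma OT_z_sections:
  fixes f :: "real \<times> real \<times> real \<Rightarrow> real"
  assumes f: "integrable (OT T) f"
  shows "AE q in leb_on 0 T \<Otimes>\<^sub>M I1. integrable I1 (\<lambda>z. f (fst q, snd q, z))"
    "integrable (leb_on 0 T \<Otimes>\<^sub>M I1) (\<lambda>q. \<integral>z. f (fst q, snd q, z) \<partial>I1)"
    "(\<integral>p. f p \<partial>OT T) = (\<integral>q. \<integral>z. f (fst q, snd q, z) \<partial>I1 \<partial>(leb_on 0 T \<Otimes>\<^sub>M I1))"
proof -
  note [measurable] = borel_measurable_integrable[OF f, simplified]
  define \<pi> where "\<pi> = (\<lambda>(z, t, x). (t, x, z) :: real \<times> real \<times> real)"
  have [measurable]: "\<pi> \<in> Borel" unfolding \<pi>_def case_prod_unfold by (intro borel_measurable_continuous_onI continuous_intros)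
  have \<pi>: "\<pi> (perm_z p) = p" for p by (simp add: \<pi>_def perm_z_def case_prod_unfold)
  let ?R = "I1 \<Otimes>\<^sub>M (leb_on 0 T \<Otimes>\<^sub>M I1)"
  have Fm: "(\<lambda>r. f (\<pi> r)) \<in> Borel" by measurable
  have "integrable ?R (\<lambda>r. f (\<pi> r))" using perm_integral(4)[OF Fm, of 0 1 0 T 0 1] f by (simp add: \<pi>)
  then have FR: "integrable ?R (\<lambda>(z, q). f (\<pi> (z, q)))" by (simp only: case_prod_unfold prod.collapse)
  interpret Q: pair_sigma_finite I1 "leb_on 0 T \<Otimes>\<^sub>M I1" by (intro pair_sigma_finite.intro sigma_finite_leb)
  show "AE q in leb_on 0 T \<Otimes>\<^sub>M I1. integrable I1 (\<lambda>z. f (fst q, snd q, z))"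
    using Q.AE_integrable_snd[OF FR] by (simp add: \<pi>_def case_prod_unfold)
  show "integrable (leb_on 0 T \<Otimes>\<^sub>M I1) (\<lambda>q. \<integral>z. f (fst q, snd q, z) \<partial>I1)"
    using Q.integrable_snd[OF FR] by (simp add: \<pi>_def case_prod_unfold)
  have "(\<integral>p. f p \<partial>OT T) = (\<integral>r. f (\<pi> r) \<partial>?R)" using perm_integral(3)[OF Fm, of 0 1 0 T 0 1] by (simp add: \<pi>)
  also have "\<dots> = (\<integral>q. \<integral>z. f (\<pi> (z, q)) \<partial>I1 \<partial>(leb_on 0 T \<Otimes>\<^sub>M I1))" by (subst Q.integral_snd[OF FR]) (simp only: case_prod_unfold prod.collapse)
  finally show "(\<integral>p. f p \<partial>OT T) = (\<integral>q. \<integral>z. f (fst q, snd q, z) \<partial>I1 \<partial>(leb_on 0 T \<Otimes>\<^sub>M I1))"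
    by (simp add: \<pi>_def case_prod_unfold)
qed

lemma OT_integrable_lift:
  fixes h :: "real \<times> real \<Rightarrow> real"
  assumes h: "integrable (leb_on 0 T \<Otimes>\<^sub>M I1) h" shows "integrable (OT T) (\<lambda>p. h (fst p, fst (snd p)))"
proof -
  have hm: "h \<in> Borel" using borel_measurable_integrable[OF h] by simp
  have "integrable (I1 \<Otimes>\<^sub>M (leb_on 0 T \<Otimes>\<^sub>M I1)) (\<lambda>(z, q). 1 * h q)"
    by (rule integrable_tensor[OF sigma_finite_leb(1) sigma_finite_leb(2) _ h]) simp
  then have i: "integrable (I1 \<Otimes>\<^sub>M (leb_on 0 T \<Otimes>\<^sub>M I1)) (\<lambda>r. h (snd r))" by (simp add: case_prod_unfold)
  have m: "(\<lambda>r::real\<times>real\<times>real. h (snd r)) \<in> Borel"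
    by (rule measurable_compose[OF borel_measurable_continuous_onI hm]) (intro continuous_intros)
  from i show ?thesis unfolding perm_integral(4)[OF m, of 0 1 0 T 0 1] by (simp add: perm_z_def case_prod_unfold)
qed

definition zmean :: "(real \<times> real \<times> real \<Rightarrow> real) \<Rightarrow> real \<times> real \<times> real \<Rightarrow> real" where
  "zmean G p = (\<integral>\<zeta>. G (fst p, fst (snd p), \<zeta>) \<partial>I1)"

lemma zmean_integrable: "integrable (OT T) G \<Longrightarrow> integrable (OT T) (zmean G)"
  using OT_integrable_lift[OF OT_z_sections(2)] by (simp add: zmean_def[abs_def])

text \<open>A general \<open>c\<close> is replaced by \<open>c\<close> minus its mean times an
  approximation of the constant 1. The correction disappears for \<open>U\<close>, which has mean
  zero in \<open>z\<close>, and for \<open>G\<close> it becomes the subtraction of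
  \<open>zmean G\<close>. In this way the equation gains a function of \<open>t\<close> and
  \<open>x\<close> that stands for the pressure gradient.\<close>

lemma weak_form_mean_free:
  fixes U G :: "real \<times> real \<times> real \<Rightarrow> real"
  assumes U: "integrable (OT T) U" and G: "integrable (OT T) G"
    and mean0: "AE q in leb_on 0 T \<Otimes>\<^sub>M I1. (\<integral>z. U (fst q, snd q, z) \<partial>I1) = 0"
    and wf: "\<And>c. c \<in> C1c 0 1 \<Longrightarrow> (\<integral>z. c z \<partial>I1) = 0 \<Longrightarrow>
      (\<integral>p. U p * prod_test (deriv a) b c p \<partial>OT T) = (\<integral>p. G p * prod_test a b c p \<partial>OT T)"
    and a: "a \<in> C1c 0 T" and b: "b \<in> C1c 0 1" and c: "c \<in> C1c 0 1"
  shows "(\<integral>p. U p * prod_test (deriv a) b c p \<partial>OT T) = (\<integral>p. (G p - zmean G p) * prod_test a b c p \<partial>OT T)"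
proof -
  obtain \<phi> :: "nat \<Rightarrow> real \<Rightarrow> real" where \<phi>: "\<And>n. \<phi> n \<in> C1c 0 1" "\<And>n x. 0 \<le> \<phi> n x" "\<And>n x. \<phi> n x \<le> 1"
    "\<And>x. (\<lambda>n. \<phi> n x) \<longlonglongrightarrow> indicator {0<..<1} x"
    by (rule C1c_approx_indicator[of 0 1 0 1]) auto
  obtain Ka where Ka: "\<And>s. \<bar>a s\<bar> \<le> Ka" "\<And>s. \<bar>deriv a s\<bar> \<le> Ka" using C1c_bounded[OF a] by metis
  obtain Kb where Kb: "\<And>s. \<bar>b s\<bar> \<le> Kb" using C1c_bounded[OF b] by metis
  obtain Kc where Kc: "\<And>s. \<bar>c s\<bar> \<le> Kc" using C1c_bounded[OF c] by metis
  have cb: "(\<lambda>p::real\<times>real\<times>real. h (fst p)) \<in> Borel" "(\<lambda>p::real\<times>real\<times>real. h (fst (snd p))) \<in> Borel"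
    "(\<lambda>p::real\<times>real\<times>real. h (snd (snd p))) \<in> Borel" if "h \<in> Borel" for h :: "real \<Rightarrow> real"
    by (rule measurable_compose[OF borel_measurable_continuous_onI that]; intro continuous_intros)+
  note [measurable] = cb[OF C1c_measurable(1)[OF a]] cb[OF C1c_measurable(2)[OF a]] cb[OF C1c_measurable(1)[OF b]] cb(3)[OF C1c_measurable(1)[OF c]]
    cb(3)[OF C1c_measurable(1)[OF \<phi>(1)]] C1c_measurable(1)[OF \<phi>(1)]
    borel_measurable_integrable[OF U, simplified] borel_measurable_integrable[OF G, simplified]
  have c_int: "integrable I1 c" by (rule integrable_bounded_AE[OF leb_on.finite_measure_axioms, of _ _ _ Kc]) (use Kc C1c_measurable(1)[OF c] in auto)
  have \<phi>_int: "integrable I1 (\<phi> n)" for n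
    by (rule integrable_bounded_AE[OF leb_on.finite_measure_axioms, of _ _ _ 1]) (use \<phi> C1c_measurable(1)[OF \<phi>(1)] in auto)
  define m where "m = (\<integral>z. c z \<partial>I1)"
  define k where "k n = (\<integral>z. \<phi> n z \<partial>I1)" for n
  have klim: "k \<longlonglongrightarrow> (\<integral>z. 1 \<partial>I1)"
    unfolding k_def
  proof (rule integral_dominated_convergence[where w="\<lambda>_. 1"])
    show "AE z in I1. (\<lambda>n. \<phi> n z) \<longlonglongrightarrow> 1" using AE_interior[of 0 1]
    proof eventually_elim
      case (elim z) then show ?case using \<phi>(4)[of z] by simp
    qed
  qed (use \<phi> in auto)
  then have klim: "k \<longlonglongrightarrow> 1" by simp
  let ?t = "\<lambda>d e p. prod_test d b e p"
  have tint: "integrable (OT T) (\<lambda>p. f p * ?t d e p)"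
    if f: "integrable (OT T) f" and d: "d \<in> {a, deriv a}" and e: "e \<in> Borel" "\<And>s. \<bar>e s\<bar> \<le> Ke" for f d Ke and e :: "real \<Rightarrow> real"
    by (rule prod_test_integrable[OF f sets_leb3 _ C1c_measurable(1)[OF b] e(1) _ Kb e(2), where Ka=Ka]) (use d Ka C1c_measurable[OF a] in auto)
  have \<phi>b: "\<bar>\<phi> n s\<bar> \<le> 1" for n s using \<phi>(2,3)[of n s] by simp
  have one: "\<bar>1::real\<bar> \<le> 1" by simp
  have lim: "(\<lambda>n. \<integral>p. f p * ?t d (\<phi> n) p \<partial>OT T) \<longlonglongrightarrow> (\<integral>p. f p * ?t d (\<lambda>_. 1) p \<partial>OT T)" if f: "integrable (OT T) f" and d: "d \<in> {a, deriv a}" for f d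
  proof (rule integral_dominated_convergence[where w="\<lambda>p. norm (f p * ?t d (\<lambda>_. 1) p)"])
    show "integrable (OT T) (\<lambda>p. norm (f p * ?t d (\<lambda>_. 1) p))" by (rule integrable_norm[OF tint[OF f d _ one]]) simp
    show "(\<lambda>p. f p * ?t d (\<lambda>_. 1) p) \<in> borel_measurable (OT T)" by (rule borel_measurable_integrable[OF tint[OF f d _ one]]) simp
    show "(\<lambda>p. f p * ?t d (\<phi> n) p) \<in> borel_measurable (OT T)" for n
      by (rule borel_measurable_integrable[OF tint[OF f d C1c_measurable(1)[OF \<phi>(1)] \<phi>b]])
    have "AE y in O2. 0 < snd y \<and> snd y < 1" by (rule AE_fst_snd(2)[OF sigma_finite_leb(1) sigma_finite_leb(1) AE_interior])
    then have "AE p in OT T. 0 < snd (snd p) \<and> snd (snd p) < 1" by (rule AE_fst_snd(2)[OF sigma_finite_leb(1) sigma_finite_leb(2)])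
    then show "AE p in OT T. (\<lambda>n. f p * ?t d (\<phi> n) p) \<longlonglongrightarrow> f p * ?t d (\<lambda>_. 1) p"
    proof eventually_elim
      case (elim p)
      then have "(\<lambda>n. \<phi> n (snd (snd p))) \<longlonglongrightarrow> 1" using \<phi>(4)[of "snd (snd p)"] by simp
      then show ?case by (intro tendsto_mult tendsto_const)
    qed
    have "\<bar>f p * ?t d (\<phi> n) p\<bar> \<le> \<bar>f p * ?t d (\<lambda>_. 1) p\<bar>" for n p
    proof -
      have "\<bar>f p * ?t d (\<phi> n) p\<bar> = \<bar>f p * ?t d (\<lambda>_. 1) p\<bar> * \<phi> n (snd (snd p))" using \<phi>(2)[of n "snd (snd p)"] by (simp add: abs_mult)
      also have "\<dots> \<le> \<bar>f p * ?t d (\<lambda>_. 1) p\<bar> * 1" by (intro mult_left_mono \<phi>) auto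
      finally show ?thesis by simp
    qed
    then show "AE p in OT T. norm (f p * ?t d (\<phi> n) p) \<le> norm (f p * ?t d (\<lambda>_. 1) p)" for n by (intro AE_I2) (simp only: real_norm_def)
  qed
  have split: "(\<integral>p. f p * ?t d (\<lambda>s. k n * c s - m * \<phi> n s) p \<partial>OT T) = k n * (\<integral>p. f p * ?t d c p \<partial>OT T) - m * (\<integral>p. f p * ?t d (\<phi> n) p \<partial>OT T)"
    if f: "integrable (OT T) f" and d: "d \<in> {a, deriv a}" for f d n
  proof -
    have i: "integrable (OT T) (\<lambda>p. f p * ?t d c p)" "integrable (OT T) (\<lambda>p. f p * ?t d (\<phi> n) p)"
      by (rule tint[OF f d C1c_measurable(1)[OF c] Kc], rule tint[OF f d C1c_measurable(1)[OF \<phi>(1)] \<phi>b])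
    have "(\<integral>p. f p * ?t d (\<lambda>s. k n * c s - m * \<phi> n s) p \<partial>OT T) = (\<integral>p. k n * (f p * ?t d c p) - m * (f p * ?t d (\<phi> n) p) \<partial>OT T)"
      by (rule Bochner_Integration.integral_cong) (auto simp: algebra_simps)
    then show ?thesis using i by simp
  qed
  \<comment> \<open>The factors \<open>k n\<close> and \<open>m\<close> make
    \<open>k n * c - m * \<phi> n\<close> have mean zero exactly. The constant 1 itself is no
    admissible test, having no compact support inside the interval, so it enters only in the
    limit.\<close>
  have step: "k n * (\<integral>p. U p * ?t (deriv a) c p \<partial>OT T) - m * (\<integral>p. U p * ?t (deriv a) (\<phi> n) p \<partial>OT T) =
      k n * (\<integral>p. G p * ?t a c p \<partial>OT T) - m * (\<integral>p. G p * ?t a (\<phi> n) p \<partial>OT T)" for n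
  proof -
    have "(\<lambda>s. (c s + (k n - 1) * c s) + (- m) * \<phi> n s) \<in> C1c 0 1" by (rule C1c_add_scale[OF C1c_add_scale[OF c c] \<phi>(1)])
    moreover have "(\<lambda>s. (c s + (k n - 1) * c s) + (- m) * \<phi> n s) = (\<lambda>s. k n * c s - m * \<phi> n s)" by (auto simp: algebra_simps)
    ultimately have C: "(\<lambda>s. k n * c s - m * \<phi> n s) \<in> C1c 0 1" by simp
    have 0: "(\<integral>s. k n * c s - m * \<phi> n s \<partial>I1) = 0" using c_int \<phi>_int by (simp add: m_def k_def)
    show ?thesis using wf[OF C 0] split[OF U, of "deriv a" n] split[OF G, of a n] by simp
  qed
  have "(\<lambda>n. k n * (\<integral>p. U p * ?t (deriv a) c p \<partial>OT T) - m * (\<integral>p. U p * ?t (deriv a) (\<phi> n) p \<partial>OT T))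
      \<longlonglongrightarrow> 1 * (\<integral>p. U p * ?t (deriv a) c p \<partial>OT T) - m * (\<integral>p. U p * ?t (deriv a) (\<lambda>_. 1) p \<partial>OT T)"
    by (intro tendsto_intros klim lim U) simp
  moreover have "(\<lambda>n. k n * (\<integral>p. U p * ?t (deriv a) c p \<partial>OT T) - m * (\<integral>p. U p * ?t (deriv a) (\<phi> n) p \<partial>OT T))
      \<longlonglongrightarrow> 1 * (\<integral>p. G p * ?t a c p \<partial>OT T) - m * (\<integral>p. G p * ?t a (\<lambda>_. 1) p \<partial>OT T)"
    unfolding step by (intro tendsto_intros klim lim G) simp
  ultimately have L: "(\<integral>p. U p * ?t (deriv a) c p \<partial>OT T) - m * (\<integral>p. U p * ?t (deriv a) (\<lambda>_. 1) p \<partial>OT T) =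
      (\<integral>p. G p * ?t a c p \<partial>OT T) - m * (\<integral>p. G p * ?t a (\<lambda>_. 1) p \<partial>OT T)"
    using LIMSEQ_unique by fastforce
  have "(\<integral>p. U p * ?t (deriv a) (\<lambda>_. 1) p \<partial>OT T) = (\<integral>q. \<integral>z. U (fst q, snd q, z) * (deriv a (fst q) * b (snd q)) \<partial>I1 \<partial>(leb_on 0 T \<Otimes>\<^sub>M I1))"
    by (subst OT_z_sections(3)) (rule tint[OF U _ _ one], simp_all)
  also have "\<dots> = (\<integral>q. 0 \<partial>(leb_on 0 T \<Otimes>\<^sub>M I1))"
  proof (rule integral_cong_AE)
    show "(\<lambda>q. \<integral>z. U (fst q, snd q, z) * (deriv a (fst q) * b (snd q)) \<partial>I1) \<in> borel_measurable (leb_on 0 T \<Otimes>\<^sub>M I1)"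
      using borel_measurable_integrable[OF OT_z_sections(2)[OF tint[OF U _ _ one, of "deriv a"]]] by simp
    show "AE q in leb_on 0 T \<Otimes>\<^sub>M I1. (\<integral>z. U (fst q, snd q, z) * (deriv a (fst q) * b (snd q)) \<partial>I1) = 0"
      using mean0 by eventually_elim simp
  qed simp
  finally have U0: "(\<integral>p. U p * ?t (deriv a) (\<lambda>_. 1) p \<partial>OT T) = 0" by simp
  have zi: "integrable (OT T) (zmean G)" by (rule zmean_integrable[OF G])
  have i: "integrable (OT T) (\<lambda>p. zmean G p * ?t a c p)" "integrable (OT T) (\<lambda>p. G p * ?t a c p)"
    by (rule tint[OF zi _ C1c_measurable(1)[OF c] Kc] tint[OF G _ C1c_measurable(1)[OF c] Kc]; simp)+
  have "(\<integral>p. zmean G p * ?t a c p \<partial>OT T) = (\<integral>q. \<integral>z. (zmean G (fst q, snd q, z) * (a (fst q) * b (snd q))) * c z \<partial>I1 \<partial>(leb_on 0 T \<Otimes>\<^sub>M I1))"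
    by (subst OT_z_sections(3)[OF i(1)]) (simp add: mult.assoc)
  also have "\<dots> = (\<integral>q. m * (\<integral>z. G (fst q, snd q, z) * (a (fst q) * b (snd q)) \<partial>I1) \<partial>(leb_on 0 T \<Otimes>\<^sub>M I1))"
    by (rule Bochner_Integration.integral_cong) (simp_all add: zmean_def m_def)
  also have "\<dots> = m * (\<integral>p. G p * ?t a (\<lambda>_. 1) p \<partial>OT T)"
    by (subst OT_z_sections(3)) (rule tint[OF G _ _ one], simp_all)
  finally have "(\<integral>p. zmean G p * ?t a c p \<partial>OT T) = m * (\<integral>p. G p * ?t a (\<lambda>_. 1) p \<partial>OT T)" .
  then show ?thesis using L U0 i by (simp add: left_diff_distrib)
qed

text \<open>The constant \<open>C\<close> depends on \<open>y\<close> with no known measurability,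
  so the representation cannot be integrated directly. Paired with the derivative of a test function
  it drops out; after integration over \<open>y\<close>, du Bois-Reymond restores a primitive with
  one constant.\<close>

lemma integrate_slices:
  fixes f k :: "real \<times> real \<times> real \<Rightarrow> real"
  assumes T: "T > 0" and f: "integrable (OT T) f" and k: "integrable (OT T) k"
    and rep: "AE y in O2. \<exists>C. AE s in leb_on 0 T. f (s, y) = C + prim 0 T (\<lambda>\<sigma>. k (\<sigma>, y)) s"
  obtains E0 where "AE s in leb_on 0 T. (\<integral>y. f (s, y) \<partial>O2) = E0 + prim 0 T (\<lambda>\<sigma>. \<integral>y. k (\<sigma>, y) \<partial>O2) s"
proof -
  let ?L = "leb_on 0 T"
  note [measurable] = borel_measurable_integrable[OF f, simplified] borel_measurable_integrable[OF k, simplified]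
  define F where "F s = (\<integral>y. f (s, y) \<partial>O2)" for s
  define K where "K s = (\<integral>y. k (s, y) \<partial>O2)" for s
  have Fi: "integrable ?L F" and Ki: "integrable ?L K" unfolding F_def K_def by (rule OT_sections(2)[OF f], rule OT_sections(2)[OF k])
  have lift: "integrable (?L \<Otimes>\<^sub>M I1) (\<lambda>p. H (fst p))" if "integrable ?L H" for H :: "real \<Rightarrow> real"
  proof -
    have "integrable (?L \<Otimes>\<^sub>M I1) (\<lambda>(s, y). H s * 1)" by (rule integrable_tensor[OF sigma_finite_leb(1) sigma_finite_leb(1) that]) simp
    then show ?thesis by (simp add: case_prod_unfold)
  qed
  have weak: "(\<integral>s. F s * deriv \<phi> s \<partial>?L) = - (\<integral>s. K s * \<phi> s \<partial>?L)" if \<phi>: "\<phi> \<in> C1c 0 T" for \<phi>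
  proof -
    note [measurable] = C1c_measurable[OF \<phi>]
    obtain C where C: "\<And>s. \<bar>\<phi> s\<bar> \<le> C" "\<And>s. \<bar>deriv \<phi> s\<bar> \<le> C" using C1c_bounded[OF \<phi>] by metis
    have ft: "(\<lambda>p::real\<times>real\<times>real. h (fst p)) \<in> Borel" if "h \<in> Borel" for h :: "real \<Rightarrow> real"
      by (rule measurable_compose[OF borel_measurable_continuous_onI that]) (intro continuous_intros)
    have i: "integrable (OT T) (\<lambda>p. f p * deriv \<phi> (fst p))" "integrable (OT T) (\<lambda>p. k p * \<phi> (fst p))"
      by (rule integrable_mult_bounded_AE(1)[OF f, of _ C] integrable_mult_bounded_AE(1)[OF k, of _ C]; use C ft C1c_measurable[OF \<phi>] in simp)+
    have d0: "(\<integral>s. deriv \<phi> s \<partial>?L) = 0"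
      using prim_upper[of T T "deriv \<phi>" 0] C1c_eq_prim[OF \<phi>, of T] C1c_endpoints[OF \<phi>, of T] T by simp
    have "(\<integral>s. F s * deriv \<phi> s \<partial>?L) = (\<integral>p. f p * deriv \<phi> (fst p) \<partial>OT T)"
      unfolding OT_sections(3)[OF i(1)] F_def by simp
    also have "\<dots> = (\<integral>y. \<integral>s. f (s, y) * deriv \<phi> s \<partial>?L \<partial>O2)" unfolding OT_sections(6)[OF i(1)] by simp
    also have "\<dots> = (\<integral>y. - (\<integral>s. k (s, y) * \<phi> s \<partial>?L) \<partial>O2)"
    proof (rule integral_cong_AE)
      show "(\<lambda>y. \<integral>s. f (s, y) * deriv \<phi> s \<partial>?L) \<in> borel_measurable O2" using borel_measurable_integrable[OF OT_sections(5)[OF i(1)]] by simp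
      show "(\<lambda>y. - (\<integral>s. k (s, y) * \<phi> s \<partial>?L)) \<in> borel_measurable O2" using borel_measurable_integrable[OF OT_sections(5)[OF i(2)]] by simp
      show "AE y in O2. (\<integral>s. f (s, y) * deriv \<phi> s \<partial>?L) = - (\<integral>s. k (s, y) * \<phi> s \<partial>?L)"
        using rep OT_sections(4)[OF k] OT_sections(4)[OF f]
      proof eventually_elim
        case (elim y)
        then obtain D where D: "AE s in ?L. f (s, y) = D + prim 0 T (\<lambda>\<sigma>. k (\<sigma>, y)) s" by blast
        note [measurable] = borel_measurable_integrable[OF elim(2), simplified] borel_measurable_integrable[OF elim(3), simplified]
        have di: "integrable ?L (deriv \<phi>)" by (rule integrable_bounded_AE[OF leb_on.finite_measure_axioms, of _ _ _ C]) (use C in auto)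
        have pi: "integrable ?L (\<lambda>s. prim 0 T (\<lambda>\<sigma>. k (\<sigma>, y)) s * deriv \<phi> s)"
          by (rule integrable_mult_bounded_AE(2)[OF di, where C="\<integral>\<sigma>. \<bar>k (\<sigma>, y)\<bar> \<partial>?L"]) (use prim_bound[OF elim(2)] in auto)
        have "(\<integral>s. f (s, y) * deriv \<phi> s \<partial>?L) = (\<integral>s. D * deriv \<phi> s + prim 0 T (\<lambda>\<sigma>. k (\<sigma>, y)) s * deriv \<phi> s \<partial>?L)"
        proof (rule integral_cong_AE)
          show "AE s in ?L. f (s, y) * deriv \<phi> s = D * deriv \<phi> s + prim 0 T (\<lambda>\<sigma>. k (\<sigma>, y)) s * deriv \<phi> s"
            using D by eventually_elim (simp add: distrib_right)
        qed auto
        also have "\<dots> = - (\<integral>s. k (s, y) * \<phi> s \<partial>?L)"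
          using di pi d0 prim_integrate_by_parts[OF \<phi> elim(2) T] by simp
        finally show ?case .
      qed
    qed
    also have "\<dots> = - (\<integral>p. k p * \<phi> (fst p) \<partial>OT T)" unfolding OT_sections(6)[OF i(2)] by simp
    also have "\<dots> = - (\<integral>s. K s * \<phi> s \<partial>?L)" unfolding OT_sections(3)[OF i(2)] K_def by simp
    finally show ?thesis .
  qed
  \<comment> \<open>\<open>weak_deriv_slices\<close> expects a second variable; a dummy one is
    added, on which nothing depends.\<close>
  have "AE y in I1. integrable ?L (\<lambda>s. K (fst (s, y))) \<and> (\<exists>C. AE s in ?L. F (fst (s, y)) = C + prim 0 T (\<lambda>\<sigma>. K (fst (\<sigma>, y))) s)"
  proof (rule weak_deriv_slices[OF T leb_on.finite_measure_axioms total_tests_C1c, where f="\<lambda>p. F (fst p)" and g="\<lambda>p. K (fst p)"])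
    fix \<phi> \<psi> assume \<phi>: "\<phi> \<in> C1c 0 T" and \<psi>: "\<psi> \<in> C1c 0 1"
    note [measurable] = C1c_measurable[OF \<phi>]
    obtain C where C: "\<And>s. \<bar>\<phi> s\<bar> \<le> C" "\<And>s. \<bar>deriv \<phi> s\<bar> \<le> C" using C1c_bounded[OF \<phi>] by metis
    obtain D where D: "\<And>s. \<bar>\<psi> s\<bar> \<le> D" using C1c_bounded[OF \<psi>] by metis
    have \<psi>i: "integrable I1 \<psi>" by (rule integrable_bounded_AE[OF leb_on.finite_measure_axioms, of _ _ _ D]) (use D C1c_measurable(1)[OF \<psi>] in auto)
    have prod: "(\<integral>p. H (fst p) * (h (fst p) * \<psi> (snd p)) \<partial>(?L \<Otimes>\<^sub>M I1)) = (\<integral>s. H s * h s \<partial>?L) * (\<integral>y. \<psi> y \<partial>I1)"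
      if H: "integrable ?L H" and h: "h \<in> Borel" "\<And>s. \<bar>h s\<bar> \<le> C" for H h :: "real \<Rightarrow> real"
    proof -
      have Hh: "integrable ?L (\<lambda>s. H s * h s)" by (rule integrable_mult_bounded_AE(1)[OF H, of _ C]) (use h in auto)
      have i: "integrable (?L \<Otimes>\<^sub>M I1) (\<lambda>(s, y). H s * h s * \<psi> y)" by (rule integrable_tensor[OF sigma_finite_leb(1) sigma_finite_leb(1) Hh \<psi>i])
      have "(\<integral>p. H (fst p) * (h (fst p) * \<psi> (snd p)) \<partial>(?L \<Otimes>\<^sub>M I1)) = (\<integral>p. (case p of (s, y) \<Rightarrow> H s * h s * \<psi> y) \<partial>(?L \<Otimes>\<^sub>M I1))"
        by (simp add: case_prod_unfold mult.assoc)
      also have "\<dots> = (\<integral>s. \<integral>y. H s * h s * \<psi> y \<partial>I1 \<partial>?L)" by (rule leb_pair.integral_fst[OF i, symmetric])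
      finally show ?thesis by simp
    qed
    show "(\<integral>p. F (fst p) * (deriv \<phi> (fst p) * \<psi> (snd p)) \<partial>(?L \<Otimes>\<^sub>M I1)) = - (\<integral>p. K (fst p) * (\<phi> (fst p) * \<psi> (snd p)) \<partial>(?L \<Otimes>\<^sub>M I1))"
      unfolding prod[OF Fi C1c_measurable(2)[OF \<phi>] C(2)] prod[OF Ki C1c_measurable(1)[OF \<phi>] C(1)] weak[OF \<phi>] by simp
  qed (use lift[OF Fi] lift[OF Ki] in simp_all)
  then have "AE y in I1. \<exists>C. AE s in ?L. F s = C + prim 0 T K s" by eventually_elim auto
  then obtain y where "\<exists>C. AE s in ?L. F s = C + prim 0 T K s" using AE_leb_on_dense[of 0 1 "\<lambda>_. \<exists>C. AE s in ?L. F s = C + prim 0 T K s" 0] by auto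
  then show ?thesis using that unfolding F_def K_def by blast
qed

lemma prim_mono:
  assumes "integrable (leb_on a b) f" "integrable (leb_on a b) g" "AE s in leb_on a b. f s \<le> g s"
  shows "prim a b f s \<le> prim a b g s"
  unfolding prim_def
proof (rule integral_mono_AE)
  show "integrable (leb_on a b) (\<lambda>\<sigma>. f \<sigma> * indicat_real {..s} \<sigma>)" "integrable (leb_on a b) (\<lambda>\<sigma>. g \<sigma> * indicat_real {..s} \<sigma>)"
    by (rule integrable_ind[OF assms(1)], rule integrable_ind[OF assms(2)])
  show "AE \<sigma> in leb_on a b. f \<sigma> * indicat_real {..s} \<sigma> \<le> g \<sigma> * indicat_real {..s} \<sigma>"
    using assms(3) by eventually_elim (simp add: mult_right_mono)
qed

text \<open>The chain rule for powers, by repeated use of the product rule; integrability is proved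
  alongside because the next step requires it.\<close>

lemma prim_power:
  assumes f: "integrable (leb_on a b) f"
  shows "(prim a b f s) ^ Suc n = prim a b (\<lambda>\<sigma>. real (Suc n) * (f \<sigma> * (prim a b f \<sigma>) ^ n)) s"
    and "integrable (leb_on a b) (\<lambda>\<sigma>. f \<sigma> * (prim a b f \<sigma>) ^ n)"
proof (induction n arbitrary: s)
  case 0
  { case 1 show ?case by simp }
  { case 2 show ?case using f by simp }
next
  case (Suc n)
  let ?g = "\<lambda>\<sigma>. real (Suc n) * (f \<sigma> * (prim a b f \<sigma>) ^ n)"
  have g: "integrable (leb_on a b) ?g" using Suc(2) by simp
  have i: "integrable (leb_on a b) (\<lambda>\<sigma>. f \<sigma> * (0 + prim a b ?g \<sigma>) + (0 + prim a b f \<sigma>) * ?g \<sigma>)" by (rule prim_product(2)[OF f g])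
  have e: "f \<sigma> * (0 + prim a b ?g \<sigma>) + (0 + prim a b f \<sigma>) * ?g \<sigma> = real (Suc (Suc n)) * (f \<sigma> * (prim a b f \<sigma>) ^ Suc n)" for \<sigma>
    unfolding Suc(1)[of \<sigma>, symmetric] by (simp add: algebra_simps)
  { case 1
    have "(prim a b f s) ^ Suc (Suc n) = (0 + prim a b f s) * (0 + prim a b ?g s)" using Suc(1)[of s] by simp
    also have "\<dots> = prim a b (\<lambda>\<sigma>. f \<sigma> * (0 + prim a b ?g \<sigma>) + (0 + prim a b f \<sigma>) * ?g \<sigma>) s"
      using prim_product(1)[OF f g, of 0 s 0] by simp
    finally show ?case unfolding e . }
  { case 2
    have "integrable (leb_on a b) (\<lambda>\<sigma>. (1 / real (Suc (Suc n))) * (real (Suc (Suc n)) * (f \<sigma> * (prim a b f \<sigma>) ^ Suc n)))"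
      using i unfolding e by (rule integrable_mult_right)
    then show ?case by (simp del: of_nat_Suc) }
qed

text \<open>Iterating the inequality bounds the primitive of \<open>H\<close> by a constant times
  the \<open>n\<close>-th term of the exponential series of the primitive of \<open>\<phi>\<close>,
  and these terms tend to zero. Neither continuity of \<open>\<phi>\<close> nor an integrating
  factor enters.\<close>

lemma gronwall_prim:
  assumes H: "integrable (leb_on 0 T) H" and \<phi>: "integrable (leb_on 0 T) \<phi>" and \<phi>0: "AE s in leb_on 0 T. 0 \<le> \<phi> s"
    and le: "AE s in leb_on 0 T. H s \<le> \<phi> s * prim 0 T H s"
  shows "prim 0 T H s \<le> 0"
proof -
  define B where "B = (\<integral>\<sigma>. \<bar>H \<sigma>\<bar> \<partial>leb_on 0 T)"
  have V: "prim 0 T H s \<le> B" for s using prim_bound[OF H, of s] by (simp add: B_def)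
  have bd: "prim 0 T H s \<le> B * ((prim 0 T \<phi> s) ^ n / fact n)" for n s
  proof (induction n arbitrary: s)
    case 0 then show ?case using V by simp
  next
    case (Suc n)
    have "prim 0 T H s \<le> prim 0 T (\<lambda>\<sigma>. (B / fact n) * (\<phi> \<sigma> * (prim 0 T \<phi> \<sigma>) ^ n)) s"
    proof (rule prim_mono[OF H])
      show "integrable (leb_on 0 T) (\<lambda>\<sigma>. (B / fact n) * (\<phi> \<sigma> * (prim 0 T \<phi> \<sigma>) ^ n))" using prim_power(2)[OF \<phi>] by simp
      show "AE s in leb_on 0 T. H s \<le> (B / fact n) * (\<phi> s * (prim 0 T \<phi> s) ^ n)"
        using le \<phi>0
      proof eventually_elim
        case (elim s)
        have "\<phi> s * prim 0 T H s \<le> \<phi> s * (B * ((prim 0 T \<phi> s) ^ n / fact n))" using elim(2) Suc by (intro mult_left_mono) auto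
        then show ?case using elim(1) by (simp add: mult_ac)
      qed
    qed
    also have "\<dots> = (B / fact (Suc n)) * prim 0 T (\<lambda>\<sigma>. real (Suc n) * (\<phi> \<sigma> * (prim 0 T \<phi> \<sigma>) ^ n)) s"
      unfolding prim_cmult by (simp add: field_simps del: of_nat_Suc)
    also have "\<dots> = B * ((prim 0 T \<phi> s) ^ Suc n / fact (Suc n))" unfolding prim_power(1)[OF \<phi>, symmetric] by simp
    finally show ?case .
  qed
  have "(\<lambda>n. (prim 0 T \<phi> s) ^ n / fact n) \<longlonglongrightarrow> 0"
    using summable_LIMSEQ_zero[OF summable_exp[of "prim 0 T \<phi> s"]] by (simp add: divide_inverse mult.commute)
  then have "(\<lambda>n. B * ((prim 0 T \<phi> s) ^ n / fact n)) \<longlonglongrightarrow> B * 0" by (rule tendsto_mult_left)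
  then show ?thesis using bd by (intro LIMSEQ_le_const[of _ "B * 0", simplified]) auto
qed

text \<open>Sobolev norms of the slices enter the Gronwall coefficient, so they must be measurable
  in time.\<close>

lemma sq_nz_measurable:
  fixes v :: "real \<times> real \<times> real \<Rightarrow> real"
  assumes v: "v \<in> Borel"
  shows "(\<lambda>t. sq s (nz (\<lambda>y. v (t, y)))) \<in> Borel"
proof -
  have hf: "(\<lambda>q. hf (\<lambda>y. v (fst q, y)) k (snd q)) \<in> borel_measurable (leb2 0 1 0 1)" for k
  proof -
    have "(\<lambda>r. v (fst (fst r), snd r, snd (fst r))) \<in> borel_measurable ((leb2 0 1 0 1) \<Otimes>\<^sub>M I1)"
      by (intro measurable_compose[OF _ v] borel_measurable_Pair) (simp_all del: borel_measurable_leb_eq)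
    then have "(\<lambda>(q, x). complex_of_real (v (fst q, x, snd q)) * chr (- k) x) \<in> borel_measurable ((leb2 0 1 0 1) \<Otimes>\<^sub>M I1)"
      by (simp add: case_prod_unfold del: borel_measurable_leb_eq)
    from leb_on.borel_measurable_lebesgue_integral[OF this] show ?thesis by (simp add: hf_def fc_def del: borel_measurable_leb_eq)
  qed
  have nz: "(\<lambda>t. nz (\<lambda>y. v (t, y)) k) \<in> Borel" for k
  proof -
    have "(\<lambda>(t, z). (norm (hf (\<lambda>y. v (t, y)) k z))\<^sup>2) \<in> borel_measurable (leb_on 0 1 \<Otimes>\<^sub>M I1)"
      using hf[of k] by (simp add: case_prod_unfold del: borel_measurable_leb_eq)
    from leb_on.borel_measurable_lebesgue_integral[OF this] show ?thesis by (simp add: nz_def)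
  qed
  have "(\<lambda>p. ennreal (wt (fst p) powr (2 * s) * (nz (\<lambda>y. v (snd p, y)) (fst p))\<^sup>2)) \<in> borel_measurable (cs \<Otimes>\<^sub>M borel)"
  proof (rule measurable_pair_measure_countable1)
    fix k :: int
    note [measurable] = nz[of k]
    show "(\<lambda>t. ennreal (wt (fst (k, t)) powr (2 * s) * (nz (\<lambda>y. v (snd (k, t), y)) (fst (k, t)))\<^sup>2)) \<in> Borel" by simp
  qed simp
  from measurable_pair_swap[OF this] have "(\<lambda>(t, k). ennreal (wt k powr (2 * s) * (nz (\<lambda>y. v (t, y)) k)\<^sup>2)) \<in> borel_measurable (borel \<Otimes>\<^sub>M cs)"
    by (simp add: case_prod_unfold)
  from sigma_finite_measure.borel_measurable_nn_integral[OF sigma_finite_cs this] show ?thesis by (simp add: sq_def)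
qed

lemma Hspace_mean_zero:
  fixes u :: field
  assumes H: "cont_H T u" and ui: "integrable (OT T) (case_prod u)"
  shows "AE q in leb_on 0 T \<Otimes>\<^sub>M I1. (\<integral>z. case_prod u (fst q, snd q, z) \<partial>I1) = 0"
proof (rule leb_pair.AE_pair_measure)
  have m: "(\<lambda>q. \<integral>z. case_prod u (fst q, snd q, z) \<partial>I1) \<in> Borel"
    using borel_measurable_integrable[OF OT_z_sections(2)[OF ui]] by simp
  show "{q \<in> space (leb_on 0 T \<Otimes>\<^sub>M I1). (\<integral>z. case_prod u (fst q, snd q, z) \<partial>I1) = 0} \<in> sets (leb_on 0 T \<Otimes>\<^sub>M I1)"
    unfolding sets_leb2 space_pair_measure using borel_measurable_eq[OF m, of "\<lambda>_. 0"] by simp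
  have A: "AE x in I1. (\<integral>z. u t (x, z) \<partial>I1) = 0" if "t \<in> {0..T}" for t
  proof -
    have ut: "u t \<in> Hspace" using H that by (auto simp: cont_H_def)
    then have "u t \<in> Borel" by (auto simp: Hspace_def L2_meas)
    then have "(\<integral>z. u t (x, z) \<partial>I1) = (LINT z:{0..1}|lborel. u t (x, z))" for x by (intro integral_leb_on borel_section(2))
    then show ?thesis using ut unfolding AE_leb_on by (auto simp: Hspace_def elim!: eventually_mono)
  qed
  show "AE t in leb_on 0 T. AE x in I1. (\<integral>z. case_prod u (fst (t, x), snd (t, x), z) \<partial>I1) = 0"
    unfolding AE_leb_on[where a=0 and b=T] by (rule AE_I2, rule impI) (use A in simp)
qed

lemma L2_diff:
  assumes "f \<in> L2" "g \<in> L2" shows "integrable O2 (\<lambda>y. (f y - g y)\<^sup>2)"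
proof (rule Bochner_Integration.integrable_bound)
  note [measurable] = L2_meas[OF assms(1)] L2_meas[OF assms(2)]
  show "integrable O2 (\<lambda>y. 2 * (f y)\<^sup>2 + 2 * (g y)\<^sup>2)" using assms by (simp add: L2_O2)
  show "(\<lambda>y. (f y - g y)\<^sup>2) \<in> borel_measurable O2" by simp
  have "(f y - g y)\<^sup>2 \<le> 2 * (f y)\<^sup>2 + 2 * (g y)\<^sup>2" for y
    using zero_le_power2[of "f y + g y"] by (simp add: power2_eq_square algebra_simps)
  then show "AE y in O2. norm ((f y - g y)\<^sup>2) \<le> norm (2 * (f y)\<^sup>2 + 2 * (g y)\<^sup>2)" by (intro AE_I2) simp
qed

text \<open>The triangle inequality for squares of three terms, whence the factor 3. It compares the
  distance of two solutions at one time with their distance at another.\<close>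

lemma L2_energy_triangle:
  assumes L: "f \<in> L2" "g \<in> L2" "f' \<in> L2" "g' \<in> L2"
  shows "(\<integral>y. (f y - g y)\<^sup>2 \<partial>O2) \<le> 3 * (L2_norm (\<lambda>y. f' y - f y))\<^sup>2 + 3 * (L2_norm (\<lambda>y. g' y - g y))\<^sup>2 + 3 * (\<integral>y. (f' y - g' y)\<^sup>2 \<partial>O2)"
proof -
  note m = L[THEN L2_meas]
  have n: "(L2_norm (\<lambda>y. f' y - f y))\<^sup>2 = (\<integral>y. (f' y - f y)\<^sup>2 \<partial>O2)" "(L2_norm (\<lambda>y. g' y - g y))\<^sup>2 = (\<integral>y. (g' y - g y)\<^sup>2 \<partial>O2)"
    by (rule L2_norm_sq; use m in simp)+
  have i: "integrable O2 (\<lambda>y. (f' y - f y)\<^sup>2)" "integrable O2 (\<lambda>y. (g' y - g y)\<^sup>2)" "integrable O2 (\<lambda>y. (f' y - g' y)\<^sup>2)" "integrable O2 (\<lambda>y. (f y - g y)\<^sup>2)"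
    by (intro L2_diff L)+
  have pt: "(x - y)\<^sup>2 \<le> 3 * (x' - x)\<^sup>2 + 3 * (y' - y)\<^sup>2 + 3 * (x' - y')\<^sup>2" for x y x' y' :: real
  proof -
    define p q r where "p = x - x'" and "q = x' - y'" and "r = y' - y"
    have "(p + q + r)\<^sup>2 \<le> 3 * p\<^sup>2 + 3 * r\<^sup>2 + 3 * q\<^sup>2"
      using zero_le_power2[of "p - q"] zero_le_power2[of "q - r"] zero_le_power2[of "p - r"] by (simp add: power2_eq_square algebra_simps)
    then show ?thesis by (simp add: p_def q_def r_def power2_commute[of x x'])
  qed
  have "(\<integral>y. (f y - g y)\<^sup>2 \<partial>O2) \<le> (\<integral>y. 3 * (f' y - f y)\<^sup>2 + 3 * (g' y - g y)\<^sup>2 + 3 * (f' y - g' y)\<^sup>2 \<partial>O2)"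
    using i by (intro integral_mono) (auto intro: pt)
  also have "\<dots> = 3 * (\<integral>y. (f' y - f y)\<^sup>2 \<partial>O2) + 3 * (\<integral>y. (g' y - g y)\<^sup>2 \<partial>O2) + 3 * (\<integral>y. (f' y - g' y)\<^sup>2 \<partial>O2)" using i by simp
  finally show ?thesis unfolding n .
qed

lemma cont_H_sequentially:
  assumes "cont_H T u" "t \<in> {0..T}" "\<And>n. x n \<in> {0..T}" "x \<longlonglongrightarrow> t"
  shows "(\<lambda>n. L2_norm (\<lambda>y. u (x n) y - u t y)) \<longlonglongrightarrow> 0"
proof -
  have z: "L2_norm (\<lambda>y. u t y - u t y) = 0" by (simp add: L2_norm_def)
  have "continuous (at t within {0..T}) (\<lambda>s. L2_norm (\<lambda>y. u s y - u t y))"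
    unfolding continuous_within z using assms(1,2) by (simp add: cont_H_def)
  from continuous_within_tendsto_compose'[OF this assms(3,4)] show ?thesis unfolding z .
qed

text \<open>On almost every line in \<open>t\<close>, \<open>U\<close> is a primitive of
  \<open>- (G - zmean G)\<close>, so its square is one by the product rule. Integrated over the
  square, the term with \<open>zmean G\<close> disappears because \<open>U\<close> has mean zero in
  \<open>z\<close>.\<close>

lemma energy_identity:
  fixes U G :: "real \<times> real \<times> real \<Rightarrow> real"
  assumes T: "T > 0" and U: "U \<in> Borel" "AE p in OT T. \<bar>U p\<bar> \<le> C" and G: "integrable (OT T) G"
    and mean0: "AE q in leb_on 0 T \<Otimes>\<^sub>M I1. (\<integral>z. U (fst q, snd q, z) \<partial>I1) = 0"
    and wf: "\<And>a b c. a \<in> C1c 0 T \<Longrightarrow> b \<in> C1c 0 1 \<Longrightarrow> c \<in> C1c 0 1 \<Longrightarrow> (\<integral>z. c z \<partial>I1) = 0 \<Longrightarrow>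
      (\<integral>p. U p * prod_test (deriv a) b c p \<partial>OT T) = (\<integral>p. G p * prod_test a b c p \<partial>OT T)"
  obtains E0 H where "integrable (leb_on 0 T) H" "AE s in leb_on 0 T. (\<integral>y. (U (s, y))\<^sup>2 \<partial>O2) = E0 + prim 0 T H s"
    "AE s in leb_on 0 T. H s = - 2 * (\<integral>y. U (s, y) * G (s, y) \<partial>O2)"
proof -
  note [measurable] = U(1) borel_measurable_integrable[OF G, simplified]
  have Ui: "integrable (OT T) U" by (rule integrable_bounded_AE[OF finite_measure_leb3, where C=C]) (use U in auto)
  have U2i: "integrable (OT T) (\<lambda>p. (U p)\<^sup>2)"
    using integrable_mult_bounded_AE(1)[OF Ui _, of U C] U by (simp add: power2_eq_square)
  have Zi: "integrable (OT T) (zmean G)" by (rule zmean_integrable[OF G])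
  note [measurable] = borel_measurable_integrable[OF Zi, simplified]
  define h where "h p = - (G p - zmean G p)" for p
  have hi: "integrable (OT T) h" unfolding h_def using G Zi by simp
  note hm [measurable] = borel_measurable_integrable[OF hi, simplified]
  have ki: "integrable (OT T) (\<lambda>p. 2 * (h p * U p))"
    by (intro integrable_mult_right integrable_mult_bounded_AE(1)[OF hi, where C=C]) (use U in auto)
  have ZU: "integrable (OT T) (\<lambda>p. zmean G p * U p)" by (rule integrable_mult_bounded_AE(1)[OF Zi, where C=C]) (use U in auto)
  have GU: "integrable (OT T) (\<lambda>p. U p * G p)" by (rule integrable_mult_bounded_AE(2)[OF G, where C=C]) (use U in auto)
  have sec: "(\<lambda>\<sigma>. f (\<sigma>, y)) \<in> Borel" if "f \<in> Borel" for f :: "real \<times> real \<times> real \<Rightarrow> real" and y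
    by (rule measurable_compose[OF borel_measurable_continuous_onI that]) (intro continuous_intros)
  have sl: "AE y in O2. integrable (leb_on 0 T) (\<lambda>s. h (s, y)) \<and> (\<exists>D. AE s in leb_on 0 T. U (s, y) = D + prim 0 T (\<lambda>\<sigma>. h (\<sigma>, y)) s)"
  proof (rule weak_deriv_slices[OF T finite_measure_leb2 total_tests_box Ui hi])
    fix \<phi> \<psi> assume \<phi>: "\<phi> \<in> C1c 0 T" and "\<psi> \<in> {tensor \<phi> \<psi> |\<phi> \<psi>. \<phi> \<in> C1c 0 1 \<and> \<psi> \<in> C1c 0 1}"
    then obtain b c where \<psi>: "\<psi> = tensor b c" and bc: "b \<in> C1c 0 1" "c \<in> C1c 0 1" by blast
    have "(\<integral>p. U p * prod_test (deriv \<phi>) b c p \<partial>OT T) = (\<integral>p. (G p - zmean G p) * prod_test \<phi> b c p \<partial>OT T)"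
      by (rule weak_form_mean_free[OF Ui G mean0 wf[OF \<phi> bc(1)] \<phi> bc])
    moreover have "(\<integral>p. h p * prod_test \<phi> b c p \<partial>OT T) = - (\<integral>p. (G p - zmean G p) * prod_test \<phi> b c p \<partial>OT T)"
      unfolding h_def mult_minus_left by simp
    ultimately show "(\<integral>p. U p * (deriv \<phi> (fst p) * \<psi> (snd p)) \<partial>OT T) = - (\<integral>p. h p * (\<phi> (fst p) * \<psi> (snd p)) \<partial>OT T)"
      unfolding \<psi> tensor_def case_prod_unfold by simp
  qed simp_all
  have rep: "AE y in O2. \<exists>D. AE s in leb_on 0 T. (U (s, y))\<^sup>2 = D + prim 0 T (\<lambda>\<sigma>. 2 * (h (\<sigma>, y) * U (\<sigma>, y))) s"
    using sl
  proof eventually_elim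
    case (elim y)
    then obtain D where D: "AE s in leb_on 0 T. U (s, y) = D + prim 0 T (\<lambda>\<sigma>. h (\<sigma>, y)) s" and hy: "integrable (leb_on 0 T) (\<lambda>s. h (s, y))" by blast
    let ?V = "\<lambda>s. D + prim 0 T (\<lambda>\<sigma>. h (\<sigma>, y)) s"
    note [measurable] = sec[OF U(1), of y] sec[OF hm, of y]
    have pc: "prim 0 T (\<lambda>\<sigma>. h (\<sigma>, y) * ?V \<sigma> + ?V \<sigma> * h (\<sigma>, y)) s = prim 0 T (\<lambda>\<sigma>. 2 * (h (\<sigma>, y) * U (\<sigma>, y))) s" for s
      by (rule prim_cong_AE) (use D in eventually_elim, simp, measurable)
    have "AE s in leb_on 0 T. (U (s, y))\<^sup>2 = D * D + prim 0 T (\<lambda>\<sigma>. 2 * (h (\<sigma>, y) * U (\<sigma>, y))) s"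
      using D
    proof eventually_elim
      case (elim s)
      show ?case unfolding pc[symmetric] prim_product(1)[OF hy hy, of D s D, symmetric] using elim by (simp add: power2_eq_square)
    qed
    then show ?case by blast
  qed
  obtain E0 where E0: "AE s in leb_on 0 T. (\<integral>y. (U (s, y))\<^sup>2 \<partial>O2) = E0 + prim 0 T (\<lambda>\<sigma>. \<integral>y. 2 * (h (\<sigma>, y) * U (\<sigma>, y)) \<partial>O2) s"
    by (rule integrate_slices[OF T U2i ki rep])
  have "AE s in leb_on 0 T. (\<integral>y. 2 * (h (s, y) * U (s, y)) \<partial>O2) = - 2 * (\<integral>y. U (s, y) * G (s, y) \<partial>O2)"
    using AE_leb2_fst[OF mean0] OT_sections(1)[OF ZU] OT_sections(1)[OF GU]
  proof eventually_elim
    case (elim s)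
    have "(\<integral>y. zmean G (s, y) * U (s, y) \<partial>O2) = (\<integral>x. \<integral>z. zmean G (s, x, z) * U (s, x, z) \<partial>I1 \<partial>I1)" by (rule O2_sections(6)[OF elim(2)])
    also have "\<dots> = (\<integral>x. 0 \<partial>I1)"
    proof (rule integral_cong_AE)
      show "(\<lambda>x. \<integral>z. zmean G (s, x, z) * U (s, x, z) \<partial>I1) \<in> borel_measurable I1" by (rule borel_measurable_integrable[OF O2_sections(4)[OF elim(2)]])
      show "AE x in I1. (\<integral>z. zmean G (s, x, z) * U (s, x, z) \<partial>I1) = 0" using elim(1) by eventually_elim (simp add: zmean_def)
    qed simp
    finally have z: "(\<integral>y. zmean G (s, y) * U (s, y) \<partial>O2) = 0" by simp
    have "(\<integral>y. 2 * (h (s, y) * U (s, y)) \<partial>O2) = (\<integral>y. 2 * (zmean G (s, y) * U (s, y)) - 2 * (U (s, y) * G (s, y)) \<partial>O2)"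
      by (rule Bochner_Integration.integral_cong) (auto simp: h_def algebra_simps)
    also have "\<dots> = 2 * (\<integral>y. zmean G (s, y) * U (s, y) \<partial>O2) - 2 * (\<integral>y. U (s, y) * G (s, y) \<partial>O2)" using elim(2,3) by simp
    finally show ?case using z by simp
  qed
  with E0 OT_sections(2)[OF ki] show ?thesis by (intro that) auto
qed

lemma L2_dom_sq_integrable:
  fixes v :: field
  assumes L: "L2_dom T s v" and s: "s \<ge> 0"
  shows "integrable (leb_on 0 T) (\<lambda>t. enn2real (sq s (nz (v t))))" "AE t in leb_on 0 T. sq s (nz (v t)) = ennreal (enn2real (sq s (nz (v t))))"
proof -
  have v: "case_prod v \<in> Borel" and d: "AE t in Itime T. v t \<in> dom_Lambda_h s"
    and f: "(\<integral>\<^sup>+ t. ennreal ((L2_norm (v t))\<^sup>2 + (L2_norm (Lambda_h s (v t)))\<^sup>2) \<partial>Itime T) < \<infinity>"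
    using L unfolding L2_dom_def torus_field_def by auto
  have m [measurable]: "(\<lambda>t. sq s (nz (v t))) \<in> Borel" using sq_nz_measurable[OF v, of s] by simp
  have b: "AE t in Itime T. sq s (nz (v t)) \<le> ennreal ((L2_norm (v t))\<^sup>2 + (L2_norm (Lambda_h s (v t)))\<^sup>2)"
    using d by eventually_elim (rule sq_dom_Lambda_h[OF _ s])
  then have "AE t in leb_on 0 T. sq s (nz (v t)) < \<infinity>"
    unfolding AE_Itime by eventually_elim (auto intro: le_less_trans)
  then show "AE t in leb_on 0 T. sq s (nz (v t)) = ennreal (enn2real (sq s (nz (v t))))" by eventually_elim simp
  show "integrable (leb_on 0 T) (\<lambda>t. enn2real (sq s (nz (v t))))"
  proof (rule integrableI_nonneg)
    have "ennreal (enn2real r) \<le> r" for r by (cases r) auto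
    then have "(\<integral>\<^sup>+t. ennreal (enn2real (sq s (nz (v t)))) \<partial>leb_on 0 T) \<le> (\<integral>\<^sup>+t. sq s (nz (v t)) \<partial>leb_on 0 T)" by (intro nn_integral_mono)
    also have "\<dots> = (\<integral>\<^sup>+t. sq s (nz (v t)) \<partial>Itime T)" by (rule nn_integral_Itime[OF m, symmetric])
    also have "\<dots> \<le> (\<integral>\<^sup>+ t. ennreal ((L2_norm (v t))\<^sup>2 + (L2_norm (Lambda_h s (v t)))\<^sup>2) \<partial>Itime T)" by (rule nn_integral_mono_AE[OF b])
    finally show "(\<integral>\<^sup>+t. ennreal (enn2real (sq s (nz (v t)))) \<partial>leb_on 0 T) < \<infinity>" using f by (rule le_less_trans)
  qed (simp_all)
qed

text \<open>The parameter \<open>s1\<close> unites the two ranges of \<alpha>: it is 0 for the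
  larger values and \<open>3/2 - \<alpha>\<close> for the smaller ones, and the four inequalities
  are what the trilinear estimate needs of it.\<close>

lemma uniqueness_core:
  fixes u v om et :: field
  assumes T: "T > 0" and \<nu>: "\<nu> > 0" and \<alpha>: "1 < \<alpha>" "\<alpha> < 2" and s1: "0 \<le> s1" "s1 < 1/2" "3/2 - \<alpha> \<le> s1" "s1 \<le> 1 - \<alpha>/2"
    and Su: "strong_solution \<nu> \<alpha> T u0 u" and Sv: "strong_solution \<nu> \<alpha> T u0 v"
    and om: "weak_dz T u om" "AE p in OT T. \<bar>case_prod om p\<bar> \<le> Bu" and et: "weak_dz T v et" "AE p in OT T. \<bar>case_prod et p\<bar> \<le> Bv"
    and X: "AE t in leb_on 0 T. sq s1 (nz (et t)) \<le> ennreal X" "X \<ge> 0" and L: "L2_dom T (s1 + \<alpha> / 2) et"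
    and t: "t \<in> {0..T}"
  shows "AE y in Omega. u t y = v t y"
proof -
  have \<alpha>1: "1 \<le> \<alpha>" using \<alpha> by simp
  obtain C1 ux w g ut P px pz where F1: "flow \<alpha> T C1 (case_prod u) ux (case_prod om) w g"
    and w1: "weak_deriv (space_time T) (1, 0, 0) (case_prod u) ut" "weak_deriv (space_time T) (0, 1, 0) P px" "weak_deriv (space_time T) (0, 0, 1) P pz"
    and m1: "ut \<in> Borel" "P \<in> Borel" "px \<in> Borel" "pz \<in> Borel"
    and e1: "AE p in OT T. ut p + (case_prod u p * ux p + w p * case_prod om p + \<nu> * g p) + px p = 0" "AE p in OT T. pz p = 0"
    by (rule strong_solution_flow[OF T \<alpha>(1) Su om])
  obtain C2 vx w' g' vt P' px' pz' where F2: "flow \<alpha> T C2 (case_prod v) vx (case_prod et) w' g'"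
    and w2: "weak_deriv (space_time T) (1, 0, 0) (case_prod v) vt" "weak_deriv (space_time T) (0, 1, 0) P' px'" "weak_deriv (space_time T) (0, 0, 1) P' pz'"
    and m2: "vt \<in> Borel" "P' \<in> Borel" "px' \<in> Borel" "pz' \<in> Borel"
    and e2: "AE p in OT T. vt p + (case_prod v p * vx p + w' p * case_prod et p + \<nu> * g' p) + px' p = 0" "AE p in OT T. pz' p = 0"
    by (rule strong_solution_flow[OF T \<alpha>(1) Sv et])
  note f1 = flow_integrable[OF F1 \<alpha>1] and f2 = flow_integrable[OF F2 \<alpha>1]
  have Hu: "cont_H T u" and Hv: "cont_H T v" using Su Sv by (auto simp: strong_solution_def)
  define A where "A = case_prod u"
  define B where "B = case_prod v"
  define N1 where "N1 p = A p * ux p + w p * case_prod om p + \<nu> * g p" for p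
  define N2 where "N2 p = B p * vx p + w' p * case_prod et p + \<nu> * g' p" for p
  define U where "U p = A p - B p" for p
  define G where "G p = N1 p - N2 p" for p
  have Ai: "integrable (OT T) A" and Bi: "integrable (OT T) B" and N1i: "integrable (OT T) N1" and N2i: "integrable (OT T) N2"
    unfolding A_def B_def N1_def N2_def by (rule f1(8), rule f2(8), rule f1(10), rule f2(10))
  note [measurable] = borel_measurable_integrable[OF Ai, simplified] borel_measurable_integrable[OF Bi, simplified]
  have N1m: "N1 \<in> Borel" and N2m: "N2 \<in> Borel"
    using borel_measurable_integrable[OF N1i] borel_measurable_integrable[OF N2i] by simp_all
  have Um: "U \<in> Borel" unfolding U_def by measurable
  have Ub: "AE p in OT T. \<bar>U p\<bar> \<le> C1 + C2"
    using f1(6)[folded A_def] f2(6)[folded B_def] unfolding U_def by eventually_elim linarith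
  have Gi: "integrable (OT T) G" unfolding G_def using N1i N2i by simp
  have mean0: "AE q in leb_on 0 T \<Otimes>\<^sub>M I1. (\<integral>z. U (fst q, snd q, z) \<partial>I1) = 0"
    using Hspace_mean_zero[OF Hu Ai[unfolded A_def], folded A_def] Hspace_mean_zero[OF Hv Bi[unfolded B_def], folded B_def]
      OT_z_sections(1)[OF Ai] OT_z_sections(1)[OF Bi]
    unfolding U_def by eventually_elim simp
  have wf: "(\<integral>p. U p * prod_test (deriv a) b c p \<partial>OT T) = (\<integral>p. G p * prod_test a b c p \<partial>OT T)"
    if a: "a \<in> C1c 0 T" and b: "b \<in> C1c 0 1" and c: "c \<in> C1c 0 1" and c0: "(\<integral>z. c z \<partial>I1) = 0" for a b c
  proof -
    obtain Ka where Ka: "\<And>s. \<bar>a s\<bar> \<le> Ka" "\<And>s. \<bar>deriv a s\<bar> \<le> Ka" using C1c_bounded[OF a] by metis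
    obtain Kb where Kb: "\<And>s. \<bar>b s\<bar> \<le> Kb" using C1c_bounded[OF b] by metis
    obtain Kc where Kc: "\<And>s. \<bar>c s\<bar> \<le> Kc" using C1c_bounded[OF c] by metis
    note i0 = prod_test_integrable[OF _ sets_leb3 C1c_measurable(1)[OF a] C1c_measurable(1)[OF b] C1c_measurable(1)[OF c] Ka(1) Kb Kc]
    note i1 = prod_test_integrable[OF _ sets_leb3 C1c_measurable(2)[OF a] C1c_measurable(1)[OF b] C1c_measurable(1)[OF c] Ka(2) Kb Kc]
    have 1: "(\<integral>p. A p * prod_test (deriv a) b c p \<partial>OT T) = (\<integral>p. N1 p * prod_test a b c p \<partial>OT T)"
      by (rule weak_form_without_pressure[OF T _ N1m m1 _ w1(2,3) _ e1(2) N1i a b c c0])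
         (use f1(1) w1(1) e1(1) in \<open>simp_all only: A_def N1_def\<close>)
    have 2: "(\<integral>p. B p * prod_test (deriv a) b c p \<partial>OT T) = (\<integral>p. N2 p * prod_test a b c p \<partial>OT T)"
      by (rule weak_form_without_pressure[OF T _ N2m m2 _ w2(2,3) _ e2(2) N2i a b c c0])
         (use f2(1) w2(1) e2(1) in \<open>simp_all only: B_def N2_def\<close>)
    show ?thesis unfolding U_def G_def left_diff_distrib
        Bochner_Integration.integral_diff[OF i1[OF Ai] i1[OF Bi]] Bochner_Integration.integral_diff[OF i0[OF N1i] i0[OF N2i]] 1 2 by simp
  qed
  obtain E0 H where H: "integrable (leb_on 0 T) H" and E: "AE s in leb_on 0 T. (\<integral>y. (U (s, y))\<^sup>2 \<partial>O2) = E0 + prim 0 T H s"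
    and HG: "AE s in leb_on 0 T. H s = - 2 * (\<integral>y. U (s, y) * G (s, y) \<partial>O2)"
    by (rule energy_identity[OF T Um Ub Gi mean0 wf])
  define e where "e s = (\<integral>y. (u s y - v s y)\<^sup>2 \<partial>O2)" for s
  have e_eq: "(\<integral>y. (U (s, y))\<^sup>2 \<partial>O2) = e s" for s by (simp add: U_def A_def B_def e_def)
  have e0: "e s \<ge> 0" for s by (simp add: e_def)
  have LL: "u s \<in> L2" "v s \<in> L2" if "s \<in> {0..T}" for s using Hu Hv that by (auto simp: cont_H_def Hspace_def)
  have lim: "(\<lambda>n. 3 * (L2_norm (\<lambda>y. u (x n) y - u s y))\<^sup>2 + 3 * (L2_norm (\<lambda>y. v (x n) y - v s y))\<^sup>2) \<longlonglongrightarrow> 3 * 0\<^sup>2 + 3 * 0\<^sup>2"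
    if "s \<in> {0..T}" "\<And>n. x n \<in> {0..T}" "x \<longlonglongrightarrow> s" for s x
    by (intro tendsto_intros cont_H_sequentially[OF Hu] cont_H_sequentially[OF Hv] that)
  \<comment> \<open>The representation of the energy holds at almost every time. Along such times
    tending to 0, continuity in \<open>L2\<close> and the common initial value send the energy to 0,
    while the right-hand side tends to \<open>E0\<close>.\<close>
  have "E0 = 0"
  proof -
    have z0: "(0::real) \<in> {0..T}" using T by simp
    have "AE y in O2. u 0 y = v 0 y" using Su Sv unfolding strong_solution_def AE_Omega by (auto elim: eventually_elim2)
    then have "e 0 = (\<integral>y. 0 \<partial>O2)" unfolding e_def using LL[OF z0, THEN L2_meas] by (intro integral_cong_AE) (auto elim!: eventually_mono)
    then have ez: "e 0 = 0" by simp
    obtain x where x: "\<And>n. e (x n) = E0 + prim 0 T H (x n)" "\<And>n. x n \<in> {0..T}" "x \<longlonglongrightarrow> 0"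
      by (rule AE_leb_on_dense[OF T E[unfolded e_eq] z0]) (rule that; assumption)
    have "e (x n) \<le> 3 * (L2_norm (\<lambda>y. u (x n) y - u 0 y))\<^sup>2 + 3 * (L2_norm (\<lambda>y. v (x n) y - v 0 y))\<^sup>2" for n
    proof -
      have c: "L2_norm (\<lambda>y. f y - g y) = L2_norm (\<lambda>y. g y - f y)" for f g by (simp add: L2_norm_def power2_commute)
      show ?thesis using L2_energy_triangle[OF LL[OF x(2)[of n]] LL[OF z0]] ez unfolding e_def c[of "u 0"] c[of "v 0"] by simp
    qed
    note up = this
    have l0: "(\<lambda>n. 3 * (L2_norm (\<lambda>y. u (x n) y - u 0 y))\<^sup>2 + 3 * (L2_norm (\<lambda>y. v (x n) y - v 0 y))\<^sup>2) \<longlonglongrightarrow> 0"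
      using lim[OF z0 x(2,3)] by simp
    have l1: "(\<lambda>n. e (x n)) \<longlonglongrightarrow> 0"
      by (rule tendsto_sandwich[OF always_eventually always_eventually tendsto_const l0]) (intro allI e0, intro allI up)
    have "isCont (prim 0 T H) 0" using prim_continuous[OF H] by (simp add: continuous_on_eq_continuous_at)
    from tendsto_add[OF tendsto_const isCont_tendsto_compose[OF this x(3)]]
    have l2: "(\<lambda>n. e (x n)) \<longlonglongrightarrow> E0 + prim 0 T H 0" unfolding x(1) .
    have "E0 + prim 0 T H 0 = 0" by (rule LIMSEQ_unique[OF l2 l1])
    then show ?thesis using prim_lower[of 0 0 H T] borel_measurable_integrable[OF H] by simp
  qed
  then have ep: "AE s in leb_on 0 T. e s = prim 0 T H s" using E unfolding e_eq by simp
  obtain K where K: "K \<ge> 0" "\<And>C1 C2 u1 ux1 om1 w1 g1 u2 ux2 om2 w2 g2 a y.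
      slice \<alpha> C1 u1 ux1 om1 w1 g1 \<Longrightarrow> slice \<alpha> C2 u2 ux2 om2 w2 g2 \<Longrightarrow>
      sq s1 (nz om2) \<le> ennreal X \<Longrightarrow> sq (s1 + \<alpha> / 2) (nz om2) \<le> ennreal y \<Longrightarrow> sq \<alpha> (nz u2) \<le> ennreal a \<Longrightarrow> a \<ge> 0 \<Longrightarrow> y \<ge> 0 \<Longrightarrow>
      - (\<integral>p. (u1 p - u2 p) * ((u1 p * ux1 p + w1 p * om1 p + \<nu> * g1 p) - (u2 p * ux2 p + w2 p * om2 p + \<nu> * g2 p)) \<partial>O2)
        \<le> K * (1 + a + y) * (\<integral>p. (u1 p - u2 p)\<^sup>2 \<partial>O2)"
    by (rule energy_estimate[OF \<alpha> s1 \<nu> X(2)]) (rule that; assumption)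
  \<comment> \<open>\<open>y\<close> and \<open>a\<close> are the Sobolev bounds for the second
    solution at time \<open>s\<close>. Both are integrable in time, which makes
    \<open>2 * K * (1 + a s + y s)\<close> an admissible Gronwall coefficient.\<close>
  define y where "y s = enn2real (sq (s1 + \<alpha> / 2) (nz (et s)))" for s
  define a where "a s = (\<integral>p. (B (s, p))\<^sup>2 \<partial>O2) + (\<integral>p. (g' (s, p))\<^sup>2 \<partial>O2)" for s
  have s\<alpha>: "s1 + \<alpha> / 2 \<ge> 0" using s1 \<alpha> by simp
  have yi: "integrable (leb_on 0 T) y" unfolding y_def by (rule L2_dom_sq_integrable(1)[OF L s\<alpha>])
  have ai: "integrable (leb_on 0 T) a" unfolding a_def
    using OT_sections(2)[OF f2(9)[folded B_def]] OT_sections(2)[of T "\<lambda>p. (g' p)\<^sup>2"] F2 by (simp add: flow_def)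
  have sl1: "AE s in leb_on 0 T. slice \<alpha> C1 (u s) (\<lambda>y. ux (s, y)) (om s) (\<lambda>y. w (s, y)) (\<lambda>y. g (s, y))" using F1 by (simp add: flow_def)
  have sl2: "AE s in leb_on 0 T. slice \<alpha> C2 (v s) (\<lambda>y. vx (s, y)) (et s) (\<lambda>y. w' (s, y)) (\<lambda>y. g' (s, y))" using F2 by (simp add: flow_def)
  have \<phi>i: "integrable (leb_on 0 T) (\<lambda>s. 2 * K * (1 + a s + y s))" using ai yi by simp
  have an: "a s \<ge> 0" and yn: "y s \<ge> 0" for s by (simp_all add: a_def y_def)
  have Hle: "AE s in leb_on 0 T. H s \<le> 2 * K * (1 + a s + y s) * prim 0 T H s"
    using sl1 sl2 X(1) L2_dom_sq_integrable(2)[OF L s\<alpha>] HG ep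
  proof eventually_elim
    case (elim s)
    have sa: "sq \<alpha> (nz (v s)) \<le> ennreal (a s)" using sl_sobolev[OF elim(2)] \<alpha> by (simp add: a_def B_def)
    have sy: "sq (s1 + \<alpha> / 2) (nz (et s)) \<le> ennreal (y s)" using elim(4) by (simp add: y_def)
    have "- (\<integral>p. U (s, p) * G (s, p) \<partial>O2) \<le> K * (1 + a s + y s) * e s"
      using K(2)[OF elim(1,2,3) sy sa an yn] unfolding U_def G_def N1_def N2_def A_def B_def e_def prod.case .
    then have "2 * - (\<integral>p. U (s, p) * G (s, p) \<partial>O2) \<le> 2 * (K * (1 + a s + y s) * e s)" by (rule mult_left_mono) simp
    also have "\<dots> = 2 * K * (1 + a s + y s) * prim 0 T H s" by (simp only: elim(6) mult.assoc)
    finally show ?case by (simp only: elim(5) mult_minus_left mult_minus_right)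
  qed
  have np: "prim 0 T H s \<le> 0" for s
    by (rule gronwall_prim[OF H \<phi>i _ Hle]) (use K(1) an yn in \<open>simp add: add_nonneg_nonneg\<close>)
  have ez: "AE s in leb_on 0 T. e s = 0"
    using ep
  proof eventually_elim
    case (elim s) show ?case using elim np[of s] e0[of s] by linarith
  qed
  \<comment> \<open>From almost every time to the given \<open>t\<close>, again by continuity in
    \<open>L2\<close>.\<close>
  obtain x where x: "\<And>n. e (x n) = 0" "\<And>n. x n \<in> {0..T}" "x \<longlonglongrightarrow> t"
    by (rule AE_leb_on_dense[OF T ez t]) (rule that; assumption)
  have "e t \<le> 3 * (L2_norm (\<lambda>y. u (x n) y - u t y))\<^sup>2 + 3 * (L2_norm (\<lambda>y. v (x n) y - v t y))\<^sup>2" for n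
    using L2_energy_triangle[OF LL[OF t] LL[OF x(2)[of n]]] x(1)[of n] unfolding e_def by simp
  then have "e t \<le> 3 * 0\<^sup>2 + 3 * 0\<^sup>2" by (intro LIMSEQ_le_const[OF lim[OF t x(2,3)]]) auto
  then have "e t = 0" using e0[of t] by simp
  then have "AE y in O2. (u t y - v t y)\<^sup>2 = 0"
    unfolding e_def by (subst (asm) integral_nonneg_eq_0_iff_AE[OF L2_diff[OF LL[OF t]]]) auto
  then show ?thesis unfolding AE_Omega by eventually_elim simp
qed

lemma Linf_Linf_bound:
  assumes "Linf_Linf T v" obtains C where "C \<ge> 0" "AE p in OT T. \<bar>case_prod v p\<bar> \<le> C"
proof -
  have m: "case_prod v \<in> Borel" using assms by (simp add: Linf_Linf_def torus_field_def)
  obtain C where "AE t in Itime T. v t \<in> Linf \<and> (AE y in Omega. \<bar>v t y\<bar> \<le> C)" using assms unfolding Linf_Linf_def by blast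
  then have "AE t in leb_on 0 T. AE y in O2. \<bar>v t y\<bar> \<le> \<bar>C\<bar>"
    unfolding AE_Itime AE_Omega by (elim eventually_mono conjE) (auto elim!: eventually_mono)
  then have "AE p in OT T. \<bar>case_prod v p\<bar> \<le> \<bar>C\<bar>" by (intro AE_OTI[OF _ Collect_le_borel[OF m]]) simp
  then show ?thesis by (rule that[rotated]) simp
qed

text \<open>With \<open>s1 = 0\<close> the uniform bound on the vertical derivative is its
  \<open>L2\<close> norm, supplied by boundedness and Bessel, and the required order
  \<open>\<alpha> / 2\<close> is part of the notion of strong solution.\<close>

lemma uniqueness_large_alpha:
  assumes T: "T > 0" and \<nu>: "\<nu> > 0" and \<alpha>: "3/2 \<le> \<alpha>" "\<alpha> < 2"
    and Su: "strong_solution \<nu> \<alpha> T u0 u" and Sv: "strong_solution \<nu> \<alpha> T u0 v" and t: "t \<in> {0..T}"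
  shows "AE y in Omega. u t y = v t y"
proof -
  obtain om where om: "weak_dz T u om" "Linf_Linf T om" using Su unfolding strong_solution_def by blast
  obtain et where et: "weak_dz T v et" "Linf_Linf T et" "L2_dom T (\<alpha> / 2) et" using Sv unfolding strong_solution_def by blast
  obtain Bu where Bu: "AE p in OT T. \<bar>case_prod om p\<bar> \<le> Bu" using Linf_Linf_bound[OF om(2)] by metis
  obtain Bv where Bv: "Bv \<ge> 0" "AE p in OT T. \<bar>case_prod et p\<bar> \<le> Bv" using Linf_Linf_bound[OF et(2)] by metis
  have m: "case_prod et \<in> Borel" using et(1) by (simp add: weak_dz_def torus_field_def)
  have X: "AE t in leb_on 0 T. sq 0 (nz (et t)) \<le> ennreal (\<integral>y. Bv\<^sup>2 \<partial>O2)"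
    using AE_OT[OF Bv(2)]
  proof eventually_elim
    case (elim t)
    then have b: "AE y in O2. \<bar>et t y\<bar> \<le> Bv" by simp
    note mt = field_section(1)[OF m, of t]
    note i = integrable_O2_bounded(2)[OF mt b]
    have "(\<integral>y. (et t y)\<^sup>2 \<partial>O2) \<le> (\<integral>y. Bv\<^sup>2 \<partial>O2)"
    proof (rule integral_mono_AE[OF i])
      show "integrable O2 (\<lambda>y. Bv\<^sup>2)" by (rule integrable_O2_bounded(1)[where C="Bv\<^sup>2"]) simp_all
      show "AE y in O2. (et t y)\<^sup>2 \<le> Bv\<^sup>2" using b by eventually_elim (use Bv(1) in \<open>simp add: abs_le_square_iff[symmetric]\<close>)
    qed
    then show ?case using bessel_O2(3)[OF mt i] by (meson ennreal_leI order_trans)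
  qed
  show ?thesis
    by (rule uniqueness_core[OF T \<nu> _ \<alpha>(2) _ _ _ _ Su Sv om(1) Bu et(1) Bv(2) X _ _ t]) (use \<alpha> et(3) in simp_all)
qed

text \<open>With \<open>s1 = 3/2 - \<alpha>\<close> the two orders \<open>s1\<close> and
  \<open>s1 + \<alpha> / 2\<close> are those of the additional condition. Boundedness is known for
  the derivative from the definition of a strong solution and is carried over to \<open>et\<close>
  by uniqueness of weak derivatives.\<close>

lemma uniqueness_small_alpha:
  assumes T: "T > 0" and \<nu>: "\<nu> > 0" and \<alpha>: "1 < \<alpha>" "\<alpha> < 3/2"
    and Su: "strong_solution \<nu> \<alpha> T u0 u" and Sv: "strong_solution \<nu> \<alpha> T u0 v"
    and et: "weak_dz T v et" "Linf_dom T (3/2 - \<alpha>) et" "L2_dom T ((3 - \<alpha>) / 2) et" and t: "t \<in> {0..T}"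
  shows "AE y in Omega. u t y = v t y"
proof -
  obtain om where om: "weak_dz T u om" "Linf_Linf T om" using Su unfolding strong_solution_def by blast
  obtain et' where et': "weak_dz T v et'" "Linf_Linf T et'" using Sv unfolding strong_solution_def by blast
  obtain Bu where Bu: "AE p in OT T. \<bar>case_prod om p\<bar> \<le> Bu" using Linf_Linf_bound[OF om(2)] by metis
  obtain Bv where "AE p in OT T. \<bar>case_prod et' p\<bar> \<le> Bv" using Linf_Linf_bound[OF et'(2)] by metis
  then have Bv: "AE p in OT T. \<bar>case_prod et p\<bar> \<le> Bv" using weak_dz_unique[OF T et(1) et'(1)] by eventually_elim (simp only:)
  obtain C where "AE t in Itime T. et t \<in> dom_Lambda_h (3/2 - \<alpha>) \<and> L2_norm (et t) \<le> C \<and> L2_norm (Lambda_h (3/2 - \<alpha>) (et t)) \<le> C"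
    using et(2) unfolding Linf_dom_def by blast
  then have X: "AE t in leb_on 0 T. sq (3/2 - \<alpha>) (nz (et t)) \<le> ennreal (2 * C\<^sup>2)"
    unfolding AE_Itime
  proof eventually_elim
    case (elim t)
    have n: "L2_norm f \<ge> 0" for f unfolding L2_norm_def by (intro real_sqrt_ge_zero integral_nonneg) simp
    have "(L2_norm (et t))\<^sup>2 \<le> C\<^sup>2" "(L2_norm (Lambda_h (3/2 - \<alpha>) (et t)))\<^sup>2 \<le> C\<^sup>2" using elim n by (auto intro!: power_mono)
    then have "ennreal ((L2_norm (et t))\<^sup>2 + (L2_norm (Lambda_h (3/2 - \<alpha>) (et t)))\<^sup>2) \<le> ennreal (2 * C\<^sup>2)" by (intro ennreal_leI) simp
    then show ?case using sq_dom_Lambda_h[of "et t" "3/2 - \<alpha>"] elim \<alpha> by (auto intro: order_trans)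
  qed
  have e: "3/2 - \<alpha> + \<alpha> / 2 = (3 - \<alpha>) / 2" by (simp add: field_simps)
  have L: "L2_dom T (3/2 - \<alpha> + \<alpha> / 2) et" unfolding e by (rule et(3))
  show ?thesis
    by (rule uniqueness_core[OF T \<nu> \<alpha>(1) _ _ _ _ _ Su Sv om(1) Bu et(1) Bv X _ L t]) (use \<alpha> in simp_all)
qed

theorem theorem4p3:
  fixes \<nu> \<alpha> T :: real and u\<^sub>0 \<omega>\<^sub>0 :: "real \<times> real \<Rightarrow> real"
  assumes "\<nu> > 0" and "T > 0"
    and "u\<^sub>0 \<in> dom_Lambda_h (\<alpha> / 2) \<inter> Hspace"
    and "weak_deriv (UNIV \<times> {0<..<1}) (0, 1) u\<^sub>0 \<omega>\<^sub>0" and "\<omega>\<^sub>0 \<in> Linf"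
  shows "(\<alpha> \<in> {3/2..<2} \<longrightarrow>
           (\<forall>u v. strong_solution \<nu> \<alpha> T u\<^sub>0 u \<and> strong_solution \<nu> \<alpha> T u\<^sub>0 v \<longrightarrow>
              (\<forall>t\<in>{0..T}. AE y in Omega. u t y = v t y))) \<and>
         (\<alpha> \<in> {1<..<3/2} \<longrightarrow>
           (\<forall>u v \<omega> \<eta>. strong_solution \<nu> \<alpha> T u\<^sub>0 u \<and> strong_solution \<nu> \<alpha> T u\<^sub>0 v \<and>
              weak_dz T u \<omega> \<and> Linf_dom T (3/2 - \<alpha>) \<omega> \<and> L2_dom T ((3 - \<alpha>) / 2) \<omega> \<and>
              weak_dz T v \<eta> \<and> Linf_dom T (3/2 - \<alpha>) \<eta> \<and> L2_dom T ((3 - \<alpha>) / 2) \<eta> \<longrightarrow>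
              (\<forall>t\<in>{0..T}. AE y in Omega. u t y = v t y)))"
  using uniqueness_large_alpha[OF assms(2,1)] uniqueness_small_alpha[OF assms(2,1)] by (intro conjI impI allI ballI) auto

end
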